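(* Let $\mathfrak{g}$ be a finite-dimensional Lie algebra over a field $\mathbb{K}$ of characteristic $0$ with basis $\{x_a\}$, let $\kappa:\bigwedge^3\mathfrak{g}\to\mathbb{K}$ be a $3$-cocycle, let $\mathfrak{g}_\kappa$ be the associated string Lie $2$-algebra, and let $A=\mathrm{CE}^\bullet(\mathfrak{g}_\kappa)$. Every pair $(\pi,\tilde\pi)$ consisting of an invariant symmetric tensor $\pi=\frac12\pi^{ab}x_ax_b\in(\mathrm{Sym}^2\mathfrak{g})^{\mathfrak{g}}$ and a linear map $\tilde\pi:\mathfrak{g}\to\mathfrak{g}$, $x_a\mapsto\tilde\pi_a^bx_b$, satisfying $$(\tilde\pi\otimes\mathrm{id}_{\mathfrak{g}})(\pi)+(\mathrm{id}_{\mathfrak{g}}\otimes\tilde\pi)(\pi)=0$$ and $$\tilde\pi([x,y])=[\tilde\pi(x),y]+[x,\tilde\pi(y)]+(\kappa(x,y,-)\otimes\mathrm{id}_{\mathfrak{g}})(\pi)+(\mathrm{id}_{\mathfrak{g}}\otimes\kappa(x,y,-))(\pi)\quad\text{for all }x,y\in\mathfrak{g},$$ defines, via the $2$-shifted Poisson structure $\pi^{(2)}=\frac12\pi^{ab}s^3\partial_a\,s^3\partial_b+\tilde\pi_b^a\theta^b\,s^3\partial_a\,s^3\partial_\nu$ on $\mathrm{CE}^\bullet(\mathfrak{g}_\kappa)$, a $\gamma$-equivariant infinitesimal $2$-braiding $$t:=\iota_\pi\circ\sigma\circ\big(\mathrm{Id}_{\otimes_A}\ast(\xi\boxtimes\xi)\big):\otimes_A\Rightarrow\otimes_A$$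 (with $\xi,\sigma,\iota_\pi$ as in the context) on the homotopy $2$-category ${}_{\mathrm{CE}^\bullet(\mathfrak{g}_\kappa)}\mathbf{C}$ of the symmetric monoidal dg-category of finitely generated semi-free $\mathrm{CE}^\bullet(\mathfrak{g}_\kappa)$-dg-modules.
   Context: **Lie $2$-algebra data.** $\mathfrak{g}_\kappa$ is the Lie $2$-algebra with $\mathfrak{g}_\kappa^0=\mathfrak{g}$, $\mathfrak{g}_\kappa^{-1}=\mathbb{K}$, zero differential, and brackets $\ell_2(x,y)=[x,y]$, $\ell_3(x,y,z)=\kappa(x,y,z)$ for $x,y,z\in\mathfrak{g}$. With $[x_a,x_b]=f^c_{ab}x_c$ and $\kappa_{abc}=\kappa(x_a,x_b,x_c)$ (summation convention), $\mathrm{CE}^\bullet(\mathfrak{g}_\kappa)$ has underlying graded commutative algebra $\mathbb{K}[\{\theta^a\},\nu]$, free on $\theta^a$ of degree $1$ ($a=1,\dots,\dim\mathfrak{g}$) and $\nu$ of degree $2$, with $\mathrm{d}_{\mathrm{CE}}\theta^a=-\frac12f^a_{bc}\theta^b\theta^c$, $\mathrm{d}_{\mathrm{CE}}\nu=-\frac1{3!}\kappa_{abc}\theta^a\theta^b\theta^c$. $\partial_a$ (degree $-1$) and $\partial_\nu$ (degree $-2$) are the derivations dual to the generators: $\partial_a\theta^b=\delta_a^b$, $\partial_a\nu=0$, $\partial_\nu\theta^a=0$, $\partial_\nu\nu=1$. Coefficients are symmetric, $\pi^{ab}=\pi^{ba}$; invariance means $f^a_{cd}\pi^{db}+f^b_{cd}\pi^{ad}=0$;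 as an element of $\mathfrak{g}\otimes\mathfrak{g}$, $\pi=\frac12\pi^{ab}x_a\otimes x_b$. In coefficients, the two displayed conditions are $\pi^{ac}\tilde\pi_c^b+\pi^{bc}\tilde\pi_c^a=0$ and $f_{bc}^d\tilde\pi^a_d-f_{bd}^a\tilde\pi^d_c+f_{cd}^a\tilde\pi^d_b-\kappa_{bcd}\pi^{da}=0$. **Enriched calculus.** $\mathbf{Ch}_{\mathbb{K}}$ is the symmetric monoidal category of unbounded cochain complexes (Koszul signs); $\mathbf{Ch}_{\mathbb{K}}^{[-1,0]}$ is the full subcategory of complexes concentrated in degrees $-1,0$. Good truncation: $\tau^{[-1,0]}(V)=\big(V^{-1}/\mathrm{d}V^{-2}\to\ker(\mathrm{d}:V^0\to V^1)\big)$. $\mathbf{Ch}_{\mathbb{K}}^{[-1,0]}$ is symmetric monoidal with $V\widetilde{\otimes}W:=\tau^{[-1,0]}(V\otimes W)$, unit $\mathbb{K}$, braiding $v\otimes w\mapsto w\otimes v$. For enriched categories, $\mathbf{C}\boxtimes\mathbf{D}$ has objects pairs $(c,d)$ and morphisms $\mathbf{C}(c,c')\widetilde{\otimes}\mathbf{D}(d,d')$; $\tau:\mathbf{C}\boxtimes\mathbf{D}\to\mathbf{D}\boxtimes\mathbf{C}$ is the flip functor; $F'\ast F$ is composition of enriched functors. A $\mathbf{Ch}_{\mathbb{K}}^{[-1,0]}$-enriched pseudo-natural transformation $\zeta:F\Rightarrow G:\mathbf{C}\to\mathbf{D}$ consists of elements $\zeta_c\in\mathbf{D}(F(c),G(c))^0$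 for all $c$ and linear maps $\zeta_{c,c'}:\mathbf{C}(c,c')^0\to\mathbf{D}(F(c),G(c'))^{-1}$ for all $c,c'$, such that: (1) $G(h)\zeta_c-\zeta_{c'}F(h)=\mathrm{d}(\zeta_{c,c'}(h))$ for $h\in\mathbf{C}(c,c')^0$ and $G(k)\zeta_c-\zeta_{c'}F(k)=\zeta_{c,c'}(\mathrm{d}k)$ for $k\in\mathbf{C}(c,c')^{-1}$; (2) $\zeta_{c,c}(\mathrm{id}_c)=0$; (3) $\zeta_{c,c''}(h'h)=\zeta_{c',c''}(h')F(h)+G(h')\zeta_{c,c'}(h)$. It is strict if all $\zeta_{c,c'}=0$. Sums are componentwise. Compositions: - for $\zeta:F\Rightarrow G$, $\eta:G\Rightarrow H$: $(\eta\circ\zeta)_c=\eta_c\zeta_c$, $(\eta\circ\zeta)_{c,c'}(h)=\eta_{c,c'}(h)\zeta_c+\eta_{c'}\zeta_{c,c'}(h)$; identity $\mathrm{Id}_F$ with $(\mathrm{Id}_F)_c=\mathrm{id}$, $(\mathrm{Id}_F)_{c,c'}=0$; - for $\zeta:F\Rightarrow G:\mathbf{C}\to\mathbf{D}$, $\zeta':F'\Rightarrow G':\mathbf{D}\to\mathbf{E}$: $(\zeta'\ast\zeta)_c=\zeta'_{G(c)}F'(\zeta_c)$, $(\zeta'\ast\zeta)_{c,c'}(h)=\zeta'_{G(c),G(c')}(G(h))F'(\zeta_c)+\zeta'_{G(c')}F'(\zeta_{c,c'}(h))$; - for $\zeta:F\Rightarrow F'$, $\eta:G\Rightarrow G'$: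 $(\zeta\boxtimes\eta)_{(c,d)}=\zeta_c\widetilde{\otimes}\eta_d$, $(\zeta\boxtimes\eta)_{(c,d),(c',d')}(h\widetilde{\otimes}k)=\zeta_{c,c'}(h)\widetilde{\otimes}G'(k)\eta_d+\zeta_{c'}F(h)\widetilde{\otimes}\eta_{d,d'}(k)$. **dg-modules.** An $A$-dg-module $M$ is finitely generated semi-free if $M^\sharp\cong A^\sharp\otimes W^\sharp$ as graded $A^\sharp$-modules with $W^\sharp$ of finite total dimension ($\sharp$ denotes forgetting differentials). Objects come with such generators $W^\sharp$, and $M\otimes_AN$ carries the induced generators. $\underline{\mathrm{hom}}_A(M,N)$ is the complex of homogeneous linear maps with $f(am)=(-1)^{|f||a|}af(m)$ and differential $\mathrm{d}_Nf-(-1)^{|f|}f\mathrm{d}_M$. ${}_A\mathbf{C}$ is the $\mathbf{Ch}_{\mathbb{K}}^{[-1,0]}$-enriched category (homotopy $2$-category) with objects the finitely generated semi-free $A$-dg-modules and ${}_A\mathbf{C}(M,N)=\tau^{[-1,0]}\underline{\mathrm{hom}}_A(M,N)$, symmetric monoidal with the relative tensor product functor $\otimes_A$, unit $A$, standard strict associator $\alpha:\otimes_A\ast(\otimes_A\boxtimes\mathrm{id})\Rightarrow\otimes_A\ast(\mathrm{id}\boxtimes\otimes_A)$ and unitors, and strict braiding $\gamma:\otimes_A\Rightarrow\otimes_A\ast\tau$, $\gamma_{M,N}(m\otimes n)=(-1)^{|m||n|}n\otimes m$. **Infinitesimal $2$-braidings.** Write $\tau_{12}=\tau\boxtimes\mathrm{id}$,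 $\tau_{23}=\mathrm{id}\boxtimes\tau$. An infinitesimal $2$-braiding on ${}_A\mathbf{C}$ is an enriched pseudo-natural transformation $t:\otimes_A\Rightarrow\otimes_A$ such that $$\alpha^{-1}\circ(t\ast\mathrm{Id}_{\mathrm{id}\boxtimes\otimes_A})\circ\alpha=\mathrm{Id}\ast(t\boxtimes\mathrm{Id})+\big(\mathrm{Id}\ast(\gamma\boxtimes\mathrm{Id})^{-1}\big)\circ\Big(\big(\alpha^{-1}\circ(\mathrm{Id}\ast(\mathrm{Id}\boxtimes t))\circ\alpha\big)\ast\mathrm{Id}_{\tau_{12}}\Big)\circ\big(\mathrm{Id}\ast(\gamma\boxtimes\mathrm{Id})\big),$$ $$\alpha\circ(t\ast\mathrm{Id}_{\otimes_A\boxtimes\mathrm{id}})\circ\alpha^{-1}=\mathrm{Id}\ast(\mathrm{Id}\boxtimes t)+\big(\mathrm{Id}\ast(\mathrm{Id}\boxtimes\gamma)^{-1}\big)\circ\Big(\big(\alpha\circ(\mathrm{Id}\ast(t\boxtimes\mathrm{Id}))\circ\alpha^{-1}\big)\ast\mathrm{Id}_{\tau_{23}}\Big)\circ\big(\mathrm{Id}\ast(\mathrm{Id}\boxtimes\gamma)\big).$$ It is $\gamma$-equivariant if $\gamma\circ t=(t\ast\mathrm{Id}_\tau)\circ\gamma$. **$2$-shifted Poisson structures.** $V[n]^i=V^{i+n}$, $\mathrm{d}_{V[n]}=(-1)^n\mathrm{d}_V$; elements of $V[n]\cong\mathbb{K}[n]\otimes V$ are $s^{-n}v$, $|s^{-n}|=-n$,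 $a\cdot s^{-n}v=(-1)^{n|a|}s^{-n}(av)$. $\mathsf{T}_A$ is the $A$-dg-module of graded derivations of $A$ (differential $[\mathrm{d}_A,\cdot]$). $\widehat{\mathrm{Pol}}(A,2)=\prod_{m\geq0}\mathrm{Sym}_A^m(\mathsf{T}_A[-3])$ ($m$ = weight) carries the degree $-3$ bracket with $\{a,a'\}=0$, $\{s^3D,a\}=D(a)$, $\{s^3D,s^3D'\}=(-1)^{|D|}s^3[D,D']$, extended by $\{P,Q\}=(-1)^{|P||Q|}\{Q,P\}$ and $\{P,QQ'\}=\{P,Q\}Q'+(-1)^{(|P|-3)|Q|}Q\{P,Q'\}$. A $2$-shifted Poisson structure is an element of degree $4$ and weight $\geq2$ satisfying $\mathrm{d}\pi+\frac12\{\pi,\pi\}=0$. **Construction of $t$.** $\Omega_A=\underline{\mathrm{hom}}_A(\mathsf{T}_A,A)$, $\langle D,\omega\rangle=(-1)^{|D||\omega|}\omega(D)$, and $\mathrm{d}_{\mathrm{dR}}:A\to\Omega_A$ satisfies $\langle D,\mathrm{d}_{\mathrm{dR}}a\rangle=D(a)$. $\xi:\mathrm{id}\Rightarrow\Omega_A[1]\otimes_A(\cdot)$ is the pseudo-natural transformation given on generators by $\xi_M(1\otimes w)=s^{-1}(\mathrm{d}_{\mathrm{dR}}\otimes\mathrm{id})(\mathrm{d}_M(1\otimes w))$ and $\xi_{M,M'}(h)(1\otimes w)=-s^{-1}(\mathrm{d}_{\mathrm{dR}}\otimes\mathrm{id})(h(1\otimes w))$, extended $A$-linearly (with Koszul sign).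 $\sigma$ is the strict natural isomorphism with components $\mathrm{id}\otimes_A\gamma_{M,\Omega_A[1]}\otimes_A\mathrm{id}:\Omega_A[1]\otimes_AM\otimes_A\Omega_A[1]\otimes_AN\to\Omega_A[1]\otimes_A\Omega_A[1]\otimes_AM\otimes_AN$. Via $\mathrm{Sym}_A^2(\mathsf{T}_A[-3])^4\cong\mathrm{Sym}^2_A(\mathsf{T}_A[-1])^0$, $\pi^{(2)}$ defines $\langle\pi^{(2)},\cdot\rangle:\Omega_A[1]\otimes_A\Omega_A[1]\to A$ through $$\langle sD\,sD',s^{-1}\omega\otimes_As^{-1}\omega'\rangle=(-1)^{|\omega|+|D|}\langle D,\langle D',\omega\rangle\cdot\omega'\rangle+(-1)^{(|D|+1)(|D'|+1)}(-1)^{|\omega|+|D'|}\langle D',\langle D,\omega\rangle\cdot\omega'\rangle,$$ and $\iota_\pi$ is the strict natural transformation with components $\langle\pi^{(2)},\cdot\rangle\otimes_A\mathrm{id}\otimes_A\mathrm{id}$. *)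

theory Defs
  imports Main HOL.Vector_Spaces "HOL-Library.Poly_Mapping" "HOL-Library.Function_Algebras"
    "HOL-Library.Product_Plus"
begin

section \<open>Lie algebras and 3-cocycles\<close>

definition lie_algebra ::
  "('k::field \<Rightarrow> 'g::ab_group_add \<Rightarrow> 'g) \<Rightarrow> ('g \<Rightarrow> 'g \<Rightarrow> 'g) \<Rightarrow> bool" where
  "lie_algebra scale br \<longleftrightarrow>
     vector_space scale \<and>
     (\<forall>u. Vector_Spaces.linear scale scale (br u)) \<and>
     (\<forall>v. Vector_Spaces.linear scale scale (\<lambda>u. br u v)) \<and>
     (\<forall>u. br u u = 0) \<and>
     (\<forall>u v w. br u (br v w) + br v (br w u) + br w (br u v) = 0)"

definition finite_basis ::
  "('k::field \<Rightarrow> 'g::ab_group_add \<Rightarrow> 'g) \<Rightarrow> nat \<Rightarrow> (nat \<Rightarrow> 'g) \<Rightarrow> bool" where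
  "finite_basis scale n x \<longleftrightarrow>
     inj_on x {..<n} \<and> \<not> module.dependent scale (x ` {..<n}) \<and>
     module.span scale (x ` {..<n}) = UNIV"

definition three_cocycle ::
  "('k::field \<Rightarrow> 'g::ab_group_add \<Rightarrow> 'g) \<Rightarrow> ('g \<Rightarrow> 'g \<Rightarrow> 'g) \<Rightarrow>
   ('g \<Rightarrow> 'g \<Rightarrow> 'g \<Rightarrow> 'k) \<Rightarrow> bool" where
  "three_cocycle scale br \<kappa> \<longleftrightarrow>
     (\<forall>v w. Vector_Spaces.linear scale (*) (\<lambda>u. \<kappa> u v w)) \<and>
     (\<forall>u w. Vector_Spaces.linear scale (*) (\<lambda>v. \<kappa> u v w)) \<and>
     (\<forall>u v. Vector_Spaces.linear scale (*) (\<lambda>w. \<kappa> u v w)) \<and>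
     (\<forall>u v. \<kappa> u u v = 0 \<and> \<kappa> u v v = 0 \<and> \<kappa> u v u = 0) \<and>
     (\<forall>u v w z. \<kappa> (br u v) w z - \<kappa> (br u w) v z + \<kappa> (br u z) v w
              + \<kappa> (br v w) u z - \<kappa> (br v z) u w + \<kappa> (br w z) u v = 0)"


section \<open>Free graded commutative algebras with a differential\<close>

text \<open>
  Elements of the free graded commutative algebra on generators z_0, ..., z_{N-1} are linear
  combinations of exponent vectors; the exponent vector m stands for the ordered product
  z_0^{m_0} z_1^{m_1} ... , where generators of odd degree occur at most once.
\<close>

type_synonym 'k fga = "(nat \<Rightarrow>\<^sub>0 nat) \<Rightarrow>\<^sub>0 'k"

record gvars =
  ngen :: nat
  zdeg :: "nat \<Rightarrow> int"

record (overloaded) 'k cdga = gvars +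
  adiff :: "'k fga \<Rightarrow> 'k fga"

definition sg :: "int \<Rightarrow> 'a::ring_1" where
  "sg k = (if even k then 1 else - 1)"

definition mon_ok :: "'z gvars_scheme \<Rightarrow> (nat \<Rightarrow>\<^sub>0 nat) \<Rightarrow> bool" where
  "mon_ok V m \<longleftrightarrow>
     Poly_Mapping.keys m \<subseteq> {..<ngen V} \<and> (\<forall>i. odd (zdeg V i) \<longrightarrow> Poly_Mapping.lookup m i \<le> 1)"

definition mdeg :: "'z gvars_scheme \<Rightarrow> (nat \<Rightarrow>\<^sub>0 nat) \<Rightarrow> int" where
  "mdeg V m = (\<Sum>i\<in>Poly_Mapping.keys m. int (Poly_Mapping.lookup m i) * zdeg V i)"

definition acar :: "'z gvars_scheme \<Rightarrow> 'k::field fga set" where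
  "acar V = {a. \<forall>m\<in>Poly_Mapping.keys a. mon_ok V m}"

definition ahom :: "'z gvars_scheme \<Rightarrow> int \<Rightarrow> 'k::field fga set" where
  "ahom V k = {a \<in> acar V. \<forall>m\<in>Poly_Mapping.keys a. mdeg V m = k}"

definition fsm :: "'k::field \<Rightarrow> ('a \<Rightarrow>\<^sub>0 'k) \<Rightarrow> ('a \<Rightarrow>\<^sub>0 'k)" where
  "fsm c = Poly_Mapping.map ((*) c)"

definition avar :: "nat \<Rightarrow> 'k::field fga" where
  "avar i = Poly_Mapping.single (Poly_Mapping.single i 1) 1"

text \<open>
  The multiplication of \<^typ>\<open>'k fga\<close> that comes with \<^theory>\<open>HOL-Library.Poly_Mapping\<close> is
  the ungraded one and is never used; only its unit and its additive structure are.
\<close>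

definition amul :: "'z gvars_scheme \<Rightarrow> 'k::field fga \<Rightarrow> 'k fga \<Rightarrow> 'k fga" where
  "amul V a b =
     (\<Sum>m\<in>Poly_Mapping.keys a. \<Sum>m'\<in>Poly_Mapping.keys b.
        if mon_ok V (m + m') then
          Poly_Mapping.single (m + m')
            (sg (\<Sum>i\<in>Poly_Mapping.keys m. \<Sum>j\<in>Poly_Mapping.keys m' \<inter> {..<i}.
                   int (Poly_Mapping.lookup m i) * zdeg V i *
                   (int (Poly_Mapping.lookup m' j) * zdeg V j))
             * Poly_Mapping.lookup a m * Poly_Mapping.lookup b m')
        else 0)"

text \<open>The linear extension of a \<open>\<mapsto>\<close> (-1)^{k |a|} a on homogeneous a.\<close>

definition ksgn :: "'z gvars_scheme \<Rightarrow> int \<Rightarrow> 'k::field fga \<Rightarrow> 'k fga" where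
  "ksgn V k a =
     (\<Sum>m\<in>Poly_Mapping.keys a.
        Poly_Mapping.single m (sg (k * mdeg V m) * Poly_Mapping.lookup a m))"

text \<open>
  The derivation dual to z_i, acting from the left: moving it past the generators
  preceding z_i produces the sign.
\<close>

definition apar :: "'z gvars_scheme \<Rightarrow> nat \<Rightarrow> 'k::field fga \<Rightarrow> 'k fga" where
  "apar V i a =
     (\<Sum>m\<in>Poly_Mapping.keys a.
        Poly_Mapping.single (m - Poly_Mapping.single i 1)
          (of_nat (Poly_Mapping.lookup m i)
           * sg (zdeg V i * (\<Sum>j\<in>Poly_Mapping.keys m \<inter> {..<i}.
                                int (Poly_Mapping.lookup m j) * zdeg V j))
           * Poly_Mapping.lookup a m))"

text \<open>The derivation with prescribed values v i on the generators z_i.\<close>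

definition ader :: "'z gvars_scheme \<Rightarrow> (nat \<Rightarrow> 'k::field fga) \<Rightarrow> 'k fga \<Rightarrow> 'k fga" where
  "ader V v a = (if a \<in> acar V then (\<Sum>i<ngen V. amul V (v i) (apar V i a)) else 0)"

text \<open>
  The Chevalley-Eilenberg algebra of the string Lie 2-algebra: theta^a is the generator with
  number a < n, nu is the generator with number n. Here f a b c is the coefficient of x_c in
  [x_a, x_b], and K a b c is the value of the cocycle on (x_a, x_b, x_c).
\<close>

definition CE_gvars :: "nat \<Rightarrow> gvars" where
  "CE_gvars n = \<lparr>ngen = Suc n, zdeg = (\<lambda>i. if i < n then 1 else 2)\<rparr>"

definition CE ::
  "nat \<Rightarrow> (nat \<Rightarrow> nat \<Rightarrow> nat \<Rightarrow> 'k::field_char_0) \<Rightarrow> (nat \<Rightarrow> nat \<Rightarrow> nat \<Rightarrow> 'k) \<Rightarrow> 'k cdga" where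
  "CE n f K =
     (let V = CE_gvars n in
      \<lparr>ngen = ngen V, zdeg = zdeg V, adiff = ader V (\<lambda>i.
        if i < n then
          (\<Sum>b<n. \<Sum>c<n. fsm (- (1 / 2) * f b c i) (amul V (avar b) (avar c)))
        else
          (\<Sum>a<n. \<Sum>b<n. \<Sum>c<n.
             fsm (- (1 / fact 3) * K a b c) (amul V (amul V (avar a) (avar b)) (avar c))))\<rparr>)"


section \<open>Derivations and 2-shifted Poisson structures\<close>

text \<open>The degree p part of the dg-module of derivations of A.\<close>

definition der :: "'z gvars_scheme \<Rightarrow> int \<Rightarrow> ('k::field fga \<Rightarrow> 'k fga) set" where
  "der V p = {D.
     (\<forall>a. a \<notin> acar V \<longrightarrow> D a = 0) \<and>
     (\<forall>a\<in>acar V. \<forall>b\<in>acar V. D (a + b) = D a + D b) \<and>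
     (\<forall>c. \<forall>a\<in>acar V. D (fsm c a) = fsm c (D a)) \<and>
     (\<forall>k. \<forall>a\<in>ahom V k. D a \<in> ahom V (k + p)) \<and>
     (\<forall>k. \<forall>a\<in>ahom V k. \<forall>b\<in>acar V.
        D (amul V a b) = amul V (D a) b + fsm (sg (p * k)) (amul V a (D b)))}"

definition dcomm ::
  "int \<Rightarrow> int \<Rightarrow> ('k::field fga \<Rightarrow> 'k fga) \<Rightarrow> ('k fga \<Rightarrow> 'k fga) \<Rightarrow> 'k fga \<Rightarrow> 'k fga" where
  "dcomm p q D D' a = D (D' a) - fsm (sg (p * q)) (D' (D a))"

text \<open>
  As T_A is free over A on the derivations dual to the generators, Sym_A(T_A[-3]) is the free
  graded commutative algebra on z_i (i < N) and s^3 d/dz_i, the latter being generator number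
  N + i, of degree 3 - |z_i|; A is contained in it as the set of elements in the first N
  variables. In the applications all these generators have positive degree, so that a
  homogeneous element of the product over all weights is a finite sum.
\<close>

definition Pol_gvars :: "'z gvars_scheme \<Rightarrow> gvars" where
  "Pol_gvars A = \<lparr>ngen = 2 * ngen A,
     zdeg = (\<lambda>i. if i < ngen A then zdeg A i else 3 - zdeg A (i - ngen A))\<rparr>"

definition s3par :: "'z gvars_scheme \<Rightarrow> nat \<Rightarrow> 'k::field fga" where
  "s3par A i = avar (ngen A + i)"

text \<open>
  s^3 D for a derivation D = sum_i D(z_i) d/dz_i, using s^3 (a D) = (-1)^{|a|} a s^3 D.
\<close>

definition s3 :: "'z gvars_scheme \<Rightarrow> ('k::field fga \<Rightarrow> 'k fga) \<Rightarrow> 'k fga" where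
  "s3 A D = (\<Sum>i<ngen A. amul (Pol_gvars A) (ksgn A 1 (D (avar i))) (s3par A i))"

text \<open>The differential of T_A[-3] is s^3 D \<open>\<mapsto>\<close> - s^3 [d, D].\<close>

definition Pol_diff :: "'k::field cdga \<Rightarrow> 'k fga \<Rightarrow> 'k fga" where
  "Pol_diff A = ader (Pol_gvars A) (\<lambda>i.
     if i < ngen A then adiff A (avar i)
     else - s3 A (dcomm 1 (- zdeg A (i - ngen A)) (adiff A) (apar A (i - ngen A))))"

definition Pol_weight :: "'z gvars_scheme \<Rightarrow> (nat \<Rightarrow>\<^sub>0 nat) \<Rightarrow> nat" where
  "Pol_weight A m = (\<Sum>i\<in>Poly_Mapping.keys m - {..<ngen A}. Poly_Mapping.lookup m i)"

definition is_Pol_bracket ::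
  "'k::field cdga \<Rightarrow> ('k fga \<Rightarrow> 'k fga \<Rightarrow> 'k fga) \<Rightarrow> bool" where
  "is_Pol_bracket A br \<longleftrightarrow> (let V = Pol_gvars A in
     (\<forall>P\<in>acar V. \<forall>Q\<in>acar V. \<forall>R\<in>acar V. \<forall>c.
        br (P + Q) R = br P R + br Q R \<and> br P (Q + R) = br P Q + br P R \<and>
        br (fsm c P) Q = fsm c (br P Q) \<and> br P (fsm c Q) = fsm c (br P Q)) \<and>
     (\<forall>p q. \<forall>P\<in>ahom V p. \<forall>Q\<in>ahom V q. br P Q \<in> ahom V (p + q - 3)) \<and>
     (\<forall>a\<in>acar A. \<forall>a'\<in>acar A. br a a' = 0) \<and>
     (\<forall>p. \<forall>D\<in>der A p. \<forall>a\<in>acar A. br (s3 A D) a = D a) \<and>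
     (\<forall>p q. \<forall>D\<in>der A p. \<forall>D'\<in>der A q.
        br (s3 A D) (s3 A D') = fsm (sg p) (s3 A (dcomm p q D D'))) \<and>
     (\<forall>p q. \<forall>P\<in>ahom V p. \<forall>Q\<in>ahom V q. br P Q = fsm (sg (p * q)) (br Q P)) \<and>
     (\<forall>p q. \<forall>P\<in>ahom V p. \<forall>Q\<in>ahom V q. \<forall>R\<in>acar V.
        br P (amul V Q R) =
          amul V (br P Q) R + fsm (sg ((p - 3) * q)) (amul V Q (br P R))))"

text \<open>The conditions determine the bracket uniquely on the elements of the algebra.\<close>

definition Pol_bracket :: "'k::field cdga \<Rightarrow> 'k fga \<Rightarrow> 'k fga \<Rightarrow> 'k fga" where
  "Pol_bracket A = (SOME br. is_Pol_bracket A br)"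

definition poisson2 :: "'k::field cdga \<Rightarrow> 'k fga \<Rightarrow> bool" where
  "poisson2 A P \<longleftrightarrow>
     P \<in> ahom (Pol_gvars A) 4 \<and>
     (\<forall>m\<in>Poly_Mapping.keys P. 2 \<le> Pol_weight A m) \<and>
     Pol_diff A P + fsm (1 / 2) (Pol_bracket A P P) = 0"

text \<open>Here pt b a is the coefficient of x_a in the image of x_b.\<close>

definition pi2 ::
  "nat \<Rightarrow> (nat \<Rightarrow> nat \<Rightarrow> 'k::field_char_0) \<Rightarrow> (nat \<Rightarrow> nat \<Rightarrow> 'k) \<Rightarrow> 'k fga" where
  "pi2 n \<pi> pt = (let A = CE_gvars n; V = Pol_gvars A in
     (\<Sum>a<n. \<Sum>b<n. fsm (1 / 2 * \<pi> a b) (amul V (s3par A a) (s3par A b))) +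
     (\<Sum>a<n. \<Sum>b<n. fsm (pt b a) (amul V (amul V (avar b) (s3par A a)) (s3par A n))))"


section \<open>Finitely generated semi-free dg-modules\<close>

text \<open>
  A finitely generated semi-free A-dg-module is given by a homogeneous basis of the graded
  vector space W of generators together with a differential on the free module A (x) W. The
  basis elements are labelled by binary trees, so that the labels are closed under forming
  pairs; GPair v w labels the generator v (x) w of a relative tensor product. The element
  sum_w a_w (x) w is the function mapping w to a_w.
\<close>

datatype gen = GAtom nat | GPair gen gen

type_synonym 'k mel = "gen \<Rightarrow> 'k fga"
type_synonym 'k mmap = "'k mel \<Rightarrow> 'k mel"

record (overloaded) 'k sfmod =
  gens :: "gen set"
  gdeg :: "gen \<Rightarrow> int"
  mdiff :: "'k mmap"

definition mcar :: "'z gvars_scheme \<Rightarrow> gen set \<Rightarrow> 'k::field mel set" where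
  "mcar A W = {x. \<forall>w. x w \<in> acar A \<and> (w \<notin> W \<longrightarrow> x w = 0)}"

definition mhom :: "'z gvars_scheme \<Rightarrow> 'k::field sfmod \<Rightarrow> int \<Rightarrow> 'k mel set" where
  "mhom A M k = {x \<in> mcar A (gens M). \<forall>w\<in>gens M. x w \<in> ahom A (k - gdeg M w)}"

definition msc :: "'k::field \<Rightarrow> 'k mel \<Rightarrow> 'k mel" where
  "msc c x = (\<lambda>w. fsm c (x w))"

definition mact :: "'z gvars_scheme \<Rightarrow> 'k::field fga \<Rightarrow> 'k mel \<Rightarrow> 'k mel" where
  "mact A a x = (\<lambda>w. amul A a (x w))"

definition ge :: "gen \<Rightarrow> 'k::field mel" where
  "ge w = (\<lambda>v. if v = w then 1 else 0)"

definition is_sfmod :: "'k::field cdga \<Rightarrow> 'k sfmod \<Rightarrow> bool" where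
  "is_sfmod A M \<longleftrightarrow> finite (gens M) \<and>
     (\<forall>x. x \<notin> mcar A (gens M) \<longrightarrow> mdiff M x = 0) \<and>
     (\<forall>x\<in>mcar A (gens M). \<forall>y\<in>mcar A (gens M). mdiff M (x + y) = mdiff M x + mdiff M y) \<and>
     (\<forall>c. \<forall>x\<in>mcar A (gens M). mdiff M (msc c x) = msc c (mdiff M x)) \<and>
     (\<forall>k. \<forall>x\<in>mhom A M k. mdiff M x \<in> mhom A M (k + 1)) \<and>
     (\<forall>x\<in>mcar A (gens M). mdiff M (mdiff M x) = 0) \<and>
     (\<forall>k. \<forall>a\<in>ahom A k. \<forall>x\<in>mcar A (gens M).
        mdiff M (mact A a x) = mact A (adiff A a) x + msc (sg k) (mact A a (mdiff M x)))"

text \<open>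
  The degree p map on the free module with basis W that satisfies
  F(a x) = (-1)^{p |a|} a F(x) and has the values phi w on the basis.
\<close>

definition alin ::
  "'z gvars_scheme \<Rightarrow> gen set \<Rightarrow> int \<Rightarrow> (gen \<Rightarrow> 'k::field mel) \<Rightarrow> 'k mmap" where
  "alin A W p \<phi> x =
     (if x \<in> mcar A W then (\<Sum>w\<in>W. mact A (ksgn A p (x w)) (\<phi> w)) else 0)"

text \<open>
  The degree 1 map d on the free module with basis W that satisfies
  d(a x) = d(a) x + (-1)^{|a|} a d(x) and has the values phi w on the basis.
\<close>

definition dlin ::
  "'k::field cdga \<Rightarrow> gen set \<Rightarrow> (gen \<Rightarrow> 'k mel) \<Rightarrow> 'k mmap" where
  "dlin A W \<phi> x =
     (if x \<in> mcar A W then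
        (\<Sum>w\<in>W. mact A (adiff A (x w)) (ge w) + mact A (ksgn A 1 (x w)) (\<phi> w)) else 0)"

text \<open>
  The element x (x)_A y of a relative tensor product; dg is the degree of the generators of
  the left module: (a v) (x) (b w) = (-1)^{|v| |b|} a b (v (x) w).
\<close>

definition tel :: "'z gvars_scheme \<Rightarrow> (gen \<Rightarrow> int) \<Rightarrow> 'k::field mel \<Rightarrow> 'k mel \<Rightarrow> 'k mel" where
  "tel A dg x y = (\<lambda>g. case g of GAtom i \<Rightarrow> 0
     | GPair v w \<Rightarrow> amul A (x v) (ksgn A (dg v) (y w)))"

definition mtens :: "'k::field cdga \<Rightarrow> 'k sfmod \<Rightarrow> 'k sfmod \<Rightarrow> 'k sfmod" where
  "mtens A M N = (let W = (\<lambda>(v, w). GPair v w) ` (gens M \<times> gens N) in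
     \<lparr>gens = W,
      gdeg = (\<lambda>g. case g of GAtom i \<Rightarrow> 0 | GPair v w \<Rightarrow> gdeg M v + gdeg N w),
      mdiff = dlin A W (\<lambda>g. case g of GAtom i \<Rightarrow> 0 | GPair v w \<Rightarrow>
        tel A (gdeg M) (mdiff M (ge v)) (ge w) +
        msc (sg (gdeg M v)) (tel A (gdeg M) (ge v) (mdiff N (ge w))))\<rparr>)"

text \<open>
  The map h (x)_A k from M (x)_A N for h of degree p with values in M' and k of degree q:
  (h (x) k)(m (x) n) = (-1)^{q |m|} h(m) (x) k(n).
\<close>

definition tmap ::
  "'k::field cdga \<Rightarrow> 'k sfmod \<Rightarrow> 'k sfmod \<Rightarrow> 'k sfmod \<Rightarrow> int \<Rightarrow> int \<Rightarrow>
   'k mmap \<Rightarrow> 'k mmap \<Rightarrow> 'k mmap" where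
  "tmap A M N M' p q h k =
     alin A (gens (mtens A M N)) (p + q) (\<lambda>g. case g of GAtom i \<Rightarrow> 0 | GPair v w \<Rightarrow>
       msc (sg (q * gdeg M v)) (tel A (gdeg M') (h (ge v)) (k (ge w))))"

text \<open>
  The degree p part of the complex of morphisms from M to N. As maps are extended by zero
  outside the module M, equality of morphisms is equality of functions.
\<close>

definition lin_hom ::
  "'k::field cdga \<Rightarrow> 'k sfmod \<Rightarrow> 'k sfmod \<Rightarrow> int \<Rightarrow> 'k mmap set" where
  "lin_hom A M N p = {h.
     (\<forall>x. x \<notin> mcar A (gens M) \<longrightarrow> h x = 0) \<and>
     (\<forall>x\<in>mcar A (gens M). \<forall>y\<in>mcar A (gens M). h (x + y) = h x + h y) \<and>
     (\<forall>c. \<forall>x\<in>mcar A (gens M). h (msc c x) = msc c (h x)) \<and>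
     (\<forall>k. \<forall>x\<in>mhom A M k. h x \<in> mhom A N (k + p)) \<and>
     (\<forall>k. \<forall>a\<in>ahom A k. \<forall>x\<in>mcar A (gens M).
        h (mact A a x) = msc (sg (p * k)) (mact A a (h x)))}"

definition hdiff ::
  "'k::field sfmod \<Rightarrow> 'k sfmod \<Rightarrow> int \<Rightarrow> 'k mmap \<Rightarrow> 'k mmap" where
  "hdiff M N p h = (\<lambda>x. mdiff N (h x) - msc (sg p) (h (mdiff M x)))"

definition mid :: "'z gvars_scheme \<Rightarrow> 'k::field sfmod \<Rightarrow> 'k mmap" where
  "mid A M = (\<lambda>x. if x \<in> mcar A (gens M) then x else 0)"


section \<open>Calculus enriched in cochain complexes concentrated in degrees -1 and 0\<close>

text \<open>
  A complex concentrated in degrees -1 and 0 is presented by subquotients: its degree 0 part is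
  deg0 modulo the subspace null0 and its degree -1 part is degm modulo nullm. Elements are
  given by representatives, and equality of elements is congruence modulo the null subspace.
\<close>

record ('k, 'm, 'n) ch2 =
  deg0 :: "'m set"
  null0 :: "'m set"
  degm :: "'n set"
  nullm :: "'n set"
  dd :: "'n \<Rightarrow> 'm"
  sc0 :: "'k \<Rightarrow> 'm \<Rightarrow> 'm"
  scm :: "'k \<Rightarrow> 'n \<Rightarrow> 'n"

definition eq0 :: "('k, 'm::ab_group_add, 'n) ch2 \<Rightarrow> 'm \<Rightarrow> 'm \<Rightarrow> bool" where
  "eq0 V u v \<longleftrightarrow> u - v \<in> null0 V"

definition eqm :: "('k, 'm, 'n::ab_group_add) ch2 \<Rightarrow> 'n \<Rightarrow> 'n \<Rightarrow> bool" where
  "eqm V u v \<longleftrightarrow> u - v \<in> nullm V"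

text \<open>
  The tensor product of A modulo NA and B modulo NB is the space of formal linear combinations
  of pairs (u, v) modulo the following subspace.
\<close>

inductive_set tnull ::
  "('k::field \<Rightarrow> 'm::ab_group_add \<Rightarrow> 'm) \<Rightarrow> 'm set \<Rightarrow> 'm set \<Rightarrow>
   ('k \<Rightarrow> 'n::ab_group_add \<Rightarrow> 'n) \<Rightarrow> 'n set \<Rightarrow> 'n set \<Rightarrow> (('m \<times> 'n) \<Rightarrow>\<^sub>0 'k) set"
  for sA :: "'k \<Rightarrow> 'm \<Rightarrow> 'm" and A NA :: "'m set"
  and sB :: "'k \<Rightarrow> 'n \<Rightarrow> 'n" and B NB :: "'n set" where
  zero: "0 \<in> tnull sA A NA sB B NB"
| plus: "p \<in> tnull sA A NA sB B NB \<Longrightarrow> q \<in> tnull sA A NA sB B NB \<Longrightarrow>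
    p + q \<in> tnull sA A NA sB B NB"
| add_left: "u \<in> A \<Longrightarrow> u' \<in> A \<Longrightarrow> v \<in> B \<Longrightarrow>
    Poly_Mapping.single (u + u', v) c - Poly_Mapping.single (u, v) c
      - Poly_Mapping.single (u', v) c \<in> tnull sA A NA sB B NB"
| add_right: "u \<in> A \<Longrightarrow> v \<in> B \<Longrightarrow> v' \<in> B \<Longrightarrow>
    Poly_Mapping.single (u, v + v') c - Poly_Mapping.single (u, v) c
      - Poly_Mapping.single (u, v') c \<in> tnull sA A NA sB B NB"
| scale_left: "u \<in> A \<Longrightarrow> v \<in> B \<Longrightarrow>
    Poly_Mapping.single (sA r u, v) c - Poly_Mapping.single (u, v) (r * c)
      \<in> tnull sA A NA sB B NB"
| scale_right: "u \<in> A \<Longrightarrow> v \<in> B \<Longrightarrow>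
    Poly_Mapping.single (u, sB r v) c - Poly_Mapping.single (u, v) (r * c)
      \<in> tnull sA A NA sB B NB"
| null_left: "u \<in> NA \<Longrightarrow> v \<in> B \<Longrightarrow> Poly_Mapping.single (u, v) c \<in> tnull sA A NA sB B NB"
| null_right: "u \<in> A \<Longrightarrow> v \<in> NB \<Longrightarrow> Poly_Mapping.single (u, v) c \<in> tnull sA A NA sB B NB"

definition tcar :: "'m set \<Rightarrow> 'n set \<Rightarrow> (('m \<times> 'n) \<Rightarrow>\<^sub>0 'k::zero) set" where
  "tcar A B = {p. Poly_Mapping.keys p \<subseteq> A \<times> B}"

definition psum :: "('u \<Rightarrow> 'k \<Rightarrow> 'x) \<Rightarrow> ('u \<Rightarrow>\<^sub>0 'k::zero) \<Rightarrow> 'x::comm_monoid_add" where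
  "psum b p = (\<Sum>u\<in>Poly_Mapping.keys p. b u (Poly_Mapping.lookup p u))"

text \<open>
  The truncated tensor product. Its degree -1 part consists of pairs with components in
  V^0 (x) W^{-1} and V^{-1} (x) W^0, modulo the elements
  d(v (x) w) = d(v) (x) w - v (x) d(w) with v and w of degree -1.
\<close>

definition ch2_tens ::
  "('k::field, 'm::ab_group_add, 'n::ab_group_add) ch2 \<Rightarrow>
   ('k, 'r::ab_group_add, 's::ab_group_add) ch2 \<Rightarrow>
   ('k, ('m \<times> 'r) \<Rightarrow>\<^sub>0 'k, (('m \<times> 's) \<Rightarrow>\<^sub>0 'k) \<times> (('n \<times> 'r) \<Rightarrow>\<^sub>0 'k)) ch2" where
  "ch2_tens V W =
    \<lparr>deg0 = tcar (deg0 V) (deg0 W),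
     null0 = tnull (sc0 V) (deg0 V) (null0 V) (sc0 W) (deg0 W) (null0 W),
     degm = tcar (deg0 V) (degm W) \<times> tcar (degm V) (deg0 W),
     nullm = {(p + psum (\<lambda>(v, w). Poly_Mapping.single (dd V v, w)) r,
               q - psum (\<lambda>(v, w). Poly_Mapping.single (v, dd W w)) r) | p q r.
               p \<in> tnull (sc0 V) (deg0 V) (null0 V) (scm W) (degm W) (nullm W) \<and>
               q \<in> tnull (scm V) (degm V) (nullm V) (sc0 W) (deg0 W) (null0 W) \<and>
               r \<in> tcar (degm V) (degm W)},
     dd = (\<lambda>(p, q). psum (\<lambda>(v, w). Poly_Mapping.single (v, dd W w)) p +
                    psum (\<lambda>(v, w). Poly_Mapping.single (dd V v, w)) q),
     sc0 = fsm,
     scm = (\<lambda>c (p, q). (fsm c p, fsm c q))\<rparr>"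

text \<open>
  In an enriched category, composition is recorded by its components (deg 0, deg 0),
  (deg 0, deg -1) and (deg -1, deg 0), the morphism applied last being written first.
\<close>

record ('k, 'o, 'm, 'n) ecat =
  Ob :: "'o set"
  Hom :: "'o \<Rightarrow> 'o \<Rightarrow> ('k, 'm, 'n) ch2"
  c00 :: "'m \<Rightarrow> 'm \<Rightarrow> 'm"
  c0m :: "'m \<Rightarrow> 'n \<Rightarrow> 'n"
  cm0 :: "'n \<Rightarrow> 'm \<Rightarrow> 'n"
  idm :: "'o \<Rightarrow> 'm"

record ('o, 'm, 'n, 'p, 'r, 's) efun =
  fo :: "'o \<Rightarrow> 'p"
  f0 :: "'o \<Rightarrow> 'o \<Rightarrow> 'm \<Rightarrow> 'r"
  fm :: "'o \<Rightarrow> 'o \<Rightarrow> 'n \<Rightarrow> 's"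

definition boxC ::
  "('k::field, 'o, 'm::ab_group_add, 'n::ab_group_add) ecat \<Rightarrow>
   ('k, 'p, 'r::ab_group_add, 's::ab_group_add) ecat \<Rightarrow>
   ('k, 'o \<times> 'p, ('m \<times> 'r) \<Rightarrow>\<^sub>0 'k, (('m \<times> 's) \<Rightarrow>\<^sub>0 'k) \<times> (('n \<times> 'r) \<Rightarrow>\<^sub>0 'k)) ecat" where
  "boxC C D =
    \<lparr>Ob = Ob C \<times> Ob D,
     Hom = (\<lambda>(c, d) (c', d'). ch2_tens (Hom C c c') (Hom D d d')),
     c00 = (\<lambda>p q. psum (\<lambda>(h, k) a. psum (\<lambda>(h', k') b.
              Poly_Mapping.single (c00 C h h', c00 D k k') (a * b)) q) p),
     c0m = (\<lambda>p (q1, q2).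
              (psum (\<lambda>(h, k) a. psum (\<lambda>(h', k') b.
                 Poly_Mapping.single (c00 C h h', c0m D k k') (a * b)) q1) p,
               psum (\<lambda>(h, k) a. psum (\<lambda>(h', k') b.
                 Poly_Mapping.single (c0m C h h', c00 D k k') (a * b)) q2) p)),
     cm0 = (\<lambda>(p1, p2) q.
              (psum (\<lambda>(h, k) a. psum (\<lambda>(h', k') b.
                 Poly_Mapping.single (c00 C h h', cm0 D k k') (a * b)) q) p1,
               psum (\<lambda>(h, k) a. psum (\<lambda>(h', k') b.
                 Poly_Mapping.single (cm0 C h h', c00 D k k') (a * b)) q) p2)),
     idm = (\<lambda>(c, d). Poly_Mapping.single (idm C c, idm D d) 1)\<rparr>"

definition idF :: "('o, 'm, 'n, 'o, 'm, 'n) efun" where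
  "idF = \<lparr>fo = (\<lambda>c. c), f0 = (\<lambda>c c' h. h), fm = (\<lambda>c c' k. k)\<rparr>"

definition compF ::
  "('p, 'r, 's, 'q, 'u, 'v) efun \<Rightarrow> ('o, 'm, 'n, 'p, 'r, 's) efun \<Rightarrow>
   ('o, 'm, 'n, 'q, 'u, 'v) efun" where
  "compF G F = \<lparr>fo = (\<lambda>c. fo G (fo F c)),
     f0 = (\<lambda>c c' h. f0 G (fo F c) (fo F c') (f0 F c c' h)),
     fm = (\<lambda>c c' k. fm G (fo F c) (fo F c') (fm F c c' k))\<rparr>"

definition boxF ::
  "('o, 'm, 'n, 'o1, 'm1, 'n1) efun \<Rightarrow> ('p, 'r, 's, 'p1, 'r1, 's1) efun \<Rightarrow>
   ('o \<times> 'p, ('m \<times> 'r) \<Rightarrow>\<^sub>0 'k::field, (('m \<times> 's) \<Rightarrow>\<^sub>0 'k) \<times> (('n \<times> 'r) \<Rightarrow>\<^sub>0 'k),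
    'o1 \<times> 'p1, ('m1 \<times> 'r1) \<Rightarrow>\<^sub>0 'k, (('m1 \<times> 's1) \<Rightarrow>\<^sub>0 'k) \<times> (('n1 \<times> 'r1) \<Rightarrow>\<^sub>0 'k)) efun" where
  "boxF F G =
    \<lparr>fo = (\<lambda>(c, d). (fo F c, fo G d)),
     f0 = (\<lambda>(c, d) (c', d'). psum (\<lambda>(h, k).
             Poly_Mapping.single (f0 F c c' h, f0 G d d' k))),
     fm = (\<lambda>(c, d) (c', d') (p, q).
             (psum (\<lambda>(h, k). Poly_Mapping.single (f0 F c c' h, fm G d d' k)) p,
              psum (\<lambda>(h, k). Poly_Mapping.single (fm F c c' h, f0 G d d' k)) q))\<rparr>"

definition flipF ::
  "('o \<times> 'p, ('m \<times> 'r) \<Rightarrow>\<^sub>0 'k::field, (('m \<times> 's) \<Rightarrow>\<^sub>0 'k) \<times> (('n \<times> 'r) \<Rightarrow>\<^sub>0 'k),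
    'p \<times> 'o, ('r \<times> 'm) \<Rightarrow>\<^sub>0 'k, (('r \<times> 'n) \<Rightarrow>\<^sub>0 'k) \<times> (('s \<times> 'm) \<Rightarrow>\<^sub>0 'k)) efun" where
  "flipF =
    \<lparr>fo = (\<lambda>(c, d). (d, c)),
     f0 = (\<lambda>_ _. psum (\<lambda>(h, k). Poly_Mapping.single (k, h))),
     fm = (\<lambda>_ _ (p, q). (psum (\<lambda>(h, k). Poly_Mapping.single (k, h)) q,
                         psum (\<lambda>(h, k). Poly_Mapping.single (k, h)) p))\<rparr>"

text \<open>The canonical isomorphism from (B x C) x D to B x (C x D), and its inverse.\<close>

definition assocF where
  "assocF =
    \<lparr>fo = (\<lambda>((b, c), d). (b, (c, d))),
     f0 = (\<lambda>_ _. psum (\<lambda>(q, l) x. psum (\<lambda>(h, k) y.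
             Poly_Mapping.single (h, Poly_Mapping.single (k, l) 1) (x * y)) q)),
     fm = (\<lambda>_ _ (p1, p2).
       (psum (\<lambda>(q, l) x. psum (\<lambda>(h, k) y.
          Poly_Mapping.single (h, (Poly_Mapping.single (k, l) 1, 0)) (x * y)) q) p1 +
        psum (\<lambda>((q1, q2), l) x. psum (\<lambda>(h, k) y.
          Poly_Mapping.single (h, (0, Poly_Mapping.single (k, l) 1)) (x * y)) q1) p2,
        psum (\<lambda>((q1, q2), l) x. psum (\<lambda>(h, k) y.
          Poly_Mapping.single (h, Poly_Mapping.single (k, l) 1) (x * y)) q2) p2))\<rparr>"

definition assocF_inv where
  "assocF_inv =
    \<lparr>fo = (\<lambda>(b, (c, d)). ((b, c), d)),
     f0 = (\<lambda>_ _. psum (\<lambda>(h, q) x. psum (\<lambda>(k, l) y.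
             Poly_Mapping.single (Poly_Mapping.single (h, k) 1, l) (x * y)) q)),
     fm = (\<lambda>_ _ (p1, p2).
       (psum (\<lambda>(h, (q1, q2)) x. psum (\<lambda>(k, l) y.
          Poly_Mapping.single (Poly_Mapping.single (h, k) 1, l) (x * y)) q1) p1,
        psum (\<lambda>(h, (q1, q2)) x. psum (\<lambda>(k, l) y.
          Poly_Mapping.single ((Poly_Mapping.single (h, k) 1, 0), l) (x * y)) q2) p1 +
        psum (\<lambda>(h, q) x. psum (\<lambda>(k, l) y.
          Poly_Mapping.single ((0, Poly_Mapping.single (h, k) 1), l) (x * y)) q) p2))\<rparr>"

record ('o, 'm, 'r, 's) ptrans =
  cmp :: "'o \<Rightarrow> 'r"
  coh :: "'o \<Rightarrow> 'o \<Rightarrow> 'm \<Rightarrow> 's"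

definition is_ptrans ::
  "('k, 'o, 'm::ab_group_add, 'n) ecat \<Rightarrow>
   ('k, 'p, 'r::ab_group_add, 's::ab_group_add) ecat \<Rightarrow>
   ('o, 'm, 'n, 'p, 'r, 's) efun \<Rightarrow> ('o, 'm, 'n, 'p, 'r, 's) efun \<Rightarrow>
   ('o, 'm, 'r, 's) ptrans \<Rightarrow> bool" where
  "is_ptrans C D F G \<zeta> \<longleftrightarrow>
     (\<forall>c\<in>Ob C. cmp \<zeta> c \<in> deg0 (Hom D (fo F c) (fo G c))) \<and>
     (\<forall>c\<in>Ob C. \<forall>c'\<in>Ob C.
        let V = Hom C c c'; U = Hom D (fo F c) (fo G c'); z = coh \<zeta> c c' in
        \<comment> \<open>z is a well-defined linear map on the degree 0 part of V\<close>
        (\<forall>h\<in>deg0 V. z h \<in> degm U) \<and>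
        (\<forall>h\<in>null0 V. z h \<in> nullm U) \<and>
        (\<forall>h\<in>deg0 V. \<forall>h'\<in>deg0 V. eqm U (z (h + h')) (z h + z h')) \<and>
        (\<forall>r. \<forall>h\<in>deg0 V. eqm U (z (sc0 V r h)) (scm U r (z h))) \<and>
        (\<forall>h\<in>deg0 V. eq0 U
           (c00 D (f0 G c c' h) (cmp \<zeta> c) - c00 D (cmp \<zeta> c') (f0 F c c' h)) (dd U (z h))) \<and>
        (\<forall>k\<in>degm V. eqm U
           (cm0 D (fm G c c' k) (cmp \<zeta> c) - c0m D (cmp \<zeta> c') (fm F c c' k)) (z (dd V k)))) \<and>
     (\<forall>c\<in>Ob C. eqm (Hom D (fo F c) (fo G c)) (coh \<zeta> c c (idm C c)) 0) \<and>
     (\<forall>c\<in>Ob C. \<forall>c'\<in>Ob C. \<forall>c''\<in>Ob C.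
        \<forall>h\<in>deg0 (Hom C c c'). \<forall>h'\<in>deg0 (Hom C c' c'').
        eqm (Hom D (fo F c) (fo G c''))
          (coh \<zeta> c c'' (c00 C h' h))
          (cm0 D (coh \<zeta> c' c'' h') (f0 F c c' h) + c0m D (f0 G c' c'' h') (coh \<zeta> c c' h)))"

definition ptrans_eq ::
  "('k, 'o, 'm, 'n) ecat \<Rightarrow> ('k, 'p, 'r::ab_group_add, 's::ab_group_add) ecat \<Rightarrow>
   ('o, 'm, 'n, 'p, 'r, 's) efun \<Rightarrow> ('o, 'm, 'n, 'p, 'r, 's) efun \<Rightarrow>
   ('o, 'm, 'r, 's) ptrans \<Rightarrow> ('o, 'm, 'r, 's) ptrans \<Rightarrow> bool" where
  "ptrans_eq C D F G \<zeta> \<eta> \<longleftrightarrow>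
     (\<forall>c\<in>Ob C. eq0 (Hom D (fo F c) (fo G c)) (cmp \<zeta> c) (cmp \<eta> c)) \<and>
     (\<forall>c\<in>Ob C. \<forall>c'\<in>Ob C. \<forall>h\<in>deg0 (Hom C c c').
        eqm (Hom D (fo F c) (fo G c')) (coh \<zeta> c c' h) (coh \<eta> c c' h))"

definition padd ::
  "('o, 'm, 'r::ab_group_add, 's::ab_group_add) ptrans \<Rightarrow> ('o, 'm, 'r, 's) ptrans \<Rightarrow>
   ('o, 'm, 'r, 's) ptrans" where
  "padd \<zeta> \<eta> = \<lparr>cmp = (\<lambda>c. cmp \<zeta> c + cmp \<eta> c),
     coh = (\<lambda>c c' h. coh \<zeta> c c' h + coh \<eta> c c' h)\<rparr>"

definition pid ::
  "('k, 'p, 'r, 's::ab_group_add) ecat \<Rightarrow> ('o, 'm, 'n, 'p, 'r, 's) efun \<Rightarrow>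
   ('o, 'm, 'r, 's) ptrans" where
  "pid D F = \<lparr>cmp = (\<lambda>c. idm D (fo F c)), coh = (\<lambda>c c' h. 0)\<rparr>"

text \<open>The vertical composition of \<open>\<zeta>\<close> followed by \<open>\<eta>\<close>, with values in the category D.\<close>

definition vcomp ::
  "('k, 'p, 'r, 's::ab_group_add) ecat \<Rightarrow> ('o, 'm, 'r, 's) ptrans \<Rightarrow>
   ('o, 'm, 'r, 's) ptrans \<Rightarrow> ('o, 'm, 'r, 's) ptrans" where
  "vcomp D \<eta> \<zeta> = \<lparr>cmp = (\<lambda>c. c00 D (cmp \<eta> c) (cmp \<zeta> c)),
     coh = (\<lambda>c c' h. cm0 D (coh \<eta> c c' h) (cmp \<zeta> c) + c0m D (cmp \<eta> c') (coh \<zeta> c c' h))\<rparr>"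

text \<open>
  The horizontal composition of \<open>\<zeta>\<close> from F to G with \<open>\<zeta>'\<close>, whose source is F'; E is the
  category in which \<open>\<zeta>'\<close> takes its values.
\<close>

definition hcomp ::
  "('k, 'q, 'u, 'v::ab_group_add) ecat \<Rightarrow>
   ('o, 'm, 'n, 'p, 'r, 's) efun \<Rightarrow> ('o, 'm, 'n, 'p, 'r, 's) efun \<Rightarrow>
   ('p, 'r, 's, 'q, 'u, 'v) efun \<Rightarrow>
   ('p, 'r, 'u, 'v) ptrans \<Rightarrow> ('o, 'm, 'r, 's) ptrans \<Rightarrow> ('o, 'm, 'u, 'v) ptrans" where
  "hcomp E F G F' \<zeta>' \<zeta> =
    \<lparr>cmp = (\<lambda>c. c00 E (cmp \<zeta>' (fo G c)) (f0 F' (fo F c) (fo G c) (cmp \<zeta> c))),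
     coh = (\<lambda>c c' h.
       cm0 E (coh \<zeta>' (fo G c) (fo G c') (f0 G c c' h))
             (f0 F' (fo F c) (fo G c) (cmp \<zeta> c)) +
       c0m E (cmp \<zeta>' (fo G c')) (fm F' (fo F c) (fo G c') (coh \<zeta> c c' h)))\<rparr>"

abbreviation whisker ::
  "('k, 'q, 'u, 'v::ab_group_add) ecat \<Rightarrow> ('p, 'r, 's, 'q, 'u, 'v) efun \<Rightarrow>
   ('p, 'r, 'u, 'v) ptrans \<Rightarrow> ('k, 'p, 'r, 's::ab_group_add) ecat \<Rightarrow>
   ('o, 'm, 'n, 'p, 'r, 's) efun \<Rightarrow> ('o, 'm, 'u, 'v) ptrans" where
  "whisker E F' \<zeta>' D H \<equiv> hcomp E H H F' \<zeta>' (pid D H)"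

text \<open>
  The product of \<open>\<zeta>\<close>, with source F and values in C', and \<open>\<eta>\<close>, with target G' and values in
  D'. The first component of the coherence map lies in (deg 0) (x) (deg -1), the second in
  (deg -1) (x) (deg 0).
\<close>

definition boxP ::
  "('k::field, 'o1, 'm1, 'n1) ecat \<Rightarrow> ('k, 'p1, 'r1, 's1) ecat \<Rightarrow>
   ('o, 'm, 'n, 'o1, 'm1, 'n1) efun \<Rightarrow> ('p, 'r, 's, 'p1, 'r1, 's1) efun \<Rightarrow>
   ('o, 'm, 'm1, 'n1) ptrans \<Rightarrow> ('p, 'r, 'r1, 's1) ptrans \<Rightarrow>
   ('o \<times> 'p, ('m \<times> 'r) \<Rightarrow>\<^sub>0 'k, ('m1 \<times> 'r1) \<Rightarrow>\<^sub>0 'k,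
    (('m1 \<times> 's1) \<Rightarrow>\<^sub>0 'k) \<times> (('n1 \<times> 'r1) \<Rightarrow>\<^sub>0 'k)) ptrans" where
  "boxP C' D' F G' \<zeta> \<eta> =
    \<lparr>cmp = (\<lambda>(c, d). Poly_Mapping.single (cmp \<zeta> c, cmp \<eta> d) 1),
     coh = (\<lambda>(c, d) (c', d') p.
       (psum (\<lambda>(h, k). Poly_Mapping.single
          (c00 C' (cmp \<zeta> c') (f0 F c c' h), coh \<eta> d d' k)) p,
        psum (\<lambda>(h, k). Poly_Mapping.single
          (coh \<zeta> c c' h, c00 D' (f0 G' d d' k) (cmp \<eta> d))) p))\<rparr>"


section \<open>The homotopy 2-category of dg-modules and infinitesimal 2-braidings\<close>

definition fsc :: "'k::field \<Rightarrow> 'k mmap \<Rightarrow> 'k mmap" where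
  "fsc c h = (\<lambda>x. msc c (h x))"

definition hcat :: "'k::field cdga \<Rightarrow> ('k, 'k sfmod, 'k mmap, 'k mmap) ecat" where
  "hcat A =
    \<lparr>Ob = {M. is_sfmod A M},
     Hom = (\<lambda>M N.
       \<lparr>deg0 = {h \<in> lin_hom A M N 0. hdiff M N 0 h = 0}, null0 = {0},
        degm = lin_hom A M N (- 1), nullm = hdiff M N (- 2) ` lin_hom A M N (- 2),
        dd = hdiff M N (- 1), sc0 = fsc, scm = fsc\<rparr>),
     c00 = (\<lambda>h k x. h (k x)), c0m = (\<lambda>h k x. h (k x)), cm0 = (\<lambda>h k x. h (k x)),
     idm = mid A\<rparr>"

abbreviation hcat2 where "hcat2 A \<equiv> boxC (hcat A) (hcat A)"

type_synonym 'k hom2 = "('k mmap \<times> 'k mmap) \<Rightarrow>\<^sub>0 'k"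

type_synonym 'k trans2 = "('k sfmod \<times> 'k sfmod, 'k hom2, 'k mmap, 'k mmap) ptrans"

definition tensF :: "'k::field cdga \<Rightarrow>
   ('k sfmod \<times> 'k sfmod, 'k hom2, 'k hom2 \<times> 'k hom2, 'k sfmod, 'k mmap, 'k mmap) efun" where
  "tensF A =
    \<lparr>fo = (\<lambda>(M, N). mtens A M N),
     f0 = (\<lambda>(M, N) (M', N'). psum (\<lambda>(h, k) a. fsc a (tmap A M N M' 0 0 h k))),
     fm = (\<lambda>(M, N) (M', N') (p, q).
             psum (\<lambda>(h, k) a. fsc a (tmap A M N M' 0 (- 1) h k)) p +
             psum (\<lambda>(h, k) a. fsc a (tmap A M N M' (- 1) 0 h k)) q)\<rparr>"

text \<open>
  The associator from (L (x) M) (x) N to L (x) (M (x) N). The functor assocF makes the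
  identification of the two ways to bracket a triple of arguments explicit.
\<close>

definition asc :: "'k::field cdga \<Rightarrow>
   (('k sfmod \<times> 'k sfmod) \<times> 'k sfmod, 'm, 'k mmap, 'k mmap) ptrans" where
  "asc A =
    \<lparr>cmp = (\<lambda>((L, M), N). alin A (gens (mtens A (mtens A L M) N)) 0 (\<lambda>g.
       case g of GPair (GPair u v) w \<Rightarrow> ge (GPair u (GPair v w)) | _ \<Rightarrow> 0)),
     coh = (\<lambda>_ _ _. 0)\<rparr>"

definition asc_inv :: "'k::field cdga \<Rightarrow>
   (('k sfmod \<times> 'k sfmod) \<times> 'k sfmod, 'm, 'k mmap, 'k mmap) ptrans" where
  "asc_inv A =
    \<lparr>cmp = (\<lambda>((L, M), N). alin A (gens (mtens A L (mtens A M N))) 0 (\<lambda>g.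
       case g of GPair u (GPair v w) \<Rightarrow> ge (GPair (GPair u v) w) | _ \<Rightarrow> 0)),
     coh = (\<lambda>_ _ _. 0)\<rparr>"

definition braid :: "'k::field cdga \<Rightarrow> 'k sfmod \<Rightarrow> 'k sfmod \<Rightarrow> 'k mmap" where
  "braid A M N = alin A (gens (mtens A M N)) 0 (\<lambda>g. case g of GAtom i \<Rightarrow> 0
     | GPair v w \<Rightarrow> msc (sg (gdeg M v * gdeg N w)) (ge (GPair w v)))"

definition gam :: "'k::field cdga \<Rightarrow> 'k trans2" where
  "gam A = \<lparr>cmp = (\<lambda>(M, N). braid A M N), coh = (\<lambda>_ _ _. 0)\<rparr>"

definition gam_inv :: "'k::field cdga \<Rightarrow> 'k trans2" where
  "gam_inv A = \<lparr>cmp = (\<lambda>(M, N). braid A N M), coh = (\<lambda>_ _ _. 0)\<rparr>"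

text \<open>
  Both hexagon relations. In the first one all transformations are between functors on
  (C x C) x C, in the second one between functors on C x (C x C).
\<close>

definition hexagon1 :: "'k::field cdga \<Rightarrow> 'k trans2 \<Rightarrow> bool" where
  "hexagon1 A t \<longleftrightarrow> (let
     C = hcat A; CC = hcat2 A; T = tensF A; TI = boxF T idF; IT = boxF idF T;
     Id = pid C T; I = pid C idF; t12 = boxF flipF idF;
     L = compF T TI;
     conj = (\<lambda>z. vcomp C (vcomp C (asc_inv A) z) (asc A));
     gI = hcomp C TI (compF TI t12) T Id (boxP C C T idF (gam A) I);
     gI_inv = hcomp C (compF TI t12) TI T Id (boxP C C (compF T flipF) idF (gam_inv A) I);
     It = hcomp C IT IT T Id (boxP C C idF T I t)
   in ptrans_eq (boxC CC C) C L L
        (conj (whisker C T t CC (compF IT assocF)))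
        (padd (hcomp C TI TI T Id (boxP C C T idF t I))
           (vcomp C (vcomp C gI_inv
              (whisker C L
                 (conj (whisker C (compF T IT) It (boxC C CC) assocF))
                 (boxC CC C) t12))
              gI)))"

definition hexagon2 :: "'k::field cdga \<Rightarrow> 'k trans2 \<Rightarrow> bool" where
  "hexagon2 A t \<longleftrightarrow> (let
     C = hcat A; CC = hcat2 A; T = tensF A; TI = boxF T idF; IT = boxF idF T;
     Id = pid C T; I = pid C idF; t23 = boxF idF flipF;
     R = compF T IT;
     a = whisker C (compF T TI) (asc A) (boxC CC C) assocF_inv;
     a_inv = whisker C (compF R assocF) (asc_inv A) (boxC CC C) assocF_inv;
     conj = (\<lambda>z. vcomp C (vcomp C a z) a_inv);
     Ig = hcomp C IT (compF IT t23) T Id (boxP C C idF (compF T flipF) I (gam A));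
     Ig_inv = hcomp C (compF IT t23) IT T Id (boxP C C idF T I (gam_inv A));
     tI = hcomp C TI TI T Id (boxP C C T idF t I)
   in ptrans_eq (boxC C CC) C R R
        (conj (whisker C T t CC (compF TI assocF_inv)))
        (padd (hcomp C IT IT T Id (boxP C C idF T I t))
           (vcomp C (vcomp C Ig_inv
              (whisker C R
                 (conj (whisker C (compF T TI) tI (boxC CC C) assocF_inv))
                 (boxC C CC) t23))
              Ig)))"

definition inf_2braiding :: "'k::field cdga \<Rightarrow> 'k trans2 \<Rightarrow> bool" where
  "inf_2braiding A t \<longleftrightarrow>
     is_ptrans (hcat2 A) (hcat A) (tensF A) (tensF A) t \<and> hexagon1 A t \<and> hexagon2 A t"

definition gamma_equivariant :: "'k::field cdga \<Rightarrow> 'k trans2 \<Rightarrow> bool" where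
  "gamma_equivariant A t \<longleftrightarrow>
     ptrans_eq (hcat2 A) (hcat A) (tensF A) (compF (tensF A) flipF)
       (vcomp (hcat A) (gam A) t)
       (vcomp (hcat A) (whisker (hcat A) (tensF A) t (hcat2 A) flipF) (gam A))"


section \<open>The transformation defined by a bivector\<close>

text \<open>
  The module Omega_A = hom_A(T_A, A) is free on the elements d_dR z_i, labelled by GAtom i,
  where d_dR z_i is determined by \<open>\<langle>D, d_dR z_i\<rangle> = D(z_i)\<close>. An element \<open>\<omega>\<close> is the functional
  D \<open>\<mapsto>\<close> (-1)^{|D| |\<open>\<omega>\<close>|} \<open>\<langle>D, \<omega>\<rangle>\<close> on T_A; the pairing with D of degree p satisfies
  \<open>\<langle>D, a \<omega>\<rangle> = (-1)^{p |a|} a \<langle>D, \<omega>\<rangle>\<close>.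
\<close>

definition Om_gens :: "'z gvars_scheme \<Rightarrow> gen set" where
  "Om_gens A = GAtom ` {..<ngen A}"

definition pairing ::
  "'z gvars_scheme \<Rightarrow> int \<Rightarrow> ('k::field fga \<Rightarrow> 'k fga) \<Rightarrow> 'k mel \<Rightarrow> 'k fga" where
  "pairing A p D \<omega> = (\<Sum>i<ngen A. amul A (ksgn A p (\<omega> (GAtom i))) (D (avar i)))"

definition ddR :: "'z gvars_scheme \<Rightarrow> 'k::field fga \<Rightarrow> 'k mel" where
  "ddR A a = (THE \<omega>. \<omega> \<in> mcar A (Om_gens A) \<and>
     (\<forall>p. \<forall>D\<in>der A p. pairing A p D \<omega> = D a))"

text \<open>
  Rewritten in terms of the pairing, the differential
  d \<open>\<omega>\<close> = d o \<open>\<omega>\<close> - (-1)^{|\<open>\<omega>\<close>|} \<open>\<omega>\<close> o [d, -] of hom_A(T_A, A) is given by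
  \<open>\<langle>D, d \<omega>\<rangle> = (-1)^{|D|} (d \<langle>D, \<omega>\<rangle> - \<langle>[d, D], \<omega>\<rangle>)\<close>.
\<close>

definition Om :: "'k::field cdga \<Rightarrow> 'k sfmod" where
  "Om A =
    \<lparr>gens = Om_gens A,
     gdeg = (\<lambda>g. case g of GAtom i \<Rightarrow> zdeg A i | GPair v w \<Rightarrow> 0),
     mdiff = (\<lambda>\<omega>. if \<omega> \<in> mcar A (Om_gens A) then
       (THE \<eta>. \<eta> \<in> mcar A (Om_gens A) \<and>
          (\<forall>p. \<forall>D\<in>der A p. pairing A p D \<eta> =
             fsm (sg p) (adiff A (pairing A p D \<omega>)
                         - pairing A (p + 1) (dcomm 1 p (adiff A) D) \<omega>))) else 0)\<rparr>"

text \<open>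
  M[1] has the generators s^{-1} w; as a s^{-1} x = (-1)^{|a|} s^{-1} (a x), the map s^{-1} is
  x \<open>\<mapsto>\<close> ksgn 1 x in coordinates, and this is also the formula for its inverse.
\<close>

definition sinv :: "'z gvars_scheme \<Rightarrow> 'k::field mel \<Rightarrow> 'k mel" where
  "sinv A x = (\<lambda>w. ksgn A 1 (x w))"

definition shift1 :: "'k::field cdga \<Rightarrow> 'k sfmod \<Rightarrow> 'k sfmod" where
  "shift1 A M = \<lparr>gens = gens M, gdeg = (\<lambda>w. gdeg M w - 1),
     mdiff = (\<lambda>x. - sinv A (mdiff M (sinv A x)))\<rparr>"

abbreviation Om1 :: "'k::field cdga \<Rightarrow> 'k sfmod" where
  "Om1 A \<equiv> shift1 A (Om A)"

text \<open>The map s^{-1} (d_dR (x) id) from M = A (x) W to Omega_A[1] (x)_A M.\<close>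

definition sddR :: "'k::field cdga \<Rightarrow> 'k sfmod \<Rightarrow> 'k mel \<Rightarrow> 'k mel" where
  "sddR A M x = (\<Sum>w\<in>gens M. tel A (gdeg (Om1 A)) (sinv A (ddR A (x w))) (ge w))"

definition OmF :: "'k::field cdga \<Rightarrow> ('k sfmod, 'k mmap, 'k mmap, 'k sfmod, 'k mmap, 'k mmap) efun" where
  "OmF A =
    \<lparr>fo = (\<lambda>M. mtens A (Om1 A) M),
     f0 = (\<lambda>M M' h. tmap A (Om1 A) M (Om1 A) 0 0 (mid A (Om1 A)) h),
     fm = (\<lambda>M M' k. tmap A (Om1 A) M (Om1 A) 0 (- 1) (mid A (Om1 A)) k)\<rparr>"

definition xi :: "'k::field cdga \<Rightarrow> ('k sfmod, 'k mmap, 'k mmap, 'k mmap) ptrans" where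
  "xi A =
    \<lparr>cmp = (\<lambda>M. alin A (gens M) 0 (\<lambda>w. sddR A M (mdiff M (ge w)))),
     coh = (\<lambda>M M' h. alin A (gens M) (- 1) (\<lambda>w. - sddR A M' (h (ge w))))\<rparr>"

text \<open>
  The middle interchange from (Omega[1] (x) M) (x) (Omega[1] (x) N) to
  (Omega[1] (x) Omega[1]) (x) (M (x) N).
\<close>

definition sigma :: "'k::field cdga \<Rightarrow> 'k trans2" where
  "sigma A =
    \<lparr>cmp = (\<lambda>(M, N). alin A (gens (mtens A (mtens A (Om1 A) M) (mtens A (Om1 A) N))) 0 (\<lambda>g.
       case g of GPair (GPair i v) (GPair j w) \<Rightarrow>
         msc (sg (gdeg M v * gdeg (Om1 A) j)) (ge (GPair (GPair i j) (GPair v w))) | _ \<Rightarrow> 0)),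
     coh = (\<lambda>_ _ _. 0)\<rparr>"

text \<open>
  The pairing \<open>\<langle>s D s D', s^{-1} \<omega> (x) s^{-1} \<omega>'\<rangle>\<close> for |D| = p, |D'| = q and |\<open>\<omega>\<close>| = k.
\<close>

definition bipairing ::
  "'z gvars_scheme \<Rightarrow> int \<Rightarrow> ('k::field fga \<Rightarrow> 'k fga) \<Rightarrow> int \<Rightarrow> ('k fga \<Rightarrow> 'k fga) \<Rightarrow>
   int \<Rightarrow> 'k mel \<Rightarrow> 'k mel \<Rightarrow> 'k fga" where
  "bipairing A p D q D' k \<omega> \<omega>' =
     fsm (sg (k + p)) (pairing A p D (mact A (pairing A q D' \<omega>) \<omega>')) +
     fsm (sg ((p + 1) * (q + 1)) * sg (k + q))
       (pairing A q D' (mact A (pairing A p D \<omega>) \<omega>'))"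

text \<open>
  For P in Sym_A(T_A[-3]), the coefficient in A of s^3 d/dz_i s^3 d/dz_j in the weight 2 part
  of P. There is no sign as the generators s^3 d/dz_i come after the z_i in all monomials, and
  none from replacing s^3 d/dz_i s^3 d/dz_j by s d/dz_i s d/dz_j as s^2 is even.
\<close>

definition wt2_coeff ::
  "'z gvars_scheme \<Rightarrow> 'k::field fga \<Rightarrow> nat \<Rightarrow> nat \<Rightarrow> 'k fga" where
  "wt2_coeff A P i j =
     (let e = Poly_Mapping.single (ngen A + i) 1 + Poly_Mapping.single (ngen A + j) 1 in
      \<Sum>u | Poly_Mapping.keys u \<subseteq> {..<ngen A} \<and> u + e \<in> Poly_Mapping.keys P.
        Poly_Mapping.single u (Poly_Mapping.lookup P (u + e)))"

definition wt2_pairing :: "'z gvars_scheme \<Rightarrow> 'k::field fga \<Rightarrow> gen \<Rightarrow> gen \<Rightarrow> 'k fga" where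
  "wt2_pairing A P g g' = (case (g, g') of (GAtom k, GAtom l) \<Rightarrow>
     (\<Sum>j<ngen A. \<Sum>i\<le>j. amul A (wt2_coeff A P i j)
        (bipairing A (- zdeg A i) (apar A i) (- zdeg A j) (apar A j) (zdeg A k) (ge g) (ge g')))
     | _ \<Rightarrow> 0)"

text \<open>
  A (x)_A (M (x)_A N) is identified with M (x)_A N; \<open>\<langle>P, -\<rangle>\<close> is A-linear of degree 0.
\<close>

definition iota :: "'k::field cdga \<Rightarrow> 'k fga \<Rightarrow> 'k trans2" where
  "iota A P =
    \<lparr>cmp = (\<lambda>(M, N). alin A (gens (mtens A (mtens A (Om1 A) (Om1 A)) (mtens A M N))) 0 (\<lambda>g.
       case g of GPair (GPair i j) h \<Rightarrow> mact A (wt2_pairing A P i j) (ge h) | _ \<Rightarrow> 0)),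
     coh = (\<lambda>_ _ _. 0)\<rparr>"

definition tbraid :: "'k::field cdga \<Rightarrow> 'k fga \<Rightarrow> 'k trans2" where
  "tbraid A P =
     vcomp (hcat A) (vcomp (hcat A) (iota A P) (sigma A))
       (hcomp (hcat A) (boxF idF idF) (boxF (OmF A) (OmF A)) (tensF A)
          (pid (hcat A) (tensF A))
          (boxP (hcat A) (hcat A) idF (OmF A) (xi A) (xi A)))"

end

(* The infinitesimal 2-braiding is a first-order bidifferential operator: on M (x) N it contracts the derivatives of
  the two module differentials along the derivations d/dz_i with the coefficients Pi i j of the bivector, and its
  coherence maps do the same with a derivative of a module differential and a derivative of a morphism. All
  identities (closedness, pseudo-naturality, hexagons) follow from the commutation of the derivatives d/dz_i with the
  Leibniz rule. Modulo exact terms only two facts on the coefficients enter: their graded symmetry, and the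
  closedness of the bivector under the Lie derivative along the differential of A, which in the case of CE(g_kappa) are
  the invariance of pi and the compatibility of pi-tilde with the brackets. The remaining condition on pi-tilde says
  that the square of the bivector in the Poisson bracket vanishes. *)
theory Submission
 imports Defs
begin
subsection \<open>Signs and linear extension\<close>

text \<open>A map of degree p from M to Omega_A[1] (x) N is stored by its components along the basis
  s^{-1} d_dR z_i: a family of A-linear maps of degrees p - (|z_i| - 1). In this dictionary the hom
  differential becomes \<open>DD\<close>, the Atiyah cocycle of M becomes \<open>XX\<close>, and
  contraction with the bivector becomes \<open>TT\<close>, so that the differential of Omega_A never
  has to be handled directly. The pivot is \<open>hdiff_TT\<close>: closedness of the coefficients
  gives \<open>TT\<close> a Leibniz rule in its two arguments. Every homotopy that is required is
  again a value of \<open>TT\<close>, composed with a braiding where necessary. Two obstacles shape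
  the rest. Morphisms of degree -1 count modulo exact maps: composition, naturality in degree -1 and
  equivariance of the coherences hold only up to such homotopies, whereas components and hexagons
  hold for the chosen representatives. And morphisms of the box product are formal linear
  combinations of pairs; each law is proved for single pairs and carried over by
  \<open>lext\<close>. Finally, the bracket is a \<open>SOME\<close>, so the Poisson equation is
  accessible only through an explicit bracket and a uniqueness argument.\<close>

lemma sg_0[simp]: "sg 0 = 1"
 by (simp add: sg_def)

lemma sg_add: "sg (a + b) = sg a * sg b"
 by (auto simp: sg_def)

lemma sg_eqI: "(even a \<longleftrightarrow> even b) \<Longrightarrow> sg a = sg b"
 by (simp add: sg_def)

lemma sg_minus[simp]: "sg (- a) = sg a"
 by (simp add: sg_def)

lemma sg_square[simp]: "sg a * sg a = 1"
 by (simp add: sg_def)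

lemma sg_square_left[simp]: "sg a * (sg a * x) = x"
 by (simp add: sg_def)

lemma sg_even: "even a \<Longrightarrow> sg a = 1"
 by (simp add: sg_def)

lemma sg_odd: "odd a \<Longrightarrow> sg a = - 1"
 by (simp add: sg_def)

lemma sg_commute: "sg a * (x :: 'a::comm_ring_1) = x * sg a"
 by (simp add: mult.commute)

lemma sum_apply: "(\<Sum>i\<in>I. f i) x = (\<Sum>i\<in>I. f i x)"
 by (induction I rule: infinite_finite_induct) auto

lemma lookup_fsm[simp]: "Poly_Mapping.lookup (fsm c p) k = c * Poly_Mapping.lookup p k"
 unfolding fsm_def by (simp add: Poly_Mapping.map.rep_eq when_def)

lemma fsm_add: "fsm c (p + q) = fsm c p + fsm c q"
 by (rule poly_mapping_eqI) (simp add: lookup_add algebra_simps)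

lemma fsm_add_left: "fsm (c + d) p = fsm c p + fsm d p"
 by (rule poly_mapping_eqI) (simp add: lookup_add algebra_simps)

lemma fsm_diff: "fsm c (p - q) = fsm c p - fsm c q"
 by (rule poly_mapping_eqI) (simp add: lookup_minus algebra_simps)

lemma fsm_uminus: "fsm c (- p) = - fsm c p"
 by (rule poly_mapping_eqI) simp

lemma fsm_uminus_left: "fsm (- c) p = - fsm c p"
 by (rule poly_mapping_eqI) simp

lemma fsm_0[simp]: "fsm c 0 = 0" "fsm 0 p = 0"
 by (rule poly_mapping_eqI; simp)+

lemma fsm_1[simp]: "fsm 1 p = p"
 by (rule poly_mapping_eqI) simp

lemma fsm_fsm[simp]: "fsm c (fsm d p) = fsm (c * d) p"
 by (rule poly_mapping_eqI) (simp add: mult.assoc)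

lemma fsm_single[simp]: "fsm c (Poly_Mapping.single m x) = Poly_Mapping.single m (c * x)"
 by (rule poly_mapping_eqI) (simp add: lookup_single when_def)

lemma fsm_sum: "fsm c (sum f S) = (\<Sum>i\<in>S. fsm c (f i))"
 by (induction S rule: infinite_finite_induct) (auto simp: fsm_add)

lemma fsm_sum_left: "fsm (sum f S) p = (\<Sum>i\<in>S. fsm (f i) p)"
 by (induction S rule: infinite_finite_induct) (auto simp: fsm_add_left)

lemma keys_fsm: "Poly_Mapping.keys (fsm c p) \<subseteq> Poly_Mapping.keys p"
 by (auto simp: in_keys_iff)

lemma poly_mapping_decomp:
 "(p :: 'a \<Rightarrow>\<^sub>0 'b::comm_monoid_add) = (\<Sum>u\<in>Poly_Mapping.keys p. Poly_Mapping.single u (Poly_Mapping.lookup p u))"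
 by (rule poly_mapping_eqI)
   (auto simp: lookup_sum lookup_single when_def in_keys_iff sum.delta' not_in_keys_iff_lookup_eq_zero)

text \<open>The plus case may assume that both summands are supported in \<open>S\<close>. For this
  the inner induction carries the support of the partial sums along with the property.\<close>

lemma poly_mapping_linear_induct[case_names zero single plus]:
 fixes P :: "('a \<Rightarrow>\<^sub>0 'b::comm_monoid_add) \<Rightarrow> bool"
 assumes "P 0" "\<And>u c. u \<in> S \<Longrightarrow> P (Poly_Mapping.single u c)"
  "\<And>p q. Poly_Mapping.keys p \<subseteq> S \<Longrightarrow> Poly_Mapping.keys q \<subseteq> S \<Longrightarrow> P p \<Longrightarrow> P q \<Longrightarrow> P (p + q)"
  and "Poly_Mapping.keys p \<subseteq> S"
 shows "P p"
proof -
 have "finite K \<Longrightarrow> K \<subseteq> S \<Longrightarrow> P (\<Sum>u\<in>K. Poly_Mapping.single u (Poly_Mapping.lookup p u)) \<and>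
   Poly_Mapping.keys (\<Sum>u\<in>K. Poly_Mapping.single u (Poly_Mapping.lookup p u)) \<subseteq> S" for K
 proof (induction K rule: finite_induct)
  case empty
  then show ?case using assms(1) by simp
 next
  case (insert x F)
  have "Poly_Mapping.keys (Poly_Mapping.single x (Poly_Mapping.lookup p x)) \<subseteq> S"
   using insert by auto
  then show ?case using insert assms(2,3) keys_add by (fastforce simp: subset_iff)
 qed
 from this[of "Poly_Mapping.keys p"] show ?thesis
  using assms(4) poly_mapping_decomp[of p] by auto
qed

lemma poly_mapping_linear_induct_UNIV[case_names zero single plus]:
 fixes P :: "('a \<Rightarrow>\<^sub>0 'b::comm_monoid_add) \<Rightarrow> bool"
 assumes "P 0" "\<And>u c. P (Poly_Mapping.single u c)" "\<And>p q. P p \<Longrightarrow> P q \<Longrightarrow> P (p + q)"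
 shows "P p"
 by (rule poly_mapping_linear_induct[where S = UNIV]) (use assms in auto)

text \<open>Additivity of each \<open>b u\<close> makes \<open>psum b\<close> additive although its
  sum runs over the support: it forces \<open>b u 0 = 0\<close>, so a coefficient that cancels may
  drop out.\<close>

definition addb :: "('u \<Rightarrow> 'k::ab_group_add \<Rightarrow> 'x::ab_group_add) \<Rightarrow> bool" where
 "addb b \<longleftrightarrow> (\<forall>u x y. b u (x + y) = b u x + b u y)"

lemma addb_0: "addb b \<Longrightarrow> b u 0 = 0"
 unfolding addb_def by (metis add_cancel_left_right)

lemma psum_0[simp]: "psum b 0 = 0"
 by (simp add: psum_def)

lemma psum_add: "addb b \<Longrightarrow> psum b (p + q) = psum b p + psum b q"
 unfolding psum_def by (rule setsum_keys_plus_distrib) (auto simp: addb_0, auto simp: addb_def)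

lemma psum_single: "b u 0 = 0 \<Longrightarrow> psum b (Poly_Mapping.single u x) = b u x"
 by (simp add: psum_def)

lemma psum_sum: "addb b \<Longrightarrow> psum b (sum f S) = (\<Sum>i\<in>S. psum b (f i))"
 by (induction S rule: infinite_finite_induct) (auto simp: psum_add)

lemma psum_uminus: "addb b \<Longrightarrow> psum b (- p) = - psum b p"
 using psum_add[of b p "- p"] by (simp add: eq_neg_iff_add_eq_0 add.commute)

lemma psum_diff: "addb b \<Longrightarrow> psum b (p - q) = psum b p - psum b q"
 using psum_add[of b p "- q"] by (simp add: psum_uminus)

lemma psum_superset:
 assumes "\<And>u. b u 0 = 0" "finite S" "Poly_Mapping.keys p \<subseteq> S"
 shows "psum b p = (\<Sum>u\<in>S. b u (Poly_Mapping.lookup p u))"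
 unfolding psum_def using assms by (intro sum.mono_neutral_left) (auto simp: in_keys_iff)

lemma psum_cong:
 "(\<And>u x. u \<in> Poly_Mapping.keys p \<Longrightarrow> b u x = b' u x) \<Longrightarrow> psum b p = psum b' p"
 by (simp add: psum_def)

lemma psum_psum:
 assumes "addb b"
 shows "psum b (psum c p) = psum (\<lambda>u x. psum b (c u x)) p"
 unfolding psum_def[of c] psum_sum[OF assms] by (simp add: psum_def)

lemma psum_single_id: "psum Poly_Mapping.single p = p"
 unfolding psum_def by (rule poly_mapping_decomp[symmetric])

subsection \<open>The free graded commutative algebra\<close>

text \<open>The exponent of the Koszul sign in \<open>amul\<close>: it adds up the products of
  degrees over all pairs that are out of order when z^m z^m' is sorted. Being biadditive, it reduces
  identities between products to identities between sums.\<close>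

definition chi :: "'z gvars_scheme \<Rightarrow> (nat \<Rightarrow>\<^sub>0 nat) \<Rightarrow> (nat \<Rightarrow>\<^sub>0 nat) \<Rightarrow> int" where
 "chi V m m' = (\<Sum>i\<in>Poly_Mapping.keys m. \<Sum>j\<in>Poly_Mapping.keys m' \<inter> {..<i}.
   int (Poly_Mapping.lookup m i) * zdeg V i * (int (Poly_Mapping.lookup m' j) * zdeg V j))"

text \<open>The total degree of the factors that the derivation dual to z_i has to pass, hence the
  sign exponent in \<open>apar\<close> up to the factor |z_i|.\<close>

definition below :: "'z gvars_scheme \<Rightarrow> nat \<Rightarrow> (nat \<Rightarrow>\<^sub>0 nat) \<Rightarrow> int" where
 "below V i m = (\<Sum>j\<in>Poly_Mapping.keys m \<inter> {..<i}. int (Poly_Mapping.lookup m j) * zdeg V j)"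

lemma below_superset:
 assumes "finite S" "Poly_Mapping.keys m \<subseteq> S"
 shows "below V i m = (\<Sum>j\<in>S \<inter> {..<i}. int (Poly_Mapping.lookup m j) * zdeg V j)"
 unfolding below_def using assms by (intro sum.mono_neutral_left) (auto simp: in_keys_iff)

lemma chi_superset:
 assumes "finite S" "Poly_Mapping.keys m \<subseteq> S"
 shows "chi V m m' = (\<Sum>i\<in>S. int (Poly_Mapping.lookup m i) * zdeg V i * below V i m')"
proof -
 have "chi V m m' = (\<Sum>i\<in>Poly_Mapping.keys m. int (Poly_Mapping.lookup m i) * zdeg V i * below V i m')"
  by (simp add: chi_def below_def sum_distrib_left)
 also have "\<dots> = (\<Sum>i\<in>S. int (Poly_Mapping.lookup m i) * zdeg V i * below V i m')"
  using assms by (intro sum.mono_neutral_left) (auto simp: in_keys_iff)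
 finally show ?thesis .
qed

lemma mdeg_superset:
 assumes "finite S" "Poly_Mapping.keys m \<subseteq> S"
 shows "mdeg V m = (\<Sum>i\<in>S. int (Poly_Mapping.lookup m i) * zdeg V i)"
 unfolding mdeg_def using assms by (intro sum.mono_neutral_left) (auto simp: in_keys_iff)

lemma keys_plus_nat: "Poly_Mapping.keys (m + m') = Poly_Mapping.keys m \<union> Poly_Mapping.keys (m' :: _ \<Rightarrow>\<^sub>0 nat)"
 by (auto simp: in_keys_iff lookup_add)

lemma below_add: "below V i (m + m') = below V i m + below V i m'"
 by (simp add: below_superset[of "Poly_Mapping.keys m \<union> Poly_Mapping.keys m'"] keys_plus_nat
   lookup_add algebra_simps sum.distrib)

lemma chi_add_left: "chi V (m + m') k = chi V m k + chi V m' k"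
 by (simp add: chi_superset[of "Poly_Mapping.keys m \<union> Poly_Mapping.keys m'"] keys_plus_nat
   lookup_add algebra_simps sum.distrib)

lemma chi_add_right: "chi V k (m + m') = chi V k m + chi V k m'"
 by (simp add: chi_superset[of "Poly_Mapping.keys k"] below_add algebra_simps sum.distrib)

lemma mdeg_add: "mdeg V (m + m') = mdeg V m + mdeg V m'"
 by (simp add: mdeg_superset[of "Poly_Mapping.keys m \<union> Poly_Mapping.keys m'"] keys_plus_nat
   lookup_add algebra_simps sum.distrib)

lemma chi_0[simp]: "chi V 0 m = 0" "chi V m 0 = 0"
 by (simp_all add: chi_def)

lemma below_0[simp]: "below V i 0 = 0"
 by (simp add: below_def)

lemma mdeg_0[simp]: "mdeg V 0 = 0"
 by (simp add: mdeg_def)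

lemma mdeg_single[simp]: "mdeg V (Poly_Mapping.single i 1) = zdeg V i"
 "mdeg V (Poly_Mapping.single i (Suc 0)) = zdeg V i"
 by (simp_all add: mdeg_def)

lemma chi_single_left: "chi V (Poly_Mapping.single i 1) m = zdeg V i * below V i m"
 by (simp add: chi_def below_def sum_distrib_left)

text \<open>The two exponents together run over all pairs of distinct indices, so they differ from
  the product of the degrees by the diagonal terms only. A diagonal term is even: either z_i is
  even, or admissibility of m + m' forces one of the two exponents of z_i to vanish.\<close>

lemma chi_commute:
 assumes "mon_ok V (m + m')"
 shows "even (chi V m m' + chi V m' m) \<longleftrightarrow> even (mdeg V m * mdeg V m')"
proof -
 let ?S = "Poly_Mapping.keys m \<union> Poly_Mapping.keys m'"
 let ?a = "\<lambda>i. int (Poly_Mapping.lookup m i) * zdeg V i"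
 let ?b = "\<lambda>i. int (Poly_Mapping.lookup m' i) * zdeg V i"
 have fin: "finite ?S" by simp
 have 1: "chi V m m' = (\<Sum>i\<in>?S. \<Sum>j\<in>?S. if j < i then ?a i * ?b j else 0)"
  by (auto simp: chi_superset[of ?S] below_superset[of ?S] sum_distrib_left
    sum.inter_restrict lessThan_def intro!: sum.cong)
 have 2: "chi V m' m = (\<Sum>i\<in>?S. \<Sum>j\<in>?S. if i < j then ?a i * ?b j else 0)"
  by (subst sum.swap) (auto simp: chi_superset[of ?S] below_superset[of ?S] sum_distrib_left
    sum.inter_restrict lessThan_def ac_simps intro!: sum.cong)
 have 3: "mdeg V m * mdeg V m' = (\<Sum>i\<in>?S. \<Sum>j\<in>?S. ?a i * ?b j)"
  by (simp add: mdeg_superset[of ?S] sum_product)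
 have "mdeg V m * mdeg V m' - (chi V m m' + chi V m' m)
   = (\<Sum>i\<in>?S. \<Sum>j\<in>?S. if i = j then ?a i * ?b j else 0)"
  unfolding 1 2 3 sum.distrib[symmetric] sum_subtractf[symmetric]
  by (intro sum.cong refl) auto
 also have "\<dots> = (\<Sum>i\<in>?S. ?a i * ?b i)"
  by simp
 also have "even \<dots>"
 proof (rule dvd_sum)
  fix i assume "i \<in> ?S"
  show "even (?a i * ?b i)"
  proof (cases "odd (zdeg V i)")
   case True
   then have "Poly_Mapping.lookup m i + Poly_Mapping.lookup m' i \<le> 1"
    using assms by (auto simp: mon_ok_def lookup_add)
   then have "Poly_Mapping.lookup m i = 0 \<or> Poly_Mapping.lookup m' i = 0" by linarith
   then show ?thesis by auto
  qed auto
 qed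
 finally show ?thesis by (simp only: even_diff) (metis even_add)
qed

lemma mon_ok_0[simp]: "mon_ok V 0"
 by (simp add: mon_ok_def)

lemma mon_ok_addD: "mon_ok V (m + m') \<Longrightarrow> mon_ok V m" "mon_ok V (m + m') \<Longrightarrow> mon_ok V m'"
 by (fastforce simp: mon_ok_def keys_plus_nat lookup_add)+

lemma mon_ok_single[simp]: "mon_ok V (Poly_Mapping.single i (Suc 0)) \<longleftrightarrow> i < ngen V"
 by (auto simp: mon_ok_def lookup_single when_def)

definition mmul :: "'z gvars_scheme \<Rightarrow> (nat \<Rightarrow>\<^sub>0 nat) \<Rightarrow> (nat \<Rightarrow>\<^sub>0 nat) \<Rightarrow> 'k::field \<Rightarrow> 'k fga" where
 "mmul V m m' x =
  (if mon_ok V (m + m') then Poly_Mapping.single (m + m') (sg (chi V m m') * x) else 0)"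

lemma amul_psum: "amul V a b = psum (\<lambda>m x. psum (\<lambda>m' y. mmul V m m' (x * y)) b) a"
 by (auto simp: amul_def psum_def mmul_def chi_def mult.assoc intro!: sum.cong)

lemma mmul_add: "mmul V m m' (x + y) = mmul V m m' x + mmul V m m' y"
 by (simp add: mmul_def single_add algebra_simps)

lemma mmul_0[simp]: "mmul V m m' 0 = 0"
 by (simp add: mmul_def)

lemma amul_single:
 "amul V (Poly_Mapping.single m x) (Poly_Mapping.single m' y) = mmul V m m' (x * y)"
 by (simp add: amul_psum psum_single)

lemma amul_add_right: "amul V a (b + c) = amul V a b + amul V a c"
 unfolding amul_psum
 by (subst psum_add)
   (auto simp: addb_def mmul_add algebra_simps psum_def sum.distrib)

lemma amul_add_left: "amul V (a + b) c = amul V a c + amul V b c"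
 unfolding amul_psum
 by (subst psum_add)
   (auto simp: addb_def mmul_add algebra_simps psum_def sum.distrib)

lemma amul_0[simp]: "amul V 0 a = 0" "amul V a 0 = 0"
 by (simp_all add: amul_psum psum_def)

lemma amul_uminus_left: "amul V (- a) b = - amul V a b"
 using amul_add_left[of V a "- a" b] by (simp add: eq_neg_iff_add_eq_0 add.commute)

lemma amul_uminus_right: "amul V a (- b) = - amul V a b"
 using amul_add_right[of V a b "- b"] by (simp add: eq_neg_iff_add_eq_0 add.commute)

lemma amul_diff_left: "amul V (a - b) c = amul V a c - amul V b c"
 using amul_add_left[of V a "- b" c] by (simp add: amul_uminus_left)

lemma amul_diff_right: "amul V a (b - c) = amul V a b - amul V a c"
 using amul_add_right[of V a b "- c"] by (simp add: amul_uminus_right)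

lemma amul_sum_left: "amul V (sum f S) a = (\<Sum>i\<in>S. amul V (f i) a)"
 by (induction S rule: infinite_finite_induct) (auto simp: amul_add_left)

lemma amul_sum_right: "amul V a (sum f S) = (\<Sum>i\<in>S. amul V a (f i))"
 by (induction S rule: infinite_finite_induct) (auto simp: amul_add_right)

lemma fsm_mmul: "fsm c (mmul V m m' x) = mmul V m m' (c * x)"
 by (simp add: mmul_def algebra_simps)

lemma amul_fsm_left: "amul V (fsm c a) b = fsm c (amul V a b)"
proof (induction a rule: poly_mapping_linear_induct_UNIV)
 case (single u x)
 show ?case
  by (induction b rule: poly_mapping_linear_induct_UNIV)
    (auto simp: amul_single fsm_mmul amul_add_right fsm_add mult.assoc)
qed (auto simp: amul_add_left fsm_add)

lemma amul_fsm_right: "amul V a (fsm c b) = fsm c (amul V a b)"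
proof (induction a rule: poly_mapping_linear_induct_UNIV)
 case (single u x)
 show ?case
  by (induction b rule: poly_mapping_linear_induct_UNIV)
    (auto simp: amul_single fsm_mmul amul_add_right fsm_add ac_simps)
qed (auto simp: amul_add_left fsm_add)

text \<open>On monomials both bracketings carry the exponent chi(u,v) + chi(u,w) + chi(v,w), by
  biadditivity. If a partial product is inadmissible then so is the total one, and both sides
  vanish.\<close>

lemma amul_assoc: "amul V (amul V a b) c = amul V a (amul V b c)"
proof (induction a rule: poly_mapping_linear_induct_UNIV)
 case (single u x)
 show ?case
 proof (induction b rule: poly_mapping_linear_induct_UNIV)
  case (single v y)
  show ?case
  proof (induction c rule: poly_mapping_linear_induct_UNIV)
   case (single w z)
   show ?case
    unfolding amul_single mmul_def
    using mon_ok_addD(1)[of V "u + v" w] mon_ok_addD(2)[of V u "v + w"]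
    by (auto simp: amul_single mmul_def chi_add_left chi_add_right sg_add ac_simps)
  qed (auto simp: amul_add_right)
 qed (auto simp: amul_add_right amul_add_left)
qed (auto simp: amul_add_left)

lemma acar_0[simp]: "0 \<in> acar V"
 by (simp add: acar_def)

lemma acar_single: "mon_ok V m \<Longrightarrow> Poly_Mapping.single m x \<in> acar V"
 by (simp add: acar_def)

lemma acar_1[simp]: "1 \<in> acar V"
 by (simp add: acar_def)

lemma acar_add: "a \<in> acar V \<Longrightarrow> b \<in> acar V \<Longrightarrow> a + b \<in> acar V"
 unfolding acar_def using keys_add[of a b] by auto

lemma acar_fsm: "a \<in> acar V \<Longrightarrow> fsm c a \<in> acar V"
 unfolding acar_def using keys_fsm[of c a] by auto

lemma acar_uminus: "a \<in> acar V \<Longrightarrow> - a \<in> acar V"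
 unfolding acar_def by simp

lemma acar_diff: "a \<in> acar V \<Longrightarrow> b \<in> acar V \<Longrightarrow> a - b \<in> acar V"
 using acar_add[of a V "- b"] acar_uminus by force

lemma acar_sum: "(\<And>i. i \<in> S \<Longrightarrow> f i \<in> acar V) \<Longrightarrow> sum f S \<in> acar V"
 by (induction S rule: infinite_finite_induct) (auto intro: acar_add)

lemma acar_mmul: "mmul V m m' x \<in> acar V"
 by (simp add: mmul_def acar_single)

lemma acar_amul[simp]: "amul V a b \<in> acar V"
 unfolding amul_psum psum_def by (intro acar_sum acar_mmul)

lemma acar_avar: "i < ngen V \<Longrightarrow> avar i \<in> acar V"
 by (simp add: avar_def acar_single)

lemma acar_induct[consumes 1, case_names zero single plus]:
 assumes "a \<in> acar V" "P 0" "\<And>m c. mon_ok V m \<Longrightarrow> P (Poly_Mapping.single m c)"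
  "\<And>a b. a \<in> acar V \<Longrightarrow> b \<in> acar V \<Longrightarrow> P a \<Longrightarrow> P b \<Longrightarrow> P (a + b)"
 shows "P a"
 by (rule poly_mapping_linear_induct[of P "{m. mon_ok V m}"])
   (use assms in \<open>auto simp: acar_def subset_iff\<close>)

lemma ahom_acar: "a \<in> ahom V k \<Longrightarrow> a \<in> acar V"
 by (simp add: ahom_def)

lemma ahom_0[simp]: "0 \<in> ahom V k"
 by (simp add: ahom_def)

lemma ahom_single: "mon_ok V m \<Longrightarrow> mdeg V m = k \<Longrightarrow> Poly_Mapping.single m x \<in> ahom V k"
 by (simp add: ahom_def acar_single)

lemma ahom_1[simp]: "1 \<in> ahom V 0"
 by (simp add: ahom_def)

lemma ahom_add: "a \<in> ahom V k \<Longrightarrow> b \<in> ahom V k \<Longrightarrow> a + b \<in> ahom V k"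
 unfolding ahom_def using keys_add[of a b] by (auto simp: acar_add)

lemma ahom_fsm: "a \<in> ahom V k \<Longrightarrow> fsm c a \<in> ahom V k"
 unfolding ahom_def using keys_fsm[of c a] by (auto simp: acar_fsm)

lemma ahom_uminus: "a \<in> ahom V k \<Longrightarrow> - a \<in> ahom V k"
 unfolding ahom_def by (simp add: acar_uminus)

lemma ahom_diff: "a \<in> ahom V k \<Longrightarrow> b \<in> ahom V k \<Longrightarrow> a - b \<in> ahom V k"
 using ahom_add[of a V k "- b"] ahom_uminus by force

lemma ahom_sum: "(\<And>i. i \<in> S \<Longrightarrow> f i \<in> ahom V k) \<Longrightarrow> sum f S \<in> ahom V k"
 by (induction S rule: infinite_finite_induct) (auto intro: ahom_add)

lemma ahom_avar: "i < ngen V \<Longrightarrow> zdeg V i = k \<Longrightarrow> avar i \<in> ahom V k"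
 by (simp add: avar_def ahom_single)

lemma ahom_induct[consumes 1, case_names zero single plus]:
 assumes "a \<in> ahom V k" "P 0"
  "\<And>m c. mon_ok V m \<Longrightarrow> mdeg V m = k \<Longrightarrow> P (Poly_Mapping.single m c)"
  "\<And>a b. a \<in> ahom V k \<Longrightarrow> b \<in> ahom V k \<Longrightarrow> P a \<Longrightarrow> P b \<Longrightarrow> P (a + b)"
 shows "P a"
 by (rule poly_mapping_linear_induct[of P "{m. mon_ok V m \<and> mdeg V m = k}"])
   (use assms in \<open>auto simp: ahom_def acar_def subset_iff\<close>)

lemma ahom_amul:
 assumes "a \<in> ahom V k" "b \<in> ahom V l" "k + l = r"
 shows "amul V a b \<in> ahom V r"
 using assms unfolding amul_psum psum_def ahom_def[of V k] ahom_def[of V l]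
 by (intro ahom_sum) (auto simp: mmul_def mdeg_add intro!: ahom_single)

lemma amul_1_left: "a \<in> acar V \<Longrightarrow> amul V 1 a = a"
 by (induction a rule: acar_induct)
   (auto simp: amul_add_right amul_single mmul_def simp flip: single_one)

lemma amul_1_right: "a \<in> acar V \<Longrightarrow> amul V a 1 = a"
 by (induction a rule: acar_induct)
   (auto simp: amul_add_left amul_single mmul_def simp flip: single_one)

subsection \<open>The parity involutions\<close>

lemma ksgn_psum: "ksgn V k a = psum (\<lambda>m x. Poly_Mapping.single m (sg (k * mdeg V m) * x)) a"
 by (simp add: ksgn_def psum_def)

lemma ksgn_add: "ksgn V k (a + b) = ksgn V k a + ksgn V k b"
 unfolding ksgn_psum by (rule psum_add) (simp add: addb_def single_add algebra_simps)

lemma ksgn_single: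
 "ksgn V k (Poly_Mapping.single m x) = Poly_Mapping.single m (sg (k * mdeg V m) * x)"
 by (simp add: ksgn_psum psum_single)

lemma ksgn_0[simp]: "ksgn V k 0 = 0"
 by (simp add: ksgn_psum)

lemma ksgn_1[simp]: "ksgn V k 1 = 1"
 by (simp add: ksgn_single flip: single_one)

lemma lookup_ksgn: "Poly_Mapping.lookup (ksgn V k a) m = sg (k * mdeg V m) * Poly_Mapping.lookup a m"
 by (induction a rule: poly_mapping_linear_induct_UNIV)
   (auto simp: ksgn_single ksgn_add lookup_add lookup_single when_def algebra_simps)

lemma ksgn_fsm: "ksgn V k (fsm c a) = fsm c (ksgn V k a)"
 by (rule poly_mapping_eqI) (simp add: lookup_ksgn algebra_simps)

lemma ksgn_uminus: "ksgn V k (- a) = - ksgn V k a"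
 by (rule poly_mapping_eqI) (simp add: lookup_ksgn)

lemma ksgn_diff: "ksgn V k (a - b) = ksgn V k a - ksgn V k b"
 by (rule poly_mapping_eqI) (simp add: lookup_ksgn lookup_minus algebra_simps)

lemma ksgn_sum: "ksgn V k (sum f S) = (\<Sum>i\<in>S. ksgn V k (f i))"
 by (induction S rule: infinite_finite_induct) (auto simp: ksgn_add)

lemma ksgn_ksgn: "ksgn V k (ksgn V l a) = ksgn V (k + l) a"
 by (rule poly_mapping_eqI) (simp add: lookup_ksgn sg_add algebra_simps)

lemma ksgn_cong: "(even k \<longleftrightarrow> even l) \<Longrightarrow> ksgn V k a = ksgn V l a"
 by (rule poly_mapping_eqI) (auto simp: lookup_ksgn sg_def)

lemma ksgn_even: "even k \<Longrightarrow> ksgn V k a = a"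
 by (rule poly_mapping_eqI) (auto simp: lookup_ksgn sg_def)

lemma ksgn_ahom: "a \<in> ahom V l \<Longrightarrow> ksgn V k a = fsm (sg (k * l)) a"
 by (induction a rule: ahom_induct) (auto simp: ksgn_single ksgn_add fsm_add)

lemma keys_ksgn: "Poly_Mapping.keys (ksgn V k a) = Poly_Mapping.keys a"
 by (auto simp: in_keys_iff lookup_ksgn sg_def)

lemma acar_ksgn[simp]: "ksgn V k a \<in> acar V \<longleftrightarrow> a \<in> acar V"
 by (simp add: acar_def keys_ksgn)

lemma ahom_ksgn[simp]: "ksgn V k a \<in> ahom V l \<longleftrightarrow> a \<in> ahom V l"
 by (simp add: ahom_def keys_ksgn)

lemma ksgn_amul: "ksgn V k (amul V a b) = amul V (ksgn V k a) (ksgn V k b)"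
proof (induction a rule: poly_mapping_linear_induct_UNIV)
 case (single u x)
 show ?case
  by (induction b rule: poly_mapping_linear_induct_UNIV)
    (auto simp: amul_single mmul_def ksgn_single ksgn_add amul_add_right mdeg_add
     distrib_left sg_add ac_simps)
qed (auto simp: amul_add_left ksgn_add)

text \<open>Only \<open>a\<close> is homogeneous; the involution \<open>ksgn\<close> supplies the
  right sign for every homogeneous component of \<open>b\<close> at once. On monomials this is
  \<open>chi_commute\<close>.\<close>

lemma amul_commute:
 fixes a b :: "'k::field fga"
 assumes "a \<in> ahom V k"
 shows "amul V a b = amul V (ksgn V k b) a"
 using assms
proof (induction a rule: ahom_induct)
 case (single m x)
 show ?case
 proof (induction b rule: poly_mapping_linear_induct_UNIV)
  case (single u y)
  have "sg (chi V m u) = (sg (k * mdeg V u) * sg (chi V u m) :: 'k)" if "mon_ok V (m + u)"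
   unfolding sg_add[symmetric]
   using chi_commute[OF that] \<open>mdeg V m = k\<close> by (intro sg_eqI) (auto simp: even_add)
  then show ?case
   by (auto simp: amul_single ksgn_single mmul_def ac_simps)
 qed (auto simp: amul_add_right amul_add_left ksgn_add)
qed (auto simp: amul_add_left amul_add_right)

lemma amul_commute_hom:
 assumes "a \<in> ahom V k" "b \<in> ahom V l"
 shows "amul V a b = fsm (sg (k * l)) (amul V b a)"
 using amul_commute[OF assms(1)] assms(2) by (simp add: ksgn_ahom amul_fsm_left)

subsection \<open>The coordinate derivations\<close>

lemma apar_psum: "apar V i a = psum (\<lambda>m x. Poly_Mapping.single (m - Poly_Mapping.single i 1)
  (of_nat (Poly_Mapping.lookup m i) * sg (zdeg V i * below V i m) * x)) a"
 by (simp add: apar_def psum_def below_def)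

lemma apar_add: "apar V i (a + b) = apar V i a + apar V i b"
 unfolding apar_psum by (rule psum_add) (simp add: addb_def single_add algebra_simps)

lemma apar_single: "apar V i (Poly_Mapping.single m x) = Poly_Mapping.single (m - Poly_Mapping.single i 1)
  (of_nat (Poly_Mapping.lookup m i) * sg (zdeg V i * below V i m) * x)"
 by (simp add: apar_psum psum_single)

lemma apar_0[simp]: "apar V i 0 = 0"
 by (simp add: apar_psum)

lemma apar_1[simp]: "apar V i 1 = 0"
 by (simp add: apar_single flip: single_one)

lemma apar_fsm: "apar V i (fsm c a) = fsm c (apar V i a)"
 by (induction a rule: poly_mapping_linear_induct_UNIV)
   (auto simp: apar_single apar_add fsm_add ac_simps)

lemma apar_uminus: "apar V i (- a) = - apar V i a"
 using apar_add[of V i a "- a"] by (simp add: eq_neg_iff_add_eq_0 add.commute)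

lemma apar_diff: "apar V i (a - b) = apar V i a - apar V i b"
 using apar_add[of V i a "- b"] by (simp add: apar_uminus)

lemma apar_sum: "apar V i (sum f S) = (\<Sum>j\<in>S. apar V i (f j))"
 by (induction S rule: infinite_finite_induct) (auto simp: apar_add)

lemma minus_single_add:
 "Poly_Mapping.lookup m i \<noteq> 0 \<Longrightarrow> m = (m - Poly_Mapping.single i 1) + Poly_Mapping.single i (1 :: nat)"
 by (rule poly_mapping_eqI) (auto simp: lookup_add lookup_minus lookup_single when_def)

lemma mdeg_minus:
 "Poly_Mapping.lookup m i \<noteq> 0 \<Longrightarrow> mdeg V (m - Poly_Mapping.single i (Suc 0)) = mdeg V m - zdeg V i"
 using minus_single_add[of m i] mdeg_add[of V "m - Poly_Mapping.single i 1" "Poly_Mapping.single i 1"]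
 by simp

lemma mon_ok_minus: "mon_ok V m \<Longrightarrow> mon_ok V (m - Poly_Mapping.single i (Suc 0))"
 unfolding mon_ok_def
 by (intro conjI allI impI subsetI)
   (auto simp: lookup_minus in_keys_iff subset_iff intro: order_trans[OF diff_le_self])

lemma acar_apar: "a \<in> acar V \<Longrightarrow> apar V i a \<in> acar V"
 by (induction a rule: acar_induct) (auto simp: apar_single apar_add acar_add acar_single mon_ok_minus)

lemma ahom_apar: "a \<in> ahom V k \<Longrightarrow> l = k - zdeg V i \<Longrightarrow> apar V i a \<in> ahom V l"
proof (induction a rule: ahom_induct)
 case (single m c)
 then show ?case
  by (cases "Poly_Mapping.lookup m i = 0")
    (auto simp: apar_single intro!: ahom_single mon_ok_minus mdeg_minus)
qed (auto simp: apar_add ahom_add)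

lemma ksgn_apar: "ksgn V k (apar V i a) = fsm (sg (k * zdeg V i)) (apar V i (ksgn V k a))"
proof (induction a rule: poly_mapping_linear_induct_UNIV)
 case (single m c)
 show ?case
 proof (cases "Poly_Mapping.lookup m i = 0")
  case False
  then have "sg (k * (mdeg V m - zdeg V i)) = (sg (k * zdeg V i) * sg (k * mdeg V m) :: 'a)"
   by (auto simp: algebra_simps sg_add[symmetric] intro!: sg_eqI)
  with False show ?thesis
   by (simp add: apar_single ksgn_single mdeg_minus ac_simps)
 qed (auto simp: apar_single ksgn_single)
qed (auto simp: apar_add ksgn_add fsm_add)

text \<open>Bringing z_i in from the right crosses the factors of higher index. Their total degree
  is that of m minus the part below i and minus the part at i.\<close>

lemma chi_single_right:
 "even (chi V m (Poly_Mapping.single i 1) + zdeg V i * (mdeg V m - below V i m - int (Poly_Mapping.lookup m i) * zdeg V i))"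
proof -
 define S where "S = insert i (Poly_Mapping.keys m)"
 have S: "finite S" "Poly_Mapping.keys m \<subseteq> S" "i \<in> S" by (auto simp: S_def)
 have b: "below V j (Poly_Mapping.single i 1) = (if i < j then zdeg V i else 0)" for j
  by (auto simp: below_def)
 have "mdeg V m - below V i m - int (Poly_Mapping.lookup m i) * zdeg V i
   = (\<Sum>j\<in>S. if i < j then int (Poly_Mapping.lookup m j) * zdeg V j else 0)"
 proof -
  have "mdeg V m = (\<Sum>j\<in>S. int (Poly_Mapping.lookup m j) * zdeg V j)"
   by (rule mdeg_superset) (use S in auto)
  moreover have "below V i m = (\<Sum>j\<in>S. if j < i then int (Poly_Mapping.lookup m j) * zdeg V j else 0)"
   using S by (simp add: below_superset[of S] sum.inter_restrict lessThan_def)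
  moreover have "int (Poly_Mapping.lookup m i) * zdeg V i
    = (\<Sum>j\<in>S. if j = i then int (Poly_Mapping.lookup m j) * zdeg V j else 0)"
   using S by simp
  ultimately show ?thesis
   by (simp only: sum_subtractf[symmetric]) (intro sum.cong, auto)
 qed
 moreover have "chi V m (Poly_Mapping.single i 1)
   = zdeg V i * (\<Sum>j\<in>S. if i < j then int (Poly_Mapping.lookup m j) * zdeg V j else 0)"
  using S by (auto simp: chi_superset[of S] b[unfolded One_nat_def] sum_distrib_left intro!: sum.cong)
 ultimately show ?thesis by simp
qed

lemma mon_ok_add_iff:
 assumes "mon_ok V m" "mon_ok V m'"
 shows "mon_ok V (m + m') \<longleftrightarrow>
  (\<forall>j. odd (zdeg V j) \<longrightarrow> Poly_Mapping.lookup m j + Poly_Mapping.lookup m' j \<le> 1)"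
 using assms by (auto simp: mon_ok_def keys_plus_nat lookup_add)

lemma plus_minus_single:
 "Poly_Mapping.lookup m i \<noteq> 0 \<Longrightarrow> m - Poly_Mapping.single i (1::nat) + m' = m + m' - Poly_Mapping.single i 1"
 "Poly_Mapping.lookup m i \<noteq> 0 \<Longrightarrow> m' + (m - Poly_Mapping.single i (1::nat)) = m' + m - Poly_Mapping.single i 1"
 by (rule poly_mapping_eqI; auto simp: lookup_add lookup_minus lookup_single when_def)+

text \<open>On two monomials all three terms are multiples of one monomial, with coefficients a + b,
  a and b, where a and b are the exponents of z_i in the two factors. What remains is to compare
  signs and to treat the products that vanish because an odd generator is repeated.\<close>

lemma apar_amul:
 fixes a b :: "'k::field fga"
 assumes "a \<in> ahom V k" "b \<in> acar V"
 shows "apar V i (amul V a b) =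
  amul V (apar V i a) b + fsm (sg (zdeg V i * k)) (amul V a (apar V i b))"
 using assms(1)
proof (induction a rule: ahom_induct)
 case (single m x)
 note m = \<open>mon_ok V m\<close> \<open>mdeg V m = k\<close>
 show ?case
  using assms(2)
 proof (induction b rule: acar_induct)
  case (single m' y)
  let ?E = "Poly_Mapping.single i 1 :: nat \<Rightarrow>\<^sub>0 nat"
  let ?z = "zdeg V i"
  let ?a = "Poly_Mapping.lookup m i" and ?b = "Poly_Mapping.lookup m' i"
  \<comment> \<open>The sign common to the three terms. The right-hand term carries the additional
    sign |z_i| a, which is dealt with separately.\<close>
  let ?s = "sg (?z * below V i m + chi V m m' + ?z * below V i m') :: 'k"
  have 0: "apar V i (amul V (Poly_Mapping.single m x) (Poly_Mapping.single m' y)) =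
   (if mon_ok V (m + m') then Poly_Mapping.single (m + m' - ?E) (of_nat (?a + ?b) * ?s * (x * y)) else 0)"
   by (auto simp: amul_single mmul_def apar_single below_add lookup_add sg_add algebra_simps)
  have 1: "amul V (apar V i (Poly_Mapping.single m x)) (Poly_Mapping.single m' y) =
   (if mon_ok V (m + m' - ?E) then Poly_Mapping.single (m + m' - ?E) (of_nat ?a * ?s * (x * y)) else 0)"
  proof (cases "?a = 0")
   case False
   have "chi V m m' = chi V (m - ?E) m' + ?z * below V i m'"
    using minus_single_add[OF False] chi_add_left[of V "m - ?E" ?E m'] chi_single_left[of V i m'] by simp
   then have s: "?s = sg (?z * below V i m) * sg (chi V (m - ?E) m')"
    by (auto simp: sg_add[symmetric] intro!: sg_eqI)
   show ?thesis
    unfolding s by (simp add: apar_single amul_single mmul_def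
     plus_minus_single[OF False, unfolded One_nat_def] ac_simps)
  qed (simp add: apar_single)
  have 2: "fsm (sg (?z * k)) (amul V (Poly_Mapping.single m x) (apar V i (Poly_Mapping.single m' y))) =
   (if mon_ok V (m + m' - ?E) then Poly_Mapping.single (m + m' - ?E)
     (of_nat ?b * ?s * sg (?z * int ?a) * (x * y)) else 0)"
  proof (cases "?b = 0")
   case False
   have "chi V m m' = chi V m (m' - ?E) + chi V m ?E"
    using minus_single_add[OF False] chi_add_right[of V m "m' - ?E" ?E] by simp
   with chi_single_right[of V m i] m have
    "?s * sg (?z * int ?a) = sg (?z * k) * sg (?z * below V i m') * sg (chi V m (m' - ?E))"
    unfolding sg_add[symmetric] by (intro sg_eqI) auto
   then have s: "c * ?s * sg (?z * int ?a) * d =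
     c * (sg (?z * k) * sg (?z * below V i m') * sg (chi V m (m' - ?E))) * d" for c d
    by (simp only: mult.assoc)
   show ?thesis
    unfolding s by (simp add: apar_single amul_single mmul_def
     plus_minus_single[OF False, unfolded One_nat_def] ac_simps)
  qed (simp add: apar_single)
  show ?case
  proof (cases "mon_ok V (m + m')")
   case True
   then have "mon_ok V (m + m' - ?E)"
    using mon_ok_minus[of V "m + m'" i] by simp
   \<comment> \<open>The additional sign matters only for odd z_i, and then admissibility lets z_i
     occur in at most one of the factors.\<close>
   moreover have "of_nat ?b * ?s * sg (?z * int ?a) = of_nat ?b * ?s"
   proof (cases "odd ?z")
    case odd: True
    with True have "?a + ?b \<le> 1" by (auto simp: mon_ok_def lookup_add)
    then have "?a = 0 \<or> ?b = 0" by linarith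
    then show ?thesis by auto
   qed (simp add: sg_even)
   ultimately show ?thesis
    unfolding 0 1 2 using True
    by (simp only: if_True single_add[symmetric] of_nat_add distrib_right)
  next
   case False
   show ?thesis
   proof (cases "mon_ok V (m + m' - ?E)")
    case True
    \<comment> \<open>Lowering the exponent of z_i restores admissibility, so the excess sits at i:
      z_i is odd and occurs once in each factor. The left side is 0 and the two terms on the right
      cancel.\<close>
    obtain j where j: "odd (zdeg V j)" "\<not> Poly_Mapping.lookup m j + Poly_Mapping.lookup m' j \<le> 1"
     using False m single mon_ok_add_iff by blast
    have "Poly_Mapping.lookup (m + m' - ?E) j \<le> 1"
     using True j by (auto simp: mon_ok_def)
    then have "j = i"
     using j by (cases "j = i") (auto simp: lookup_add lookup_minus lookup_single)
    moreover have "Poly_Mapping.lookup m j \<le> 1" "Poly_Mapping.lookup m' j \<le> 1"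
     using j m single by (auto simp: mon_ok_def)
    ultimately have "?a = 1" "?b = 1" "odd ?z"
     using j by auto
    then show ?thesis
     unfolding 0 1 2 using False True by (simp add: single_add[symmetric] sg_odd)
   qed (use 0 1 2 False in simp)
  qed
 qed (auto simp: amul_add_right apar_add fsm_add)
qed (auto simp: amul_add_left apar_add fsm_add)

lemma apar_avar: "apar V i (avar j) = (if i = j then 1 else 0)"
 by (auto simp: avar_def apar_single below_def lookup_single when_def)

section \<open>Derivations and their values on the generators\<close>

lemma ader_apply: "a \<in> acar V \<Longrightarrow> ader V v a = (\<Sum>i<ngen V. amul V (v i) (apar V i a))"
 by (simp add: ader_def)

lemma derD:
 assumes "D \<in> der V p"
 shows der_outside: "a \<notin> acar V \<Longrightarrow> D a = 0"
  and der_add: "a \<in> acar V \<Longrightarrow> b \<in> acar V \<Longrightarrow> D (a + b) = D a + D b"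
  and der_fsm: "a \<in> acar V \<Longrightarrow> D (fsm c a) = fsm c (D a)"
  and der_ahom: "a \<in> ahom V k \<Longrightarrow> l = k + p \<Longrightarrow> D a \<in> ahom V l"
  and der_amul: "a \<in> ahom V k \<Longrightarrow> b \<in> acar V \<Longrightarrow>
   D (amul V a b) = amul V (D a) b + fsm (sg (p * k)) (amul V a (D b))"
 using assms by (auto simp: der_def)

text \<open>Moving \<open>v i\<close> past a costs the sign (|z_i| + p) k. Together with the sign
  |z_i| k from the Leibniz rule of the coordinate derivation this leaves p k for every i.\<close>

lemma ader_der:
 fixes v :: "nat \<Rightarrow> 'k::field fga"
 assumes v: "\<And>i. i < ngen V \<Longrightarrow> v i \<in> ahom V (zdeg V i + p)"
 shows "ader V v \<in> der V p"
 unfolding der_def mem_Collect_eq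
proof (intro conjI allI impI ballI)
 fix a :: "'k fga" assume "a \<notin> acar V"
 then show "ader V v a = 0" by (simp add: ader_def)
next
 fix a b :: "'k fga" assume "a \<in> acar V" "b \<in> acar V"
 then show "ader V v (a + b) = ader V v a + ader V v b"
  by (simp add: ader_apply acar_add apar_add amul_add_right sum.distrib)
next
 fix c and a :: "'k fga" assume "a \<in> acar V"
 then show "ader V v (fsm c a) = fsm c (ader V v a)"
  by (simp add: ader_apply acar_fsm apar_fsm amul_fsm_right fsm_sum)
next
 fix k and a :: "'k fga" assume a: "a \<in> ahom V k"
 have "amul V (v i) (apar V i a) \<in> ahom V (k + p)" if "i < ngen V" for i
  by (rule ahom_amul[OF v[OF that] ahom_apar[OF a refl]]) simp
 then show "ader V v a \<in> ahom V (k + p)"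
  by (auto simp: ader_apply ahom_acar[OF a] intro!: ahom_sum)
next
 fix k and a b :: "'k fga" assume a: "a \<in> ahom V k" and b: "b \<in> acar V"
 have "amul V (v i) (apar V i (amul V a b)) =
   amul V (amul V (v i) (apar V i a)) b + fsm (sg (p * k)) (amul V a (amul V (v i) (apar V i b)))"
  if "i < ngen V" for i
 proof -
  have "amul V (v i) (amul V a (apar V i b)) =
    fsm (sg ((zdeg V i + p) * k)) (amul V a (amul V (v i) (apar V i b)))"
   unfolding amul_assoc[symmetric] amul_commute_hom[OF v[OF that] a] by (simp add: amul_fsm_left)
  moreover have "sg (zdeg V i * k) * sg ((zdeg V i + p) * k) = (sg (p * k) :: 'k)"
   unfolding sg_add[symmetric] by (rule sg_eqI) auto
  ultimately show ?thesis
   by (simp add: apar_amul[OF a b] amul_add_right amul_fsm_right amul_assoc)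
 qed
 then show "ader V v (amul V a b) = amul V (ader V v a) b + fsm (sg (p * k)) (amul V a (ader V v b))"
  using ahom_acar[OF a] b
  by (simp add: ader_apply amul_sum_left amul_sum_right fsm_sum sum.distrib)
qed

lemma sum_lessThan_delta: "i < (n::nat) \<Longrightarrow> (\<Sum>j<n. if j = i then f j else 0) = f i"
 "i < (n::nat) \<Longrightarrow> (\<Sum>j<n. if i = j then f j else 0) = f i"
 by (simp_all add: sum.delta sum.delta')

lemma ader_avar:
 assumes "i < ngen V" "v i \<in> acar V"
 shows "ader V v (avar i) = v i"
proof -
 have "ader V v (avar i) = (\<Sum>j<ngen V. if j = i then v i else 0)"
  unfolding ader_apply[OF acar_avar[OF assms(1)]] apar_avar
  by (intro sum.cong refl) (use assms in \<open>auto simp: amul_1_right\<close>)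
 with assms show ?thesis by simp
qed

lemma der_1:
 fixes D :: "'k::field fga \<Rightarrow> 'k fga"
 assumes "D \<in> der V p" shows "D 1 = 0"
proof -
 have "D 1 \<in> acar V"
  using ahom_acar[OF der_ahom[OF assms ahom_1 refl]] .
 moreover have "D (amul V 1 1) = amul V (D 1) 1 + amul V 1 (D 1)"
  using der_amul[OF assms ahom_1 acar_1] by (simp only: mult_zero_right sg_0 fsm_1)
 ultimately have "D 1 = D 1 + D 1"
  by (metis amul_1_left amul_1_right acar_1)
 then show ?thesis by (metis add_cancel_left_right)
qed

lemma der_0: "D \<in> der V p \<Longrightarrow> D 0 = 0"
 using der_fsm[of D V p 0 0] by simp

lemma der_uminus: "D \<in> der V p \<Longrightarrow> a \<in> acar V \<Longrightarrow> D (- a) = - D a"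
 using der_fsm[of D V p a "- 1"] by (simp add: fsm_uminus_left)

lemma der_diff: "D \<in> der V p \<Longrightarrow> a \<in> acar V \<Longrightarrow> b \<in> acar V \<Longrightarrow> D (a - b) = D a - D b"
 using der_add[of D V p a "- b"] by (simp add: der_uminus acar_uminus)

lemma der_sum: "D \<in> der V p \<Longrightarrow> (\<And>i. i \<in> S \<Longrightarrow> f i \<in> acar V) \<Longrightarrow> D (sum f S) = (\<Sum>i\<in>S. D (f i))"
 by (induction S rule: infinite_finite_induct) (auto simp: der_0 der_add acar_sum)

lemma acar_der: "D \<in> der V p \<Longrightarrow> D a \<in> acar V"
proof (cases "a \<in> acar V")
 case True
 assume D: "D \<in> der V p"
 from True show ?thesis
 proof (induction a rule: acar_induct)
  case (single m c)
  then show ?case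
   using ahom_acar[OF der_ahom[OF D ahom_single[OF single refl] refl]] by simp
 qed (auto simp: der_0[OF D] der_add[OF D] acar_add)
qed (simp add: der_outside)

text \<open>Induction on the total exponent of a monomial, splitting off one generator and applying
  the Leibniz rule to both derivations.\<close>

lemma der_eqI:
 fixes D E :: "'k::field fga \<Rightarrow> 'k fga"
 assumes D: "D \<in> der V p" and E: "E \<in> der V p"
  and eq: "\<And>i. i < ngen V \<Longrightarrow> D (avar i) = E (avar i)"
 shows "D a = E a"
proof (cases "a \<in> acar V")
 case True
 have mono: "D (Poly_Mapping.single m c) = E (Poly_Mapping.single m c)" if "mon_ok V m" for m c
  using that
 proof (induction "\<Sum>i\<in>Poly_Mapping.keys m. Poly_Mapping.lookup m i" arbitrary: m rule: less_induct)
  case less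
  show ?case
  proof (cases "m = 0")
   case True
   have "(Poly_Mapping.single 0 c :: 'k fga) = fsm c 1"
    by (simp flip: single_one)
   with True show ?thesis
    using der_fsm[OF D acar_1, of c] der_fsm[OF E acar_1, of c] der_1[OF D] der_1[OF E] by simp
  next
   case False
   \<comment> \<open>The least index: the generator then stands at the front of the sorted monomial,
     and splitting it off produces no sign.\<close>
   define i where "i = Min (Poly_Mapping.keys m)"
   have i: "i \<in> Poly_Mapping.keys m"
    using False by (simp add: i_def)
   then have i': "Poly_Mapping.lookup m i \<noteq> 0" by (simp add: in_keys_iff)
   define n where "n = m - Poly_Mapping.single i 1"
   have m: "m = Poly_Mapping.single i 1 + n"
    using minus_single_add[OF i'] by (simp add: n_def add.commute)
   have "below V i n = 0"
    unfolding below_def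
   proof (intro sum.neutral ballI)
    fix j assume "j \<in> Poly_Mapping.keys n \<inter> {..<i}"
    then have "j \<in> Poly_Mapping.keys m" "j < i" by (auto simp: m keys_plus_nat)
    then have "Min (Poly_Mapping.keys m) \<le> j" by simp
    with \<open>j < i\<close> show "int (Poly_Mapping.lookup n j) * zdeg V j = 0" by (simp add: i_def)
   qed
   then have split: "Poly_Mapping.single m c = amul V (avar i) (Poly_Mapping.single n c)"
    using less.prems by (simp add: avar_def amul_single mmul_def m chi_single_left[unfolded One_nat_def])
   have n: "mon_ok V n"
    using mon_ok_addD[of V] less.prems m by metis
   have "i < ngen V"
    using less.prems i by (auto simp: mon_ok_def)
   moreover have "D (Poly_Mapping.single n c) = E (Poly_Mapping.single n c)"
   proof (rule less.hyps[OF _ n])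
    have "(\<Sum>j\<in>Poly_Mapping.keys n. Poly_Mapping.lookup n j) \<le> (\<Sum>j\<in>Poly_Mapping.keys m. Poly_Mapping.lookup n j)"
     by (rule sum_mono2) (auto simp: m keys_plus_nat)
    also have "\<dots> < (\<Sum>j\<in>Poly_Mapping.keys m. Poly_Mapping.lookup m j)"
     by (rule sum_strict_mono_ex1) (use i in \<open>auto simp: m lookup_add intro!: bexI[of _ i]\<close>)
    finally show "(\<Sum>j\<in>Poly_Mapping.keys n. Poly_Mapping.lookup n j) <
      (\<Sum>j\<in>Poly_Mapping.keys m. Poly_Mapping.lookup m j)" .
   qed
   ultimately show ?thesis
    unfolding split
    using der_amul[OF D ahom_avar[OF _ refl] acar_single[OF n]]
     der_amul[OF E ahom_avar[OF _ refl] acar_single[OF n]] eq by simp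
  qed
 qed
 from True show ?thesis
  by (induction a rule: acar_induct) (auto simp: mono der_0[OF D] der_0[OF E] der_add[OF D] der_add[OF E])
qed (simp add: der_outside[OF D] der_outside[OF E])

lemma der_apply:
 assumes D: "D \<in> der V p" and a: "a \<in> acar V"
 shows "D a = (\<Sum>i<ngen V. amul V (D (avar i)) (apar V i a))"
proof -
 have "D a = ader V (\<lambda>i. D (avar i)) a"
  by (rule der_eqI[OF D ader_der])
    (auto intro!: der_ahom[OF D] ahom_avar simp: ader_avar acar_der[OF D])
 with a show ?thesis by (simp add: ader_apply)
qed

subsection \<open>Free modules and linear maps\<close>

text \<open>Module elements, maps and families of maps are all functions. With the pointwise rules
  switched off, sums of them stay sums, and \<open>fapp\<close> evaluates them where wanted.\<close>

declare plus_fun_apply[simp del] zero_fun_apply[simp del] minus_apply[simp del] uminus_apply[simp del]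

lemmas fapp = plus_fun_apply zero_fun_apply minus_apply uminus_apply

lemma msc_simps[simp]:
 "msc c 0 = 0" "msc 0 x = 0" "msc 1 x = x" "msc c (msc d x) = msc (c * d) x"
 by (auto simp: msc_def fun_eq_iff fapp)

lemma msc_apply: "msc c x w = fsm c (x w)"
 by (simp add: msc_def)

lemma mact_apply: "mact A a x w = amul A a (x w)"
 by (simp add: mact_def)

lemma msc_add: "msc c (x + y) = msc c x + msc c y"
 by (auto simp: msc_def fun_eq_iff fapp fsm_add)

lemma msc_diff: "msc c (x - y) = msc c x - msc c y"
 by (auto simp: msc_def fun_eq_iff fapp fsm_diff)

lemma msc_uminus: "msc c (- x) = - msc c x"
 by (auto simp: msc_def fun_eq_iff fapp fsm_uminus)

lemma msc_uminus_left: "msc (- c) x = - msc c x"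
 by (auto simp: msc_def fun_eq_iff fapp fsm_uminus_left)

lemma msc_add_left: "msc (c + d) x = msc c x + msc d x"
 by (auto simp: msc_def fun_eq_iff fapp fsm_add_left)

lemma msc_sum: "msc c (sum f S) = (\<Sum>i\<in>S. msc c (f i))"
 by (induction S rule: infinite_finite_induct) (auto simp: msc_add)

lemma mact_simps[simp]:
 "mact A a 0 = 0" "mact A 0 x = 0"
 "mact A a (msc c x) = msc c (mact A a x)" "mact A (fsm c a) x = msc c (mact A a x)"
 "mact A a (mact A b x) = mact A (amul A a b) x"
 by (auto simp: mact_def msc_def fun_eq_iff fapp amul_fsm_left amul_fsm_right amul_assoc)

lemma mact_add: "mact A a (x + y) = mact A a x + mact A a y"
 by (auto simp: mact_def fun_eq_iff fapp amul_add_right)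

lemma mact_diff: "mact A a (x - y) = mact A a x - mact A a y"
 by (auto simp: mact_def fun_eq_iff fapp amul_diff_right)

lemma mact_uminus: "mact A a (- x) = - mact A a x"
 by (auto simp: mact_def fun_eq_iff fapp amul_uminus_right)

lemma mact_add_left: "mact A (a + b) x = mact A a x + mact A b x"
 by (auto simp: mact_def fun_eq_iff fapp amul_add_left)

lemma mact_uminus_left: "mact A (- a) x = - mact A a x"
 by (auto simp: mact_def fun_eq_iff fapp amul_uminus_left)

lemma mact_sum: "mact A a (sum f S) = (\<Sum>i\<in>S. mact A a (f i))"
 by (induction S rule: infinite_finite_induct) (auto simp: mact_add)

lemma mact_sum_left: "mact A (sum f S) x = (\<Sum>i\<in>S. mact A (f i) x)"
 by (induction S rule: infinite_finite_induct) (auto simp: mact_add_left)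

lemma mact_1: "x \<in> mcar A W \<Longrightarrow> mact A 1 x = x"
 by (auto simp: mact_def mcar_def fun_eq_iff fapp amul_1_left)

lemma mcar_0[simp]: "0 \<in> mcar A W"
 by (simp add: mcar_def fapp)

lemma mcar_add: "x \<in> mcar A W \<Longrightarrow> y \<in> mcar A W \<Longrightarrow> x + y \<in> mcar A W"
 by (simp add: mcar_def fapp acar_add)

lemma mcar_uminus: "x \<in> mcar A W \<Longrightarrow> - x \<in> mcar A W"
 by (simp add: mcar_def fapp acar_uminus)

lemma mcar_diff: "x \<in> mcar A W \<Longrightarrow> y \<in> mcar A W \<Longrightarrow> x - y \<in> mcar A W"
 by (simp add: mcar_def fapp acar_diff)

lemma mcar_msc: "x \<in> mcar A W \<Longrightarrow> msc c x \<in> mcar A W"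
 by (simp add: mcar_def msc_def acar_fsm)

lemma mcar_mact: "x \<in> mcar A W \<Longrightarrow> mact A a x \<in> mcar A W"
 by (simp add: mcar_def mact_def)

lemma mcar_sum: "(\<And>i. i \<in> S \<Longrightarrow> f i \<in> mcar A W) \<Longrightarrow> sum f S \<in> mcar A W"
 by (induction S rule: infinite_finite_induct) (auto intro: mcar_add)

lemma mcar_ge: "w \<in> W \<Longrightarrow> ge w \<in> mcar A W"
 by (simp add: mcar_def ge_def)

lemma mhom_mcar: "x \<in> mhom A M k \<Longrightarrow> x \<in> mcar A (gens M)"
 by (simp add: mhom_def)

lemma mhom_0[simp]: "0 \<in> mhom A M k"
 by (simp add: mhom_def fapp)

lemma mhom_add: "x \<in> mhom A M k \<Longrightarrow> y \<in> mhom A M k \<Longrightarrow> x + y \<in> mhom A M k"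
 by (simp add: mhom_def fapp mcar_add ahom_add)

lemma mhom_uminus: "x \<in> mhom A M k \<Longrightarrow> - x \<in> mhom A M k"
 by (simp add: mhom_def fapp mcar_uminus ahom_uminus)

lemma mhom_diff: "x \<in> mhom A M k \<Longrightarrow> y \<in> mhom A M k \<Longrightarrow> x - y \<in> mhom A M k"
 by (simp add: mhom_def fapp mcar_diff ahom_diff)

lemma mhom_msc: "x \<in> mhom A M k \<Longrightarrow> msc c x \<in> mhom A M k"
 by (auto simp add: mhom_def mcar_msc) (simp add: msc_def ahom_fsm)

lemma mhom_mact: "a \<in> ahom A l \<Longrightarrow> x \<in> mhom A M k \<Longrightarrow> r = l + k \<Longrightarrow> mact A a x \<in> mhom A M r"
 by (auto simp add: mhom_def mcar_mact) (auto simp: mact_def intro!: ahom_amul)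

lemma mhom_sum: "(\<And>i. i \<in> S \<Longrightarrow> f i \<in> mhom A M k) \<Longrightarrow> sum f S \<in> mhom A M k"
 by (induction S rule: infinite_finite_induct) (auto intro: mhom_add)

lemma mhom_ge: "w \<in> gens M \<Longrightarrow> gdeg M w = k \<Longrightarrow> ge w \<in> mhom A M k"
 by (auto simp: mhom_def mcar_ge) (simp add: ge_def)

lemma mcar_decomp:
 assumes "finite W" "x \<in> mcar A W"
 shows "x = (\<Sum>w\<in>W. mact A (x w) (ge w))"
proof (rule ext)
 fix v
 have "(\<Sum>w\<in>W. mact A (x w) (ge w)) v = (\<Sum>w\<in>W. if v = w then x w else 0)"
  unfolding sum_apply
  by (intro sum.cong refl) (use assms(2) in \<open>auto simp: mact_def ge_def amul_1_right mcar_def\<close>)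
 also have "\<dots> = x v"
  using assms by (auto simp: mcar_def)
 finally show "x v = (\<Sum>w\<in>W. mact A (x w) (ge w)) v" ..
qed

text \<open>A homogeneous element is a sum of multiples of generators by coefficients of
  complementary degree, so additive statements need to be checked only on these.\<close>

lemma mhom_induct[consumes 2, case_names zero act plus]:
 assumes "x \<in> mhom A M k" "finite (gens M)" "P 0"
  "\<And>a w. a \<in> ahom A (k - gdeg M w) \<Longrightarrow> w \<in> gens M \<Longrightarrow> P (mact A a (ge w))"
  "\<And>x y. x \<in> mhom A M k \<Longrightarrow> y \<in> mhom A M k \<Longrightarrow> P x \<Longrightarrow> P y \<Longrightarrow> P (x + y)"
 shows "P x"
proof -
 have g: "mact A (x w) (ge w) \<in> mhom A M k" if "w \<in> gens M" for w
  using that assms(1) by (intro mhom_mact[OF _ mhom_ge]) (auto simp: mhom_def)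
 have "finite S \<Longrightarrow> S \<subseteq> gens M \<Longrightarrow> P (\<Sum>w\<in>S. mact A (x w) (ge w))" for S
 proof (induction S rule: finite_induct)
  case (insert w F)
  then show ?case
   using assms(1) g by (auto intro!: assms(4,5) mhom_sum simp: mhom_def subset_iff)
 qed (use assms in auto)
 from this[OF assms(2) subset_refl] show ?thesis
  using mcar_decomp[OF assms(2) mhom_mcar[OF assms(1)]] by simp
qed

lemma mcar_induct[consumes 2, case_names zero act plus]:
 assumes "x \<in> mcar A W" "finite W" "P 0"
  "\<And>k a w. a \<in> ahom A k \<Longrightarrow> w \<in> W \<Longrightarrow> P (mact A a (ge w))"
  "\<And>x y. x \<in> mcar A W \<Longrightarrow> y \<in> mcar A W \<Longrightarrow> P x \<Longrightarrow> P y \<Longrightarrow> P (x + y)"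
 shows "P x"
proof -
 have act: "P (mact A a (ge w))" if "a \<in> acar A" "w \<in> W" for a w
  using that(1)
 proof (induction a rule: acar_induct)
  case (single m c)
  then show ?case using assms(4) that(2) ahom_single by blast
 next
  case (plus a b)
  then show ?case using that(2) by (auto simp: mact_add_left intro!: assms(5) mcar_mact mcar_ge)
 qed (use assms in simp)
 have "finite S \<Longrightarrow> S \<subseteq> W \<Longrightarrow> P (\<Sum>w\<in>S. mact A (x w) (ge w))" for S
 proof (induction S rule: finite_induct)
  case (insert w F)
  then show ?case
   using assms(1) by (auto intro!: act assms(5) mcar_sum mcar_mact mcar_ge simp: mcar_def subset_iff)
 qed (use assms in auto)
 from this[OF assms(2) subset_refl] show ?thesis
  using mcar_decomp[OF assms(2,1)] by simp
qed

lemma lin_homD: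
 assumes "h \<in> lin_hom A M N p"
 shows lh_outside: "x \<notin> mcar A (gens M) \<Longrightarrow> h x = 0"
  and lh_add: "x \<in> mcar A (gens M) \<Longrightarrow> y \<in> mcar A (gens M) \<Longrightarrow> h (x + y) = h x + h y"
  and lh_msc: "x \<in> mcar A (gens M) \<Longrightarrow> h (msc c x) = msc c (h x)"
  and lh_mhom: "x \<in> mhom A M k \<Longrightarrow> r = k + p \<Longrightarrow> h x \<in> mhom A N r"
  and lh_mact: "a \<in> ahom A k \<Longrightarrow> x \<in> mcar A (gens M) \<Longrightarrow>
   h (mact A a x) = msc (sg (p * k)) (mact A a (h x))"
 using assms by (auto simp: lin_hom_def)

lemma lh_0: "h \<in> lin_hom A M N p \<Longrightarrow> h 0 = 0"
 using lh_msc[of h A M N p 0 0] by simp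

lemma lh_uminus: "h \<in> lin_hom A M N p \<Longrightarrow> x \<in> mcar A (gens M) \<Longrightarrow> h (- x) = - h x"
 using lh_msc[of h A M N p x "- 1"] by (simp add: msc_uminus_left)

lemma lh_diff: "h \<in> lin_hom A M N p \<Longrightarrow> x \<in> mcar A (gens M) \<Longrightarrow> y \<in> mcar A (gens M) \<Longrightarrow>
  h (x - y) = h x - h y"
 using lh_add[of h A M N p x "- y"] by (simp add: lh_uminus mcar_uminus)

lemma lh_sum: "h \<in> lin_hom A M N p \<Longrightarrow> (\<And>i. i \<in> S \<Longrightarrow> f i \<in> mcar A (gens M)) \<Longrightarrow>
  h (sum f S) = (\<Sum>i\<in>S. h (f i))"
 by (induction S rule: infinite_finite_induct) (auto simp: lh_0 lh_add mcar_sum)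

lemma lh_mact_ksgn:
 assumes "h \<in> lin_hom A M N p" "a \<in> acar A" "x \<in> mcar A (gens M)"
 shows "h (mact A a x) = mact A (ksgn A p a) (h x)"
 using assms(2)
proof (induction a rule: acar_induct)
 case (single m c)
 then show ?case
  using lh_mact[OF assms(1) ahom_single[OF single refl] assms(3)]
  by (simp add: ksgn_ahom[OF ahom_single[OF single refl]] del: fsm_single)
next
 case (plus a b)
 then show ?case
  using assms by (simp add: mact_add_left lh_add[OF assms(1)] mcar_mact ksgn_add)
qed (simp add: lh_0[OF assms(1)])

lemma lh_mcar:
 assumes "h \<in> lin_hom A M N p" "finite (gens M)"
 shows "h x \<in> mcar A (gens N)"
proof (cases "x \<in> mcar A (gens M)")
 case True
 then show ?thesis
  using assms(2)
 proof (induction x rule: mcar_induct)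
  case (act k a w)
  then show ?case
   using lh_mhom[OF assms(1) mhom_mact[OF act(1) mhom_ge[OF act(2) refl] refl] refl] mhom_mcar by blast
 qed (auto simp: lh_0[OF assms(1)] lh_add[OF assms(1)] mcar_add)
qed (simp add: lh_outside[OF assms(1)])

lemma alin_apply: "x \<in> mcar A W \<Longrightarrow> alin A W p \<phi> x = (\<Sum>w\<in>W. mact A (ksgn A p (x w)) (\<phi> w))"
 by (simp add: alin_def)

lemma alin_ge:
 assumes "finite W" "w \<in> W" "\<phi> w \<in> mcar A W'"
 shows "alin A W p \<phi> (ge w) = \<phi> w"
proof -
 have "alin A W p \<phi> (ge w) = (\<Sum>v\<in>W. if v = w then \<phi> w else 0)"
  unfolding alin_apply[OF mcar_ge[OF assms(2)]]
  by (intro sum.cong refl) (use assms in \<open>auto simp: ge_def mact_1\<close>)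
 with assms show ?thesis by simp
qed

lemma alin_lin_hom:
 fixes \<phi> :: "gen \<Rightarrow> 'k::field mel"
 assumes "finite (gens M)" and \<phi>: "\<And>w. w \<in> gens M \<Longrightarrow> \<phi> w \<in> mhom A N (gdeg M w + p)"
  and W: "W = gens M"
 shows "alin A W p \<phi> \<in> lin_hom A M N p"
 unfolding lin_hom_def mem_Collect_eq W
proof (intro conjI allI impI ballI)
 fix x y :: "'k mel" assume "x \<in> mcar A (gens M)" "y \<in> mcar A (gens M)"
 then show "alin A (gens M) p \<phi> (x + y) = alin A (gens M) p \<phi> x + alin A (gens M) p \<phi> y"
  by (simp add: alin_apply mcar_add fapp ksgn_add mact_add_left sum.distrib)
next
 fix c and x :: "'k mel" assume "x \<in> mcar A (gens M)"
 then show "alin A (gens M) p \<phi> (msc c x) = msc c (alin A (gens M) p \<phi> x)"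
  by (simp add: alin_apply mcar_msc, simp add: msc_sum, simp add: msc_apply ksgn_fsm)
next
 fix k and x :: "'k mel" assume x: "x \<in> mhom A M k"
 have "mact A (ksgn A p (x w)) (\<phi> w) \<in> mhom A N (k + p)" if "w \<in> gens M" for w
  by (rule mhom_mact[OF _ \<phi>[OF that], of _ "k - gdeg M w"]) (use x that in \<open>auto simp: mhom_def\<close>)
 then show "alin A (gens M) p \<phi> x \<in> mhom A N (k + p)"
  by (auto simp: alin_apply mhom_mcar[OF x] intro!: mhom_sum)
next
 fix k and a :: "'k fga" and x :: "'k mel" assume "a \<in> ahom A k" "x \<in> mcar A (gens M)"
 then show "alin A (gens M) p \<phi> (mact A a x) = msc (sg (p * k)) (mact A a (alin A (gens M) p \<phi> x))"
  by (simp add: alin_apply mcar_mact, simp add: mact_sum msc_sum)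
    (simp add: mact_apply ksgn_amul ksgn_ahom amul_fsm_left)
qed (simp add: alin_def)

text \<open>Values on the generators determine a map that is linear up to Koszul sign. Only the
  parities of the two degrees enter and the targets may differ, so that the two sides of an identity
  can be typed separately. Nearly all identities between maps below are proved this way.\<close>

lemma lin_hom_eqI:
 assumes "h \<in> lin_hom A M N p" "k \<in> lin_hom A M N' q" "finite (gens M)" "even p \<longleftrightarrow> even q"
  and "\<And>w. w \<in> gens M \<Longrightarrow> h (ge w) = k (ge w)"
 shows "h = k"
proof (rule ext)
 fix x
 show "h x = k x"
 proof (cases "x \<in> mcar A (gens M)")
  case True
  then show ?thesis
   using assms(3)
  proof (induction x rule: mcar_induct)
   case (act l a w)
   have "sg (p * l) = (sg (q * l) :: 'a)"
    using assms(4) by (intro sg_eqI) auto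
   with act show ?case
    by (simp add: lh_mact[OF assms(1)] lh_mact[OF assms(2)] mcar_ge assms(5))
  qed (simp_all add: lh_0[OF assms(1)] lh_0[OF assms(2)] lh_add[OF assms(1)] lh_add[OF assms(2)])
 qed (simp add: lh_outside[OF assms(1)] lh_outside[OF assms(2)])
qed

lemma lin_hom_comp:
 assumes "h' \<in> lin_hom A N L q" "h \<in> lin_hom A M N p" "finite (gens M)" "r = p + q"
 shows "(\<lambda>x. h' (h x)) \<in> lin_hom A M L r"
proof -
 note c = lh_mcar[OF assms(2,3)]
 have s: "sg (p * k) * sg (q * k) = (sg (r * k) :: 'a)" for k
  unfolding sg_add[symmetric] by (rule sg_eqI) (auto simp: assms(4))
 show ?thesis
  unfolding lin_hom_def mem_Collect_eq
  by (auto simp: lh_outside[OF assms(2)] lh_0[OF assms(1)] lh_add[OF assms(2)] lh_add[OF assms(1)] c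
    lh_msc[OF assms(2)] lh_msc[OF assms(1)] mcar_mact lh_mact[OF assms(2)] lh_mact[OF assms(1)] s
    assms(4) intro!: lh_mhom[OF assms(1)] lh_mhom[OF assms(2)])
qed

lemma lin_hom_0[simp]: "0 \<in> lin_hom A M N p"
 by (simp add: lin_hom_def fapp)

lemma lin_hom_0'[simp]: "(\<lambda>x. 0) \<in> lin_hom A M N p"
 by (simp add: lin_hom_def)

lemma lin_hom_add: "h \<in> lin_hom A M N p \<Longrightarrow> k \<in> lin_hom A M N p \<Longrightarrow> h + k \<in> lin_hom A M N p"
 unfolding lin_hom_def by (simp add: fapp msc_add mact_add mhom_add)

lemma lin_hom_uminus: "h \<in> lin_hom A M N p \<Longrightarrow> - h \<in> lin_hom A M N p"
 unfolding lin_hom_def by (simp add: fapp msc_uminus mact_uminus mhom_uminus)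

lemma lin_hom_diff: "h \<in> lin_hom A M N p \<Longrightarrow> k \<in> lin_hom A M N p \<Longrightarrow> h - k \<in> lin_hom A M N p"
 unfolding lin_hom_def by (simp add: fapp msc_diff mact_diff mhom_diff)

lemma lin_hom_fsc: "h \<in> lin_hom A M N p \<Longrightarrow> fsc c h \<in> lin_hom A M N p"
 unfolding lin_hom_def fsc_def by (simp add: msc_add mhom_msc mult.commute)

lemma lin_hom_sum: "(\<And>i. i \<in> S \<Longrightarrow> f i \<in> lin_hom A M N p) \<Longrightarrow> sum f S \<in> lin_hom A M N p"
 by (induction S rule: infinite_finite_induct) (auto intro: lin_hom_add)

lemma lin_hom_mid: "mid A M \<in> lin_hom A M M 0"
 unfolding lin_hom_def mid_def by (auto simp: mcar_add mcar_msc mcar_mact mhom_mcar)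

definition mo :: "'z gvars_scheme \<Rightarrow> 'k::field fga \<Rightarrow> 'k mmap \<Rightarrow> 'k mmap" where
 "mo A a h = (\<lambda>x. mact A a (h x))"

lemma lin_hom_mo:
 assumes "a \<in> ahom A r" "h \<in> lin_hom A M N p" "q = r + p"
 shows "mo A a h \<in> lin_hom A M N q"
proof -
 have c: "amul A a b = fsm (sg (r * k)) (amul A b a)" if "b \<in> ahom A k" for b k
  using amul_commute_hom[OF assms(1) that] .
 have s: "sg (p * k) * sg (r * k) = (sg (q * k) :: 'a)" for k
  unfolding sg_add[symmetric] by (rule sg_eqI) (auto simp: assms(3))
 show ?thesis
  unfolding lin_hom_def mem_Collect_eq mo_def
  by (auto simp: lh_outside[OF assms(2)] lh_add[OF assms(2)] mact_add
    lh_msc[OF assms(2)] lh_mact[OF assms(2)] c s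
    assms(3) intro!: lh_mhom[OF assms(2)] mhom_mact[OF assms(1)])
qed

lemma fsc_simps[simp]:
 "fsc c 0 = 0" "fsc 0 h = 0" "fsc 1 h = h" "fsc c (fsc d h) = fsc (c * d) h"
 by (auto simp: fsc_def fun_eq_iff fapp)

lemma fsc_add: "fsc c (h + k) = fsc c h + fsc c k"
 by (auto simp: fsc_def fun_eq_iff fapp msc_add)

lemma fsc_diff: "fsc c (h - k) = fsc c h - fsc c k"
 by (auto simp: fsc_def fun_eq_iff fapp msc_diff)

lemma fsc_uminus: "fsc c (- h) = - fsc c h"
 by (auto simp: fsc_def fun_eq_iff fapp msc_uminus)

lemma fsc_uminus_left: "fsc (- c) h = - fsc c h"
 by (auto simp: fsc_def fun_eq_iff fapp msc_uminus_left)

lemma fsc_add_left: "fsc (c + d) h = fsc c h + fsc d h"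
 by (auto simp: fsc_def fun_eq_iff fapp msc_add_left)

lemma fsc_sum: "fsc c (sum f S) = (\<Sum>i\<in>S. fsc c (f i))"
 by (induction S rule: infinite_finite_induct) (auto simp: fsc_add)

lemma fsc_apply: "fsc c h x = msc c (h x)"
 by (simp add: fsc_def)

lemma mo_simps[simp]:
 "mo A a 0 = 0" "mo A 0 h = 0" "mo A a (fsc c h) = fsc c (mo A a h)"
 "mo A (fsm c a) h = fsc c (mo A a h)" "mo A a (mo A b h) = mo A (amul A a b) h"
 by (auto simp: mo_def fun_eq_iff fapp fsc_def)

lemma mo_add: "mo A a (h + k) = mo A a h + mo A a k"
 by (auto simp: mo_def fun_eq_iff fapp mact_add)

lemma mo_diff: "mo A a (h - k) = mo A a h - mo A a k"
 by (auto simp: mo_def fun_eq_iff fapp mact_diff)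

lemma mo_add_left: "mo A (a + b) h = mo A a h + mo A b h"
 by (auto simp: mo_def fun_eq_iff fapp mact_add_left)

lemma mo_sum: "mo A a (sum f S) = (\<Sum>i\<in>S. mo A a (f i))"
 by (induction S rule: infinite_finite_induct) (auto simp: mo_add)

lemma mo_sum_left: "mo A (sum f S) h = (\<Sum>i\<in>S. mo A (f i) h)"
 by (induction S rule: infinite_finite_induct) (auto simp: mo_add_left)

subsection \<open>Differentials\<close>

text \<open>The axioms of \<open>is_sfmod\<close> behind the Leibniz computations. They pass to
  \<open>mtens\<close> by a check on generators, whereas d^2 = 0 enters separately, for the given
  objects, in \<open>DD_XX\<close>.\<close>

definition dmod :: "'k::field cdga \<Rightarrow> 'k sfmod \<Rightarrow> bool" where
 "dmod A M \<longleftrightarrow> finite (gens M) \<and>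
   (\<forall>x. x \<notin> mcar A (gens M) \<longrightarrow> mdiff M x = 0) \<and>
   (\<forall>x\<in>mcar A (gens M). \<forall>y\<in>mcar A (gens M). mdiff M (x + y) = mdiff M x + mdiff M y) \<and>
   (\<forall>c. \<forall>x\<in>mcar A (gens M). mdiff M (msc c x) = msc c (mdiff M x)) \<and>
   (\<forall>k. \<forall>x\<in>mhom A M k. mdiff M x \<in> mhom A M (k + 1)) \<and>
   (\<forall>k. \<forall>a\<in>ahom A k. \<forall>x\<in>mcar A (gens M).
    mdiff M (mact A a x) = mact A (adiff A a) x + msc (sg k) (mact A a (mdiff M x)))"

lemma is_sfmod_dmod: "is_sfmod A M \<Longrightarrow> dmod A M"
 by (simp add: is_sfmod_def dmod_def)

lemma is_sfmod_square: "is_sfmod A M \<Longrightarrow> x \<in> mcar A (gens M) \<Longrightarrow> mdiff M (mdiff M x) = 0"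
 by (simp add: is_sfmod_def)

lemma dmodD:
 assumes "dmod A M"
 shows dm_finite: "finite (gens M)"
  and dm_outside: "x \<notin> mcar A (gens M) \<Longrightarrow> mdiff M x = 0"
  and dm_add: "x \<in> mcar A (gens M) \<Longrightarrow> y \<in> mcar A (gens M) \<Longrightarrow> mdiff M (x + y) = mdiff M x + mdiff M y"
  and dm_msc: "x \<in> mcar A (gens M) \<Longrightarrow> mdiff M (msc c x) = msc c (mdiff M x)"
  and dm_mhom: "x \<in> mhom A M k \<Longrightarrow> r = k + 1 \<Longrightarrow> mdiff M x \<in> mhom A M r"
  and dm_mact: "a \<in> ahom A k \<Longrightarrow> x \<in> mcar A (gens M) \<Longrightarrow>
   mdiff M (mact A a x) = mact A (adiff A a) x + msc (sg k) (mact A a (mdiff M x))"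
 using assms by (auto simp: dmod_def)

lemma dm_0: "dmod A M \<Longrightarrow> mdiff M 0 = 0"
 using dm_msc[of A M 0 0] by simp

lemma dm_uminus: "dmod A M \<Longrightarrow> x \<in> mcar A (gens M) \<Longrightarrow> mdiff M (- x) = - mdiff M x"
 using dm_msc[of A M x "- 1"] by (simp add: msc_uminus_left)

lemma dm_diff: "dmod A M \<Longrightarrow> x \<in> mcar A (gens M) \<Longrightarrow> y \<in> mcar A (gens M) \<Longrightarrow>
  mdiff M (x - y) = mdiff M x - mdiff M y"
 using dm_add[of A M x "- y"] by (simp add: dm_uminus mcar_uminus)

lemma dm_sum: "dmod A M \<Longrightarrow> (\<And>i. i \<in> S \<Longrightarrow> f i \<in> mcar A (gens M)) \<Longrightarrow>
  mdiff M (sum f S) = (\<Sum>i\<in>S. mdiff M (f i))"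
 by (induction S rule: infinite_finite_induct) (auto simp: dm_0 dm_add mcar_sum)

lemma dm_mcar:
 assumes "dmod A M"
 shows "mdiff M x \<in> mcar A (gens M)"
proof (cases "x \<in> mcar A (gens M)")
 case True
 then show ?thesis
  using dm_finite[OF assms]
 proof (induction x rule: mcar_induct)
  case (act k a w)
  then show ?case
   using dm_mhom[OF assms mhom_mact[OF act(1) mhom_ge[OF act(2) refl] refl] refl] mhom_mcar by blast
 qed (auto simp: dm_0[OF assms] dm_add[OF assms] mcar_add)
qed (simp add: dm_outside[OF assms])

lemma hdiff_lin_hom:
 fixes A :: "'k::field cdga"
 assumes dA: "adiff A \<in> der A 1" and M: "dmod A M" and N: "dmod A N"
  and h: "h \<in> lin_hom A M N p" and q: "q = p + 1"
 shows "hdiff M N p h \<in> lin_hom A M N q"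
proof -
 note c = lh_mcar[OF h dm_finite[OF M]] dm_mcar[OF M] dm_mcar[OF N]
 show ?thesis
  unfolding lin_hom_def mem_Collect_eq hdiff_def
 proof (intro conjI allI impI ballI)
  fix k and a :: "'k fga" and x :: "'k mel" assume a: "a \<in> ahom A k" and x: "x \<in> mcar A (gens M)"
  have da: "h (mact A (adiff A a) x) = msc (sg (p * (k + 1))) (mact A (adiff A a) (h x))"
   using lh_mact[OF h der_ahom[OF dA a refl] x] .
  have s: "sg p * sg (p * (k + 1)) = (sg (p * k) :: 'k)" "sg (p * k) * sg k = (sg (q * k) :: 'k)"
   "sg p * (sg k * sg (p * k)) = (sg (q * k) * sg p :: 'k)"
   unfolding sg_add[symmetric] by (rule sg_eqI; auto simp: q)+
  show "mdiff N (h (mact A a x)) - msc (sg p) (h (mdiff M (mact A a x))) =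
    msc (sg (q * k)) (mact A a (mdiff N (h x) - msc (sg p) (h (mdiff M x))))"
   using x by (simp add: dm_mact[OF M a] dm_mact[OF N a] lh_mact[OF h a] lh_add[OF h] lh_msc[OF h]
     mcar_mact mcar_msc c dm_msc[OF N] msc_add msc_diff mact_diff s da mult.assoc)
 qed (auto simp: lh_outside[OF h] dm_outside[OF M] lh_0[OF h] dm_0[OF N] lh_add[OF h] dm_add[OF M]
   dm_add[OF N] c msc_add lh_msc[OF h] dm_msc[OF M] dm_msc[OF N] msc_diff mult.commute q
   intro!: mhom_diff mhom_msc lh_mhom[OF h] dm_mhom[OF M] dm_mhom[OF N])
qed

lemma hdiff_0[simp]: "dmod A N \<Longrightarrow> hdiff M N p 0 = 0"
 by (auto simp: hdiff_def dm_0 fun_eq_iff fapp)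

lemma hdiff_add:
 assumes "dmod A M" "dmod A N" "h \<in> lin_hom A M N p" "k \<in> lin_hom A M N p"
 shows "hdiff M N q (h + k) = hdiff M N q h + hdiff M N q k"
 using assms by (auto simp: hdiff_def fun_eq_iff fapp msc_add dm_add dm_finite lh_mcar)

lemma hdiff_diff:
 assumes "dmod A M" "dmod A N" "h \<in> lin_hom A M N p" "k \<in> lin_hom A M N p"
 shows "hdiff M N q (h - k) = hdiff M N q h - hdiff M N q k"
 using assms by (auto simp: hdiff_def fun_eq_iff fapp msc_diff dm_diff dm_finite lh_mcar)

lemma hdiff_fsc:
 assumes "dmod A M" "dmod A N" "h \<in> lin_hom A M N p"
 shows "hdiff M N q (fsc c h) = fsc c (hdiff M N q h)"
 using assms by (auto simp: hdiff_def fun_eq_iff fapp fsc_def msc_diff dm_msc dm_finite lh_mcar mult.commute)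

lemma hdiff_sum:
 assumes "dmod A M" "dmod A N" "\<And>i. i \<in> S \<Longrightarrow> f i \<in> lin_hom A M N p"
 shows "hdiff M N q (sum f S) = (\<Sum>i\<in>S. hdiff M N q (f i))"
 using assms(3)
proof (induction S rule: infinite_finite_induct)
 case (insert x F)
 then show ?case
  using hdiff_add[OF assms(1,2), of "f x" p "sum f F" q] by (simp add: lin_hom_sum)
qed (simp_all add: hdiff_0[OF assms(2)])

lemma hdiff_comp:
 fixes A :: "'k::field cdga"
 assumes "dmod A M" "dmod A N" "h' \<in> lin_hom A N L q" "h \<in> lin_hom A M N p" "r = p + q"
 shows "hdiff M L r (\<lambda>x. h' (h x)) =
  (\<lambda>x. hdiff N L q h' (h x)) + fsc (sg q) (\<lambda>x. h' (hdiff M N p h x))"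
proof (rule ext)
 fix x
 have s: "sg q * (sg p :: 'k) = sg r"
  unfolding sg_add[symmetric] by (rule sg_eqI) (auto simp: assms(5))
 show "hdiff M L r (\<lambda>x. h' (h x)) x = ((\<lambda>x. hdiff N L q h' (h x)) + fsc (sg q) (\<lambda>x. h' (hdiff M N p h x))) x"
  using lh_mcar[OF assms(4) dm_finite[OF assms(1)]] dm_mcar[OF assms(2)]
  by (simp add: fapp hdiff_def fsc_def lh_diff[OF assms(3)] lh_msc[OF assms(3)] mcar_msc msc_diff s)
qed

lemma hdiff_mo:
 fixes A :: "'k::field cdga"
 assumes "dmod A M" "dmod A N" "h \<in> lin_hom A M N p" "a \<in> ahom A r" "q = r + p"
 shows "hdiff M N q (mo A a h) = mo A (adiff A a) h + fsc (sg r) (mo A a (hdiff M N p h))"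
proof (rule ext)
 fix x
 have s: "sg r * (sg p :: 'k) = sg q"
  unfolding sg_add[symmetric] by (rule sg_eqI) (auto simp: assms(5))
 show "hdiff M N q (mo A a h) x = (mo A (adiff A a) h + fsc (sg r) (mo A a (hdiff M N p h))) x"
  using lh_mcar[OF assms(3) dm_finite[OF assms(1)]]
  by (simp add: fapp hdiff_def fsc_def mo_def dm_mact[OF assms(2,4)] mact_diff msc_diff s)
qed

subsection \<open>Relative tensor products\<close>

lemma gens_mtens: "gens (mtens A M N) = (\<lambda>(v, w). GPair v w) ` (gens M \<times> gens N)"
 by (simp add: mtens_def Let_def)

lemma GPair_gens_mtens[simp]: "GPair v w \<in> gens (mtens A M N) \<longleftrightarrow> v \<in> gens M \<and> w \<in> gens N"
 by (auto simp: gens_mtens)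

lemma gens_mtensE:
 assumes "g \<in> gens (mtens A M N)"
 obtains v w where "g = GPair v w" "v \<in> gens M" "w \<in> gens N"
 using assms by (auto simp: gens_mtens)

lemma gdeg_mtens[simp]: "gdeg (mtens A M N) (GPair v w) = gdeg M v + gdeg N w"
 by (simp add: mtens_def Let_def)

lemma finite_gens_mtens: "finite (gens M) \<Longrightarrow> finite (gens N) \<Longrightarrow> finite (gens (mtens A M N))"
 by (simp add: gens_mtens)

lemma tel_add_left: "tel A dg (x + x') y = tel A dg x y + tel A dg x' y"
 by (auto simp: tel_def fun_eq_iff fapp amul_add_left split: gen.split)

lemma tel_add_right: "tel A dg x (y + y') = tel A dg x y + tel A dg x y'"
 by (auto simp: tel_def fun_eq_iff fapp amul_add_right ksgn_add split: gen.split)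

lemma tel_simps[simp]:
 "tel A dg 0 y = 0" "tel A dg x 0 = 0"
 "tel A dg (msc c x) y = msc c (tel A dg x y)" "tel A dg x (msc c y) = msc c (tel A dg x y)"
 "tel A dg (mact A a x) y = mact A a (tel A dg x y)"
 by (auto simp: tel_def fun_eq_iff fapp msc_def mact_def ksgn_fsm amul_fsm_left amul_fsm_right amul_assoc
   split: gen.split)

lemma tel_uminus_left: "tel A dg (- x) y = - tel A dg x y"
 by (auto simp: tel_def fun_eq_iff fapp amul_uminus_left split: gen.split)

lemma tel_uminus_right: "tel A dg x (- y) = - tel A dg x y"
 by (auto simp: tel_def fun_eq_iff fapp amul_uminus_right ksgn_uminus split: gen.split)

lemma tel_diff_left: "tel A dg (x - x') y = tel A dg x y - tel A dg x' y"
 by (auto simp: tel_def fun_eq_iff fapp amul_diff_left split: gen.split)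

lemma tel_diff_right: "tel A dg x (y - y') = tel A dg x y - tel A dg x y'"
 by (auto simp: tel_def fun_eq_iff fapp amul_diff_right ksgn_diff split: gen.split)

lemma tel_sum_left: "tel A dg (sum f S) y = (\<Sum>i\<in>S. tel A dg (f i) y)"
 by (induction S rule: infinite_finite_induct) (auto simp: tel_add_left)

lemma tel_sum_right: "tel A dg x (sum f S) = (\<Sum>i\<in>S. tel A dg x (f i))"
 by (induction S rule: infinite_finite_induct) (auto simp: tel_add_right)

lemma mact_diff_left: "mact A (a - b) x = mact A a x - mact A b x"
 by (auto simp: mact_def fun_eq_iff fapp amul_diff_left)

lemmas mod_distrib = msc_add msc_diff msc_uminus msc_uminus_left mact_add mact_diff mact_uminus
 mact_add_left mact_diff_left mact_uminus_left tel_add_left tel_add_right tel_diff_left tel_diff_right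
 tel_uminus_left tel_uminus_right

lemma tel_ge[simp]: "tel A dg (ge v) (ge w) = (ge (GPair v w) :: 'k::field mel)"
 by (auto simp: tel_def fun_eq_iff fapp ge_def amul_1_left split: gen.split)

text \<open>The coefficient b passes the whole element x. In coordinates its sign has two sources,
  the generator v inside \<open>tel\<close> and the coefficient of x at v, and their degrees add up
  to that of x.\<close>

lemma tel_mact_right:
 fixes x y :: "'k::field mel"
 assumes x: "x \<in> mhom A M j" and b: "b \<in> ahom A l"
 shows "tel A (gdeg M) x (mact A b y) = msc (sg (j * l)) (mact A b (tel A (gdeg M) x y))"
proof (rule ext)
 fix g
 show "tel A (gdeg M) x (mact A b y) g = msc (sg (j * l)) (mact A b (tel A (gdeg M) x y)) g"
 proof (cases g)
  case (GPair v w)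
  show ?thesis
  proof (cases "v \<in> gens M")
   case True
   then have "x v \<in> ahom A (j - gdeg M v)"
    using x by (simp add: mhom_def)
   note c = amul_commute_hom[OF this b]
   have s: "sg (gdeg M v * l) * sg ((j - gdeg M v) * l) = (sg (j * l) :: 'k)"
    unfolding sg_add[symmetric] by (rule sg_eqI) auto
   show ?thesis
    by (simp add: GPair tel_def mact_def msc_def ksgn_amul ksgn_ahom[OF b] amul_fsm_left
      amul_fsm_right amul_assoc[symmetric] c s)
  next
   case False
   then have "x v = 0" using x by (simp add: mhom_def mcar_def)
   then show ?thesis by (simp add: GPair tel_def mact_def msc_def)
  qed
 qed (simp add: tel_def mact_def msc_def)
qed

lemma tel_mcar:
 fixes A :: "'k::field cdga"
 shows "x \<in> mcar A (gens M) \<Longrightarrow> y \<in> mcar A (gens N) \<Longrightarrow> tel A dg x y \<in> mcar A (gens (mtens A M N))"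
 by (auto simp: mcar_def tel_def split: gen.split)

lemma tel_mhom:
 fixes A :: "'k::field cdga"
 assumes "x \<in> mhom A M j" "y \<in> mhom A N k" "l = j + k"
 shows "tel A (gdeg M) x y \<in> mhom A (mtens A M N) l"
proof -
 have "amul A (x v) (ksgn A (gdeg M v) (y w)) \<in> ahom A (l - (gdeg M v + gdeg N w))"
  if "v \<in> gens M" "w \<in> gens N" for v w
  by (rule ahom_amul[of _ _ "j - gdeg M v" _ "k - gdeg N w"])
    (use assms that in \<open>auto simp: mhom_def\<close>)
 then show ?thesis
  using tel_mcar[OF mhom_mcar[OF assms(1)] mhom_mcar[OF assms(2)]]
  by (auto simp: mhom_def tel_def elim!: gens_mtensE)
qed

lemma tel_act:
 fixes a b :: "'k::field fga" and M :: "'k sfmod"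
 assumes "v \<in> gens M" "b \<in> ahom A l"
 shows "tel A (gdeg M) (mact A a (ge v)) (mact A b (ge w)) =
  msc (sg (gdeg M v * l)) (mact A (amul A a b) (ge (GPair v w)))"
 by (simp add: tel_mact_right[OF mhom_ge[OF assms(1) refl] assms(2)])

text \<open>Everything is inherited coefficientwise from the derivation d_A; the values on
  generators contribute only their degree. The sum in \<open>dlin\<close> is the Leibniz rule for
  the decomposition of x along the generators.\<close>

lemma dlin_dmod:
 fixes A :: "'k::field cdga"
 assumes dA: "adiff A \<in> der A 1" and fin: "finite (gens M)" and d: "mdiff M = dlin A (gens M) \<phi>"
  and \<phi>: "\<And>w. w \<in> gens M \<Longrightarrow> \<phi> w \<in> mhom A M (gdeg M w + 1)"
 shows "dmod A M"
 unfolding dmod_def d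
proof (intro conjI allI impI ballI)
 show "finite (gens M)" by (rule fin)
next
 fix x :: "'k mel" assume "x \<notin> mcar A (gens M)"
 then show "dlin A (gens M) \<phi> x = 0" by (simp add: dlin_def)
next
 fix x y :: "'k mel" assume x: "x \<in> mcar A (gens M)" and y: "y \<in> mcar A (gens M)"
 then have "x w \<in> acar A" "y w \<in> acar A" for w by (auto simp: mcar_def)
 then show "dlin A (gens M) \<phi> (x + y) = dlin A (gens M) \<phi> x + dlin A (gens M) \<phi> y"
  using x y by (simp add: dlin_def mcar_add fapp der_add[OF dA] ksgn_add mact_add_left sum.distrib)
next
 fix c and x :: "'k mel" assume x: "x \<in> mcar A (gens M)"
 then have "x w \<in> acar A" for w by (auto simp: mcar_def)
 then show "dlin A (gens M) \<phi> (msc c x) = msc c (dlin A (gens M) \<phi> x)"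
  using x by (simp add: dlin_def mcar_msc msc_apply der_fsm[OF dA] ksgn_fsm) (simp add: msc_sum msc_add)
next
 fix k and x :: "'k mel" assume x: "x \<in> mhom A M k"
 have "mact A (adiff A (x w)) (ge w) + mact A (ksgn A 1 (x w)) (\<phi> w) \<in> mhom A M (k + 1)"
  if w: "w \<in> gens M" for w
 proof (rule mhom_add)
  have xw: "x w \<in> ahom A (k - gdeg M w)" using x w by (simp add: mhom_def)
  show "mact A (adiff A (x w)) (ge w) \<in> mhom A M (k + 1)"
   by (rule mhom_mact[OF der_ahom[OF dA xw refl] mhom_ge[OF w refl]]) simp
  show "mact A (ksgn A 1 (x w)) (\<phi> w) \<in> mhom A M (k + 1)"
   by (rule mhom_mact[OF _ \<phi>[OF w], of _ "k - gdeg M w"]) (use xw in auto)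
 qed
 then show "dlin A (gens M) \<phi> x \<in> mhom A M (k + 1)"
  by (auto simp: dlin_def mhom_mcar[OF x] intro!: mhom_sum)
next
 fix k and a :: "'k fga" and x :: "'k mel" assume a: "a \<in> ahom A k" and x: "x \<in> mcar A (gens M)"
 have xw: "x w \<in> acar A" for w using x by (auto simp: mcar_def)
 have "mact A (adiff A (mact A a x w)) (ge w) + mact A (ksgn A 1 (mact A a x w)) (\<phi> w) =
   mact A (adiff A a) (mact A (x w) (ge w)) +
   msc (sg k) (mact A a (mact A (adiff A (x w)) (ge w) + mact A (ksgn A 1 (x w)) (\<phi> w)))"
  if w: "w \<in> gens M" for w
  by (simp add: mact_apply der_amul[OF dA a xw] ksgn_amul ksgn_ahom[OF a] amul_fsm_left mact_add_left
    mact_add msc_add)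
 then have "dlin A (gens M) \<phi> (mact A a x) = mact A (adiff A a) (\<Sum>w\<in>gens M. mact A (x w) (ge w)) +
   msc (sg k) (mact A a (dlin A (gens M) \<phi> x))"
  using x unfolding dlin_def by (simp only: mcar_mact if_True mact_sum msc_sum sum.distrib[symmetric])
    (intro sum.cong refl, blast)
 then show "dlin A (gens M) \<phi> (mact A a x) =
   mact A (adiff A a) x + msc (sg k) (mact A a (dlin A (gens M) \<phi> x))"
  using mcar_decomp[OF fin x] by simp
qed

lemma dlin_ge:
 fixes A :: "'k::field cdga"
 assumes dA: "adiff A \<in> der A 1" and "finite W" "w \<in> W" "\<phi> w \<in> mcar A W'"
 shows "dlin A W \<phi> (ge w) = \<phi> w"
proof -
 have "dlin A W \<phi> (ge w) = (\<Sum>v\<in>W. if v = w then \<phi> w else 0)"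
  unfolding dlin_def if_P[OF mcar_ge[OF assms(3), of A]]
  by (intro sum.cong refl)
    (use assms in \<open>auto simp: ge_def mact_1 der_0[OF dA] der_1[OF dA]\<close>)
 with assms show ?thesis by simp
qed

context
 fixes A :: "'k::field cdga"
 assumes dA: "adiff A \<in> der A 1"
begin

lemma mtens_value:
 assumes M: "dmod A M" and N: "dmod A N" and v: "v \<in> gens M" and w: "w \<in> gens N"
 shows "tel A (gdeg M) (mdiff M (ge v)) (ge w) +
  msc (sg (gdeg M v)) (tel A (gdeg M) (ge v) (mdiff N (ge w))) \<in> mhom A (mtens A M N) (gdeg M v + gdeg N w + 1)"
proof -
 note g = mhom_ge[OF v refl, of A] mhom_ge[OF w refl, of A]
 show ?thesis
  by (rule mhom_add[OF tel_mhom[OF dm_mhom[OF M g(1) refl] g(2)]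
    mhom_msc[OF tel_mhom[OF g(1) dm_mhom[OF N g(2) refl]]]]) auto
qed

lemma mtens_dmod:
 assumes M: "dmod A M" and N: "dmod A N"
 shows "dmod A (mtens A M N)"
proof (rule dlin_dmod[OF dA])
 show "finite (gens (mtens A M N))"
  by (simp add: finite_gens_mtens dm_finite[OF M] dm_finite[OF N])
 show "mdiff (mtens A M N) = dlin A (gens (mtens A M N)) (\<lambda>g. case g of GAtom i \<Rightarrow> 0 | GPair v w \<Rightarrow>
    tel A (gdeg M) (mdiff M (ge v)) (ge w) +
    msc (sg (gdeg M v)) (tel A (gdeg M) (ge v) (mdiff N (ge w))))"
  by (simp add: mtens_def Let_def)
qed (auto elim!: gens_mtensE simp: mtens_value[OF M N])

lemma mdiff_mtens_ge:
 assumes M: "dmod A M" and N: "dmod A N" and v: "v \<in> gens M" and w: "w \<in> gens N"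
 shows "mdiff (mtens A M N) (ge (GPair v w)) = tel A (gdeg M) (mdiff M (ge v)) (ge w) +
  msc (sg (gdeg M v)) (tel A (gdeg M) (ge v) (mdiff N (ge w)))"
proof -
 have "mdiff (mtens A M N) = dlin A (gens (mtens A M N)) (\<lambda>g. case g of GAtom i \<Rightarrow> 0 | GPair v w \<Rightarrow>
    tel A (gdeg M) (mdiff M (ge v)) (ge w) +
    msc (sg (gdeg M v)) (tel A (gdeg M) (ge v) (mdiff N (ge w))))"
  by (simp add: mtens_def Let_def)
 moreover have "GPair v w \<in> gens (mtens A M N)" using v w by simp
 ultimately show ?thesis
  using dlin_ge[OF dA finite_gens_mtens[OF dm_finite[OF M] dm_finite[OF N]], of "GPair v w" A
    _ "gens (mtens A M N)"] mhom_mcar[OF mtens_value[OF M N v w]] by simp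
qed

text \<open>The differential of the tensor product is prescribed on pairs of generators only. Both
  sides are additive in x and y, which reduces the claim to multiples a v and b w; there only the
  parities of three degrees matter, and all cases are run through.\<close>

lemma mdiff_tel:
 assumes M: "dmod A M" and N: "dmod A N" and x: "x \<in> mhom A M j" and y: "y \<in> mcar A (gens N)"
 shows "mdiff (mtens A M N) (tel A (gdeg M) x y) =
  tel A (gdeg M) (mdiff M x) y + msc (sg j) (tel A (gdeg M) x (mdiff N y))"
 using x dm_finite[OF M]
proof (induction x rule: mhom_induct)
 case (act a v)
 note a = act(1) and v = act(2)
 show ?case
  using y dm_finite[OF N]
 proof (induction y rule: mcar_induct)
  case (act l b w)
  note b = act(1) and w = act(2)
  note ge = mhom_ge[OF v refl, of A]
  have g: "GPair v w \<in> gens (mtens A M N)" using v w by simp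
  have ab: "amul A a b \<in> ahom A (j - gdeg M v + l)"
   by (rule ahom_amul[OF a b refl])
  have av: "mact A a (ge v) \<in> mhom A M j" by (rule mhom_mact[OF a ge]) simp
  show ?case
   unfolding tel_act[OF v b] dm_mact[OF M a mcar_ge[OF v]] dm_mact[OF N b mcar_ge[OF w]]
   using dm_msc[OF mtens_dmod[OF M N] mcar_mact[OF mcar_ge[OF g]], of "sg (gdeg M v * l)" "amul A a b"]
    dm_mact[OF mtens_dmod[OF M N] ab mcar_ge[OF g]]
   by (cases "even j"; cases "even l"; cases "even (gdeg M v)")
     (simp_all add: mdiff_mtens_ge[OF M N v w] mod_distrib algebra_simps
     tel_mact_right[OF ge b] tel_mact_right[OF dm_mhom[OF M ge refl] b]
     tel_mact_right[OF ge der_ahom[OF dA b refl]] der_amul[OF dA a ahom_acar[OF b]] sg_def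
     fsm_uminus_left)
 qed (simp_all add: dm_0[OF N] dm_0[OF mtens_dmod[OF M N]] tel_add_right dm_add[OF N] dm_add[OF mtens_dmod[OF M N]]
   tel_mcar mcar_mact mcar_ge[OF v] msc_add algebra_simps)
qed (use y in \<open>simp_all add: dm_0[OF M] dm_0[OF mtens_dmod[OF M N]] tel_add_left dm_add[OF M]
  dm_add[OF mtens_dmod[OF M N]] tel_mcar mhom_mcar msc_add algebra_simps\<close>)

end

section \<open>Tensor products of maps\<close>

lemma tmap_lin_hom:
 assumes h: "h \<in> lin_hom A M M' p" and k: "k \<in> lin_hom A N N' q"
  and fin: "finite (gens M)" "finite (gens N)" and r: "r = p + q"
 shows "tmap A M N M' p q h k \<in> lin_hom A (mtens A M N) (mtens A M' N') r"
 unfolding tmap_def r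
proof (rule alin_lin_hom[OF finite_gens_mtens[OF fin]])
 fix g assume "g \<in> gens (mtens A M N)"
 then obtain v w where g: "g = GPair v w" "v \<in> gens M" "w \<in> gens N" by (rule gens_mtensE)
 show "(case g of GAtom i \<Rightarrow> 0 | GPair v w \<Rightarrow> msc (sg (q * gdeg M v)) (tel A (gdeg M') (h (ge v)) (k (ge w))))
   \<in> mhom A (mtens A M' N') (gdeg (mtens A M N) g + (p + q))"
  using g by (auto intro!: mhom_msc tel_mhom[OF lh_mhom[OF h mhom_ge[OF g(2) refl] refl]
     lh_mhom[OF k mhom_ge[OF g(3) refl] refl]])
qed simp

lemma tmap_ge:
 assumes h: "h \<in> lin_hom A M M' p" and k: "k \<in> lin_hom A N N' q"
  and fin: "finite (gens M)" "finite (gens N)" and v: "v \<in> gens M" and w: "w \<in> gens N"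
 shows "tmap A M N M' p q h k (ge (GPair v w)) =
  msc (sg (q * gdeg M v)) (tel A (gdeg M') (h (ge v)) (k (ge w)))"
 unfolding tmap_def
 by (subst alin_ge[OF finite_gens_mtens[OF fin]])
   (use v w in \<open>auto intro!: mcar_msc tel_mcar lh_mcar[OF h] lh_mcar[OF k] fin\<close>)

text \<open>Extends the defining formula from generators to arbitrary arguments, again by reduction
  to a v and b w. The coefficient b passes h(v) here, which accounts for the degree of h in the sign
  computation.\<close>

lemma tmap_tel:
 fixes x :: "'k::field mel"
 assumes h: "h \<in> lin_hom A M M' p" and k: "k \<in> lin_hom A N N' q"
  and fin: "finite (gens M)" "finite (gens N)"
  and x: "x \<in> mhom A M j" and y: "y \<in> mcar A (gens N)"
 shows "tmap A M N M' p q h k (tel A (gdeg M) x y) =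
  msc (sg (q * j)) (tel A (gdeg M') (h x) (k y))"
proof -
 note T = tmap_lin_hom[OF h k fin refl]
 show ?thesis
  using x fin(1)
 proof (induction x rule: mhom_induct)
  case (act a v)
  note a = act(1) and v = act(2)
  show ?case
   using y fin(2)
  proof (induction y rule: mcar_induct)
   case (act l b w)
   note b = act(1) and w = act(2)
   have g: "GPair v w \<in> gens (mtens A M N)" using v w by simp
   have ab: "amul A a b \<in> ahom A (j - gdeg M v + l)"
    by (rule ahom_amul[OF a b refl])
   have s: "sg (gdeg M v * l) * (sg ((p + q) * (j - gdeg M v + l)) * sg (q * gdeg M v)) =
     (sg (q * j) * (sg (q * l) * (sg (p * (j - gdeg M v)) * sg ((gdeg M v + p) * l))) :: 'k)"
    unfolding sg_add[symmetric] by (rule sg_eqI) auto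
   have hv: "h (ge v) \<in> mhom A M' (gdeg M v + p)"
    by (rule lh_mhom[OF h mhom_ge[OF v refl] refl])
   show ?case
    unfolding tel_act[OF v b] lh_msc[OF T mcar_mact[OF mcar_ge[OF g]]] lh_mact[OF T ab mcar_ge[OF g]]
     tmap_ge[OF h k fin v w] lh_mact[OF h a mcar_ge[OF v]] lh_mact[OF k b mcar_ge[OF w]]
    by (simp add: tel_mact_right[OF hv b] s mult.assoc)
  qed (simp_all add: lh_0[OF k] lh_0[OF T] tel_add_right lh_add[OF k] lh_add[OF T]
   tel_mcar mcar_mact mcar_ge[OF v] msc_add)
 qed (use y in \<open>simp_all add: lh_0[OF h] lh_0[OF T] tel_add_left lh_add[OF h]
  lh_add[OF T] tel_mcar mhom_mcar msc_add\<close>)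
qed

lemma mid_ge: "w \<in> gens M \<Longrightarrow> mid A M (ge w) = ge w"
 by (simp add: mid_def mcar_ge)

lemma tmap_mid:
 assumes "finite (gens M)" "finite (gens N)"
 shows "tmap A M N M 0 0 (mid A M) (mid A N) = mid A (mtens A M N)"
proof (rule lin_hom_eqI[OF tmap_lin_hom[OF lin_hom_mid lin_hom_mid assms refl] lin_hom_mid
   finite_gens_mtens[OF assms]])
 fix g assume g: "g \<in> gens (mtens A M N)"
 then obtain v w where "g = GPair v w" "v \<in> gens M" "w \<in> gens N" by (rule gens_mtensE)
 then show "tmap A M N M 0 0 (mid A M) (mid A N) (ge g) = mid A (mtens A M N) (ge g)"
  using g by (simp add: tmap_ge[OF lin_hom_mid lin_hom_mid assms] mid_ge)
qed simp

lemma alin_add_value: "alin A W p (\<lambda>w. \<phi> w + \<psi> w) = alin A W p \<phi> + alin A W p \<psi>"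
 by (rule ext) (simp add: alin_def fapp mact_add sum.distrib)

lemma tmap_add_left: "tmap A M N M' p q (h + h') k = tmap A M N M' p q h k + tmap A M N M' p q h' k"
 unfolding tmap_def alin_add_value[symmetric]
 by (intro arg_cong[where f = "alin A _ _"] ext) (auto simp: fapp tel_add_left msc_add split: gen.split)

lemma tmap_add_right: "tmap A M N M' p q h (k + k') = tmap A M N M' p q h k + tmap A M N M' p q h k'"
 unfolding tmap_def alin_add_value[symmetric]
 by (intro arg_cong[where f = "alin A _ _"] ext) (auto simp: fapp tel_add_right msc_add split: gen.split)

lemma tmap_0[simp]: "tmap A M N M' p q 0 k = 0" "tmap A M N M' p q h 0 = 0"
 using tmap_add_left[of A M N M' p q 0 0 k] tmap_add_right[of A M N M' p q h 0 0] by simp_all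

lemma tmap_0'[simp]: "tmap A M N M' p q (\<lambda>x. 0) k = 0" "tmap A M N M' p q h (\<lambda>x. 0) = 0"
 using tmap_0 by (simp_all add: zero_fun_def)

lemma tmap_uminus_left: "tmap A M N M' p q (- h) k = - tmap A M N M' p q h k"
 using tmap_add_left[of A M N M' p q h "- h" k] by (simp add: eq_neg_iff_add_eq_0 add.commute)

lemma tmap_uminus_right: "tmap A M N M' p q h (- k) = - tmap A M N M' p q h k"
 using tmap_add_right[of A M N M' p q h k "- k"] by (simp add: eq_neg_iff_add_eq_0 add.commute)

lemma tmap_diff_left: "tmap A M N M' p q (h - h') k = tmap A M N M' p q h k - tmap A M N M' p q h' k"
 using tmap_add_left[of A M N M' p q h "- h'" k] by (simp add: tmap_uminus_left)

lemma tmap_diff_right: "tmap A M N M' p q h (k - k') = tmap A M N M' p q h k - tmap A M N M' p q h k'"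
 using tmap_add_right[of A M N M' p q h k "- k'"] by (simp add: tmap_uminus_right)

lemma tmap_sum_left: "tmap A M N M' p q (sum f S) k = (\<Sum>i\<in>S. tmap A M N M' p q (f i) k)"
 by (induction S rule: infinite_finite_induct) (simp_all add: tmap_add_left)

lemma tmap_sum_right: "tmap A M N M' p q h (sum f S) = (\<Sum>i\<in>S. tmap A M N M' p q h (f i))"
 by (induction S rule: infinite_finite_induct) (simp_all add: tmap_add_right)

lemma alin_msc_value: "alin A W p (\<lambda>w. msc c (\<phi> w)) = fsc c (alin A W p \<phi>)"
 by (rule ext) (simp add: alin_def fsc_def msc_sum)

lemma tmap_fsc_left[simp]: "tmap A M N M' p q (fsc c h) k = fsc c (tmap A M N M' p q h k)"
 unfolding tmap_def alin_msc_value[symmetric]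
 by (intro arg_cong[where f = "alin A _ _"] ext) (auto simp: fsc_def mult.commute split: gen.split)

lemma tmap_fsc_right[simp]: "tmap A M N M' p q h (fsc c k) = fsc c (tmap A M N M' p q h k)"
 unfolding tmap_def alin_msc_value[symmetric]
 by (intro arg_cong[where f = "alin A _ _"] ext) (auto simp: fsc_def mult.commute split: gen.split)

lemma tmap_parity:
 fixes h k :: "'k::field mmap"
 shows "(even p \<longleftrightarrow> even p') \<Longrightarrow> (even q \<longleftrightarrow> even q') \<Longrightarrow> tmap A M N M' p q h k = tmap A M N M' p' q' h k"
proof -
 assume e: "even p \<longleftrightarrow> even p'" "even q \<longleftrightarrow> even q'"
 have a: "alin A W (p + q) \<phi> = alin A W (p' + q') \<phi>" for W and \<phi> :: "gen \<Rightarrow> 'k mel"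
 proof (rule ext)
  have "ksgn A (p + q) a = ksgn A (p' + q') a" for a :: "'k fga"
   by (rule ksgn_cong) (use e in auto)
  then show "alin A W (p + q) \<phi> x = alin A W (p' + q') \<phi> x" for x
   by (simp only: alin_def)
 qed
 have "(sg (q * j) :: 'k) = sg (q' * j)" for j
  using e by (intro sg_eqI) auto
 then show ?thesis
  unfolding tmap_def a by simp
qed

text \<open>The sign is the cost of moving \<open>k'\<close> past \<open>h\<close>.\<close>

lemma tmap_comp:
 assumes h: "h \<in> lin_hom A M M' p" and k: "k \<in> lin_hom A N N' q"
  and h': "h' \<in> lin_hom A M' M'' p'" and k': "k' \<in> lin_hom A N' N'' q'"
  and fin: "finite (gens M)" "finite (gens N)" "finite (gens M')" "finite (gens N')"
 shows "(\<lambda>x. tmap A M' N' M'' p' q' h' k' (tmap A M N M' p q h k x)) =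
  fsc (sg (q' * p)) (tmap A M N M'' (p + p') (q + q') (\<lambda>x. h' (h x)) (\<lambda>x. k' (k x)))"
proof (rule lin_hom_eqI)
 note F = finite_gens_mtens[OF fin(1,2)]
 show "finite (gens (mtens A M N))" by (rule F)
 note T = tmap_lin_hom[OF h k fin(1,2) refl] and T' = tmap_lin_hom[OF h' k' fin(3,4) refl]
 note hh = lin_hom_comp[OF h' h fin(1) refl] and kk = lin_hom_comp[OF k' k fin(2) refl]
 show "(\<lambda>x. tmap A M' N' M'' p' q' h' k' (tmap A M N M' p q h k x)) \<in>
   lin_hom A (mtens A M N) (mtens A M'' N'') (p + q + (p' + q'))"
  by (rule lin_hom_comp[OF T' T F refl])
 show "fsc (sg (q' * p)) (tmap A M N M'' (p + p') (q + q') (\<lambda>x. h' (h x)) (\<lambda>x. k' (k x)))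
   \<in> lin_hom A (mtens A M N) (mtens A M'' N'') (p + p' + (q + q'))"
  by (rule lin_hom_fsc[OF tmap_lin_hom[OF hh kk fin(1,2) refl]])
 fix g assume g: "g \<in> gens (mtens A M N)"
 then obtain v w where g: "g = GPair v w" "v \<in> gens M" "w \<in> gens N" by (rule gens_mtensE)
 note hv = lh_mhom[OF h mhom_ge[OF g(2) refl] refl]
 have s: "sg (q * gdeg M v) * sg (q' * (gdeg M v + p)) = (sg (q' * p) * sg ((q + q') * gdeg M v) :: 'a)"
  unfolding sg_add[symmetric] by (rule sg_eqI) auto
 show "tmap A M' N' M'' p' q' h' k' (tmap A M N M' p q h k (ge g)) =
   fsc (sg (q' * p)) (tmap A M N M'' (p + p') (q + q') (\<lambda>x. h' (h x)) (\<lambda>x. k' (k x))) (ge g)"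
  unfolding g(1) tmap_ge[OF h k fin(1,2) g(2,3)] fsc_apply tmap_ge[OF hh kk fin(1,2) g(2,3)]
   lh_msc[OF T' tel_mcar[OF lh_mcar[OF h fin(1)] lh_mcar[OF k fin(2)]]]
   tmap_tel[OF h' k' fin(3,4) hv lh_mcar[OF k fin(2)]]
  by (simp add: s)
qed auto

lemma mmap_apply:
 fixes h k :: "'k::field mmap"
 shows "(h + k) x = h x + k x" "(h - k) x = h x - k x" "(- h) x = - h x" "(0 :: 'k mmap) x = 0"
 by (simp_all add: fapp)

lemma mo_apply: "mo A a h x = mact A a (h x)"
 by (simp add: mo_def)

lemma tmap_mo_left:
 assumes h: "h \<in> lin_hom A M M' p" and k: "k \<in> lin_hom A N N' q" and a: "a \<in> ahom A r"
  and fin: "finite (gens M)" "finite (gens N)" and p': "p' = r + p"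
 shows "tmap A M N M' p' q (mo A a h) k = mo A a (tmap A M N M' p q h k)"
proof (rule lin_hom_eqI)
 note F = finite_gens_mtens[OF fin]
 show "finite (gens (mtens A M N))" by (rule F)
 note ah = lin_hom_mo[OF a h p']
 show "tmap A M N M' p' q (mo A a h) k \<in> lin_hom A (mtens A M N) (mtens A M' N') (p' + q)"
  by (rule tmap_lin_hom[OF ah k fin refl])
 show "mo A a (tmap A M N M' p q h k) \<in> lin_hom A (mtens A M N) (mtens A M' N') (r + (p + q))"
  by (rule lin_hom_mo[OF a tmap_lin_hom[OF h k fin refl] refl])
 fix g assume g: "g \<in> gens (mtens A M N)"
 then obtain v w where g: "g = GPair v w" "v \<in> gens M" "w \<in> gens N" by (rule gens_mtensE)
 show "tmap A M N M' p' q (mo A a h) k (ge g) = mo A a (tmap A M N M' p q h k) (ge g)"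
  unfolding g(1) tmap_ge[OF ah k fin g(2,3)] mo_apply tmap_ge[OF h k fin g(2,3)] by simp
qed (auto simp: p')

lemma tmap_mo_right:
 assumes h: "h \<in> lin_hom A M M' p" and k: "k \<in> lin_hom A N N' q" and a: "a \<in> ahom A r"
  and fin: "finite (gens M)" "finite (gens N)" and q': "q' = r + q"
 shows "tmap A M N M' p q' h (mo A a k) = fsc (sg (r * p)) (mo A a (tmap A M N M' p q h k))"
proof (rule lin_hom_eqI)
 note F = finite_gens_mtens[OF fin]
 show "finite (gens (mtens A M N))" by (rule F)
 note ak = lin_hom_mo[OF a k q']
 show "tmap A M N M' p q' h (mo A a k) \<in> lin_hom A (mtens A M N) (mtens A M' N') (p + q')"
  by (rule tmap_lin_hom[OF h ak fin refl])
 show "fsc (sg (r * p)) (mo A a (tmap A M N M' p q h k)) \<in> lin_hom A (mtens A M N) (mtens A M' N') (r + (p + q))"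
  by (rule lin_hom_fsc[OF lin_hom_mo[OF a tmap_lin_hom[OF h k fin refl] refl]])
 fix g assume g: "g \<in> gens (mtens A M N)"
 then obtain v w where g: "g = GPair v w" "v \<in> gens M" "w \<in> gens N" by (rule gens_mtensE)
 note hv = lh_mhom[OF h mhom_ge[OF g(2) refl] refl]
 have s: "sg (q' * gdeg M v) * sg ((gdeg M v + p) * r) = (sg (r * p) * sg (q * gdeg M v) :: 'a)"
  unfolding sg_add[symmetric] by (rule sg_eqI) (auto simp: q')
 show "tmap A M N M' p q' h (mo A a k) (ge g) = fsc (sg (r * p)) (mo A a (tmap A M N M' p q h k)) (ge g)"
  unfolding g(1) tmap_ge[OF h ak fin g(2,3)] fsc_apply mo_apply tmap_ge[OF h k fin g(2,3)]
   tel_mact_right[OF hv a] by (simp add: s)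
qed (auto simp: q')

lemma hdiff_tmap:
 fixes A :: "'k::field cdga"
 assumes dA: "adiff A \<in> der A 1" and h: "h \<in> lin_hom A M M' p" and k: "k \<in> lin_hom A N N' q"
  and dm: "dmod A M" "dmod A N" "dmod A M'" "dmod A N'" and r: "r = p + q" and p': "p' = p + 1" and q': "q' = q + 1"
 shows "hdiff (mtens A M N) (mtens A M' N') r (tmap A M N M' p q h k) =
  tmap A M N M' p' q (hdiff M M' p h) k + fsc (sg p) (tmap A M N M' p q' h (hdiff N N' q k))"
proof (rule lin_hom_eqI)
 note fin = dm_finite[OF dm(1)] dm_finite[OF dm(2)] dm_finite[OF dm(3)] dm_finite[OF dm(4)]
 note F = finite_gens_mtens[OF fin(1,2)]
 show "finite (gens (mtens A M N))" by (rule F)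
 note T = tmap_lin_hom[OF h k fin(1,2) r]
 note dh = hdiff_lin_hom[OF dA dm(1,3) h p'] and dk = hdiff_lin_hom[OF dA dm(2,4) k q']
 show "hdiff (mtens A M N) (mtens A M' N') r (tmap A M N M' p q h k) \<in>
   lin_hom A (mtens A M N) (mtens A M' N') (r + 1)"
  by (rule hdiff_lin_hom[OF dA mtens_dmod[OF dA dm(1,2)] mtens_dmod[OF dA dm(3,4)] T refl])
 show "tmap A M N M' p' q (hdiff M M' p h) k + fsc (sg p) (tmap A M N M' p q' h (hdiff N N' q k))
   \<in> lin_hom A (mtens A M N) (mtens A M' N') (r + 1)"
  by (intro lin_hom_add lin_hom_fsc tmap_lin_hom[OF dh k fin(1,2)] tmap_lin_hom[OF h dk fin(1,2)])
    (simp_all add: r p' q')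
 fix g assume g: "g \<in> gens (mtens A M N)"
 then obtain v w where g: "g = GPair v w" "v \<in> gens M" "w \<in> gens N" by (rule gens_mtensE)
 note gv = mhom_ge[OF g(2) refl, of A]
 note hv = lh_mhom[OF h gv refl]
 have s: "sg p * sg (q' * gdeg M v) = (sg (q * gdeg M v) * sg (gdeg M v + p) :: 'k)"
  "sg r * sg (q * (gdeg M v + 1)) = (sg (q * gdeg M v) * sg p :: 'k)"
  "sg r * (sg (gdeg M v) * sg (q * gdeg M v)) = (sg (q * gdeg M v) * (sg (gdeg M v + p) * sg q) :: 'k)"
  "sg p * (sg (q' * gdeg M v) * sg q) = (sg (q * gdeg M v) * (sg (gdeg M v + p) * sg q) :: 'k)"
  unfolding sg_add[symmetric] by (rule sg_eqI; auto simp: p' q' r)+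
 show "hdiff (mtens A M N) (mtens A M' N') r (tmap A M N M' p q h k) (ge g) =
   (tmap A M N M' p' q (hdiff M M' p h) k + fsc (sg p) (tmap A M N M' p q' h (hdiff N N' q k))) (ge g)"
  unfolding g(1) hdiff_def[of "mtens A M N"] mmap_apply fsc_apply tmap_ge[OF h k fin(1,2) g(2,3)]
   tmap_ge[OF dh k fin(1,2) g(2,3)] tmap_ge[OF h dk fin(1,2) g(2,3)]
   dm_msc[OF mtens_dmod[OF dA dm(3,4)] tel_mcar[OF lh_mcar[OF h fin(1)] lh_mcar[OF k fin(2)]]]
   mdiff_tel[OF dA dm(3,4) hv lh_mcar[OF k fin(2)]]
   mdiff_mtens_ge[OF dA dm(1,2) g(2,3)]
   lh_add[OF T tel_mcar[OF dm_mcar[OF dm(1)] mcar_ge[OF g(3)]]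
     mcar_msc[OF tel_mcar[OF mcar_ge[OF g(2)] dm_mcar[OF dm(2)]]]]
   lh_msc[OF T tel_mcar[OF mcar_ge[OF g(2)] dm_mcar[OF dm(2)]]]
   tmap_tel[OF h k fin(1,2) dm_mhom[OF dm(1) gv refl] mcar_ge[OF g(3)]]
   tmap_tel[OF h k fin(1,2) gv dm_mcar[OF dm(2)]]
  by (simp add: hdiff_def tel_diff_left tel_diff_right msc_add msc_diff s mult.assoc)
qed simp

subsection \<open>Braiding, associator and middle interchange\<close>

lemma braid_lin_hom:
 fixes A :: "'k::field cdga"
 assumes fin: "finite (gens M)" "finite (gens N)"
 shows "braid A M N \<in> lin_hom A (mtens A M N) (mtens A N M) 0"
 unfolding braid_def
 by (rule alin_lin_hom[OF finite_gens_mtens[OF fin]])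
   (auto elim!: gens_mtensE intro!: mhom_msc mhom_ge)

lemma braid_ge:
 fixes A :: "'k::field cdga"
 assumes fin: "finite (gens M)" "finite (gens N)" and vw: "v \<in> gens M" "w \<in> gens N"
 shows "braid A M N (ge (GPair v w)) = msc (sg (gdeg M v * gdeg N w)) (ge (GPair w v))"
 unfolding braid_def
 by (subst alin_ge[OF finite_gens_mtens[OF fin], where W' = "gens (mtens A N M)"])
   (use vw in \<open>auto intro!: mcar_msc mcar_ge\<close>)

text \<open>The braiding is given on generators. Graded commutativity of the coefficients extends
  the sign rule to all homogeneous elements.\<close>

lemma braid_tel:
 fixes x :: "'k::field mel"
 assumes fin: "finite (gens M)" "finite (gens N)" and x: "x \<in> mhom A M j" and y: "y \<in> mhom A N k"
 shows "braid A M N (tel A (gdeg M) x y) = msc (sg (j * k)) (tel A (gdeg N) y x)"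
proof -
 note T = braid_lin_hom[OF fin, of A]
 show ?thesis
  using x fin(1)
 proof (induction x rule: mhom_induct)
  case (act a v)
  note a = act(1) and v = act(2)
  show ?case
   using y fin(2)
  proof (induction y rule: mhom_induct)
   case (act b w)
   note b = act(1) and w = act(2)
   have g: "GPair v w \<in> gens (mtens A M N)" using v w by simp
   have ab: "amul A a b \<in> ahom A (j - gdeg M v + (k - gdeg N w))"
    by (rule ahom_amul[OF a b refl])
   show ?case
    unfolding tel_act[OF v b] tel_act[OF w a] lh_msc[OF T mcar_mact[OF mcar_ge[OF g]]] lh_mact[OF T ab mcar_ge[OF g]]
     braid_ge[OF fin v w]
    unfolding amul_commute_hom[OF a b]
    by (cases "even j"; cases "even k"; cases "even (gdeg M v)"; cases "even (gdeg N w)")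
      (simp_all add: sg_def mod_distrib fsm_uminus_left)
  qed (simp_all add: lh_0[OF T] mod_distrib lh_add[OF T] tel_mcar mcar_mact mcar_ge[OF v] mhom_mcar)
 qed (use y in \<open>simp_all add: lh_0[OF T] mod_distrib lh_add[OF T] tel_mcar mhom_mcar\<close>)
qed

text \<open>The components of \<open>asc\<close> and, next, of \<open>asc_inv\<close>, detached from
  the transformation records.\<close>

abbreviation asc1 :: "'k::field cdga \<Rightarrow> 'k sfmod \<Rightarrow> 'k sfmod \<Rightarrow> 'k sfmod \<Rightarrow> 'k mmap" where
 "asc1 A L M N \<equiv> alin A (gens (mtens A (mtens A L M) N)) 0 (\<lambda>g.
    case g of GPair (GPair u v) w \<Rightarrow> ge (GPair u (GPair v w)) | _ \<Rightarrow> 0)"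

abbreviation asc2 :: "'k::field cdga \<Rightarrow> 'k sfmod \<Rightarrow> 'k sfmod \<Rightarrow> 'k sfmod \<Rightarrow> 'k mmap" where
 "asc2 A L M N \<equiv> alin A (gens (mtens A L (mtens A M N))) 0 (\<lambda>g.
    case g of GPair u (GPair v w) \<Rightarrow> ge (GPair (GPair u v) w) | _ \<Rightarrow> 0)"

context
 fixes A :: "'k::field cdga" and L M N :: "'k sfmod"
 assumes fin: "finite (gens L)" "finite (gens M)" "finite (gens N)"
begin

lemma asc1_lin_hom: "asc1 A L M N \<in> lin_hom A (mtens A (mtens A L M) N) (mtens A L (mtens A M N)) 0"
 by (rule alin_lin_hom)
   (auto elim!: gens_mtensE intro!: mhom_ge finite_gens_mtens fin)

lemma asc2_lin_hom: "asc2 A L M N \<in> lin_hom A (mtens A L (mtens A M N)) (mtens A (mtens A L M) N) 0"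
 by (rule alin_lin_hom)
   (auto elim!: gens_mtensE intro!: mhom_ge finite_gens_mtens fin)

lemma asc1_ge:
 assumes "u \<in> gens L" "v \<in> gens M" "w \<in> gens N"
 shows "asc1 A L M N (ge (GPair (GPair u v) w)) = ge (GPair u (GPair v w))"
 by (subst alin_ge[of _ _ _ A "gens (mtens A L (mtens A M N))"])
   (use assms in \<open>auto intro!: mcar_ge finite_gens_mtens fin\<close>)

lemma asc2_ge:
 assumes "u \<in> gens L" "v \<in> gens M" "w \<in> gens N"
 shows "asc2 A L M N (ge (GPair u (GPair v w))) = ge (GPair (GPair u v) w)"
 by (subst alin_ge[of _ _ _ A "gens (mtens A (mtens A L M) N)"])
   (use assms in \<open>auto intro!: mcar_ge finite_gens_mtens fin\<close>)

lemma asc_inverse: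
 shows "z \<in> mcar A (gens (mtens A (mtens A L M) N)) \<Longrightarrow> asc2 A L M N (asc1 A L M N z) = z"
  and "z' \<in> mcar A (gens (mtens A L (mtens A M N))) \<Longrightarrow> asc1 A L M N (asc2 A L M N z') = z'"
proof -
 note T1 = asc1_lin_hom and T2 = asc2_lin_hom
 note F1 = finite_gens_mtens[OF finite_gens_mtens[OF fin(1,2)] fin(3), of A A]
 note F2 = finite_gens_mtens[OF fin(1) finite_gens_mtens[OF fin(2,3)], of A A]
 have "(\<lambda>z. asc2 A L M N (asc1 A L M N z)) = mid A (mtens A (mtens A L M) N)"
  by (rule lin_hom_eqI[OF lin_hom_comp[OF T2 T1 F1 refl] lin_hom_mid F1])
    (auto elim!: gens_mtensE simp: asc1_ge asc2_ge mid_ge)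
 then show "z \<in> mcar A (gens (mtens A (mtens A L M) N)) \<Longrightarrow> asc2 A L M N (asc1 A L M N z) = z"
  by (simp add: fun_eq_iff mid_def)
 have "(\<lambda>z. asc1 A L M N (asc2 A L M N z)) = mid A (mtens A L (mtens A M N))"
  by (rule lin_hom_eqI[OF lin_hom_comp[OF T1 T2 F2 refl] lin_hom_mid F2])
    (auto elim!: gens_mtensE simp: asc1_ge asc2_ge mid_ge)
 then show "z' \<in> mcar A (gens (mtens A L (mtens A M N))) \<Longrightarrow> asc1 A L M N (asc2 A L M N z') = z'"
  by (simp add: fun_eq_iff mid_def)
qed

text \<open>Pulling the three coefficients to the front passes the same generators for either
  bracketing, so no sign is left.\<close>

lemma asc1_tel:
 assumes x: "x \<in> mhom A L i" and y: "y \<in> mhom A M j" and z: "z \<in> mcar A (gens N)"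
 shows "asc1 A L M N (tel A (gdeg (mtens A L M)) (tel A (gdeg L) x y) z) =
  tel A (gdeg L) x (tel A (gdeg M) y z)"
proof -
 note T = asc1_lin_hom
 show ?thesis
  using x fin(1)
 proof (induction x rule: mhom_induct)
  case (act a u)
  note a = act(1) and u = act(2)
  show ?case
   using y fin(2)
  proof (induction y rule: mhom_induct)
   case (act b v)
   note b = act(1) and v = act(2)
   show ?case
    using z fin(3)
   proof (induction z rule: mcar_induct)
    case (act k c w)
    note c = act(1) and w = act(2)
    have uv: "GPair u v \<in> gens (mtens A L M)" using u v by simp
    have g: "GPair (GPair u v) w \<in> gens (mtens A (mtens A L M) N)" using u v w by simp
    have abc: "amul A (amul A a b) c \<in> ahom A (i - gdeg L u + (j - gdeg M v) + k)"
     by (rule ahom_amul[OF ahom_amul[OF a b refl] c refl])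
    have bc: "amul A b c \<in> ahom A (j - gdeg M v + k)" by (rule ahom_amul[OF b c refl])
    have s: "sg (gdeg L u * (j - gdeg M v)) * sg ((gdeg L u + gdeg M v) * k) =
     (sg (gdeg M v * k) * sg (gdeg L u * (j - gdeg M v + k)) :: 'k)"
     unfolding sg_add[symmetric] by (rule sg_eqI) auto
    show ?case
     unfolding tel_act[OF u b] tel_act[OF v c]
     unfolding tel_simps(3,4)
     unfolding tel_act[OF uv c] tel_act[OF u bc]
      lh_msc[OF T mcar_msc[OF mcar_mact[OF mcar_ge[OF g]]]] lh_msc[OF T mcar_mact[OF mcar_ge[OF g]]]
      lh_mact[OF T abc mcar_ge[OF g]] asc1_ge[OF u v w] gdeg_mtens
     by (simp add: amul_assoc s)
   qed (simp_all add: lh_0[OF T] mod_distrib lh_add[OF T] tel_mcar mcar_mact mcar_ge[OF u] mcar_ge[OF v] mhom_mcar)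
  qed (use z in \<open>simp_all add: lh_0[OF T] mod_distrib lh_add[OF T] tel_mcar mhom_mcar mcar_mact mcar_ge[OF u]\<close>)
 qed (use y z in \<open>simp_all add: lh_0[OF T] mod_distrib lh_add[OF T] tel_mcar mhom_mcar\<close>)
qed

lemma asc2_tel:
 assumes x: "x \<in> mhom A L i" and y: "y \<in> mhom A M j" and z: "z \<in> mcar A (gens N)"
 shows "asc2 A L M N (tel A (gdeg L) x (tel A (gdeg M) y z)) =
  tel A (gdeg (mtens A L M)) (tel A (gdeg L) x y) z"
 using asc1_tel[OF assms] asc_inverse(1)[of "tel A (gdeg (mtens A L M)) (tel A (gdeg L) x y) z"]
  tel_mcar[OF tel_mcar[OF mhom_mcar[OF x] mhom_mcar[OF y]] z] by metis

end

lemma gens_Om1: "gens (Om1 A) = GAtom ` {..<ngen A}"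
 by (simp add: shift1_def Om_def Om_gens_def)

lemma gdeg_Om1[simp]: "gdeg (Om1 A) (GAtom i) = zdeg A i - 1"
 by (simp add: shift1_def Om_def)

lemma finite_gens_Om1[simp]: "finite (gens (Om1 A))"
 by (simp add: gens_Om1)

lemma GAtom_Om1[simp]: "GAtom i \<in> gens (Om1 A) \<longleftrightarrow> i < ngen A"
 by (auto simp: gens_Om1)

lemma sigma_lin_hom:
 fixes A :: "'k::field cdga"
 assumes fin: "finite (gens M)" "finite (gens N)"
 shows "cmp (sigma A) (M, N) \<in> lin_hom A (mtens A (mtens A (Om1 A) M) (mtens A (Om1 A) N))
  (mtens A (mtens A (Om1 A) (Om1 A)) (mtens A M N)) 0"
 unfolding sigma_def ptrans.simps prod.case
 by (rule alin_lin_hom)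
   (auto elim!: gens_mtensE intro!: mhom_msc mhom_ge finite_gens_mtens fin)

lemma sigma_ge:
 fixes A :: "'k::field cdga"
 assumes fin: "finite (gens M)" "finite (gens N)"
  and g: "i \<in> gens (Om1 A)" "v \<in> gens M" "j \<in> gens (Om1 A)" "w \<in> gens N"
 shows "cmp (sigma A) (M, N) (ge (GPair (GPair i v) (GPair j w))) =
  msc (sg (gdeg M v * gdeg (Om1 A) j)) (ge (GPair (GPair i j) (GPair v w)))"
 unfolding sigma_def ptrans.simps prod.case
 by (subst alin_ge[of _ _ _ A "gens (mtens A (mtens A (Om1 A) (Om1 A)) (mtens A M N))"])
   (use g in \<open>auto intro!: mcar_msc mcar_ge finite_gens_mtens fin\<close>)

lemma tel_ge_act:
 fixes b :: "'k::field fga" and M :: "'k sfmod"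
 assumes "g \<in> gens M" "b \<in> ahom A l"
 shows "tel A (gdeg M) (ge g) (mact A b (ge w)) = msc (sg (gdeg M g * l)) (mact A b (ge (GPair g w)))"
 by (simp add: tel_mact_right[OF mhom_ge[OF assms(1) refl] assms(2)])

text \<open>Basis elements of Omega_A[1] in the two outer positions are enough, as the maps produced
  by \<open>EM\<close> are sums of terms of this form. The sign records that the second of them
  passes x.\<close>

lemma sigma_tel:
 fixes A :: "'k::field cdga"
 assumes fin: "finite (gens M)" "finite (gens N)"
  and ij: "i \<in> gens (Om1 A)" "i' \<in> gens (Om1 A)"
  and x: "x \<in> mhom A M j" and y: "y \<in> mcar A (gens N)"
 shows "cmp (sigma A) (M, N) (tel A (gdeg (mtens A (Om1 A) M)) (tel A (gdeg (Om1 A)) (ge i) x)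
   (tel A (gdeg (Om1 A)) (ge i') y)) =
  msc (sg (j * gdeg (Om1 A) i')) (tel A (gdeg (mtens A (Om1 A) (Om1 A))) (ge (GPair i i')) (tel A (gdeg M) x y))"
proof -
 note T = sigma_lin_hom[OF fin, of A]
 show ?thesis
  using x fin(1)
 proof (induction x rule: mhom_induct)
  case (act a v)
  note a = act(1) and v = act(2)
  show ?case
   using y fin(2)
  proof (induction y rule: mcar_induct)
   case (act l b w)
   note b = act(1) and w = act(2)
   have g: "GPair (GPair i v) (GPair i' w) \<in> gens (mtens A (mtens A (Om1 A) M) (mtens A (Om1 A) N))"
    and iv: "GPair i v \<in> gens (mtens A (Om1 A) M)"
    and ii: "GPair i i' \<in> gens (mtens A (Om1 A) (Om1 A))"
    using v w ij by simp_all
   have ab: "amul A a b \<in> ahom A (j - gdeg M v + l)"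
    by (rule ahom_amul[OF a b refl])
   show ?case
    unfolding tel_act[OF v b] tel_ge_act[OF ij(1) a] tel_ge_act[OF ij(2) b]
    unfolding tel_simps(3,4)
    unfolding tel_act[OF iv b]
     lh_msc[OF T mcar_msc[OF mcar_msc[OF mcar_mact[OF mcar_ge[OF g]]]]]
     lh_msc[OF T mcar_msc[OF mcar_mact[OF mcar_ge[OF g]]]] lh_msc[OF T mcar_mact[OF mcar_ge[OF g]]]
     lh_mact[OF T ab mcar_ge[OF g]] sigma_ge[OF fin ij(1) v ij(2) w] tel_ge_act[OF ii ab] gdeg_mtens
    by (cases "even j"; cases "even l"; cases "even (gdeg M v)"; cases "even (gdeg (Om1 A) i)";
      cases "even (gdeg (Om1 A) i')") (simp_all add: sg_def mod_distrib)
  qed (simp_all add: lh_0[OF T] mod_distrib lh_add[OF T] tel_mcar mcar_mact mcar_ge[OF v] mcar_ge[OF ij(1)]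
    mcar_ge[OF ij(2)])
 qed (use y in \<open>simp_all add: lh_0[OF T] mod_distrib lh_add[OF T] tel_mcar mhom_mcar mcar_ge[OF ij(1)]
    mcar_ge[OF ij(2)]\<close>)
qed

context
 fixes A :: "'k::field cdga" and P :: "'k fga" and M N :: "'k sfmod"
 assumes fin: "finite (gens M)" "finite (gens N)"
  and P: "\<And>i j. i < ngen A \<Longrightarrow> j < ngen A \<Longrightarrow>
   wt2_pairing A P (GAtom i) (GAtom j) \<in> ahom A (zdeg A i - 1 + (zdeg A j - 1))"
begin

lemma iota_lin_hom:
 "cmp (iota A P) (M, N) \<in> lin_hom A (mtens A (mtens A (Om1 A) (Om1 A)) (mtens A M N)) (mtens A M N) 0"
 unfolding iota_def ptrans.simps prod.case
 by (rule alin_lin_hom)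
   (auto elim!: gens_mtensE intro!: mhom_mact[OF P] mhom_ge finite_gens_mtens fin simp: gens_Om1)

lemma iota_ge:
 assumes "i < ngen A" "j < ngen A" "h \<in> gens (mtens A M N)"
 shows "cmp (iota A P) (M, N) (ge (GPair (GPair (GAtom i) (GAtom j)) h)) =
  mact A (wt2_pairing A P (GAtom i) (GAtom j)) (ge h)"
proof -
 have "finite (gens (mtens A (mtens A (Om1 A) (Om1 A)) (mtens A M N)))"
  by (intro finite_gens_mtens fin finite_gens_Om1)
 then show ?thesis
  unfolding iota_def ptrans.simps prod.case
  by (subst alin_ge[of _ _ _ A "gens (mtens A M N)"])
    (use assms in \<open>auto intro!: mcar_mact mcar_ge\<close>)
qed

text \<open>The pairing of two basis elements is an element of A of the same degree as the pair.
  Moving a coefficient of z past the pair therefore costs the same sign as commuting it with the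
  pairing.\<close>

lemma iota_tel:
 assumes ij: "i < ngen A" "j < ngen A" and z: "z \<in> mcar A (gens (mtens A M N))"
 shows "cmp (iota A P) (M, N) (tel A (gdeg (mtens A (Om1 A) (Om1 A))) (ge (GPair (GAtom i) (GAtom j))) z) =
  mact A (wt2_pairing A P (GAtom i) (GAtom j)) z"
proof -
 note T = iota_lin_hom
 show ?thesis
  using z finite_gens_mtens[OF fin]
 proof (induction z rule: mcar_induct)
  case (act k a w)
  note a = act(1) and w = act(2)
  have ii: "GPair (GAtom i) (GAtom j) \<in> gens (mtens A (Om1 A) (Om1 A))" using ij by simp
  have g: "GPair (GPair (GAtom i) (GAtom j)) w \<in> gens (mtens A (mtens A (Om1 A) (Om1 A)) (mtens A M N))"
   using ij w by simp
  show ?case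
   unfolding tel_ge_act[OF ii a] lh_msc[OF T mcar_mact[OF mcar_ge[OF g]]] lh_mact[OF T a mcar_ge[OF g]]
    iota_ge[OF ij w] mact_simps
   unfolding amul_commute_hom[OF P[OF ij] a]
   by (simp add: mult.commute)
 qed (use ij in \<open>simp_all add: lh_0[OF T] mod_distrib lh_add[OF T] tel_mcar mcar_ge\<close>)
qed

end

subsection \<open>The bilinear operation defined by a bivector\<close>

text \<open>The degree of the basis element s^{-1} d_dR z_i of Omega_A[1], denoted e_i in what
  follows.\<close>

abbreviation ed :: "'z gvars_scheme \<Rightarrow> nat \<Rightarrow> int" where
 "ed A i \<equiv> zdeg A i - 1"

text \<open>The components of a degree p map M to Omega_A[1] (x) N, x being sent to the sum of e_i
  (x) \<alpha>_i(x). \<open>EM\<close> reassembles the map from them.\<close>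

definition fam :: "'k::field cdga \<Rightarrow> 'k sfmod \<Rightarrow> 'k sfmod \<Rightarrow> int \<Rightarrow> (nat \<Rightarrow> 'k mmap) set" where
 "fam A M N p = {\<alpha>. \<forall>i<ngen A. \<alpha> i \<in> lin_hom A M N (p - ed A i)}"

definition PS :: "'k::field cdga \<Rightarrow> (nat \<Rightarrow> nat \<Rightarrow> 'k fga) \<Rightarrow> (nat \<Rightarrow> nat \<Rightarrow> 'k mel) \<Rightarrow> 'k mel" where
 "PS A Pi f = (\<Sum>i<ngen A. \<Sum>j<ngen A. mact A (Pi i j) (f i j))"

text \<open>The tensor product of the two maps given by \<alpha> and \<beta>, followed by the middle
  interchange and the contraction, written in components; this identification is
  \<open>iota_sigma\<close>. The sign p |e_j| is that of e_j passing \<alpha>; the part |e_i| |e_j|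
  of the interchange sign is put into the coefficients \<open>Pi_of\<close>.\<close>

definition TT :: "'k::field cdga \<Rightarrow> (nat \<Rightarrow> nat \<Rightarrow> 'k fga) \<Rightarrow> 'k sfmod \<Rightarrow> 'k sfmod \<Rightarrow> 'k sfmod \<Rightarrow>
  int \<Rightarrow> int \<Rightarrow> (nat \<Rightarrow> 'k mmap) \<Rightarrow> (nat \<Rightarrow> 'k mmap) \<Rightarrow> 'k mmap" where
 "TT A Pi M N M' p q \<alpha> \<beta> = (\<Sum>i<ngen A. \<Sum>j<ngen A.
   fsc (sg (p * ed A j)) (mo A (Pi i j) (tmap A M N M' (p - ed A i) (q - ed A j) (\<alpha> i) (\<beta> j))))"

lemma famD: "\<alpha> \<in> fam A M N p \<Longrightarrow> i < ngen A \<Longrightarrow> \<alpha> i \<in> lin_hom A M N (p - ed A i)"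
 by (simp add: fam_def)

lemma PS_cong:
 "(\<And>i j. i < ngen A \<Longrightarrow> j < ngen A \<Longrightarrow> f i j = g i j) \<Longrightarrow> PS A Pi f = PS A Pi g"
 by (simp add: PS_def)

lemma mcar_PS:
 "(\<And>i j. i < ngen A \<Longrightarrow> j < ngen A \<Longrightarrow> f i j \<in> mcar A W) \<Longrightarrow> PS A Pi f \<in> mcar A W"
 unfolding PS_def by (intro mcar_sum mcar_mact) auto

lemma msc_PS: "msc c (PS A Pi f) = PS A Pi (\<lambda>i j. msc c (f i j))"
 by (simp add: PS_def msc_sum)

lemma tel_PS_left: "tel A dg (PS A Pi f) y = PS A Pi (\<lambda>i j. tel A dg (f i j) y)"
 by (simp add: PS_def tel_sum_left)

lemma sum_mmap_apply:
 fixes f :: "'i \<Rightarrow> 'k::field mmap"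
 shows "(\<Sum>i\<in>I. f i) x = (\<Sum>i\<in>I. f i x)"
 by (rule sum_apply)

lemma TT_cong:
 assumes "\<And>i. i < ngen A \<Longrightarrow> \<alpha> i = \<alpha>' i" "\<And>i. i < ngen A \<Longrightarrow> \<beta> i = \<beta>' i"
 shows "TT A Pi M N M' p q \<alpha> \<beta> = TT A Pi M N M' p q \<alpha>' \<beta>'"
 unfolding TT_def using assms by simp

lemma fam_apply:
 fixes \<alpha> \<beta> :: "nat \<Rightarrow> 'k::field mmap"
 shows "(\<alpha> + \<beta>) i = \<alpha> i + \<beta> i" "(\<alpha> - \<beta>) i = \<alpha> i - \<beta> i" "(- \<alpha>) i = - \<alpha> i" "(0 :: nat \<Rightarrow> 'k mmap) i = 0"
 by (simp_all add: fapp)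

lemma TT_add_left: "TT A Pi M N M' p q (\<alpha> + \<alpha>') \<beta> = TT A Pi M N M' p q \<alpha> \<beta> + TT A Pi M N M' p q \<alpha>' \<beta>"
 by (simp add: TT_def fam_apply tmap_add_left mo_add fsc_add sum.distrib)

lemma TT_add_right: "TT A Pi M N M' p q \<alpha> (\<beta> + \<beta>') = TT A Pi M N M' p q \<alpha> \<beta> + TT A Pi M N M' p q \<alpha> \<beta>'"
 by (simp add: TT_def fam_apply tmap_add_right mo_add fsc_add sum.distrib)

lemma TT_diff_left: "TT A Pi M N M' p q (\<alpha> - \<alpha>') \<beta> = TT A Pi M N M' p q \<alpha> \<beta> - TT A Pi M N M' p q \<alpha>' \<beta>"
 by (simp add: TT_def fam_apply tmap_diff_left mo_diff fsc_diff sum_subtractf)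

lemma TT_diff_right: "TT A Pi M N M' p q \<alpha> (\<beta> - \<beta>') = TT A Pi M N M' p q \<alpha> \<beta> - TT A Pi M N M' p q \<alpha> \<beta>'"
 by (simp add: TT_def fam_apply tmap_diff_right mo_diff fsc_diff sum_subtractf)

lemma TT_fsc_left: "TT A Pi M N M' p q (\<lambda>i. fsc c (\<alpha> i)) \<beta> = fsc c (TT A Pi M N M' p q \<alpha> \<beta>)"
 by (simp add: TT_def fsc_sum mult.commute)

lemma TT_fsc_right: "TT A Pi M N M' p q \<alpha> (\<lambda>i. fsc c (\<beta> i)) = fsc c (TT A Pi M N M' p q \<alpha> \<beta>)"
 by (simp add: TT_def fsc_sum mult.commute)

lemma TT_0[simp]: "TT A Pi M N M' p q 0 \<beta> = 0" "TT A Pi M N M' p q \<alpha> 0 = 0"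
 by (simp_all add: TT_def fam_apply)

text \<open>Composition with h after the family. The sign is that of h passing e_i; composition on
  the other side, \<open>rm\<close>, passes nothing.\<close>

definition lm :: "'z gvars_scheme \<Rightarrow> int \<Rightarrow> 'k::field mmap \<Rightarrow> (nat \<Rightarrow> 'k mmap) \<Rightarrow> nat \<Rightarrow> 'k mmap" where
 "lm A p h \<alpha> = (\<lambda>i. fsc (sg (p * ed A i)) (\<lambda>x. h (\<alpha> i x)))"

definition rm :: "(nat \<Rightarrow> 'k::field mmap) \<Rightarrow> 'k mmap \<Rightarrow> nat \<Rightarrow> 'k mmap" where
 "rm \<alpha> h = (\<lambda>i x. \<alpha> i (h x))"

text \<open>The Jacobian matrix of the differential of A, through which the differential of Omega_A
  acts on d_dR z_j.\<close>

definition cc :: "'k::field cdga \<Rightarrow> nat \<Rightarrow> nat \<Rightarrow> 'k fga" where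
 "cc A i j = apar A i (adiff A (avar j))"

text \<open>The differential of the complex of maps from M to Omega_A[1] (x) N in components. The
  factor in front of \<open>hdiff\<close> is the sign of d passing e_i, and the sum comes from the
  differential of the basis elements e_j.\<close>

definition DD :: "'k::field cdga \<Rightarrow> 'k sfmod \<Rightarrow> 'k sfmod \<Rightarrow> int \<Rightarrow> (nat \<Rightarrow> 'k mmap) \<Rightarrow> nat \<Rightarrow> 'k mmap" where
 "DD A M N p \<alpha> = (\<lambda>i. fsc (sg (ed A i)) (hdiff M N (p - ed A i) (\<alpha> i)) - (\<Sum>j<ngen A. mo A (cc A i j) (\<alpha> j)))"

lemma lm_fam:
 assumes "h \<in> lin_hom A N L p" "\<alpha> \<in> fam A M N q" "finite (gens M)" "r = p + q"
 shows "lm A p h \<alpha> \<in> fam A M L r"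
 unfolding fam_def lm_def
 by (auto intro!: lin_hom_fsc lin_hom_comp[OF assms(1) famD[OF assms(2)] assms(3)] simp: assms(4))

lemma rm_fam:
 assumes "h \<in> lin_hom A M N p" "\<alpha> \<in> fam A N L q" "finite (gens M)" "r = p + q"
 shows "rm \<alpha> h \<in> fam A M L r"
 unfolding fam_def rm_def
 by (auto intro!: lin_hom_comp[OF famD[OF assms(2)] assms(1) assms(3)] simp: assms(4))

locale bivector =
 fixes A :: "'k::field cdga" and Pi :: "nat \<Rightarrow> nat \<Rightarrow> 'k fga"
 assumes Pi: "\<And>i j. i < ngen A \<Longrightarrow> j < ngen A \<Longrightarrow> Pi i j \<in> ahom A (ed A i + ed A j)"
begin

lemma lh_PS:
 assumes F: "F \<in> lin_hom A M N p" and f: "\<And>i j. i < ngen A \<Longrightarrow> j < ngen A \<Longrightarrow> f i j \<in> mcar A (gens M)"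
 shows "F (PS A Pi f) = PS A Pi (\<lambda>i j. msc (sg (p * (ed A i + ed A j))) (F (f i j)))"
proof -
 have m: "mact A (Pi i j) (f i j) \<in> mcar A (gens M)" if "i \<in> {..<ngen A}" "j \<in> {..<ngen A}" for i j
  using that by (intro mcar_mact f) auto
 have "F (PS A Pi f) = (\<Sum>i<ngen A. F (\<Sum>j<ngen A. mact A (Pi i j) (f i j)))"
  unfolding PS_def by (rule lh_sum[OF F mcar_sum[OF m]])
 also have "\<dots> = (\<Sum>i<ngen A. \<Sum>j<ngen A. F (mact A (Pi i j) (f i j)))"
  by (intro sum.cong refl lh_sum[OF F m])
 also have "\<dots> = PS A Pi (\<lambda>i j. msc (sg (p * (ed A i + ed A j))) (F (f i j)))"
  unfolding PS_def by (intro sum.cong refl) (simp add: lh_mact[OF F Pi f])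
 finally show ?thesis .
qed

lemma tel_PS_right:
 assumes x: "x \<in> mhom A M k"
 shows "tel A (gdeg M) x (PS A Pi f) = PS A Pi (\<lambda>i j. msc (sg (k * (ed A i + ed A j))) (tel A (gdeg M) x (f i j)))"
 unfolding PS_def tel_sum_right by (intro sum.cong refl) (simp add: tel_mact_right[OF x Pi])

lemma TT_lin_hom:
 assumes "\<alpha> \<in> fam A M M' p" "\<beta> \<in> fam A N N' q" "finite (gens M)" "finite (gens N)" "r = p + q"
 shows "TT A Pi M N M' p q \<alpha> \<beta> \<in> lin_hom A (mtens A M N) (mtens A M' N') r"
 unfolding TT_def
proof (intro lin_hom_sum lin_hom_fsc)
 fix i j assume ij: "i \<in> {..<ngen A}" "j \<in> {..<ngen A}"
 then have T: "tmap A M N M' (p - ed A i) (q - ed A j) (\<alpha> i) (\<beta> j) \<in> lin_hom A (mtens A M N) (mtens A M' N')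
   (p - ed A i + (q - ed A j))"
  by (intro tmap_lin_hom[OF famD[OF assms(1)] famD[OF assms(2)] assms(3,4) refl]) auto
 show "mo A (Pi i j) (tmap A M N M' (p - ed A i) (q - ed A j) (\<alpha> i) (\<beta> j)) \<in> lin_hom A (mtens A M N) (mtens A M' N') r"
  by (rule lin_hom_mo[OF Pi T]) (use ij in \<open>auto simp: assms(5)\<close>)
qed

lemma TT_tel:
 assumes \<alpha>: "\<alpha> \<in> fam A M M' p" and \<beta>: "\<beta> \<in> fam A N N' q" and fin: "finite (gens M)" "finite (gens N)"
  and x: "x \<in> mhom A M k" and y: "y \<in> mcar A (gens N)"
 shows "TT A Pi M N M' p q \<alpha> \<beta> (tel A (gdeg M) x y) =
  PS A Pi (\<lambda>i j. msc (sg (p * ed A j) * sg ((q - ed A j) * k)) (tel A (gdeg M') (\<alpha> i x) (\<beta> j y)))"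
 unfolding TT_def PS_def sum_mmap_apply
 by (intro sum.cong refl)
   (simp add: fsc_apply mo_apply tmap_tel[OF famD[OF \<alpha>] famD[OF \<beta>] fin x y])

lemma TT_ge:
 assumes \<alpha>: "\<alpha> \<in> fam A M M' p" and \<beta>: "\<beta> \<in> fam A N N' q" and fin: "finite (gens M)" "finite (gens N)"
  and v: "v \<in> gens M" and w: "w \<in> gens N"
 shows "TT A Pi M N M' p q \<alpha> \<beta> (ge (GPair v w)) =
  PS A Pi (\<lambda>i j. msc (sg (p * ed A j) * sg ((q - ed A j) * gdeg M v)) (tel A (gdeg M') (\<alpha> i (ge v)) (\<beta> j (ge w))))"
 using TT_tel[OF \<alpha> \<beta> fin mhom_ge[OF v refl] mcar_ge[OF w]] by simp

text \<open>The signs of h and k passing the basis elements are absorbed in \<open>lm\<close>. What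
  is left is k passing the whole family \<alpha>, of degree p.\<close>

lemma TT_comp_left:
 assumes \<alpha>: "\<alpha> \<in> fam A M M' p" and \<beta>: "\<beta> \<in> fam A N N' q"
  and h: "h \<in> lin_hom A M' M'' p'" and k: "k \<in> lin_hom A N' N'' q'"
  and fin: "finite (gens M)" "finite (gens N)" "finite (gens M')" "finite (gens N')"
 shows "(\<lambda>x. tmap A M' N' M'' p' q' h k (TT A Pi M N M' p q \<alpha> \<beta> x)) =
  fsc (sg (q' * p)) (TT A Pi M N M'' (p + p') (q + q') (lm A p' h \<alpha>) (lm A q' k \<beta>))"
proof (rule lin_hom_eqI)
 note F = finite_gens_mtens[OF fin(1,2)]
 note T = TT_lin_hom[OF \<alpha> \<beta> fin(1,2) refl] and H = tmap_lin_hom[OF h k fin(3,4) refl]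
 note l1 = lm_fam[OF h \<alpha> fin(1), OF add.commute[of p p']] and l2 = lm_fam[OF k \<beta> fin(2), OF add.commute[of q q']]
 show "(\<lambda>x. tmap A M' N' M'' p' q' h k (TT A Pi M N M' p q \<alpha> \<beta> x)) \<in>
   lin_hom A (mtens A M N) (mtens A M'' N'') (p + q + (p' + q'))"
  by (rule lin_hom_comp[OF H T F refl])
 show "fsc (sg (q' * p)) (TT A Pi M N M'' (p + p') (q + q') (lm A p' h \<alpha>) (lm A q' k \<beta>)) \<in>
   lin_hom A (mtens A M N) (mtens A M'' N'') (p + p' + (q + q'))"
  by (rule lin_hom_fsc[OF TT_lin_hom[OF l1 l2 fin(1,2) refl]])
 show "finite (gens (mtens A M N))" by (rule F)
 fix g assume "g \<in> gens (mtens A M N)"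
 then obtain v w where g: "g = GPair v w" "v \<in> gens M" "w \<in> gens N" by (rule gens_mtensE)
 show "tmap A M' N' M'' p' q' h k (TT A Pi M N M' p q \<alpha> \<beta> (ge g)) =
   fsc (sg (q' * p)) (TT A Pi M N M'' (p + p') (q + q') (lm A p' h \<alpha>) (lm A q' k \<beta>)) (ge g)"
  unfolding g(1) TT_ge[OF \<alpha> \<beta> fin(1,2) g(2,3)] fsc_apply TT_ge[OF l1 l2 fin(1,2) g(2,3)] msc_PS
 proof (subst lh_PS[OF H])
  fix i j assume ij: "i < ngen A" "j < ngen A"
  show "msc (sg (p * ed A j) * sg ((q - ed A j) * gdeg M v)) (tel A (gdeg M') (\<alpha> i (ge v)) (\<beta> j (ge w))) \<in>
    mcar A (gens (mtens A M' N'))"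
   using ij by (intro mcar_msc tel_mcar lh_mcar[OF famD[OF \<alpha>]] lh_mcar[OF famD[OF \<beta>]] fin)
 next
  show "PS A Pi (\<lambda>i j. msc (sg ((p' + q') * (ed A i + ed A j)))
    (tmap A M' N' M'' p' q' h k (msc (sg (p * ed A j) * sg ((q - ed A j) * gdeg M v))
      (tel A (gdeg M') (\<alpha> i (ge v)) (\<beta> j (ge w)))))) =
   PS A Pi (\<lambda>i j. msc (sg (q' * p)) (msc (sg ((p + p') * ed A j) * sg ((q + q' - ed A j) * gdeg M v))
     (tel A (gdeg M'') (lm A p' h \<alpha> i (ge v)) (lm A q' k \<beta> j (ge w)))))"
  proof (rule PS_cong)
   fix i j assume ij: "i < ngen A" "j < ngen A"
   note a = famD[OF \<alpha> ij(1)] and b = famD[OF \<beta> ij(2)]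
   note av = lh_mhom[OF a mhom_ge[OF g(2) refl] refl] and bw = lh_mcar[OF b fin(2)]
   show "msc (sg ((p' + q') * (ed A i + ed A j)))
    (tmap A M' N' M'' p' q' h k (msc (sg (p * ed A j) * sg ((q - ed A j) * gdeg M v))
      (tel A (gdeg M') (\<alpha> i (ge v)) (\<beta> j (ge w))))) =
    msc (sg (q' * p)) (msc (sg ((p + p') * ed A j) * sg ((q + q' - ed A j) * gdeg M v))
     (tel A (gdeg M'') (lm A p' h \<alpha> i (ge v)) (lm A q' k \<beta> j (ge w))))"
    unfolding lh_msc[OF H tel_mcar[OF mhom_mcar[OF av] bw]] tmap_tel[OF h k fin(3,4) av bw] lm_def fsc_apply
    unfolding tel_simps msc_simps sg_add[symmetric]
    by (rule arg_cong2[OF sg_eqI refl, of _ _ msc]) auto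
  qed
 qed
qed auto

text \<open>The remaining sign is that of the family \<beta> passing h.\<close>

lemma TT_comp_right:
 assumes \<alpha>: "\<alpha> \<in> fam A M' M'' p" and \<beta>: "\<beta> \<in> fam A N' N'' q"
  and h: "h \<in> lin_hom A M M' p'" and k: "k \<in> lin_hom A N N' q'"
  and fin: "finite (gens M)" "finite (gens N)" "finite (gens M')" "finite (gens N')"
 shows "(\<lambda>x. TT A Pi M' N' M'' p q \<alpha> \<beta> (tmap A M N M' p' q' h k x)) =
  fsc (sg (q * p')) (TT A Pi M N M'' (p + p') (q + q') (rm \<alpha> h) (rm \<beta> k))"
proof (rule lin_hom_eqI)
 note F = finite_gens_mtens[OF fin(1,2)]
 note T = TT_lin_hom[OF \<alpha> \<beta> fin(3,4) refl] and H = tmap_lin_hom[OF h k fin(1,2) refl]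
 note l1 = rm_fam[OF h \<alpha> fin(1), OF add.commute[of p p']] and l2 = rm_fam[OF k \<beta> fin(2), OF add.commute[of q q']]
 show "(\<lambda>x. TT A Pi M' N' M'' p q \<alpha> \<beta> (tmap A M N M' p' q' h k x)) \<in>
   lin_hom A (mtens A M N) (mtens A M'' N'') (p' + q' + (p + q))"
  by (rule lin_hom_comp[OF T H F refl])
 show "fsc (sg (q * p')) (TT A Pi M N M'' (p + p') (q + q') (rm \<alpha> h) (rm \<beta> k)) \<in>
   lin_hom A (mtens A M N) (mtens A M'' N'') (p + p' + (q + q'))"
  by (rule lin_hom_fsc[OF TT_lin_hom[OF l1 l2 fin(1,2) refl]])
 show "finite (gens (mtens A M N))" by (rule F)
 fix g assume "g \<in> gens (mtens A M N)"
 then obtain v w where g: "g = GPair v w" "v \<in> gens M" "w \<in> gens N" by (rule gens_mtensE)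
 note hv = lh_mhom[OF h mhom_ge[OF g(2) refl] refl] and kw = lh_mcar[OF k fin(2)]
 show "TT A Pi M' N' M'' p q \<alpha> \<beta> (tmap A M N M' p' q' h k (ge g)) =
   fsc (sg (q * p')) (TT A Pi M N M'' (p + p') (q + q') (rm \<alpha> h) (rm \<beta> k)) (ge g)"
  unfolding g(1) tmap_ge[OF h k fin(1,2) g(2,3)] lh_msc[OF T tel_mcar[OF mhom_mcar[OF hv] kw]]
   TT_tel[OF \<alpha> \<beta> fin(3,4) hv kw] fsc_apply TT_ge[OF l1 l2 fin(1,2) g(2,3)] msc_PS
 proof (rule PS_cong)
  fix i j assume ij: "i < ngen A" "j < ngen A"
  show "msc (sg (q' * gdeg M v)) (msc (sg (p * ed A j) * sg ((q - ed A j) * (gdeg M v + p')))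
    (tel A (gdeg M'') (\<alpha> i (h (ge v))) (\<beta> j (k (ge w))))) =
   msc (sg (q * p')) (msc (sg ((p + p') * ed A j) * sg ((q + q' - ed A j) * gdeg M v))
    (tel A (gdeg M'') (rm \<alpha> h i (ge v)) (rm \<beta> k j (ge w))))"
   unfolding rm_def msc_simps sg_add[symmetric]
   by (rule arg_cong2[OF sg_eqI refl, of _ _ msc]) auto
 qed
qed auto

end

lemma tmap_fam_left:
 assumes "\<alpha> \<in> fam A M M' p" "k \<in> lin_hom A N N' 0" "finite (gens M)" "finite (gens N)"
 shows "(\<lambda>i. tmap A M N M' (p - ed A i) 0 (\<alpha> i) k) \<in> fam A (mtens A M N) (mtens A M' N') p"
 using assms unfolding fam_def by (auto intro!: tmap_lin_hom)

lemma tmap_fam_right: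
 assumes "\<alpha> \<in> fam A N N' p" "k \<in> lin_hom A M M' 0" "finite (gens M)" "finite (gens N)"
 shows "(\<lambda>i. tmap A M N M' 0 (p - ed A i) k (\<alpha> i)) \<in> fam A (mtens A M N) (mtens A M' N') p"
 using assms unfolding fam_def by (auto intro!: tmap_lin_hom)

section \<open>Contraction, braiding and associators\<close>

context bivector
begin

lemma lh_PS_eq:
 assumes F: "F \<in> lin_hom A M N p" and f: "\<And>i j. i < ngen A \<Longrightarrow> j < ngen A \<Longrightarrow> f i j \<in> mcar A (gens M)"
  and g: "\<And>i j. i < ngen A \<Longrightarrow> j < ngen A \<Longrightarrow> msc (sg (p * (ed A i + ed A j))) (F (f i j)) = g i j"
 shows "F (PS A Pi f) = PS A Pi g"
 by (rule trans[OF lh_PS[OF F f] PS_cong[OF g]])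

lemma PS_swap:
 assumes sym: "\<And>i j. i < ngen A \<Longrightarrow> j < ngen A \<Longrightarrow> Pi j i = fsm (sg (ed A i * ed A j)) (Pi i j)"
 shows "PS A Pi f = PS A Pi (\<lambda>i j. msc (sg (ed A i * ed A j)) (f j i))"
proof -
 have "mact A (Pi j i) (f j i) = mact A (Pi i j) (msc (sg (ed A i * ed A j)) (f j i))"
  if "i < ngen A" "j < ngen A" for i j
  using sym[OF that] by simp
 then show ?thesis
  unfolding PS_def by (subst sum.swap) simp
qed

text \<open>The braiding exchanges the two values, and graded symmetry of the coefficients exchanges
  the indices i and j. The signs containing |e_i| or |e_j| then cancel, leaving the sign of
  interchanging two families of degrees p and q.\<close>

lemma TT_braid:
 assumes sym: "\<And>i j. i < ngen A \<Longrightarrow> j < ngen A \<Longrightarrow> Pi j i = fsm (sg (ed A i * ed A j)) (Pi i j)"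
  and \<alpha>: "\<alpha> \<in> fam A M M' p" and \<beta>: "\<beta> \<in> fam A N N' q"
  and fin: "finite (gens M)" "finite (gens N)" "finite (gens M')" "finite (gens N')"
 shows "(\<lambda>x. braid A M' N' (TT A Pi M N M' p q \<alpha> \<beta> x)) =
  fsc (sg (p * q)) (\<lambda>x. TT A Pi N M N' q p \<beta> \<alpha> (braid A M N x))"
proof (rule lin_hom_eqI)
 note F = finite_gens_mtens[OF fin(1,2)]
 note B = braid_lin_hom[OF fin(1,2), of A] and B' = braid_lin_hom[OF fin(3,4), of A]
 note T = TT_lin_hom[OF \<alpha> \<beta> fin(1,2) refl] and T' = TT_lin_hom[OF \<beta> \<alpha> fin(2,1) refl]
 show "finite (gens (mtens A M N))" by (rule F)
 show "(\<lambda>x. braid A M' N' (TT A Pi M N M' p q \<alpha> \<beta> x)) \<in> lin_hom A (mtens A M N) (mtens A N' M') (p + q)"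
  by (rule lin_hom_comp[OF B' T F]) simp
 show "fsc (sg (p * q)) (\<lambda>x. TT A Pi N M N' q p \<beta> \<alpha> (braid A M N x)) \<in>
   lin_hom A (mtens A M N) (mtens A N' M') (q + p)"
  by (rule lin_hom_fsc[OF lin_hom_comp[OF T' B F]]) simp
 fix g assume "g \<in> gens (mtens A M N)"
 then obtain v w where g: "g = GPair v w" "v \<in> gens M" "w \<in> gens N" by (rule gens_mtensE)
 have wv: "GPair w v \<in> gens (mtens A N M)" using g by simp
 note a = lh_mhom[OF famD[OF \<alpha>] mhom_ge[OF g(2) refl] refl] and b = lh_mhom[OF famD[OF \<beta>] mhom_ge[OF g(3) refl] refl]
 have "braid A M' N' (TT A Pi M N M' p q \<alpha> \<beta> (ge g)) = PS A Pi (\<lambda>i j.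
   msc (sg (p * ed A j) * sg ((q - ed A j) * gdeg M v))
    (msc (sg ((gdeg M v + (p - ed A i)) * (gdeg N w + (q - ed A j)))) (tel A (gdeg N') (\<beta> j (ge w)) (\<alpha> i (ge v)))))"
  unfolding g(1) TT_ge[OF \<alpha> \<beta> fin(1,2) g(2,3)]
 proof (rule lh_PS_eq[OF B'])
  fix i j assume ij: "i < ngen A" "j < ngen A"
  note t = tel_mcar[OF mhom_mcar[OF a[OF ij(1)]] mhom_mcar[OF b[OF ij(2)]]]
  show "msc (sg (p * ed A j) * sg ((q - ed A j) * gdeg M v)) (tel A (gdeg M') (\<alpha> i (ge v)) (\<beta> j (ge w)))
    \<in> mcar A (gens (mtens A M' N'))"
   by (rule mcar_msc[OF t])
  show "msc (sg (0 * (ed A i + ed A j))) (braid A M' N' (msc (sg (p * ed A j) * sg ((q - ed A j) * gdeg M v))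
     (tel A (gdeg M') (\<alpha> i (ge v)) (\<beta> j (ge w))))) =
   msc (sg (p * ed A j) * sg ((q - ed A j) * gdeg M v))
    (msc (sg ((gdeg M v + (p - ed A i)) * (gdeg N w + (q - ed A j)))) (tel A (gdeg N') (\<beta> j (ge w)) (\<alpha> i (ge v))))"
   unfolding lh_msc[OF B' t] braid_tel[OF fin(3,4) a[OF ij(1)] b[OF ij(2)]] by simp
 qed
 also have "\<dots> = PS A Pi (\<lambda>j i. msc (sg (ed A j * ed A i)) (msc (sg (p * ed A j) * sg ((q - ed A j) * gdeg M v))
    (msc (sg ((gdeg M v + (p - ed A i)) * (gdeg N w + (q - ed A j)))) (tel A (gdeg N') (\<beta> j (ge w)) (\<alpha> i (ge v))))))"
  by (rule PS_swap[OF sym])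
 also have "\<dots> = fsc (sg (p * q)) (\<lambda>x. TT A Pi N M N' q p \<beta> \<alpha> (braid A M N x)) (ge g)"
  unfolding g(1) fsc_apply braid_ge[OF fin(1,2) g(2,3)] lh_msc[OF T' mcar_ge[OF wv]]
   TT_ge[OF \<beta> \<alpha> fin(2,1) g(3,2)] msc_PS
 proof (rule PS_cong)
  fix j i assume ij: "j < ngen A" "i < ngen A"
  show "msc (sg (ed A j * ed A i)) (msc (sg (p * ed A j) * sg ((q - ed A j) * gdeg M v))
    (msc (sg ((gdeg M v + (p - ed A i)) * (gdeg N w + (q - ed A j)))) (tel A (gdeg N') (\<beta> j (ge w)) (\<alpha> i (ge v))))) =
   msc (sg (p * q)) (msc (sg (gdeg M v * gdeg N w)) (msc (sg (q * ed A i) * sg ((p - ed A i) * gdeg N w))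
    (tel A (gdeg N') (\<beta> j (ge w)) (\<alpha> i (ge v)))))"
   unfolding msc_simps sg_add[symmetric]
   by (rule arg_cong2[OF sg_eqI refl, of _ _ msc]) auto
 qed
 finally show "braid A M' N' (TT A Pi M N M' p q \<alpha> \<beta> (ge g)) =
   fsc (sg (p * q)) (\<lambda>x. TT A Pi N M N' q p \<beta> \<alpha> (braid A M N x)) (ge g)" .
qed auto

context
 fixes L M N L' M' N' :: "'k sfmod" and p q :: int
 assumes fin: "finite (gens L)" "finite (gens M)" "finite (gens N)"
  "finite (gens L')" "finite (gens M')" "finite (gens N')"
begin

lemma asc_conj_lin_hom:
 assumes "T \<in> lin_hom A (mtens A L (mtens A M N)) (mtens A L' (mtens A M' N')) r"
 shows "(\<lambda>x. asc2 A L' M' N' (T (asc1 A L M N x))) \<in>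
  lin_hom A (mtens A (mtens A L M) N) (mtens A (mtens A L' M') N') r"
 by (rule lin_hom_comp[OF asc2_lin_hom[OF fin(4-6)] lin_hom_comp[OF assms asc1_lin_hom[OF fin(1-3)] _ refl]])
   (auto intro!: finite_gens_mtens fin)

lemma asc_conj_lin_hom':
 assumes "T \<in> lin_hom A (mtens A (mtens A L M) N) (mtens A (mtens A L' M') N') r"
 shows "(\<lambda>x. asc1 A L' M' N' (T (asc2 A L M N x))) \<in>
  lin_hom A (mtens A L (mtens A M N)) (mtens A L' (mtens A M' N')) r"
 by (rule lin_hom_comp[OF asc1_lin_hom[OF fin(4-6)] lin_hom_comp[OF assms asc2_lin_hom[OF fin(1-3)] _ refl]])
   (auto intro!: finite_gens_mtens fin)

text \<open>The second family acts on the factor next to L, so rebracketing alone turns the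
  contraction into one on L (x) M.\<close>

lemma TT_hexagon_right:
 assumes \<alpha>: "\<alpha> \<in> fam A L L' p" and \<beta>: "\<beta> \<in> fam A M M' q" and l: "l \<in> lin_hom A N N' 0"
 shows "(\<lambda>x. asc2 A L' M' N' (TT A Pi L (mtens A M N) L' p q \<alpha>
   (\<lambda>j. tmap A M N M' (q - ed A j) 0 (\<beta> j) l) (asc1 A L M N x))) =
  tmap A (mtens A L M) N (mtens A L' M') (p + q) 0 (TT A Pi L M L' p q \<alpha> \<beta>) l"
proof (rule lin_hom_eqI)
 note b' = tmap_fam_left[OF \<beta> l fin(2,3)]
 note F = finite_gens_mtens[OF fin(2,3), of A]
 note T = TT_lin_hom[OF \<alpha> b' fin(1) F refl] and R = TT_lin_hom[OF \<alpha> \<beta> fin(1,2) refl]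
 show "finite (gens (mtens A (mtens A L M) N))" by (intro finite_gens_mtens fin)
 show "(\<lambda>x. asc2 A L' M' N' (TT A Pi L (mtens A M N) L' p q \<alpha>
   (\<lambda>j. tmap A M N M' (q - ed A j) 0 (\<beta> j) l) (asc1 A L M N x)))
   \<in> lin_hom A (mtens A (mtens A L M) N) (mtens A (mtens A L' M') N') (p + q)"
  by (rule asc_conj_lin_hom[OF T])
 show "tmap A (mtens A L M) N (mtens A L' M') (p + q) 0 (TT A Pi L M L' p q \<alpha> \<beta>) l
   \<in> lin_hom A (mtens A (mtens A L M) N) (mtens A (mtens A L' M') N') (p + q)"
  by (rule tmap_lin_hom[OF R l]) (simp_all add: finite_gens_mtens fin)
 fix g assume "g \<in> gens (mtens A (mtens A L M) N)"
 then obtain u v w where g: "g = GPair (GPair u v) w" and uvw: "u \<in> gens L" "v \<in> gens M" "w \<in> gens N"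
  by (auto elim!: gens_mtensE)
 have uv: "GPair u v \<in> gens (mtens A L M)" and vw: "GPair v w \<in> gens (mtens A M N)" using uvw by simp_all
 note a = lh_mhom[OF famD[OF \<alpha>] mhom_ge[OF uvw(1) refl] refl] and b = lh_mhom[OF famD[OF \<beta>] mhom_ge[OF uvw(2) refl] refl]
  and c = lh_mcar[OF l fin(3), of "ge w"]
 show "asc2 A L' M' N' (TT A Pi L (mtens A M N) L' p q \<alpha>
   (\<lambda>j. tmap A M N M' (q - ed A j) 0 (\<beta> j) l) (asc1 A L M N (ge g))) =
  tmap A (mtens A L M) N (mtens A L' M') (p + q) 0 (TT A Pi L M L' p q \<alpha> \<beta>) l (ge g)"
  unfolding g asc1_ge[OF fin(1-3) uvw] TT_ge[OF \<alpha> b' fin(1) F uvw(1) vw]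
   tmap_ge[OF R l finite_gens_mtens[OF fin(1,2)] fin(3) uv uvw(3)] TT_ge[OF \<alpha> \<beta> fin(1,2) uvw(1,2)]
   tel_PS_left msc_PS
 proof (rule lh_PS_eq[OF asc2_lin_hom[OF fin(4-6)]])
  fix i j assume ij: "i < ngen A" "j < ngen A"
  note tg = tmap_ge[OF famD[OF \<beta> ij(2)] l fin(2,3) uvw(2,3)]
  note t = tel_mcar[OF mhom_mcar[OF a[OF ij(1)]] tel_mcar[OF mhom_mcar[OF b[OF ij(2)]] c]]
  show "msc (sg (p * ed A j) * sg ((q - ed A j) * gdeg L u))
    (tel A (gdeg L') (\<alpha> i (ge u)) (tmap A M N M' (q - ed A j) 0 (\<beta> j) l (ge (GPair v w))))
    \<in> mcar A (gens (mtens A L' (mtens A M' N')))"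
   unfolding tg using t by (simp add: mcar_msc)
  show "msc (sg (0 * (ed A i + ed A j))) (asc2 A L' M' N' (msc (sg (p * ed A j) * sg ((q - ed A j) * gdeg L u))
    (tel A (gdeg L') (\<alpha> i (ge u)) (tmap A M N M' (q - ed A j) 0 (\<beta> j) l (ge (GPair v w)))))) =
   msc (sg (0 * gdeg (mtens A L M) (GPair u v))) (tel A (gdeg (mtens A L' M'))
    (msc (sg (p * ed A j) * sg ((q - ed A j) * gdeg L u)) (tel A (gdeg L') (\<alpha> i (ge u)) (\<beta> j (ge v)))) (l (ge w)))"
   unfolding tg
   by (simp add: lh_msc[OF asc2_lin_hom[OF fin(4-6)] t] asc2_tel[OF fin(4-6) a[OF ij(1)] b[OF ij(2)] c])
 qed
qed auto

text \<open>Here h stands to the left of the contraction. The signs that moving the coefficients and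
  the contraction past it cause agree with those on the other side because h has degree 0.\<close>

lemma TT_hexagon_left:
 assumes \<alpha>: "\<alpha> \<in> fam A M M' p" and \<beta>: "\<beta> \<in> fam A N N' q" and h: "h \<in> lin_hom A L L' 0"
 shows "(\<lambda>x. asc1 A L' M' N' (TT A Pi (mtens A L M) N (mtens A L' M') p q
   (\<lambda>i. tmap A L M L' 0 (p - ed A i) h (\<alpha> i)) \<beta> (asc2 A L M N x))) =
  tmap A L (mtens A M N) L' 0 (p + q) h (TT A Pi M N M' p q \<alpha> \<beta>)"
proof (rule lin_hom_eqI)
 note a' = tmap_fam_right[OF \<alpha> h fin(1,2)]
 note F = finite_gens_mtens[OF fin(1,2), of A]
 note T = TT_lin_hom[OF a' \<beta> F fin(3) refl] and R = TT_lin_hom[OF \<alpha> \<beta> fin(2,3) refl]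
 show "finite (gens (mtens A L (mtens A M N)))" by (intro finite_gens_mtens fin)
 show "(\<lambda>x. asc1 A L' M' N' (TT A Pi (mtens A L M) N (mtens A L' M') p q
   (\<lambda>i. tmap A L M L' 0 (p - ed A i) h (\<alpha> i)) \<beta> (asc2 A L M N x)))
   \<in> lin_hom A (mtens A L (mtens A M N)) (mtens A L' (mtens A M' N')) (p + q)"
  by (rule asc_conj_lin_hom'[OF T])
 show "tmap A L (mtens A M N) L' 0 (p + q) h (TT A Pi M N M' p q \<alpha> \<beta>)
   \<in> lin_hom A (mtens A L (mtens A M N)) (mtens A L' (mtens A M' N')) (p + q)"
  by (rule tmap_lin_hom[OF h R]) (simp_all add: finite_gens_mtens fin)
 fix g assume "g \<in> gens (mtens A L (mtens A M N))"
 then obtain u v w where g: "g = GPair u (GPair v w)" and uvw: "u \<in> gens L" "v \<in> gens M" "w \<in> gens N"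
  by (auto elim!: gens_mtensE)
 have uv: "GPair u v \<in> gens (mtens A L M)" and vw: "GPair v w \<in> gens (mtens A M N)" using uvw by simp_all
 note a = lh_mhom[OF famD[OF \<alpha>] mhom_ge[OF uvw(2) refl] refl] and b = lh_mcar[OF famD[OF \<beta>] fin(3), of _ "ge w"]
  and c = lh_mhom[OF h mhom_ge[OF uvw(1) refl] refl]
 show "asc1 A L' M' N' (TT A Pi (mtens A L M) N (mtens A L' M') p q
   (\<lambda>i. tmap A L M L' 0 (p - ed A i) h (\<alpha> i)) \<beta> (asc2 A L M N (ge g))) =
  tmap A L (mtens A M N) L' 0 (p + q) h (TT A Pi M N M' p q \<alpha> \<beta>) (ge g)"
  unfolding g asc2_ge[OF fin(1-3) uvw] TT_ge[OF a' \<beta> F fin(3) uv uvw(3)]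
   tmap_ge[OF h R fin(1) finite_gens_mtens[OF fin(2,3)] uvw(1) vw] TT_ge[OF \<alpha> \<beta> fin(2,3) uvw(2,3)]
   tel_PS_right[OF c] msc_PS
 proof (rule lh_PS_eq[OF asc1_lin_hom[OF fin(4-6)]])
  fix i j assume ij: "i < ngen A" "j < ngen A"
  note tg = tmap_ge[OF h famD[OF \<alpha> ij(1)] fin(1,2) uvw(1,2)]
  note t = tel_mcar[OF tel_mcar[OF mhom_mcar[OF c] mhom_mcar[OF a[OF ij(1)]]] b[OF ij(2)]]
  show "msc (sg (p * ed A j) * sg ((q - ed A j) * gdeg (mtens A L M) (GPair u v)))
    (tel A (gdeg (mtens A L' M')) (tmap A L M L' 0 (p - ed A i) h (\<alpha> i) (ge (GPair u v))) (\<beta> j (ge w)))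
    \<in> mcar A (gens (mtens A (mtens A L' M') N'))"
   unfolding tg using t by (simp add: mcar_msc)
  show "msc (sg (0 * (ed A i + ed A j))) (asc1 A L' M' N' (msc (sg (p * ed A j) * sg ((q - ed A j) * gdeg (mtens A L M) (GPair u v)))
    (tel A (gdeg (mtens A L' M')) (tmap A L M L' 0 (p - ed A i) h (\<alpha> i) (ge (GPair u v))) (\<beta> j (ge w))))) =
   msc (sg ((p + q) * gdeg L u)) (msc (sg ((gdeg L u + 0) * (ed A i + ed A j)))
    (tel A (gdeg L') (h (ge u)) (msc (sg (p * ed A j) * sg ((q - ed A j) * gdeg M v))
      (tel A (gdeg M') (\<alpha> i (ge v)) (\<beta> j (ge w))))))"
   unfolding tg tel_simps msc_simps lh_msc[OF asc1_lin_hom[OF fin(4-6)] t]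
    asc1_tel[OF fin(4-6) c a[OF ij(1)] b[OF ij(2)]]
   unfolding msc_simps sg_add[symmetric] gdeg_mtens
   by (rule arg_cong2[OF sg_eqI refl, of _ _ msc]) auto
 qed
qed auto

text \<open>The families act on L and N, which M separates; braiding M to the front makes them
  adjacent. The two braidings, the contraction passing M and its coefficients passing M together
  give the sign (q - |e_j|) |v|, and this is what the second family picks up when it passes the
  generator v of M directly.\<close>

lemma TT_hexagon_middle_right:
 assumes \<alpha>: "\<alpha> \<in> fam A L L' p" and \<beta>: "\<beta> \<in> fam A N N' q" and k: "k \<in> lin_hom A M M' 0"
 shows "(\<lambda>x. asc2 A L' M' N' (TT A Pi L (mtens A M N) L' p q \<alpha>
   (\<lambda>j. tmap A M N M' 0 (q - ed A j) k (\<beta> j)) (asc1 A L M N x))) =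
  (\<lambda>x. tmap A (mtens A M' L') N' (mtens A L' M') 0 0 (braid A M' L') (mid A N')
   (asc2 A M' L' N' (tmap A M (mtens A L N) M' 0 (p + q) k (TT A Pi L N L' p q \<alpha> \<beta>)
    (asc1 A M L N (tmap A (mtens A L M) N (mtens A M L) 0 0 (braid A L M) (mid A N) x)))))"
proof (rule lin_hom_eqI)
 note b' = tmap_fam_right[OF \<beta> k fin(2,3)]
 note F = finite_gens_mtens[OF fin(2,3), of A]
 note T = TT_lin_hom[OF \<alpha> b' fin(1) F refl] and R = TT_lin_hom[OF \<alpha> \<beta> fin(1,3) refl]
 note B = tmap_lin_hom[OF braid_lin_hom[OF fin(1,2)] lin_hom_mid finite_gens_mtens[OF fin(1,2)] fin(3) refl, of A]
 note B' = tmap_lin_hom[OF braid_lin_hom[OF fin(5,4)] lin_hom_mid finite_gens_mtens[OF fin(5,4)] fin(6) refl, of A]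
 note S = tmap_lin_hom[OF k R fin(2) finite_gens_mtens[OF fin(1,3)] refl]
 note a1 = asc1_lin_hom[OF fin(2,1,3)] and a2 = asc2_lin_hom[OF fin(5,4,6)]
 show "finite (gens (mtens A (mtens A L M) N))" by (intro finite_gens_mtens fin)
 show "(\<lambda>x. asc2 A L' M' N' (TT A Pi L (mtens A M N) L' p q \<alpha>
   (\<lambda>j. tmap A M N M' 0 (q - ed A j) k (\<beta> j)) (asc1 A L M N x)))
   \<in> lin_hom A (mtens A (mtens A L M) N) (mtens A (mtens A L' M') N') (p + q)"
  by (rule asc_conj_lin_hom[OF T])
 show "(\<lambda>x. tmap A (mtens A M' L') N' (mtens A L' M') 0 0 (braid A M' L') (mid A N')
   (asc2 A M' L' N' (tmap A M (mtens A L N) M' 0 (p + q) k (TT A Pi L N L' p q \<alpha> \<beta>)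
    (asc1 A M L N (tmap A (mtens A L M) N (mtens A M L) 0 0 (braid A L M) (mid A N) x)))))
   \<in> lin_hom A (mtens A (mtens A L M) N) (mtens A (mtens A L' M') N') (p + q)"
  by (rule lin_hom_comp[OF B' lin_hom_comp[OF a2 lin_hom_comp[OF S lin_hom_comp[OF a1 B _ refl] _ refl] _ refl]])
    (auto intro!: finite_gens_mtens fin)
 fix g assume "g \<in> gens (mtens A (mtens A L M) N)"
 then obtain u v w where g: "g = GPair (GPair u v) w" and uvw: "u \<in> gens L" "v \<in> gens M" "w \<in> gens N"
  by (auto elim!: gens_mtensE)
 have uv: "GPair u v \<in> gens (mtens A L M)" and vw: "GPair v w \<in> gens (mtens A M N)"
  and vuw: "GPair (GPair v u) w \<in> gens (mtens A (mtens A M L) N)" "GPair v (GPair u w) \<in> gens (mtens A M (mtens A L N))"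
  and uw: "GPair u w \<in> gens (mtens A L N)"
  using uvw by simp_all
 note a = lh_mhom[OF famD[OF \<alpha>] mhom_ge[OF uvw(1) refl] refl] and b = lh_mcar[OF famD[OF \<beta>] fin(3), of _ "ge w"]
  and c = lh_mhom[OF k mhom_ge[OF uvw(2) refl] refl]
 have "asc2 A L' M' N' (TT A Pi L (mtens A M N) L' p q \<alpha>
   (\<lambda>j. tmap A M N M' 0 (q - ed A j) k (\<beta> j)) (asc1 A L M N (ge g))) =
  PS A Pi (\<lambda>i j. msc (sg (p * ed A j) * sg ((q - ed A j) * gdeg L u) * sg ((q - ed A j) * gdeg M v))
   (tel A (gdeg (mtens A L' M')) (tel A (gdeg L') (\<alpha> i (ge u)) (k (ge v))) (\<beta> j (ge w))))"
  unfolding g asc1_ge[OF fin(1-3) uvw] TT_ge[OF \<alpha> b' fin(1) F uvw(1) vw]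
 proof (rule lh_PS_eq[OF asc2_lin_hom[OF fin(4-6)]])
  fix i j assume ij: "i < ngen A" "j < ngen A"
  note tg = tmap_ge[OF k famD[OF \<beta> ij(2)] fin(2,3) uvw(2,3)]
  note t = tel_mcar[OF mhom_mcar[OF a[OF ij(1)]] tel_mcar[OF mhom_mcar[OF c] b[OF ij(2)]]]
  show "msc (sg (p * ed A j) * sg ((q - ed A j) * gdeg L u))
    (tel A (gdeg L') (\<alpha> i (ge u)) (tmap A M N M' 0 (q - ed A j) k (\<beta> j) (ge (GPair v w))))
    \<in> mcar A (gens (mtens A L' (mtens A M' N')))"
   unfolding tg using t by (simp add: mcar_msc)
  show "msc (sg (0 * (ed A i + ed A j))) (asc2 A L' M' N' (msc (sg (p * ed A j) * sg ((q - ed A j) * gdeg L u))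
    (tel A (gdeg L') (\<alpha> i (ge u)) (tmap A M N M' 0 (q - ed A j) k (\<beta> j) (ge (GPair v w)))))) =
   msc (sg (p * ed A j) * sg ((q - ed A j) * gdeg L u) * sg ((q - ed A j) * gdeg M v))
   (tel A (gdeg (mtens A L' M')) (tel A (gdeg L') (\<alpha> i (ge u)) (k (ge v))) (\<beta> j (ge w)))"
   unfolding tg tel_simps msc_simps
   by (simp add: lh_msc[OF asc2_lin_hom[OF fin(4-6)] t] asc2_tel[OF fin(4-6) a[OF ij(1)] c b[OF ij(2)]])
 qed
 moreover have "tmap A M (mtens A L N) M' 0 (p + q) k (TT A Pi L N L' p q \<alpha> \<beta>)
   (asc1 A M L N (tmap A (mtens A L M) N (mtens A M L) 0 0 (braid A L M) (mid A N) (ge g))) =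
  PS A Pi (\<lambda>i j. msc (sg (gdeg L u * gdeg M v) * sg ((p + q) * gdeg M v) * sg (gdeg M v * (ed A i + ed A j)) *
    sg (p * ed A j) * sg ((q - ed A j) * gdeg L u)) (tel A (gdeg M') (k (ge v)) (tel A (gdeg L') (\<alpha> i (ge u)) (\<beta> j (ge w)))))"
  unfolding g tmap_ge[OF braid_lin_hom[OF fin(1,2)] lin_hom_mid finite_gens_mtens[OF fin(1,2)] fin(3) uv uvw(3)]
   braid_ge[OF fin(1,2) uvw(1,2)] mid_ge[OF uvw(3)] tel_simps tel_ge
   lh_msc[OF a1 mcar_msc[OF mcar_ge[OF vuw(1)]]] lh_msc[OF a1 mcar_ge[OF vuw(1)]] asc1_ge[OF fin(2,1,3) uvw(2,1,3)]
   lh_msc[OF S mcar_msc[OF mcar_ge[OF vuw(2)]]] lh_msc[OF S mcar_ge[OF vuw(2)]]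
   tmap_ge[OF k R fin(2) finite_gens_mtens[OF fin(1,3)] uvw(2) uw] TT_ge[OF \<alpha> \<beta> fin(1,3) uvw(1,3)]
   tel_PS_right[OF c] msc_PS
  by (rule PS_cong) (simp add: mult.assoc)
 moreover have "asc2 A M' L' N' (PS A Pi (\<lambda>i j. msc (sg (gdeg L u * gdeg M v) * sg ((p + q) * gdeg M v) * sg (gdeg M v * (ed A i + ed A j)) *
    sg (p * ed A j) * sg ((q - ed A j) * gdeg L u)) (tel A (gdeg M') (k (ge v)) (tel A (gdeg L') (\<alpha> i (ge u)) (\<beta> j (ge w)))))) =
  PS A Pi (\<lambda>i j. msc (sg (gdeg L u * gdeg M v) * sg ((p + q) * gdeg M v) * sg (gdeg M v * (ed A i + ed A j)) *
    sg (p * ed A j) * sg ((q - ed A j) * gdeg L u))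
    (tel A (gdeg (mtens A M' L')) (tel A (gdeg M') (k (ge v)) (\<alpha> i (ge u))) (\<beta> j (ge w))))"
 proof (rule lh_PS_eq[OF a2])
  fix i j assume ij: "i < ngen A" "j < ngen A"
  note t = tel_mcar[OF mhom_mcar[OF c] tel_mcar[OF mhom_mcar[OF a[OF ij(1)]] b[OF ij(2)]]]
  show "msc s (tel A (gdeg M') (k (ge v)) (tel A (gdeg L') (\<alpha> i (ge u)) (\<beta> j (ge w))))
   \<in> mcar A (gens (mtens A M' (mtens A L' N')))" for s
   by (rule mcar_msc[OF t])
  show "msc (sg (0 * (ed A i + ed A j))) (asc2 A M' L' N' (msc s (tel A (gdeg M') (k (ge v)) (tel A (gdeg L') (\<alpha> i (ge u)) (\<beta> j (ge w)))))) =
   msc s (tel A (gdeg (mtens A M' L')) (tel A (gdeg M') (k (ge v)) (\<alpha> i (ge u))) (\<beta> j (ge w)))" for s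
   by (simp add: lh_msc[OF a2 t] asc2_tel[OF fin(5,4,6) c a[OF ij(1)] b[OF ij(2)]])
 qed
 moreover have "tmap A (mtens A M' L') N' (mtens A L' M') 0 0 (braid A M' L') (mid A N')
  (PS A Pi (\<lambda>i j. msc (sg (gdeg L u * gdeg M v) * sg ((p + q) * gdeg M v) * sg (gdeg M v * (ed A i + ed A j)) *
    sg (p * ed A j) * sg ((q - ed A j) * gdeg L u))
    (tel A (gdeg (mtens A M' L')) (tel A (gdeg M') (k (ge v)) (\<alpha> i (ge u))) (\<beta> j (ge w))))) =
  PS A Pi (\<lambda>i j. msc (sg (p * ed A j) * sg ((q - ed A j) * gdeg L u) * sg ((q - ed A j) * gdeg M v))
   (tel A (gdeg (mtens A L' M')) (tel A (gdeg L') (\<alpha> i (ge u)) (k (ge v))) (\<beta> j (ge w))))"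
 proof (rule lh_PS_eq[OF B'])
  fix i j assume ij: "i < ngen A" "j < ngen A"
  note t1 = tel_mhom[OF c a[OF ij(1)] refl]
  note t = tel_mcar[OF mhom_mcar[OF t1] b[OF ij(2)]]
  have m: "mid A N' (\<beta> j (ge w)) = \<beta> j (ge w)" using b[OF ij(2)] by (simp add: mid_def)
  show "msc s (tel A (gdeg (mtens A M' L')) (tel A (gdeg M') (k (ge v)) (\<alpha> i (ge u))) (\<beta> j (ge w)))
   \<in> mcar A (gens (mtens A (mtens A M' L') N'))" for s
   by (rule mcar_msc[OF t])
  show "msc (sg ((0 + 0) * (ed A i + ed A j))) (tmap A (mtens A M' L') N' (mtens A L' M') 0 0 (braid A M' L') (mid A N')
    (msc (sg (gdeg L u * gdeg M v) * sg ((p + q) * gdeg M v) * sg (gdeg M v * (ed A i + ed A j)) *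
    sg (p * ed A j) * sg ((q - ed A j) * gdeg L u))
    (tel A (gdeg (mtens A M' L')) (tel A (gdeg M') (k (ge v)) (\<alpha> i (ge u))) (\<beta> j (ge w))))) =
   msc (sg (p * ed A j) * sg ((q - ed A j) * gdeg L u) * sg ((q - ed A j) * gdeg M v))
   (tel A (gdeg (mtens A L' M')) (tel A (gdeg L') (\<alpha> i (ge u)) (k (ge v))) (\<beta> j (ge w)))"
   unfolding lh_msc[OF B' t] tmap_tel[OF braid_lin_hom[OF fin(5,4)] lin_hom_mid finite_gens_mtens[OF fin(5,4)] fin(6) t1 b[OF ij(2)]]
    braid_tel[OF fin(5,4) c a[OF ij(1)]] m
   unfolding tel_simps msc_simps sg_add[symmetric]
   by (rule arg_cong2[OF sg_eqI refl, of _ _ msc]) auto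
 qed
 ultimately show "asc2 A L' M' N' (TT A Pi L (mtens A M N) L' p q \<alpha>
   (\<lambda>j. tmap A M N M' 0 (q - ed A j) k (\<beta> j)) (asc1 A L M N (ge g))) =
  tmap A (mtens A M' L') N' (mtens A L' M') 0 0 (braid A M' L') (mid A N')
   (asc2 A M' L' N' (tmap A M (mtens A L N) M' 0 (p + q) k (TT A Pi L N L' p q \<alpha> \<beta>)
    (asc1 A M L N (tmap A (mtens A L M) N (mtens A M L) 0 0 (braid A L M) (mid A N) (ge g)))))"
  by simp
qed auto

text \<open>The mirror image: M is braided behind N, so the contraction does not have to pass it and
  only the two braiding signs arise.\<close>

lemma TT_hexagon_middle_left:
 assumes \<alpha>: "\<alpha> \<in> fam A L L' p" and \<beta>: "\<beta> \<in> fam A N N' q" and k: "k \<in> lin_hom A M M' 0"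
 shows "(\<lambda>x. asc1 A L' M' N' (TT A Pi (mtens A L M) N (mtens A L' M') p q
   (\<lambda>i. tmap A L M L' (p - ed A i) 0 (\<alpha> i) k) \<beta> (asc2 A L M N x))) =
  (\<lambda>x. tmap A L' (mtens A N' M') L' 0 0 (mid A L') (braid A N' M')
   (asc1 A L' N' M' (tmap A (mtens A L N) M (mtens A L' N') (p + q) 0 (TT A Pi L N L' p q \<alpha> \<beta>) k
    (asc2 A L N M (tmap A L (mtens A M N) L 0 0 (mid A L) (braid A M N) x)))))"
proof (rule lin_hom_eqI)
 note a' = tmap_fam_left[OF \<alpha> k fin(1,2)]
 note F = finite_gens_mtens[OF fin(1,2), of A]
 note T = TT_lin_hom[OF a' \<beta> F fin(3) refl] and R = TT_lin_hom[OF \<alpha> \<beta> fin(1,3) refl]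
 note B = tmap_lin_hom[OF lin_hom_mid braid_lin_hom[OF fin(2,3)] fin(1) finite_gens_mtens[OF fin(2,3)] refl, of A]
 note B' = tmap_lin_hom[OF lin_hom_mid braid_lin_hom[OF fin(6,5)] fin(4) finite_gens_mtens[OF fin(6,5)] refl, of A]
 note S = tmap_lin_hom[OF R k finite_gens_mtens[OF fin(1,3)] fin(2) refl]
 note a1 = asc1_lin_hom[OF fin(4,6,5)] and a2 = asc2_lin_hom[OF fin(1,3,2)]
 show "finite (gens (mtens A L (mtens A M N)))" by (intro finite_gens_mtens fin)
 show "(\<lambda>x. asc1 A L' M' N' (TT A Pi (mtens A L M) N (mtens A L' M') p q
   (\<lambda>i. tmap A L M L' (p - ed A i) 0 (\<alpha> i) k) \<beta> (asc2 A L M N x)))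
   \<in> lin_hom A (mtens A L (mtens A M N)) (mtens A L' (mtens A M' N')) (p + q)"
  by (rule asc_conj_lin_hom'[OF T])
 show "(\<lambda>x. tmap A L' (mtens A N' M') L' 0 0 (mid A L') (braid A N' M')
   (asc1 A L' N' M' (tmap A (mtens A L N) M (mtens A L' N') (p + q) 0 (TT A Pi L N L' p q \<alpha> \<beta>) k
    (asc2 A L N M (tmap A L (mtens A M N) L 0 0 (mid A L) (braid A M N) x)))))
   \<in> lin_hom A (mtens A L (mtens A M N)) (mtens A L' (mtens A M' N')) (p + q)"
  by (rule lin_hom_comp[OF B' lin_hom_comp[OF a1 lin_hom_comp[OF S lin_hom_comp[OF a2 B _ refl] _ refl] _ refl]])
    (auto intro!: finite_gens_mtens fin)
 fix g assume "g \<in> gens (mtens A L (mtens A M N))"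
 then obtain u v w where g: "g = GPair u (GPair v w)" and uvw: "u \<in> gens L" "v \<in> gens M" "w \<in> gens N"
  by (auto elim!: gens_mtensE)
 have uv: "GPair u v \<in> gens (mtens A L M)" and vw: "GPair v w \<in> gens (mtens A M N)"
  and vuw: "GPair u (GPair w v) \<in> gens (mtens A L (mtens A N M))" "GPair (GPair u w) v \<in> gens (mtens A (mtens A L N) M)"
  and uw: "GPair u w \<in> gens (mtens A L N)"
  using uvw by simp_all
 note a = lh_mhom[OF famD[OF \<alpha>] mhom_ge[OF uvw(1) refl] refl] and b = lh_mhom[OF famD[OF \<beta>] mhom_ge[OF uvw(3) refl] refl]
  and c = lh_mhom[OF k mhom_ge[OF uvw(2) refl] refl]
 have "asc1 A L' M' N' (TT A Pi (mtens A L M) N (mtens A L' M') p q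
   (\<lambda>i. tmap A L M L' (p - ed A i) 0 (\<alpha> i) k) \<beta> (asc2 A L M N (ge g))) =
  PS A Pi (\<lambda>i j. msc (sg (p * ed A j) * sg ((q - ed A j) * (gdeg L u + gdeg M v)))
   (tel A (gdeg L') (\<alpha> i (ge u)) (tel A (gdeg M') (k (ge v)) (\<beta> j (ge w)))))"
  unfolding g asc2_ge[OF fin(1-3) uvw] TT_ge[OF a' \<beta> F fin(3) uv uvw(3)]
 proof (rule lh_PS_eq[OF asc1_lin_hom[OF fin(4-6)]])
  fix i j assume ij: "i < ngen A" "j < ngen A"
  note tg = tmap_ge[OF famD[OF \<alpha> ij(1)] k fin(1,2) uvw(1,2)]
  note t = tel_mcar[OF tel_mcar[OF mhom_mcar[OF a[OF ij(1)]] mhom_mcar[OF c]] mhom_mcar[OF b[OF ij(2)]]]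
  show "msc (sg (p * ed A j) * sg ((q - ed A j) * gdeg (mtens A L M) (GPair u v)))
    (tel A (gdeg (mtens A L' M')) (tmap A L M L' (p - ed A i) 0 (\<alpha> i) k (ge (GPair u v))) (\<beta> j (ge w)))
    \<in> mcar A (gens (mtens A (mtens A L' M') N'))"
   unfolding tg using t by (simp add: mcar_msc)
  show "msc (sg (0 * (ed A i + ed A j))) (asc1 A L' M' N' (msc (sg (p * ed A j) * sg ((q - ed A j) * gdeg (mtens A L M) (GPair u v)))
    (tel A (gdeg (mtens A L' M')) (tmap A L M L' (p - ed A i) 0 (\<alpha> i) k (ge (GPair u v))) (\<beta> j (ge w))))) =
   msc (sg (p * ed A j) * sg ((q - ed A j) * (gdeg L u + gdeg M v)))
   (tel A (gdeg L') (\<alpha> i (ge u)) (tel A (gdeg M') (k (ge v)) (\<beta> j (ge w))))"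
   unfolding tg tel_simps msc_simps
   by (simp add: lh_msc[OF asc1_lin_hom[OF fin(4-6)] t] asc1_tel[OF fin(4-6) a[OF ij(1)] c mhom_mcar[OF b[OF ij(2)]]])
 qed
 moreover have "tmap A (mtens A L N) M (mtens A L' N') (p + q) 0 (TT A Pi L N L' p q \<alpha> \<beta>) k
   (asc2 A L N M (tmap A L (mtens A M N) L 0 0 (mid A L) (braid A M N) (ge g))) =
  PS A Pi (\<lambda>i j. msc (sg (gdeg M v * gdeg N w) * sg (p * ed A j) * sg ((q - ed A j) * gdeg L u))
   (tel A (gdeg (mtens A L' N')) (tel A (gdeg L') (\<alpha> i (ge u)) (\<beta> j (ge w))) (k (ge v))))"
  unfolding g tmap_ge[OF lin_hom_mid braid_lin_hom[OF fin(2,3)] fin(1) finite_gens_mtens[OF fin(2,3)] uvw(1) vw]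
   braid_ge[OF fin(2,3) uvw(2,3)] mid_ge[OF uvw(1)] tel_simps tel_ge
   lh_msc[OF a2 mcar_msc[OF mcar_ge[OF vuw(1)]]] lh_msc[OF a2 mcar_ge[OF vuw(1)]] asc2_ge[OF fin(1,3,2) uvw(1,3,2)]
   lh_msc[OF S mcar_msc[OF mcar_ge[OF vuw(2)]]] lh_msc[OF S mcar_ge[OF vuw(2)]]
   tmap_ge[OF R k finite_gens_mtens[OF fin(1,3)] fin(2) uw uvw(2)] TT_ge[OF \<alpha> \<beta> fin(1,3) uvw(1,3)]
   tel_PS_left msc_PS
  by (rule PS_cong) (simp add: mult.assoc)
 moreover have "asc1 A L' N' M' (PS A Pi (\<lambda>i j. msc (sg (gdeg M v * gdeg N w) * sg (p * ed A j) * sg ((q - ed A j) * gdeg L u))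
   (tel A (gdeg (mtens A L' N')) (tel A (gdeg L') (\<alpha> i (ge u)) (\<beta> j (ge w))) (k (ge v))))) =
  PS A Pi (\<lambda>i j. msc (sg (gdeg M v * gdeg N w) * sg (p * ed A j) * sg ((q - ed A j) * gdeg L u))
   (tel A (gdeg L') (\<alpha> i (ge u)) (tel A (gdeg N') (\<beta> j (ge w)) (k (ge v)))))"
 proof (rule lh_PS_eq[OF a1])
  fix i j assume ij: "i < ngen A" "j < ngen A"
  note t = tel_mcar[OF tel_mcar[OF mhom_mcar[OF a[OF ij(1)]] mhom_mcar[OF b[OF ij(2)]]] mhom_mcar[OF c]]
  show "msc s (tel A (gdeg (mtens A L' N')) (tel A (gdeg L') (\<alpha> i (ge u)) (\<beta> j (ge w))) (k (ge v)))
   \<in> mcar A (gens (mtens A (mtens A L' N') M'))" for s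
   by (rule mcar_msc[OF t])
  show "msc (sg (0 * (ed A i + ed A j))) (asc1 A L' N' M' (msc s (tel A (gdeg (mtens A L' N')) (tel A (gdeg L') (\<alpha> i (ge u)) (\<beta> j (ge w))) (k (ge v))))) =
   msc s (tel A (gdeg L') (\<alpha> i (ge u)) (tel A (gdeg N') (\<beta> j (ge w)) (k (ge v))))" for s
   by (simp add: lh_msc[OF a1 t] asc1_tel[OF fin(4,6,5) a[OF ij(1)] b[OF ij(2)] mhom_mcar[OF c]])
 qed
 moreover have "tmap A L' (mtens A N' M') L' 0 0 (mid A L') (braid A N' M')
  (PS A Pi (\<lambda>i j. msc (sg (gdeg M v * gdeg N w) * sg (p * ed A j) * sg ((q - ed A j) * gdeg L u))
   (tel A (gdeg L') (\<alpha> i (ge u)) (tel A (gdeg N') (\<beta> j (ge w)) (k (ge v)))))) =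
  PS A Pi (\<lambda>i j. msc (sg (p * ed A j) * sg ((q - ed A j) * (gdeg L u + gdeg M v)))
   (tel A (gdeg L') (\<alpha> i (ge u)) (tel A (gdeg M') (k (ge v)) (\<beta> j (ge w)))))"
 proof (rule lh_PS_eq[OF B'])
  fix i j assume ij: "i < ngen A" "j < ngen A"
  note t1 = tel_mhom[OF b[OF ij(2)] c refl]
  note t = tel_mcar[OF mhom_mcar[OF a[OF ij(1)]] mhom_mcar[OF t1]]
  have m: "mid A L' (\<alpha> i (ge u)) = \<alpha> i (ge u)" using mhom_mcar[OF a[OF ij(1)]] by (simp add: mid_def)
  show "msc s (tel A (gdeg L') (\<alpha> i (ge u)) (tel A (gdeg N') (\<beta> j (ge w)) (k (ge v))))
   \<in> mcar A (gens (mtens A L' (mtens A N' M')))" for s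
   by (rule mcar_msc[OF t])
  show "msc (sg ((0 + 0) * (ed A i + ed A j))) (tmap A L' (mtens A N' M') L' 0 0 (mid A L') (braid A N' M')
    (msc (sg (gdeg M v * gdeg N w) * sg (p * ed A j) * sg ((q - ed A j) * gdeg L u))
   (tel A (gdeg L') (\<alpha> i (ge u)) (tel A (gdeg N') (\<beta> j (ge w)) (k (ge v)))))) =
   msc (sg (p * ed A j) * sg ((q - ed A j) * (gdeg L u + gdeg M v)))
   (tel A (gdeg L') (\<alpha> i (ge u)) (tel A (gdeg M') (k (ge v)) (\<beta> j (ge w))))"
   unfolding lh_msc[OF B' t] tmap_tel[OF lin_hom_mid braid_lin_hom[OF fin(6,5)] fin(4) finite_gens_mtens[OF fin(6,5)] a[OF ij(1)] mhom_mcar[OF t1]]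
    braid_tel[OF fin(6,5) b[OF ij(2)] c] m
   unfolding tel_simps msc_simps sg_add[symmetric]
   by (rule arg_cong2[OF sg_eqI refl, of _ _ msc]) auto
 qed
 ultimately show "asc1 A L' M' N' (TT A Pi (mtens A L M) N (mtens A L' M') p q
   (\<lambda>i. tmap A L M L' (p - ed A i) 0 (\<alpha> i) k) \<beta> (asc2 A L M N (ge g))) =
  tmap A L' (mtens A N' M') L' 0 0 (mid A L') (braid A N' M')
   (asc1 A L' N' M' (tmap A (mtens A L N) M (mtens A L' N') (p + q) 0 (TT A Pi L N L' p q \<alpha> \<beta>) k
    (asc2 A L N M (tmap A L (mtens A M N) L 0 0 (mid A L) (braid A M N) (ge g)))))"
  by simp
qed auto

end

end

section \<open>The Leibniz rule of the contraction\<close>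

lemma cc_ahom:
 assumes "adiff A \<in> der A 1" "i < ngen A" "j < ngen A"
 shows "cc A i j \<in> ahom A (1 + ed A j - ed A i)"
 unfolding cc_def by (rule ahom_apar[OF der_ahom[OF assms(1) ahom_avar[OF assms(3) refl] refl]]) simp

lemma DD_fam:
 assumes "adiff A \<in> der A 1" "dmod A M" "dmod A N" "\<alpha> \<in> fam A M N p" "q = p + 1"
 shows "DD A M N p \<alpha> \<in> fam A M N q"
 unfolding fam_def DD_def
 by (auto intro!: lin_hom_diff lin_hom_fsc lin_hom_sum hdiff_lin_hom[OF assms(1-3) famD[OF assms(4)]]
   lin_hom_mo[OF cc_ahom[OF assms(1)] famD[OF assms(4)]] simp: assms(5))

text \<open>Differentiating the contraction hits the coefficients and the two families. Replacing
  the plain differentials of the families by \<open>DD\<close> brings in two Jacobian sums, and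
  \<open>closed\<close> says that these cancel the derivative of the coefficients.\<close>

lemma (in bivector) hdiff_TT:
 assumes dA: "adiff A \<in> der A 1"
  and closed: "\<And>i j. i < ngen A \<Longrightarrow> j < ngen A \<Longrightarrow> adiff A (Pi i j) +
   (\<Sum>k<ngen A. fsm (sg (ed A j)) (amul A (Pi k j) (cc A k i)) +
     fsm (sg (ed A i * (1 + ed A j + ed A k))) (amul A (Pi i k) (cc A k j))) = 0"
  and \<alpha>: "\<alpha> \<in> fam A M M' p" and \<beta>: "\<beta> \<in> fam A N N' q"
  and dm: "dmod A M" "dmod A N" "dmod A M'" "dmod A N'" and r: "r = p + q"
 shows "hdiff (mtens A M N) (mtens A M' N') r (TT A Pi M N M' p q \<alpha> \<beta>) =
  TT A Pi M N M' (p + 1) q (DD A M M' p \<alpha>) \<beta> + fsc (sg p) (TT A Pi M N M' p (q + 1) \<alpha> (DD A N N' q \<beta>))"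
proof -
 let ?n = "ngen A"
 note fin = dm_finite[OF dm(1)] dm_finite[OF dm(2)]
 note dmt = mtens_dmod[OF dA dm(1,2)] mtens_dmod[OF dA dm(3,4)]
 define X where "X i j = tmap A M N M' (p - ed A i) (q - ed A j) (\<alpha> i) (\<beta> j)" for i j
 define Da where "Da i j = tmap A M N M' (p + 1 - ed A i) (q - ed A j) (hdiff M M' (p - ed A i) (\<alpha> i)) (\<beta> j)" for i j
 define Db where "Db i j = tmap A M N M' (p - ed A i) (q + 1 - ed A j) (\<alpha> i) (hdiff N N' (q - ed A j) (\<beta> j))" for i j
 \<comment> \<open>Five kinds of terms: \<open>a\<close> differentiates the coefficients,
   \<open>b\<close> and \<open>b'\<close> the two families, while \<open>u\<close> and
   \<open>v\<close> are the Jacobian sums that \<open>DD\<close> subtracts.\<close>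
 define a where "a i j = fsc (sg (p * ed A j)) (mo A (adiff A (Pi i j)) (X i j))" for i j
 define b where "b i j = fsc (sg ((p + 1) * ed A j) * sg (ed A i)) (mo A (Pi i j) (Da i j))" for i j
 define b' where "b' i j = fsc (sg p * (sg (p * ed A j) * sg (ed A j))) (mo A (Pi i j) (Db i j))" for i j
 define u where "u i j k = fsc (sg ((p + 1) * ed A j)) (mo A (amul A (Pi i j) (cc A i k)) (X k j))" for i j k
 define v where "v i j k = fsc (sg p * (sg (p * ed A j) * sg ((1 + ed A k - ed A j) * (p - ed A i))))
  (mo A (amul A (Pi i j) (cc A j k)) (X i k))" for i j k
 have X: "X i j \<in> lin_hom A (mtens A M N) (mtens A M' N') (r - (ed A i + ed A j))" if "i < ?n" "j < ?n" for i j
  unfolding X_def by (rule tmap_lin_hom[OF famD[OF \<alpha> that(1)] famD[OF \<beta> that(2)] fin]) (simp add: r)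
 have mX: "mo A (Pi i j) (X i j) \<in> lin_hom A (mtens A M N) (mtens A M' N') r" if "i < ?n" "j < ?n" for i j
  by (rule lin_hom_mo[OF Pi[OF that] X[OF that]]) simp
 have Y: "fsc (sg (p * ed A j)) (mo A (Pi i j) (X i j)) \<in> lin_hom A (mtens A M N) (mtens A M' N') r"
  if "i \<in> {..<?n}" "j \<in> {..<?n}" for i j
  using that by (intro lin_hom_fsc mX) auto
 have "hdiff (mtens A M N) (mtens A M' N') r (fsc (sg (p * ed A j)) (mo A (Pi i j) (X i j))) = a i j + (b i j + b' i j)"
  if ij: "i < ?n" "j < ?n" for i j
 proof -
  have hd: "hdiff (mtens A M N) (mtens A M' N') r (mo A (Pi i j) (X i j)) = mo A (adiff A (Pi i j)) (X i j) +
   fsc (sg (ed A i + ed A j)) (mo A (Pi i j) (Da i j + fsc (sg (p - ed A i)) (Db i j)))"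
   using hdiff_tmap[OF dA famD[OF \<alpha> ij(1)] famD[OF \<beta> ij(2)] dm, of "r - (ed A i + ed A j)" "p + 1 - ed A i" "q + 1 - ed A j"]
    hdiff_mo[OF dmt X[OF ij] Pi[OF ij], of r]
   by (simp add: X_def Da_def Db_def r)
  have s: "sg (p * ed A j) * sg (ed A i + ed A j) = (sg ((p + 1) * ed A j) * sg (ed A i) :: 'k)"
   "sg (p * ed A j) * (sg (ed A i + ed A j) * sg (p - ed A i)) = (sg p * (sg (p * ed A j) * sg (ed A j)) :: 'k)"
   unfolding sg_add[symmetric] by (rule sg_eqI; auto)+
  show ?thesis
   unfolding hdiff_fsc[OF dmt mX[OF ij]] a_def b_def b'_def hd
   by (simp only: fsc_add mo_add fsc_simps mo_simps s)
 qed
 moreover have "hdiff (mtens A M N) (mtens A M' N') r (TT A Pi M N M' p q \<alpha> \<beta>) =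
  (\<Sum>i<?n. \<Sum>j<?n. hdiff (mtens A M N) (mtens A M' N') r (fsc (sg (p * ed A j)) (mo A (Pi i j) (X i j))))"
  unfolding TT_def X_def[symmetric]
  by (rule trans[OF hdiff_sum[OF dmt lin_hom_sum[OF Y]] sum.cong[OF refl hdiff_sum[OF dmt Y]]])
 ultimately have 1: "hdiff (mtens A M N) (mtens A M' N') r (TT A Pi M N M' p q \<alpha> \<beta>) =
  (\<Sum>i<?n. \<Sum>j<?n. a i j) + ((\<Sum>i<?n. \<Sum>j<?n. b i j) + (\<Sum>i<?n. \<Sum>j<?n. b' i j))"
  by (simp add: sum.distrib)
 have "fsc (sg ((p + 1) * ed A j)) (mo A (Pi i j) (tmap A M N M' (p + 1 - ed A i) (q - ed A j) (DD A M M' p \<alpha> i) (\<beta> j))) =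
   b i j - (\<Sum>k<?n. u i j k)" if ij: "i < ?n" "j < ?n" for i j
 proof -
  have "tmap A M N M' (p + 1 - ed A i) (q - ed A j) (mo A (cc A i k) (\<alpha> k)) (\<beta> j) = mo A (cc A i k) (X k j)" if k: "k < ?n" for k
   unfolding X_def by (rule tmap_mo_left[OF famD[OF \<alpha> k] famD[OF \<beta> ij(2)] cc_ahom[OF dA ij(1) k] fin]) simp
  then show ?thesis
   unfolding DD_def tmap_diff_left tmap_sum_left b_def u_def Da_def
   by (simp add: mo_diff fsc_diff mo_sum fsc_sum)
 qed
 then have 2: "TT A Pi M N M' (p + 1) q (DD A M M' p \<alpha>) \<beta> =
  (\<Sum>i<?n. \<Sum>j<?n. b i j) - (\<Sum>i<?n. \<Sum>j<?n. \<Sum>k<?n. u i j k)"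
  by (simp add: TT_def sum_subtractf)
 have "fsc (sg p) (fsc (sg (p * ed A j)) (mo A (Pi i j) (tmap A M N M' (p - ed A i) (q + 1 - ed A j) (\<alpha> i) (DD A N N' q \<beta> j)))) =
   b' i j - (\<Sum>k<?n. v i j k)" if ij: "i < ?n" "j < ?n" for i j
 proof -
  have "tmap A M N M' (p - ed A i) (q + 1 - ed A j) (\<alpha> i) (mo A (cc A j k) (\<beta> k)) =
    fsc (sg ((1 + ed A k - ed A j) * (p - ed A i))) (mo A (cc A j k) (X i k))" if k: "k < ?n" for k
   unfolding X_def by (rule tmap_mo_right[OF famD[OF \<alpha> ij(1)] famD[OF \<beta> k] cc_ahom[OF dA ij(2) k] fin]) simp
  then show ?thesis
   unfolding DD_def tmap_diff_right tmap_sum_right b'_def v_def Db_def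
   by (simp add: mo_diff fsc_diff mo_sum fsc_sum)
 qed
 then have 3: "fsc (sg p) (TT A Pi M N M' p (q + 1) \<alpha> (DD A N N' q \<beta>)) =
  (\<Sum>i<?n. \<Sum>j<?n. b' i j) - (\<Sum>i<?n. \<Sum>j<?n. \<Sum>k<?n. v i j k)"
  by (simp add: TT_def fsc_sum sum_subtractf)
 \<comment> \<open>The Jacobian sums are relabelled so that each term contains \<open>X i j\<close>.
   The total coefficient of \<open>X i j\<close> is then, up to a common sign, the left side of
   \<open>closed\<close>.\<close>
 have "(\<Sum>i<?n. \<Sum>j<?n. \<Sum>k<?n. u i j k) = (\<Sum>i<?n. \<Sum>k<?n. \<Sum>j<?n. u i j k)"
  by (rule sum.cong[OF refl sum.swap])
 also have "\<dots> = (\<Sum>k<?n. \<Sum>i<?n. \<Sum>j<?n. u i j k)"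
  by (rule sum.swap)
 also have "\<dots> = (\<Sum>k<?n. \<Sum>j<?n. \<Sum>i<?n. u i j k)"
  by (rule sum.cong[OF refl sum.swap])
 finally have 4: "(\<Sum>i<?n. \<Sum>j<?n. \<Sum>k<?n. u i j k) = (\<Sum>i<?n. \<Sum>j<?n. \<Sum>k<?n. u k j i)" .
 have 5: "(\<Sum>i<?n. \<Sum>j<?n. \<Sum>k<?n. v i j k) = (\<Sum>i<?n. \<Sum>j<?n. \<Sum>k<?n. v i k j)"
  by (rule sum.cong[OF refl sum.swap])
 have "a i j + ((\<Sum>k<?n. u k j i) + (\<Sum>k<?n. v i k j)) = 0" if ij: "i < ?n" "j < ?n" for i j
 proof -
  have s: "sg ((p + 1) * ed A j) = (sg (p * ed A j) * sg (ed A j) :: 'k)"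
   "sg p * (sg (p * ed A k) * sg ((1 + ed A j - ed A k) * (p - ed A i))) =
    (sg (p * ed A j) * sg (ed A i * (1 + ed A j + ed A k)) :: 'k)" for k
   unfolding sg_add[symmetric] by (rule sg_eqI; auto)+
  have "a i j + ((\<Sum>k<?n. u k j i) + (\<Sum>k<?n. v i k j)) = fsc (sg (p * ed A j)) (mo A (adiff A (Pi i j) +
   (\<Sum>k<?n. fsm (sg (ed A j)) (amul A (Pi k j) (cc A k i)) +
     fsm (sg (ed A i * (1 + ed A j + ed A k))) (amul A (Pi i k) (cc A k j)))) (X i j))"
   by (simp only: mo_simps fsc_simps a_def u_def v_def s mo_add_left mo_sum_left fsc_add fsc_sum sum.distrib)
  with closed[OF ij] show ?thesis by simp
 qed
 then have "(\<Sum>i<?n. \<Sum>j<?n. a i j) + ((\<Sum>i<?n. \<Sum>j<?n. \<Sum>k<?n. u k j i) + (\<Sum>i<?n. \<Sum>j<?n. \<Sum>k<?n. v i k j)) = 0"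
  unfolding sum.distrib[symmetric] by (intro sum.neutral ballI) auto
 then show ?thesis
  unfolding 1 2 3 4 5 by (simp add: algebra_simps eq_neg_iff_add_eq_0)
qed

text \<open>Composition with h on the right leaves the Jacobian sum untouched, so this is the
  Leibniz rule for a composite, component by component.\<close>

lemma DD_rm:
 assumes "dmod A L" "dmod A M" "h \<in> lin_hom A L M p'" "\<alpha> \<in> fam A M N p" "i < ngen A" "q = p + p'"
 shows "DD A L N q (rm \<alpha> h) i = rm (DD A M N p \<alpha>) h i + fsc (sg p) (rm \<alpha> (hdiff L M p' h) i)"
proof -
 have s: "sg (ed A i) * sg (p - ed A i) = (sg p :: 'a)"
  unfolding sg_add[symmetric] by (rule sg_eqI) auto
 have "hdiff L N (q - ed A i) (\<lambda>x. \<alpha> i (h x)) =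
   (\<lambda>x. hdiff M N (p - ed A i) (\<alpha> i) (h x)) + fsc (sg (p - ed A i)) (\<lambda>x. \<alpha> i (hdiff L M p' h x))"
  by (rule hdiff_comp[OF assms(1,2) famD[OF assms(4,5)] assms(3)]) (simp add: assms(6))
 then show ?thesis
  unfolding DD_def rm_def
  by (intro ext[where f = "_ :: 'a mmap"])
   (simp add: fsc_add s mmap_apply fsc_apply mo_apply sum_mmap_apply msc_add)
qed

text \<open>Moving h past the coefficient \<open>cc A i j\<close> costs a sign that, up to the
  overall sign of p', turns the sign of \<open>lm\<close> at i into its sign at j. Hence h passes
  through the Jacobian sum.\<close>

lemma DD_lm:
 assumes dA: "adiff A \<in> der A 1" and dm: "dmod A M" "dmod A N" "dmod A L" and h: "h \<in> lin_hom A N L p'"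
  and \<alpha>: "\<alpha> \<in> fam A M N p" and i: "i < ngen A" and q: "q = p + p'"
 shows "DD A M L q (lm A p' h \<alpha>) i = lm A (p' + 1) (hdiff N L p' h) \<alpha> i + fsc (sg p') (lm A p' h (DD A M N p \<alpha>) i)"
proof (rule ext)
 fix x
 note fin = dm_finite[OF dm(1)] dm_finite[OF dm(2)]
 have hd: "hdiff M L (q - ed A i) (\<lambda>x. h (\<alpha> i x)) =
   (\<lambda>x. hdiff N L p' h (\<alpha> i x)) + fsc (sg p') (\<lambda>x. h (hdiff M N (p - ed A i) (\<alpha> i) x))"
  by (rule hdiff_comp[OF dm(1,2) h famD[OF \<alpha> i]]) (simp add: q)
 note hf = hdiff_fsc[OF dm(1,3) lin_hom_comp[OF h famD[OF \<alpha> i] fin(1) refl]]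
 have m: "\<alpha> j y \<in> mcar A (gens N)" if "j < ngen A" for j y
  by (rule lh_mcar[OF famD[OF \<alpha> that] fin(1)])
 have m': "hdiff M N (p - ed A i) (\<alpha> i) x \<in> mcar A (gens N)"
  by (rule lh_mcar[OF hdiff_lin_hom[OF dA dm(1,2) famD[OF \<alpha> i] refl] fin(1)])
 have hs: "h (\<Sum>j<ngen A. mact A (cc A i j) (\<alpha> j x)) =
   (\<Sum>j<ngen A. msc (sg (p' * (1 + ed A j - ed A i))) (mact A (cc A i j) (h (\<alpha> j x))))"
 proof -
  have "h (\<Sum>j<ngen A. mact A (cc A i j) (\<alpha> j x)) = (\<Sum>j<ngen A. h (mact A (cc A i j) (\<alpha> j x)))"
   by (rule lh_sum[OF h]) (auto intro!: mcar_mact m)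
  also have "\<dots> = (\<Sum>j<ngen A. msc (sg (p' * (1 + ed A j - ed A i))) (mact A (cc A i j) (h (\<alpha> j x))))"
   by (rule sum.cong[OF refl], rule lh_mact[OF h cc_ahom[OF dA i] m]) auto
  finally show ?thesis .
 qed
 have ms: "(\<Sum>j<ngen A. mact A (cc A i j) (\<alpha> j x)) \<in> mcar A (gens N)"
  by (auto intro!: mcar_sum mcar_mact m)
 have s: "sg p' * (sg (p' * ed A i) * sg (p' * (1 + ed A j - ed A i))) = (sg (p' * ed A j) :: 'a)"
  "sg (ed A i) * sg (p' * ed A i) = (sg ((p' + 1) * ed A i) :: 'a)"
  "sg (ed A i) * (sg (p' * ed A i) * sg p') = (sg p' * (sg (p' * ed A i) * sg (ed A i)) :: 'a)" for j
  unfolding sg_add[symmetric] by (rule sg_eqI; auto)+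
 show "DD A M L q (lm A p' h \<alpha>) i x =
   (lm A (p' + 1) (hdiff N L p' h) \<alpha> i + fsc (sg p') (lm A p' h (DD A M N p \<alpha>) i)) x"
  unfolding DD_def lm_def hf hd mmap_apply fsc_apply mo_apply sum_mmap_apply
   lh_diff[OF h mcar_msc[OF m'] ms] lh_msc[OF h m'] hs
  by (simp only: msc_add msc_diff msc_sum msc_simps mact_simps mult.assoc s) (simp only: add_diff_eq)
qed

subsection \<open>Coordinate derivatives on free modules\<close>

text \<open>The flat connection for which the chosen generators are constant. It is not A-linear and
  does not commute with differentials or morphisms; \<open>XX\<close> and \<open>dl\<close> measure
  the two failures.\<close>

definition nab :: "'z gvars_scheme \<Rightarrow> nat \<Rightarrow> 'k::field mel \<Rightarrow> 'k mel" where
 "nab A i x = (\<lambda>w. apar A i (x w))"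

lemma nab_0[simp]: "nab A i 0 = 0"
 by (simp add: nab_def fun_eq_iff fapp)

lemma nab_add: "nab A i (x + y) = nab A i x + nab A i y"
 by (simp add: nab_def fun_eq_iff fapp apar_add)

lemma nab_diff: "nab A i (x - y) = nab A i x - nab A i y"
 by (simp add: nab_def fun_eq_iff fapp apar_diff)

lemma nab_uminus: "nab A i (- x) = - nab A i x"
 by (simp add: nab_def fun_eq_iff fapp apar_uminus)

lemma nab_msc[simp]: "nab A i (msc c x) = msc c (nab A i x)"
 by (simp add: nab_def fun_eq_iff msc_def apar_fsm)

lemma nab_ge[simp]: "nab A i (ge w) = (0 :: 'k::field mel)"
 by (simp add: nab_def fun_eq_iff fapp ge_def)

lemma nab_mcar: "x \<in> mcar A W \<Longrightarrow> nab A i x \<in> mcar A W"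
 by (simp add: nab_def mcar_def acar_apar)

lemma nab_mhom: "x \<in> mhom A M k \<Longrightarrow> l = k - zdeg A i \<Longrightarrow> nab A i x \<in> mhom A M l"
 by (auto simp: mhom_def nab_mcar) (auto simp: nab_def intro!: ahom_apar)

lemma nab_mact:
 "a \<in> ahom A k \<Longrightarrow> x \<in> mcar A W \<Longrightarrow>
  nab A i (mact A a x) = mact A (apar A i a) x + msc (sg (zdeg A i * k)) (mact A a (nab A i x))"
 by (auto simp: nab_def mact_def msc_def fun_eq_iff fapp mcar_def apar_amul)

lemma nab_mact_ge:
 fixes a :: "'k::field fga"
 assumes "a \<in> ahom A k"
 shows "nab A i (mact A a (ge w)) = mact A (apar A i a) (ge w)"
 using nab_mact[OF assms mcar_ge[of w "{w}"], of i] by simp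

lemma nab_tel:
 fixes x :: "'k::field mel"
 assumes x: "x \<in> mhom A M j" and y: "y \<in> mcar A W"
 shows "nab A i (tel A (gdeg M) x y) =
  tel A (gdeg M) (nab A i x) y + msc (sg (zdeg A i * j)) (tel A (gdeg M) x (nab A i y))"
proof (rule ext)
 fix g
 show "nab A i (tel A (gdeg M) x y) g =
  (tel A (gdeg M) (nab A i x) y + msc (sg (zdeg A i * j)) (tel A (gdeg M) x (nab A i y))) g"
 proof (cases g)
  case (GPair v w)
  show ?thesis
  proof (cases "v \<in> gens M")
   case True
   then have xv: "x v \<in> ahom A (j - gdeg M v)" and yw: "ksgn A (gdeg M v) (y w) \<in> acar A"
    using x y by (auto simp: mhom_def mcar_def)
   have s: "sg (zdeg A i * (j - gdeg M v)) = (sg (zdeg A i * j) * sg (gdeg M v * zdeg A i) :: 'k)"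
    unfolding sg_add[symmetric] by (rule sg_eqI) auto
   show ?thesis
    by (simp add: GPair nab_def tel_def fapp msc_def apar_amul[OF xv yw] ksgn_apar amul_fsm_right s)
  next
   case False
   then have "x v = 0" using x by (simp add: mhom_def mcar_def)
   then show ?thesis by (simp add: GPair nab_def tel_def fapp msc_def)
  qed
 qed (simp add: nab_def tel_def fapp msc_def)
qed

section \<open>Commutators of coordinate derivatives and the Atiyah cocycle\<close>

lemma dcomm_der:
 fixes D D' :: "'k::field fga \<Rightarrow> 'k fga"
 assumes D: "D \<in> der V p" and D': "D' \<in> der V q"
 shows "dcomm p q D D' \<in> der V (p + q)"
 unfolding der_def mem_Collect_eq dcomm_def
proof (intro conjI allI impI ballI)
 fix a :: "'k fga" assume "a \<notin> acar V"
 then show "D (D' a) - fsm (sg (p * q)) (D' (D a)) = 0"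
  by (simp add: der_outside[OF D] der_outside[OF D'] der_0[OF D] der_0[OF D'])
next
 fix a b :: "'k fga" assume "a \<in> acar V" "b \<in> acar V"
 then show "D (D' (a + b)) - fsm (sg (p * q)) (D' (D (a + b))) =
   D (D' a) - fsm (sg (p * q)) (D' (D a)) + (D (D' b) - fsm (sg (p * q)) (D' (D b)))"
  by (simp add: der_add[OF D] der_add[OF D'] acar_der[OF D] acar_der[OF D'] fsm_add)
next
 fix c and a :: "'k fga" assume "a \<in> acar V"
 then show "D (D' (fsm c a)) - fsm (sg (p * q)) (D' (D (fsm c a))) =
   fsm c (D (D' a) - fsm (sg (p * q)) (D' (D a)))"
  by (simp add: der_fsm[OF D] der_fsm[OF D'] acar_der[OF D] acar_der[OF D'] fsm_diff mult.commute)
next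
 fix k and a :: "'k fga" assume "a \<in> ahom V k"
 then show "D (D' a) - fsm (sg (p * q)) (D' (D a)) \<in> ahom V (k + (p + q))"
  by (intro ahom_diff ahom_fsm der_ahom[OF D] der_ahom[OF D']) auto
next
 fix k and a b :: "'k fga" assume a: "a \<in> ahom V k" and b: "b \<in> acar V"
 note Da = der_ahom[OF D a refl] and D'a = der_ahom[OF D' a refl]
 show "D (D' (amul V a b)) - fsm (sg (p * q)) (D' (D (amul V a b))) =
   amul V (D (D' a) - fsm (sg (p * q)) (D' (D a))) b +
   fsm (sg ((p + q) * k)) (amul V a (D (D' b) - fsm (sg (p * q)) (D' (D b))))"
  by (cases "even p"; cases "even q"; cases "even k")
    (simp_all add: der_amul[OF D a b] der_amul[OF D' a b] der_add[OF D] der_add[OF D'] der_uminus[OF D] der_uminus[OF D']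
    der_diff[OF D] der_diff[OF D'] acar_uminus acar_diff
    der_amul[OF D D'a b] der_amul[OF D' Da b] der_amul[OF D a acar_der[OF D']] der_amul[OF D' a acar_der[OF D]]
    sg_def fsm_uminus_left fsm_uminus amul_diff_left amul_diff_right amul_add_left amul_add_right algebra_simps)
qed

text \<open>The coordinate derivation set to 0 outside the carrier, as membership in
  \<open>der\<close> requires.\<close>

definition par :: "'z gvars_scheme \<Rightarrow> nat \<Rightarrow> 'k::field fga \<Rightarrow> 'k fga" where
 "par V i = ader V (\<lambda>j. if j = i then 1 else 0)"

lemma par_der: "i < ngen V \<Longrightarrow> par V i \<in> der V (- zdeg V i)"
 unfolding par_def by (rule ader_der) simp

lemma par_apply:
 assumes "i < ngen V" "a \<in> acar V"
 shows "par V i a = apar V i a"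
proof -
 have "par V i a = (\<Sum>j<ngen V. if j = i then apar V i a else 0)"
  unfolding par_def ader_apply[OF assms(2)]
  by (intro sum.cong refl) (use assms in \<open>auto simp: amul_1_left acar_apar\<close>)
 with assms show ?thesis by simp
qed

lemma par_avar: "j < ngen V \<Longrightarrow> par V i (avar j) = (if j = i then 1 else 0)"
 unfolding par_def by (subst ader_avar) auto

text \<open>The left side is the graded commutator of d/dz_i and d_A. It is a derivation, hence
  determined by its values on the generators, and these form the Jacobian matrix. The plus sign
  arises as |z_i| and \<open>ed A i\<close> have opposite parity.\<close>

lemma apar_adiff:
 fixes A :: "'k::field cdga"
 assumes dA: "adiff A \<in> der A 1" and i: "i < ngen A" and a: "a \<in> acar A"
 shows "apar A i (adiff A a) + fsm (sg (ed A i)) (adiff A (apar A i a)) =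
  (\<Sum>j<ngen A. amul A (cc A i j) (apar A j a))"
proof -
 note D = dcomm_der[OF par_der[OF i] dA]
 have s: "sg (ed A i) = (- sg (zdeg A i) :: 'k)" by (simp add: sg_def)
 have "dcomm (- zdeg A i) 1 (par A i) (adiff A) a = apar A i (adiff A a) + fsm (sg (ed A i)) (adiff A (apar A i a))"
  by (simp add: dcomm_def par_apply[OF i a] par_apply[OF i acar_der[OF dA]] s fsm_uminus_left)
 moreover have "dcomm (- zdeg A i) 1 (par A i) (adiff A) (avar j) = cc A i j" if j: "j < ngen A" for j
  unfolding dcomm_def cc_def
  by (simp add: par_avar[OF j] par_apply[OF i acar_der[OF dA]] der_1[OF dA] der_0[OF dA])
 ultimately show ?thesis
  using der_apply[OF D a] by simp
qed

text \<open>The components of the Atiyah cocycle of M. The definition differentiates the matrix of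
  the differential; the intrinsic form, a corrected commutator of \<open>nab\<close> with the
  differential, is \<open>XX_apply\<close>.\<close>

definition XX :: "'k::field cdga \<Rightarrow> 'k sfmod \<Rightarrow> nat \<Rightarrow> 'k mmap" where
 "XX A M i = alin A (gens M) (0 - ed A i) (\<lambda>w. nab A i (mdiff M (ge w)))"

text \<open>The components of the coherence of \<xi> at h. Up to sign it is the commutator of h with
  the connection, as \<open>dl_apply\<close> shows.\<close>

definition dl :: "'k::field cdga \<Rightarrow> 'k sfmod \<Rightarrow> int \<Rightarrow> 'k mmap \<Rightarrow> nat \<Rightarrow> 'k mmap" where
 "dl A M p h i = alin A (gens M) (p - 1 - ed A i) (\<lambda>w. - nab A i (h (ge w)))"

context
 fixes A :: "'k::field cdga"
 assumes dA: "adiff A \<in> der A 1"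
begin

lemma XX_fam: "dmod A M \<Longrightarrow> XX A M \<in> fam A M M 0"
 unfolding fam_def XX_def mem_Collect_eq
proof (intro allI impI)
 fix i assume M: "dmod A M" and i: "i < ngen A"
 show "alin A (gens M) (0 - ed A i) (\<lambda>w. nab A i (mdiff M (ge w))) \<in> lin_hom A M M (0 - ed A i)"
  by (rule alin_lin_hom[OF dm_finite[OF M] _ refl])
    (auto intro!: nab_mhom[OF dm_mhom[OF M mhom_ge[OF _ refl] refl]])
qed

lemma XX_ge: "dmod A M \<Longrightarrow> w \<in> gens M \<Longrightarrow> XX A M i (ge w) = nab A i (mdiff M (ge w))"
 unfolding XX_def by (subst alin_ge[where W' = "gens M"]) (auto intro!: nab_mcar dm_mcar dm_finite)

lemma dl_fam:
 assumes h: "h \<in> lin_hom A M N p" and "finite (gens M)" "q = p - 1"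
 shows "dl A M p h \<in> fam A M N q"
 unfolding fam_def dl_def mem_Collect_eq assms(3)
proof (intro allI impI)
 fix i assume i: "i < ngen A"
 show "alin A (gens M) (p - 1 - ed A i) (\<lambda>w. - nab A i (h (ge w))) \<in> lin_hom A M N (p - 1 - ed A i)"
  by (rule alin_lin_hom[OF assms(2) _ refl])
    (auto intro!: mhom_uminus nab_mhom[OF lh_mhom[OF h mhom_ge[OF _ refl] refl]])
qed

lemma dl_ge:
 assumes h: "h \<in> lin_hom A M N p" and "finite (gens M)" "w \<in> gens M"
 shows "dl A M p h i (ge w) = - nab A i (h (ge w))"
 unfolding dl_def by (subst alin_ge[where W' = "gens N"]) (auto intro!: mcar_uminus nab_mcar lh_mcar[OF h] assms)

text \<open>On a multiple a w, the terms on the right in which a is differentiated form the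
  commutator of d/dz_i and d_A applied to a. By \<open>apar_adiff\<close> the Jacobian sum removes
  it, so the right side is linear over A and agrees with \<open>XX\<close> on generators.\<close>

lemma XX_apply:
 assumes M: "dmod A M" and i: "i < ngen A" and x: "x \<in> mcar A (gens M)"
 shows "XX A M i x = nab A i (mdiff M x) + msc (sg (ed A i)) (mdiff M (nab A i x)) -
  (\<Sum>j<ngen A. mact A (cc A i j) (nab A j x))"
 using x dm_finite[OF M]
proof (induction x rule: mcar_induct)
 case zero
 then show ?case by (simp add: lh_0[OF famD[OF XX_fam[OF M] i]] dm_0[OF M])
next
 case (act k a w)
 note a = act(1) and g = mcar_ge[OF act(2), of A]
 note da = der_ahom[OF dA a refl] and pa = ahom_apar[OF a refl, of i]
 have "(\<Sum>j<ngen A. mact A (amul A (cc A i j) (apar A j a)) (ge w)) =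
   mact A (apar A i (adiff A a)) (ge w) + msc (sg (ed A i)) (mact A (adiff A (apar A i a)) (ge w))"
  by (simp only: mact_sum_left[symmetric] apar_adiff[OF dA i ahom_acar[OF a], symmetric] mact_add_left mact_simps)
 then show ?case
  unfolding lh_mact[OF famD[OF XX_fam[OF M] i] a g] XX_ge[OF M act(2)] dm_mact[OF M a g] nab_add nab_msc
   nab_mact_ge[OF a] nab_mact_ge[OF da] nab_mact[OF a dm_mcar[OF M]] dm_mact[OF M pa g]
  by (cases "even k"; cases "even (zdeg A i)")
    (simp_all add: sg_def mod_distrib mact_sum_left nab_mact_ge[OF a] algebra_simps)
next
 case (plus x y)
 show ?case
  unfolding lh_add[OF famD[OF XX_fam[OF M] i] plus(1,2)] plus(3,4) dm_add[OF M plus(1,2)] nab_add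
   dm_add[OF M nab_mcar[OF plus(1)] nab_mcar[OF plus(2)]] msc_add mact_add sum.distrib
  by simp
qed

lemma dl_apply:
 assumes h: "h \<in> lin_hom A M N p" and fin: "finite (gens M)" and i: "i < ngen A" and x: "x \<in> mcar A (gens M)"
 shows "dl A M p h i x = msc (sg (zdeg A i * p)) (h (nab A i x)) - nab A i (h x)"
proof -
 note L = famD[OF dl_fam[OF h fin refl] i]
 show ?thesis
  using x fin
 proof (induction x rule: mcar_induct)
  case (act k a w)
  note a = act(1) and g = mcar_ge[OF act(2), of A]
  show ?case
   unfolding lh_mact[OF L a g] lh_mact[OF h a g] nab_mact_ge[OF a] lh_mact[OF h ahom_apar[OF a refl] g]
    dl_ge[OF h fin act(2)] nab_msc nab_mact[OF a lh_mcar[OF h fin]]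
   by (cases "even k"; cases "even (zdeg A i)"; cases "even p")
     (simp_all add: sg_def mod_distrib algebra_simps)
 qed (simp_all add: lh_0[OF L] lh_0[OF h] lh_add[OF L] lh_add[OF h] nab_add nab_mcar mod_distrib algebra_simps)
qed

text \<open>Evaluated at d w, the formula of \<open>XX_apply\<close> loses one term by d^2 = 0. What
  remains expresses \<open>XX\<close> at d w by the differential and the Jacobian sum of
  \<open>XX\<close> at w, and this is closedness.\<close>

lemma DD_XX:
 assumes M: "dmod A M" and sq: "\<And>x. x \<in> mcar A (gens M) \<Longrightarrow> mdiff M (mdiff M x) = 0" and i: "i < ngen A"
 shows "DD A M M 0 (XX A M) i = 0"
proof (rule lin_hom_eqI[OF famD[OF DD_fam[OF dA M M XX_fam[OF M] refl] i] lin_hom_0 dm_finite[OF M] refl])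
 fix w assume w: "w \<in> gens M"
 note g = mcar_ge[OF w, of A]
 have "XX A M i (mdiff M (ge w)) = msc (sg (ed A i)) (mdiff M (XX A M i (ge w))) -
   (\<Sum>j<ngen A. mact A (cc A i j) (XX A M j (ge w)))"
  by (simp add: XX_apply[OF M i dm_mcar[OF M]] sq[OF g] XX_ge[OF M w])
 then show "DD A M M 0 (XX A M) i (ge w) = 0 (ge w)"
  by (cases "even (zdeg A i)")
    (simp_all add: zero_fun_apply DD_def hdiff_def mmap_apply fsc_apply mo_apply sum_mmap_apply sg_def mod_distrib)
qed

text \<open>A Jacobi identity: \<open>XX\<close> is the corrected commutator of the connection with
  d, and \<open>dl\<close> minus the commutator of the connection with h. So the commutator of h
  with \<open>XX\<close> is the derivative of the differential of h plus the differential of the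
  derivative of h.\<close>

lemma XX_commutator:
 assumes M: "dmod A M" and N: "dmod A N" and h: "h \<in> lin_hom A M N p" and i: "i < ngen A"
 shows "lm A p h (XX A M) i - rm (XX A N) h i =
  dl A M (p + 1) (hdiff M N p h) i + DD A M N (p - 1) (dl A M p h) i"
proof (rule lin_hom_eqI)
 note fin = dm_finite[OF M]
 note dh = hdiff_lin_hom[OF dA M N h refl]
 show "lm A p h (XX A M) i - rm (XX A N) h i \<in> lin_hom A M N (p - ed A i)"
  by (rule lin_hom_diff[OF famD[OF lm_fam[OF h XX_fam[OF M] fin] i] famD[OF rm_fam[OF h XX_fam[OF N] fin] i]]) auto
 show "dl A M (p + 1) (hdiff M N p h) i + DD A M N (p - 1) (dl A M p h) i \<in> lin_hom A M N (p - ed A i)"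
  by (rule lin_hom_add[OF famD[OF dl_fam[OF dh fin] i] famD[OF DD_fam[OF dA M N dl_fam[OF h fin refl]] i]]) auto
 show "finite (gens M)" by (rule fin)
 fix w assume w: "w \<in> gens M"
 note g = mcar_ge[OF w, of A]
 show "(lm A p h (XX A M) i - rm (XX A N) h i) (ge w) =
   (dl A M (p + 1) (hdiff M N p h) i + DD A M N (p - 1) (dl A M p h) i) (ge w)"
  unfolding mmap_apply lm_def rm_def fsc_apply XX_ge[OF M w] XX_apply[OF N i lh_mcar[OF h fin]] dl_ge[OF dh fin w]
   DD_def sum_mmap_apply mo_apply dl_ge[OF h fin w]
  unfolding mmap_apply sum_mmap_apply fsc_apply mo_apply hdiff_def dl_ge[OF h fin w] dl_apply[OF h fin i dm_mcar[OF M]]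
  by (cases "even (zdeg A i)"; cases "even p")
    (simp_all add: sg_def mod_distrib nab_diff nab_add nab_uminus dm_uminus[OF N] nab_mcar lh_mcar[OF h fin]
     sum_negf algebra_simps)
qed simp

text \<open>Commuting with the connection is a derivation for composition. This is the source of the
  third axiom of a pseudo-natural transformation.\<close>

lemma dl_comp:
 assumes h: "h \<in> lin_hom A M N 0" and h': "h' \<in> lin_hom A N L 0" and fin: "finite (gens M)" "finite (gens N)"
  and i: "i < ngen A"
 shows "dl A M 0 (\<lambda>x. h' (h x)) i = rm (dl A N 0 h') h i + lm A 0 h' (dl A M 0 h) i"
proof (rule lin_hom_eqI)
 note hh = lin_hom_comp[OF h' h fin(1), of 0, simplified]
 show "dl A M 0 (\<lambda>x. h' (h x)) i \<in> lin_hom A M L (- 1 - ed A i)"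
  by (rule famD[OF dl_fam[OF hh fin(1)] i]) simp
 show "rm (dl A N 0 h') h i + lm A 0 h' (dl A M 0 h) i \<in> lin_hom A M L (- 1 - ed A i)"
  by (rule lin_hom_add[OF famD[OF rm_fam[OF h dl_fam[OF h' fin(2) refl] fin(1)] i]
    famD[OF lm_fam[OF h' dl_fam[OF h fin(1) refl] fin(1)] i]]) auto
 show "finite (gens M)" by (rule fin)
 fix w assume w: "w \<in> gens M"
 show "dl A M 0 (\<lambda>x. h' (h x)) i (ge w) = (rm (dl A N 0 h') h i + lm A 0 h' (dl A M 0 h) i) (ge w)"
  unfolding dl_ge[OF hh fin(1) w] mmap_apply rm_def lm_def fsc_apply dl_ge[OF h fin(1) w]
   dl_apply[OF h' fin(2) i lh_mcar[OF h fin(1)]]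
  by (simp add: lh_uminus[OF h'] nab_mcar lh_mcar[OF h fin(1)])
qed simp

text \<open>The tensor differential and the connection obey Leibniz rules, and the generators are
  constant for the connection, so no mixed terms occur. Both hexagons rest on this
  splitting.\<close>

lemma XX_mtens:
 assumes M: "dmod A M" and N: "dmod A N" and i: "i < ngen A"
 shows "XX A (mtens A M N) i =
  tmap A M N M (0 - ed A i) 0 (XX A M i) (mid A N) + tmap A M N M 0 (0 - ed A i) (mid A M) (XX A N i)"
proof (rule lin_hom_eqI)
 note MN = mtens_dmod[OF dA M N] and fin = dm_finite[OF M] dm_finite[OF N]
 note x = famD[OF XX_fam[OF M] i] and y = famD[OF XX_fam[OF N] i]
 show "XX A (mtens A M N) i \<in> lin_hom A (mtens A M N) (mtens A M N) (0 - ed A i)"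
  by (rule famD[OF XX_fam[OF MN] i])
 show "tmap A M N M (0 - ed A i) 0 (XX A M i) (mid A N) + tmap A M N M 0 (0 - ed A i) (mid A M) (XX A N i)
   \<in> lin_hom A (mtens A M N) (mtens A M N) (0 - ed A i)"
  by (rule lin_hom_add[OF tmap_lin_hom[OF x lin_hom_mid fin] tmap_lin_hom[OF lin_hom_mid y fin]]) auto
 show "finite (gens (mtens A M N))" by (rule dm_finite[OF MN])
 fix g assume "g \<in> gens (mtens A M N)"
 then obtain v w where g: "g = GPair v w" "v \<in> gens M" "w \<in> gens N" by (rule gens_mtensE)
 have vw: "GPair v w \<in> gens (mtens A M N)" using g by simp
 note gv = mhom_ge[OF g(2) refl, of A] and gw = mcar_ge[OF g(3), of A]
 show "XX A (mtens A M N) i (ge g) =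
   (tmap A M N M (0 - ed A i) 0 (XX A M i) (mid A N) + tmap A M N M 0 (0 - ed A i) (mid A M) (XX A N i)) (ge g)"
  unfolding g(1) XX_ge[OF MN vw] mmap_apply tmap_ge[OF x lin_hom_mid fin g(2,3)] tmap_ge[OF lin_hom_mid y fin g(2,3)]
   mid_ge[OF g(2)] mid_ge[OF g(3)] mdiff_mtens_ge[OF dA M N g(2,3)] nab_add nab_msc
   nab_tel[OF dm_mhom[OF M gv refl] gw] nab_tel[OF gv dm_mcar[OF N]] XX_ge[OF M g(2)] XX_ge[OF N g(3)]
  by (cases "even (zdeg A i)"; cases "even (gdeg M v)") (simp_all add: sg_def mod_distrib)
qed simp

text \<open>The counterpart of the splitting of \<open>XX\<close> for morphisms of degree 0; it
  gives the hexagons for the coherence maps.\<close>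

lemma dl_tmap:
 assumes h: "h \<in> lin_hom A M M' 0" and k: "k \<in> lin_hom A N N' 0" and fin: "finite (gens M)" "finite (gens N)"
  and i: "i < ngen A"
 shows "dl A (mtens A M N) 0 (tmap A M N M' 0 0 h k) i =
  tmap A M N M' (- 1 - ed A i) 0 (dl A M 0 h i) k + tmap A M N M' 0 (- 1 - ed A i) h (dl A N 0 k i)"
proof (rule lin_hom_eqI)
 note T = tmap_lin_hom[OF h k fin, of 0, simplified] and F = finite_gens_mtens[OF fin, of A]
 have x: "dl A M 0 h i \<in> lin_hom A M M' (- 1 - ed A i)" and y: "dl A N 0 k i \<in> lin_hom A N N' (- 1 - ed A i)"
  by (rule famD[OF dl_fam[OF h fin(1)] i], simp, rule famD[OF dl_fam[OF k fin(2)] i], simp)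
 show "dl A (mtens A M N) 0 (tmap A M N M' 0 0 h k) i \<in> lin_hom A (mtens A M N) (mtens A M' N') (- 1 - ed A i)"
  by (rule famD[OF dl_fam[OF T F] i]) simp
 show "tmap A M N M' (- 1 - ed A i) 0 (dl A M 0 h i) k + tmap A M N M' 0 (- 1 - ed A i) h (dl A N 0 k i)
   \<in> lin_hom A (mtens A M N) (mtens A M' N') (- 1 - ed A i)"
  by (rule lin_hom_add[OF tmap_lin_hom[OF x k fin] tmap_lin_hom[OF h y fin]]) auto
 show "finite (gens (mtens A M N))" by (rule F)
 fix g assume "g \<in> gens (mtens A M N)"
 then obtain v w where g: "g = GPair v w" "v \<in> gens M" "w \<in> gens N" by (rule gens_mtensE)
 have vw: "GPair v w \<in> gens (mtens A M N)" using g by simp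
 note hv = lh_mhom[OF h mhom_ge[OF g(2) refl] refl]
 show "dl A (mtens A M N) 0 (tmap A M N M' 0 0 h k) i (ge g) =
   (tmap A M N M' (- 1 - ed A i) 0 (dl A M 0 h i) k + tmap A M N M' 0 (- 1 - ed A i) h (dl A N 0 k i)) (ge g)"
  unfolding g(1) dl_ge[OF T F vw] mmap_apply tmap_ge[OF x k fin g(2,3)] tmap_ge[OF h y fin g(2,3)]
   tmap_ge[OF h k fin g(2,3)] nab_msc nab_tel[OF hv lh_mcar[OF k fin(2)]] dl_ge[OF h fin(1) g(2)] dl_ge[OF k fin(2) g(3)]
  by (cases "even (zdeg A i)"; cases "even (gdeg M v)") (simp_all add: sg_def mod_distrib)
qed simp

end

section \<open>Components and coherence homotopies of the braiding\<close>

lemma lam_zero[simp]: "(\<lambda>x. 0) = 0"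
 by (simp add: zero_fun_def)

lemma dmod_sf: "is_sfmod A M \<Longrightarrow> finite (gens M)"
 by (simp add: is_sfmod_def)

lemma hdiff_braid:
 fixes A :: "'k::field cdga"
 assumes dA: "adiff A \<in> der A 1" and M: "dmod A M" and N: "dmod A N"
 shows "hdiff (mtens A M N) (mtens A N M) 0 (braid A M N) = 0"
proof (rule lin_hom_eqI)
 note fin = dm_finite[OF M] dm_finite[OF N] and MN = mtens_dmod[OF dA M N] and NM = mtens_dmod[OF dA N M]
 note B = braid_lin_hom[OF fin, of A]
 show "hdiff (mtens A M N) (mtens A N M) 0 (braid A M N) \<in> lin_hom A (mtens A M N) (mtens A N M) 1"
  by (rule hdiff_lin_hom[OF dA MN NM B]) simp
 show "0 \<in> lin_hom A (mtens A M N) (mtens A N M) 1" by simp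
 show "finite (gens (mtens A M N))" by (rule dm_finite[OF MN])
 fix g assume "g \<in> gens (mtens A M N)"
 then obtain v w where g: "g = GPair v w" "v \<in> gens M" "w \<in> gens N" by (rule gens_mtensE)
 have wv: "GPair w v \<in> gens (mtens A N M)" using g by simp
 note gv = mhom_ge[OF g(2) refl, of A] and gw = mhom_ge[OF g(3) refl, of A]
 note dv = dm_mhom[OF M gv refl] and dw = dm_mhom[OF N gw refl]
 show "hdiff (mtens A M N) (mtens A N M) 0 (braid A M N) (ge g) = 0 (ge g)"
  unfolding g(1) hdiff_def zero_fun_apply mdiff_mtens_ge[OF dA M N g(2,3)] braid_ge[OF fin g(2,3)]
   dm_msc[OF NM mcar_ge[OF wv]] mdiff_mtens_ge[OF dA N M g(3,2)]
   lh_add[OF B tel_mcar[OF mhom_mcar[OF dv] mhom_mcar[OF gw]] mcar_msc[OF tel_mcar[OF mhom_mcar[OF gv] mhom_mcar[OF dw]]]]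
   lh_msc[OF B tel_mcar[OF mhom_mcar[OF gv] mhom_mcar[OF dw]]] braid_tel[OF fin dv gw] braid_tel[OF fin gv dw]
  by (cases "even (gdeg M v)"; cases "even (gdeg N w)") (simp_all add: sg_def mod_distrib flip: zero_fun_def)
qed simp

lemma lm_simps:
 "lm A 0 h \<alpha> i = (\<lambda>x. h (\<alpha> i x))"
 by (simp add: lm_def)

lemma dl_0[simp]: "dl A M p 0 i = 0"
 by (rule ext) (simp add: dl_def alin_def fapp zero_fun_apply)

lemma rm_apply: "rm \<alpha> h i = (\<lambda>x. \<alpha> i (h x))"
 by (simp add: rm_def)

lemma rm_zero: "\<alpha> \<in> fam A M N p \<Longrightarrow> i < ngen A \<Longrightarrow> rm \<alpha> 0 i = 0"
 by (rule ext) (simp add: rm_def zero_fun_apply lh_0[OF famD])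

lemma lm_zero: "lm A p 0 \<alpha> i = 0"
 by (rule ext) (simp add: lm_def zero_fun_apply fsc_apply)

text \<open>In \<open>closed\<close> the Lie derivative of the bivector along d_A is spelled out in
  coordinates, one Jacobian term for each index. Symmetry refers to the shifted degrees
  \<open>ed\<close>.\<close>

locale poisson_data = bivector A Pi for A :: "'k::field cdga" and Pi +
 assumes dA: "adiff A \<in> der A 1"
  and closed: "\<And>i j. i < ngen A \<Longrightarrow> j < ngen A \<Longrightarrow> adiff A (Pi i j) +
   (\<Sum>k<ngen A. fsm (sg (ed A j)) (amul A (Pi k j) (cc A k i)) +
     fsm (sg (ed A i * (1 + ed A j + ed A k))) (amul A (Pi i k) (cc A k j))) = 0"
  and sym: "\<And>i j. i < ngen A \<Longrightarrow> j < ngen A \<Longrightarrow> Pi j i = fsm (sg (ed A i * ed A j)) (Pi i j)"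
begin

abbreviation "TP \<equiv> TT A Pi"

definition tt :: "'k sfmod \<Rightarrow> 'k sfmod \<Rightarrow> 'k mmap" where
 "tt M N = TP M N M 0 0 (XX A M) (XX A N)"

text \<open>In \<open>S1\<close> the Atiyah cocycle is taken after h, in \<open>S2\<close> before k.
  This choice of order makes their boundaries telescope in \<open>tt_natural\<close>; it also makes
  their sum asymmetric, which has to be repaired in \<open>SS_braid\<close>.\<close>

definition S1 where "S1 M N M' N' h k = TP M N M' 0 (- 1) (rm (XX A M') h) (dl A N 0 k)"
definition S2 where "S2 M N M' N' h k = TP M N M' (- 1) 0 (dl A M 0 h) (lm A 0 k (XX A N))"

definition SS :: "'k sfmod \<Rightarrow> 'k sfmod \<Rightarrow> 'k sfmod \<Rightarrow> 'k sfmod \<Rightarrow> 'k mmap \<Rightarrow> 'k mmap \<Rightarrow> 'k mmap" where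
 "SS M N M' N' h k = S1 M N M' N' h k + S2 M N M' N' h k"

abbreviation cl :: "'k sfmod \<Rightarrow> 'k sfmod \<Rightarrow> 'k mmap set" where
 "cl M N \<equiv> {h \<in> lin_hom A M N 0. hdiff M N 0 h = 0}"

abbreviation nl :: "'k sfmod \<Rightarrow> 'k sfmod \<Rightarrow> 'k mmap set" where
 "nl M N \<equiv> hdiff M N (- 2) ` lin_hom A M N (- 2)"

lemma tt_lin_hom: "dmod A M \<Longrightarrow> dmod A N \<Longrightarrow> tt M N \<in> lin_hom A (mtens A M N) (mtens A M N) 0"
 unfolding tt_def by (rule TT_lin_hom[OF XX_fam[OF dA] XX_fam[OF dA]]) (auto intro: dm_finite)

context
 fixes M N M' N' :: "'k sfmod"
 assumes dm: "dmod A M" "dmod A N" "dmod A M'" "dmod A N'"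
begin

lemma S_lin_hom:
 assumes "h \<in> lin_hom A M M' 0" "k \<in> lin_hom A N N' 0"
 shows "S1 M N M' N' h k \<in> lin_hom A (mtens A M N) (mtens A M' N') (- 1)"
  and "S2 M N M' N' h k \<in> lin_hom A (mtens A M N) (mtens A M' N') (- 1)"
  and "SS M N M' N' h k \<in> lin_hom A (mtens A M N) (mtens A M' N') (- 1)"
proof -
 note fin = dm_finite[OF dm(1)] dm_finite[OF dm(2)]
 show 1: "S1 M N M' N' h k \<in> lin_hom A (mtens A M N) (mtens A M' N') (- 1)"
  unfolding S1_def
  by (rule TT_lin_hom[OF rm_fam[OF assms(1) XX_fam[OF dA dm(3)] fin(1)] dl_fam[OF dA assms(2) fin(2)] fin]) auto
 show 2: "S2 M N M' N' h k \<in> lin_hom A (mtens A M N) (mtens A M' N') (- 1)"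
  unfolding S2_def
  by (rule TT_lin_hom[OF dl_fam[OF dA assms(1) fin(1)] lm_fam[OF assms(2) XX_fam[OF dA dm(2)] fin(2)] fin]) auto
 show "SS M N M' N' h k \<in> lin_hom A (mtens A M N) (mtens A M' N') (- 1)"
  unfolding SS_def by (rule lin_hom_add[OF 1 2])
qed

end

lemma dl_add: "dl A M p (h + h') = dl A M p h + dl A M p h'"
proof (rule ext)
 fix i
 show "dl A M p (h + h') i = (dl A M p h + dl A M p h') i"
  unfolding dl_def fam_apply alin_add_value[symmetric] by (simp add: mmap_apply nab_add)
qed

lemma dl_fsc: "dl A M p (fsc c h) i = fsc c (dl A M p h i)"
 unfolding dl_def alin_msc_value[symmetric] by (simp add: fsc_apply msc_uminus)

lemma SS_fsc_left:
 assumes "dmod A M'" "h \<in> lin_hom A M M' 0" "finite (gens M)"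
 shows "SS M N M' N' (fsc c h) k = fsc c (SS M N M' N' h k)"
proof -
 have "TP M N M' 0 (- 1) (rm (XX A M') (fsc c h)) (dl A N 0 k) = TP M N M' 0 (- 1) (\<lambda>i. fsc c (rm (XX A M') h i)) (dl A N 0 k)"
  by (rule TT_cong[OF _ refl], rule ext)
    (simp add: rm_def fsc_apply lh_msc[OF famD[OF XX_fam[OF dA assms(1)]] lh_mcar[OF assms(2,3)]])
 moreover have "TP M N M' (- 1) 0 (dl A M 0 (fsc c h)) (lm A 0 k (XX A N)) =
   TP M N M' (- 1) 0 (\<lambda>i. fsc c (dl A M 0 h i)) (lm A 0 k (XX A N))"
  by (rule TT_cong[OF _ refl]) (rule dl_fsc)
 ultimately show ?thesis
  by (simp add: SS_def S1_def S2_def TT_fsc_left fsc_add)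
qed

lemma SS_fsc_right: "SS M N M' N' h (fsc c k) = fsc c (SS M N M' N' h k)"
proof -
 have "TP M N M' 0 (- 1) (rm (XX A M') h) (dl A N 0 (fsc c k)) = TP M N M' 0 (- 1) (rm (XX A M') h) (\<lambda>i. fsc c (dl A N 0 k i))"
  by (rule TT_cong[OF refl]) (rule dl_fsc)
 moreover have "TP M N M' (- 1) 0 (dl A M 0 h) (lm A 0 (fsc c k) (XX A N)) =
   TP M N M' (- 1) 0 (dl A M 0 h) (\<lambda>i. fsc c (lm A 0 k (XX A N) i))"
  by (rule TT_cong[OF refl]) (simp add: lm_def fsc_def)
 ultimately show ?thesis
  by (simp add: SS_def S1_def S2_def TT_fsc_right fsc_add)
qed

lemma SS_add_left:
 assumes "dmod A M'" "h \<in> lin_hom A M M' 0" "h' \<in> lin_hom A M M' 0" "finite (gens M)"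
 shows "SS M N M' N' (h + h') k = SS M N M' N' h k + SS M N M' N' h' k"
proof -
 have "TP M N M' 0 (- 1) (rm (XX A M') (h + h')) (dl A N 0 k) =
   TP M N M' 0 (- 1) (rm (XX A M') h + rm (XX A M') h') (dl A N 0 k)"
  by (rule TT_cong[OF _ refl], rule ext)
    (simp add: rm_def fam_apply mmap_apply
     lh_add[OF famD[OF XX_fam[OF dA assms(1)]] lh_mcar[OF assms(2,4)] lh_mcar[OF assms(3,4)]])
 then show ?thesis
  by (simp add: SS_def S1_def S2_def TT_add_left dl_add)
qed

lemma SS_add_right: "SS M N M' N' h (k + k') = SS M N M' N' h k + SS M N M' N' h k'"
proof -
 have "TP M N M' (- 1) 0 (dl A M 0 h) (lm A 0 (k + k') (XX A N)) =
   TP M N M' (- 1) 0 (dl A M 0 h) (lm A 0 k (XX A N) + lm A 0 k' (XX A N))"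
  by (rule TT_cong[OF refl], rule ext) (simp add: lm_def fam_apply mmap_apply)
 then show ?thesis
  by (simp add: SS_def S1_def S2_def TT_add_right dl_add)
qed

context
 fixes M N M' N' :: "'k sfmod"
 assumes sf: "is_sfmod A M" "is_sfmod A N" "is_sfmod A M'" "is_sfmod A N'"
begin

private lemmas dm = sf[THEN is_sfmod_dmod]
private lemmas fin = dm[THEN dm_finite]

lemma DD_XX_sf: "is_sfmod A L \<Longrightarrow> i < ngen A \<Longrightarrow> DD A L L 0 (XX A L) i = 0"
 by (rule DD_XX[OF dA is_sfmod_dmod is_sfmod_square])

lemma DD_rm_XX:
 assumes "is_sfmod A K" "is_sfmod A L" "h \<in> lin_hom A K L p" "i < ngen A"
 shows "DD A K L p (rm (XX A L) h) i = rm (XX A L) (hdiff K L p h) i"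
 using DD_rm[OF is_sfmod_dmod[OF assms(1)] is_sfmod_dmod[OF assms(2)] assms(3) XX_fam[OF dA is_sfmod_dmod[OF assms(2)]] assms(4), of p]
  DD_XX_sf[OF assms(2,4)]
 by (simp add: rm_apply) (simp add: fun_eq_iff fapp)

lemma DD_lm_XX:
 assumes "is_sfmod A K" "is_sfmod A L" "h \<in> lin_hom A K L p" "i < ngen A"
 shows "DD A K L p (lm A p h (XX A K)) i = lm A (p + 1) (hdiff K L p h) (XX A K) i"
 using DD_lm[OF dA is_sfmod_dmod[OF assms(1)] is_sfmod_dmod[OF assms(1)] is_sfmod_dmod[OF assms(2)] assms(3)
   XX_fam[OF dA is_sfmod_dmod[OF assms(1)]] assms(4), of p]
  DD_XX_sf[OF assms(1,4)]
 by (simp add: lm_def[of A p h "DD A K K 0 (XX A K)"]) (simp add: zero_fun_apply lh_0[OF assms(3)] flip: zero_fun_def)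

lemma DD_dl:
 assumes "is_sfmod A K" "is_sfmod A L" "h \<in> lin_hom A K L p" "i < ngen A" "q = p - 1"
 shows "DD A K L q (dl A K p h) i = (lm A p h (XX A K) - rm (XX A L) h - dl A K (p + 1) (hdiff K L p h)) i"
 by (simp only: fam_apply XX_commutator[OF dA is_sfmod_dmod[OF assms(1)] is_sfmod_dmod[OF assms(2)] assms(3,4)]
   assms(5) add_diff_cancel_left')

text \<open>Both families are closed by \<open>DD_XX\<close>, so \<open>hdiff_TT\<close> leaves
  nothing.\<close>

lemma hdiff_tt: "hdiff (mtens A M N) (mtens A M N) 0 (tt M N) = 0"
proof -
 note x = XX_fam[OF dA dm(1)] and y = XX_fam[OF dA dm(2)]
 have "TP M N M 1 0 (DD A M M 0 (XX A M)) (XX A N) = TP M N M 1 0 0 (XX A N)"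
  by (rule TT_cong) (simp_all add: DD_XX_sf[OF sf(1)] fam_apply)
 moreover have "TP M N M 0 1 (XX A M) (DD A N N 0 (XX A N)) = TP M N M 0 1 (XX A M) 0"
  by (rule TT_cong) (simp_all add: DD_XX_sf[OF sf(2)] fam_apply)
 ultimately show ?thesis
  unfolding tt_def using hdiff_TT[OF dA closed x y dm(1,2,1,2), of 0] by simp
qed

text \<open>The first family is closed together with h, so only the boundary of the second survives,
  and \<open>XX_commutator\<close> computes it. The degree p of k is left open so that the degree -1
  homotopies can use the same formula.\<close>

lemma hdiff_S1:
 assumes h: "h \<in> cl M M'" and k: "k \<in> lin_hom A N N' p" and q: "q = p - 1"
 shows "hdiff (mtens A M N) (mtens A M' N') q (TP M N M' 0 q (rm (XX A M') h) (dl A N p k)) =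
  TP M N M' 0 p (rm (XX A M') h) (lm A p k (XX A N) - rm (XX A N') k - dl A N (p + 1) (hdiff N N' p k))"
proof -
 have h': "h \<in> lin_hom A M M' 0" "hdiff M M' 0 h = 0" using h by simp_all
 note x = rm_fam[OF h'(1) XX_fam[OF dA dm(3)] fin(1), of 0, simplified] and y = dl_fam[OF dA k fin(2) q]
 have "TP M N M' 1 q (DD A M M' 0 (rm (XX A M') h)) (dl A N p k) = TP M N M' 1 q 0 (dl A N p k)"
  by (rule TT_cong[OF _ refl])
    (simp only: DD_rm_XX[OF sf(1,3) h'(1)] h'(2) rm_zero[OF XX_fam[OF dA dm(3)]] fam_apply)
 moreover have "TP M N M' 0 (q + 1) (rm (XX A M') h) (DD A N N' q (dl A N p k)) =
   TP M N M' 0 (q + 1) (rm (XX A M') h) (lm A p k (XX A N) - rm (XX A N') k - dl A N (p + 1) (hdiff N N' p k))"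
  by (rule TT_cong[OF refl DD_dl[OF sf(2,4) k _ q]])
 ultimately show ?thesis
  using hdiff_TT[OF dA closed x y dm, of q] q by simp
qed

lemma hdiff_S2:
 assumes h: "h \<in> lin_hom A M M' p" and k: "k \<in> cl N N'" and q: "q = p - 1"
 shows "hdiff (mtens A M N) (mtens A M' N') q (TP M N M' q 0 (dl A M p h) (lm A 0 k (XX A N))) =
  TP M N M' p 0 (lm A p h (XX A M) - rm (XX A M') h - dl A M (p + 1) (hdiff M M' p h)) (lm A 0 k (XX A N))"
proof -
 have k': "k \<in> lin_hom A N N' 0" "hdiff N N' 0 k = 0" using k by simp_all
 note x = dl_fam[OF dA h fin(1) q] and y = lm_fam[OF k'(1) XX_fam[OF dA dm(2)] fin(2), of 0, simplified]
 have "TP M N M' q 1 (dl A M p h) (DD A N N' 0 (lm A 0 k (XX A N))) = TP M N M' q 1 (dl A M p h) 0"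
  by (rule TT_cong[OF refl]) (simp add: DD_lm_XX[OF sf(2,4) k'(1)] k'(2) lm_zero fam_apply)
 moreover have "TP M N M' (q + 1) 0 (DD A M M' q (dl A M p h)) (lm A 0 k (XX A N)) =
   TP M N M' (q + 1) 0 (lm A p h (XX A M) - rm (XX A M') h - dl A M (p + 1) (hdiff M M' p h)) (lm A 0 k (XX A N))"
  by (rule TT_cong[OF DD_dl[OF sf(1,3) h _ q] refl])
 ultimately show ?thesis
  using hdiff_TT[OF dA closed x y dm, of q] q by simp
qed

lemma dl_zero: "dl A K p 0 = 0"
 by (rule ext) (simp add: fam_apply)

text \<open>Write X for the Atiyah families. The boundaries of \<open>S1\<close> and
  \<open>S2\<close> pair X h with k X - X k and h X - X h with k X. In their sum the pairing of X h
  with k X cancels, leaving h X with k X minus X h with X k.\<close>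

lemma tt_natural:
 assumes h: "h \<in> cl M M'" and k: "k \<in> cl N N'"
 shows "(\<lambda>x. tmap A M N M' 0 0 h k (tt M N x)) - (\<lambda>x. tt M' N' (tmap A M N M' 0 0 h k x)) =
  hdiff (mtens A M N) (mtens A M' N') (- 1) (SS M N M' N' h k)"
proof -
 have h': "h \<in> lin_hom A M M' 0" "hdiff M M' 0 h = 0" and k': "k \<in> lin_hom A N N' 0" "hdiff N N' 0 k = 0"
  using h k by simp_all
 note S = S_lin_hom[OF dm h'(1) k'(1)]
 note mt = mtens_dmod[OF dA dm(1,2)] mtens_dmod[OF dA dm(3,4)]
 show ?thesis
  unfolding SS_def hdiff_add[OF mt S(1,2)]
  using hdiff_S1[OF h k'(1), of "- 1"] hdiff_S2[OF h'(1) k, of "- 1"]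
   TT_comp_left[OF XX_fam[OF dA dm(1)] XX_fam[OF dA dm(2)] h'(1) k'(1) fin(1,2,1,2)]
   TT_comp_right[OF XX_fam[OF dA dm(3)] XX_fam[OF dA dm(4)] h'(1) k'(1) fin]
  by (simp add: h'(2) k'(2) dl_zero S1_def S2_def tt_def TT_diff_left TT_diff_right)
qed

text \<open>The homotopy consists of the two pairings behind \<open>S1\<close> and
  \<open>S2\<close>, now with k of degree -1. Their boundaries telescope as in
  \<open>tt_natural\<close>; the terms containing the differential of k add up to the coherence map
  at that differential.\<close>

lemma tt_natural_right:
 assumes h: "h \<in> cl M M'" and k: "k \<in> lin_hom A N N' (- 1)"
 shows "(\<lambda>x. tmap A M N M' 0 (- 1) h k (tt M N x)) - (\<lambda>x. tt M' N' (tmap A M N M' 0 (- 1) h k x)) -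
  SS M N M' N' h (hdiff N N' (- 1) k) \<in> nl (mtens A M N) (mtens A M' N')"
proof -
 have h': "h \<in> lin_hom A M M' 0" "hdiff M M' 0 h = 0" using h by simp_all
 note mt = mtens_dmod[OF dA dm(1,2)] mtens_dmod[OF dA dm(3,4)]
 let ?a = "TP M N M' 0 (- 2) (rm (XX A M') h) (dl A N (- 1) k)"
 let ?b = "TP M N M' (- 1) (- 1) (dl A M 0 h) (lm A (- 1) k (XX A N))"
 note dh = dl_fam[OF dA h'(1) fin(1), of "- 1", simplified] and lk = lm_fam[OF k XX_fam[OF dA dm(2)] fin(2), of "- 1", simplified]
 have a: "?a \<in> lin_hom A (mtens A M N) (mtens A M' N') (- 2)"
  by (rule TT_lin_hom[OF rm_fam[OF h'(1) XX_fam[OF dA dm(3)] fin(1)] dl_fam[OF dA k fin(2)] fin(1,2)]) auto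
 have b: "?b \<in> lin_hom A (mtens A M N) (mtens A M' N') (- 2)"
  by (rule TT_lin_hom[OF dh lk fin(1,2)]) auto
 have "TP M N M' 0 (- 1) (DD A M M' (- 1) (dl A M 0 h)) (lm A (- 1) k (XX A N)) =
   TP M N M' 0 (- 1) (lm A 0 h (XX A M) - rm (XX A M') h) (lm A (- 1) k (XX A N))"
  by (rule TT_cong[OF _ refl]) (simp add: DD_dl[OF sf(1,3) h'(1)] h'(2) fam_apply)
 moreover have "TP M N M' (- 1) 0 (dl A M 0 h) (DD A N N' (- 1) (lm A (- 1) k (XX A N))) =
   TP M N M' (- 1) 0 (dl A M 0 h) (lm A 0 (hdiff N N' (- 1) k) (XX A N))"
  by (rule TT_cong[OF refl]) (simp add: DD_lm_XX[OF sf(2,4) k])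
 ultimately have B: "hdiff (mtens A M N) (mtens A M' N') (- 2) ?b =
   TP M N M' 0 (- 1) (lm A 0 h (XX A M) - rm (XX A M') h) (lm A (- 1) k (XX A N)) -
   TP M N M' (- 1) 0 (dl A M 0 h) (lm A 0 (hdiff N N' (- 1) k) (XX A N))"
  using hdiff_TT[OF dA closed dh lk dm, of "- 2"] by (simp add: sg_odd fsc_uminus_left)
 have "(\<lambda>x. tmap A M N M' 0 (- 1) h k (tt M N x)) - (\<lambda>x. tt M' N' (tmap A M N M' 0 (- 1) h k x)) -
  SS M N M' N' h (hdiff N N' (- 1) k) = hdiff (mtens A M N) (mtens A M' N') (- 2) (?a + ?b)"
  unfolding hdiff_add[OF mt a b] B
  using hdiff_S1[OF h k, of "- 2"]
   TT_comp_left[OF XX_fam[OF dA dm(1)] XX_fam[OF dA dm(2)] h'(1) k fin(1,2,1,2)]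
   TT_comp_right[OF XX_fam[OF dA dm(3)] XX_fam[OF dA dm(4)] h'(1) k fin]
  by (simp add: SS_def S1_def S2_def tt_def TT_diff_left TT_diff_right)
 then show ?thesis
  using lin_hom_add[OF a b] by blast
qed

text \<open>As for k of degree -1, but here the second pairing enters with a minus sign: its first
  family has degree -1, which changes the sign in the Leibniz rule.\<close>

lemma tt_natural_left:
 assumes h: "h \<in> lin_hom A M M' (- 1)" and k: "k \<in> cl N N'"
 shows "(\<lambda>x. tmap A M N M' (- 1) 0 h k (tt M N x)) - (\<lambda>x. tt M' N' (tmap A M N M' (- 1) 0 h k x)) -
  SS M N M' N' (hdiff M M' (- 1) h) k \<in> nl (mtens A M N) (mtens A M' N')"
proof -
 have k': "k \<in> lin_hom A N N' 0" "hdiff N N' 0 k = 0" using k by simp_all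
 note mt = mtens_dmod[OF dA dm(1,2)] mtens_dmod[OF dA dm(3,4)]
 let ?a = "TP M N M' (- 2) 0 (dl A M (- 1) h) (lm A 0 k (XX A N))"
 let ?b = "TP M N M' (- 1) (- 1) (rm (XX A M') h) (dl A N 0 k)"
 note rh = rm_fam[OF h XX_fam[OF dA dm(3)] fin(1), of "- 1", simplified] and dk = dl_fam[OF dA k'(1) fin(2), of "- 1", simplified]
 have a: "?a \<in> lin_hom A (mtens A M N) (mtens A M' N') (- 2)"
  by (rule TT_lin_hom[OF dl_fam[OF dA h fin(1)] lm_fam[OF k'(1) XX_fam[OF dA dm(2)] fin(2)] fin(1,2)]) auto
 have b: "?b \<in> lin_hom A (mtens A M N) (mtens A M' N') (- 2)"
  by (rule TT_lin_hom[OF rh dk fin(1,2)]) auto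
 have "TP M N M' (- 1) 0 (rm (XX A M') h) (DD A N N' (- 1) (dl A N 0 k)) =
   TP M N M' (- 1) 0 (rm (XX A M') h) (lm A 0 k (XX A N) - rm (XX A N') k)"
  by (rule TT_cong[OF refl]) (simp add: DD_dl[OF sf(2,4) k'(1)] k'(2) fam_apply)
 moreover have "TP M N M' 0 (- 1) (DD A M M' (- 1) (rm (XX A M') h)) (dl A N 0 k) =
   TP M N M' 0 (- 1) (rm (XX A M') (hdiff M M' (- 1) h)) (dl A N 0 k)"
  by (rule TT_cong[OF _ refl]) (simp add: DD_rm_XX[OF sf(1,3) h])
 ultimately have B: "hdiff (mtens A M N) (mtens A M' N') (- 2) ?b =
   TP M N M' 0 (- 1) (rm (XX A M') (hdiff M M' (- 1) h)) (dl A N 0 k) -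
   TP M N M' (- 1) 0 (rm (XX A M') h) (lm A 0 k (XX A N) - rm (XX A N') k)"
  using hdiff_TT[OF dA closed rh dk dm, of "- 2"] by (simp add: sg_odd fsc_uminus_left)
 have "(\<lambda>x. tmap A M N M' (- 1) 0 h k (tt M N x)) - (\<lambda>x. tt M' N' (tmap A M N M' (- 1) 0 h k x)) -
  SS M N M' N' (hdiff M M' (- 1) h) k = hdiff (mtens A M N) (mtens A M' N') (- 2) (?a - ?b)"
  unfolding hdiff_diff[OF mt a b] B
  using hdiff_S2[OF h k, of "- 2"]
   TT_comp_left[OF XX_fam[OF dA dm(1)] XX_fam[OF dA dm(2)] h k'(1) fin(1,2,1,2)]
   TT_comp_right[OF XX_fam[OF dA dm(3)] XX_fam[OF dA dm(4)] h k'(1) fin]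
  by (simp add: SS_def S1_def S2_def tt_def TT_diff_left TT_diff_right)
 then show ?thesis
  using lin_hom_diff[OF a b] by blast
qed

text \<open>Braiding \<open>S1\<close> yields the derivative of k paired with X h, while the
  coherence map for the exchanged arguments pairs it with h X; the other half is off in the same
  way. The boundary of the pairing of the two derivatives, of degree -2, accounts for both
  discrepancies.\<close>

lemma SS_braid:
 assumes h: "h \<in> cl M M'" and k: "k \<in> cl N N'"
 shows "(\<lambda>x. braid A M' N' (SS M N M' N' h k x)) - (\<lambda>x. SS N M N' M' k h (braid A M N x)) \<in>
  nl (mtens A M N) (mtens A N' M')"
proof -
 have h': "h \<in> lin_hom A M M' 0" "hdiff M M' 0 h = 0" and k': "k \<in> lin_hom A N N' 0" "hdiff N N' 0 k = 0"
  using h k by simp_all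
 note dh = dl_fam[OF dA h'(1) fin(1), of "- 1", simplified] and dk = dl_fam[OF dA k'(1) fin(2), of "- 1", simplified]
 note rh = rm_fam[OF h'(1) XX_fam[OF dA dm(3)] fin(1), of 0, simplified]
  and lk = lm_fam[OF k'(1) XX_fam[OF dA dm(2)] fin(2), of 0, simplified]
 let ?b = "TP N M N' (- 1) (- 1) (dl A N 0 k) (dl A M 0 h)"
 note mt = mtens_dmod[OF dA dm(1,2)] mtens_dmod[OF dA dm(2,1)] mtens_dmod[OF dA dm(4,3)]
 have b: "?b \<in> lin_hom A (mtens A N M) (mtens A N' M') (- 2)"
  by (rule TT_lin_hom[OF dk dh fin(2,1)]) auto
 note B = braid_lin_hom[OF fin(1,2), of A] and B' = braid_lin_hom[OF fin(3,4), of A]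
 note S = S_lin_hom[OF dm h'(1) k'(1)]
 have "TP N M N' 0 (- 1) (DD A N N' (- 1) (dl A N 0 k)) (dl A M 0 h) =
   TP N M N' 0 (- 1) (lm A 0 k (XX A N) - rm (XX A N') k) (dl A M 0 h)"
  by (rule TT_cong[OF _ refl]) (simp add: DD_dl[OF sf(2,4) k'(1)] k'(2) fam_apply)
 moreover have "TP N M N' (- 1) 0 (dl A N 0 k) (DD A M M' (- 1) (dl A M 0 h)) =
   TP N M N' (- 1) 0 (dl A N 0 k) (lm A 0 h (XX A M) - rm (XX A M') h)"
  by (rule TT_cong[OF refl]) (simp add: DD_dl[OF sf(1,3) h'(1)] h'(2) fam_apply)
 ultimately have D: "hdiff (mtens A N M) (mtens A N' M') (- 2) ?b =
   TP N M N' 0 (- 1) (lm A 0 k (XX A N) - rm (XX A N') k) (dl A M 0 h) -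
   TP N M N' (- 1) 0 (dl A N 0 k) (lm A 0 h (XX A M) - rm (XX A M') h)"
  using hdiff_TT[OF dA closed dk dh dm(2,1,4,3), of "- 2"] by (simp add: sg_odd fsc_uminus_left)
 have "hdiff (mtens A M N) (mtens A N' M') (- 2) (\<lambda>x. ?b (braid A M N x)) =
   (\<lambda>x. hdiff (mtens A N M) (mtens A N' M') (- 2) ?b (braid A M N x))"
  using hdiff_comp[OF mt(1,2) b B, of "- 2"] hdiff_braid[OF dA dm(1,2)] lh_0[OF b]
  by (simp add: fun_eq_iff mmap_apply fsc_apply zero_fun_apply fapp)
 also have "\<dots> = (\<lambda>x. braid A M' N' (SS M N M' N' h k x)) - (\<lambda>x. SS N M N' M' k h (braid A M N x))"
 proof (rule ext)
  fix x
  have 1: "braid A M' N' (S1 M N M' N' h k x) = TP N M N' (- 1) 0 (dl A N 0 k) (rm (XX A M') h) (braid A M N x)"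
   using TT_braid[OF sym rh dk fin, THEN fun_cong, of x] by (simp add: S1_def fsc_apply)
  have 2: "braid A M' N' (S2 M N M' N' h k x) = TP N M N' 0 (- 1) (lm A 0 k (XX A N)) (dl A M 0 h) (braid A M N x)"
   using TT_braid[OF sym dh lk fin, THEN fun_cong, of x] by (simp add: S2_def fsc_apply)
  note c = lh_mcar[OF S(1) finite_gens_mtens[OF fin(1,2)]] lh_mcar[OF S(2) finite_gens_mtens[OF fin(1,2)]]
  show "hdiff (mtens A N M) (mtens A N' M') (- 2) ?b (braid A M N x) =
   ((\<lambda>x. braid A M' N' (SS M N M' N' h k x)) - (\<lambda>x. SS N M N' M' k h (braid A M N x))) x"
   unfolding D TT_diff_left TT_diff_right mmap_apply SS_def lh_add[OF B' c] 1 2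
   by (simp add: S1_def S2_def)
 qed
 finally have eq: "hdiff (mtens A M N) (mtens A N' M') (- 2) (\<lambda>x. ?b (braid A M N x)) =
   (\<lambda>x. braid A M' N' (SS M N M' N' h k x)) - (\<lambda>x. SS N M N' M' k h (braid A M N x))" .
 have "(\<lambda>x. ?b (braid A M N x)) \<in> lin_hom A (mtens A M N) (mtens A N' M') (- 2)"
  by (rule lin_hom_comp[OF b B finite_gens_mtens[OF fin(1,2)]]) simp
 from imageI[OF this, of "hdiff (mtens A M N) (mtens A N' M') (- 2)"] show ?thesis
  unfolding eq .
qed

lemma tt_braid: "(\<lambda>x. braid A M N (tt M N x)) = (\<lambda>x. tt N M (braid A M N x))"
 using TT_braid[OF sym XX_fam[OF dA dm(1)] XX_fam[OF dA dm(2)] fin(1,2,1,2)] by (simp add: tt_def)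

text \<open>Generators are constant for the connection, so the derivative of an identity vanishes,
  and each half contains one.\<close>

lemma SS_mid: "SS M N M N (mid A M) (mid A N) = 0"
proof -
 have "dl A K 0 (mid A K) = 0" if K: "finite (gens K)" for K
 proof (rule ext)
  fix i
  have "dl A K 0 (mid A K) i = alin A (gens K) (0 - 1 - ed A i) (\<lambda>w. 0)"
   unfolding dl_def alin_def by (rule ext) (simp add: mid_ge cong: sum.cong)
  then show "dl A K 0 (mid A K) i = 0 i" by (simp add: alin_def fam_apply fun_eq_iff fapp)
 qed
 then show ?thesis
  by (simp add: SS_def S1_def S2_def fin)
qed

text \<open>By \<open>dl_comp\<close> every term has a counterpart except that \<open>h2\<close> and
  \<open>k2\<close> stand on the wrong side of the Atiyah families: X h2 h against h2 X h in one
  half, k2 k X against k2 X k in the other. Both differences appear in the boundary of the pairing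
  of (derivative of h2) h with k2 (derivative of k).\<close>

lemma SS_comp:
 assumes sf'': "is_sfmod A M''" "is_sfmod A N''"
  and h: "h \<in> cl M M'" and k: "k \<in> cl N N'" and h2: "h2 \<in> cl M' M''" and k2: "k2 \<in> cl N' N''"
 shows "SS M N M'' N'' (\<lambda>x. h2 (h x)) (\<lambda>x. k2 (k x)) -
  ((\<lambda>x. SS M' N' M'' N'' h2 k2 (tmap A M N M' 0 0 h k x)) + (\<lambda>x. tmap A M' N' M'' 0 0 h2 k2 (SS M N M' N' h k x)))
  \<in> nl (mtens A M N) (mtens A M'' N'')"
proof -
 note dm' = sf''[THEN is_sfmod_dmod]
 note fin' = dm'[THEN dm_finite]
 have h': "h \<in> lin_hom A M M' 0" "hdiff M M' 0 h = 0" and k': "k \<in> lin_hom A N N' 0" "hdiff N N' 0 k = 0"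
  and h2': "h2 \<in> lin_hom A M' M'' 0" "hdiff M' M'' 0 h2 = 0" and k2': "k2 \<in> lin_hom A N' N'' 0" "hdiff N' N'' 0 k2 = 0"
  using h k h2 k2 by simp_all
 note dh = dl_fam[OF dA h'(1) fin(1), of "- 1", simplified] and dk = dl_fam[OF dA k'(1) fin(2), of "- 1", simplified]
 note dh2 = dl_fam[OF dA h2'(1) fin(3), of "- 1", simplified] and dk2 = dl_fam[OF dA k2'(1) fin(4), of "- 1", simplified]
 note rh = rm_fam[OF h'(1) XX_fam[OF dA dm(3)] fin(1), of 0, simplified]
  and lk = lm_fam[OF k'(1) XX_fam[OF dA dm(2)] fin(2), of 0, simplified]
 note rh2 = rm_fam[OF h2'(1) XX_fam[OF dA dm'(1)] fin(3), of 0, simplified]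
  and lk2 = lm_fam[OF k2'(1) XX_fam[OF dA dm(4)] fin(4), of 0, simplified]
 let ?al = "rm (dl A M' 0 h2) h" and ?be = "lm A 0 k2 (dl A N 0 k)"
 note al = rm_fam[OF h'(1) dh2 fin(1), of "- 1", simplified] and be = lm_fam[OF k2'(1) dk fin(2), of "- 1", simplified]
 let ?b = "TP M N M'' (- 1) (- 1) ?al ?be"
 have b: "?b \<in> lin_hom A (mtens A M N) (mtens A M'' N'') (- 2)"
  by (rule TT_lin_hom[OF al be fin(1,2)]) auto
 have ra: "DD A M M'' (- 1) ?al i = (lm A 0 h2 (rm (XX A M') h) - rm (rm (XX A M'') h2) h) i" if i: "i < ngen A" for i
  using DD_rm[OF dm(1,3) h'(1) dh2 i, of "- 1"] DD_dl[OF sf(3) sf''(1) h2'(1) i, of "- 1"]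
  by (simp add: h'(2) h2'(2) rm_zero[OF dh2 i]) (simp add: rm_apply lm_simps fam_apply mmap_apply fun_diff_def[where 'b = "'k mel"])
 have rb: "DD A N N'' (- 1) ?be i = (lm A 0 k2 (lm A 0 k (XX A N)) - rm (lm A 0 k2 (XX A N')) k) i" if i: "i < ngen A" for i
 proof -
  have "k2 (lm A 0 k (XX A N) i x - rm (XX A N') k i x) = k2 (lm A 0 k (XX A N) i x) - k2 (rm (XX A N') k i x)" for x
   by (rule lh_diff[OF k2'(1) lh_mcar[OF famD[OF lk i] fin(2)]
     lh_mcar[OF famD[OF rm_fam[OF k'(1) XX_fam[OF dA dm(4)] fin(2) refl] i] fin(2)]])
  then show ?thesis
   using DD_lm[OF dA dm(2,4) dm'(2) k2'(1) dk i, of "- 1"] DD_dl[OF sf(2,4) k'(1) i, of "- 1"]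
   by (simp add: k'(2) k2'(2) rm_apply lm_def fam_apply) (simp add: fun_eq_iff fapp fsc_def mmap_apply)
 qed
 have "TP M N M'' 0 (- 1) (DD A M M'' (- 1) ?al) ?be =
   TP M N M'' 0 (- 1) (lm A 0 h2 (rm (XX A M') h) - rm (rm (XX A M'') h2) h) ?be"
  by (rule TT_cong[OF _ refl]) (rule ra)
 moreover have "TP M N M'' (- 1) 0 ?al (DD A N N'' (- 1) ?be) =
   TP M N M'' (- 1) 0 ?al (lm A 0 k2 (lm A 0 k (XX A N)) - rm (lm A 0 k2 (XX A N')) k)"
  by (rule TT_cong[OF refl]) (rule rb)
 ultimately have D: "hdiff (mtens A M N) (mtens A M'' N'') (- 2) ?b =
   TP M N M'' 0 (- 1) (lm A 0 h2 (rm (XX A M') h) - rm (rm (XX A M'') h2) h) ?be -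
   TP M N M'' (- 1) 0 ?al (lm A 0 k2 (lm A 0 k (XX A N)) - rm (lm A 0 k2 (XX A N')) k)"
  using hdiff_TT[OF dA closed al be dm(1,2) dm', of "- 2"] by (simp add: sg_odd fsc_uminus_left)
 \<comment> \<open>From here on the four coherence terms are expanded by the product rule and by
   moving morphisms into the contraction, so that they can be compared with the boundary
   \<open>D\<close>.\<close>
 have E1: "TP M N M'' 0 (- 1) (rm (XX A M'') (\<lambda>x. h2 (h x))) (dl A N 0 (\<lambda>x. k2 (k x))) =
   TP M N M'' 0 (- 1) (rm (rm (XX A M'') h2) h) (rm (dl A N' 0 k2) k + ?be)"
  by (rule TT_cong) (simp_all add: rm_apply dl_comp[OF dA k'(1) k2'(1) fin(2,4)] fam_apply)
 have E2: "TP M N M'' (- 1) 0 (dl A M 0 (\<lambda>x. h2 (h x))) (lm A 0 (\<lambda>x. k2 (k x)) (XX A N)) =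
   TP M N M'' (- 1) 0 (?al + lm A 0 h2 (dl A M 0 h)) (lm A 0 k2 (lm A 0 k (XX A N)))"
  by (rule TT_cong) (simp_all add: lm_simps dl_comp[OF dA h'(1) h2'(1) fin(1,3)] fam_apply)
 note S = S_lin_hom[OF dm h'(1) k'(1)]
 note T2 = tmap_lin_hom[OF h2'(1) k2'(1) fin(3,4), of 0, simplified]
 have "tmap A M' N' M'' 0 0 h2 k2 (SS M N M' N' h k x) =
   tmap A M' N' M'' 0 0 h2 k2 (S1 M N M' N' h k x) + tmap A M' N' M'' 0 0 h2 k2 (S2 M N M' N' h k x)" for x
  unfolding SS_def mmap_apply
  by (rule lh_add[OF T2 lh_mcar[OF S(1) finite_gens_mtens[OF fin(1,2)]] lh_mcar[OF S(2) finite_gens_mtens[OF fin(1,2)]]])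
 then have E3: "(\<lambda>x. tmap A M' N' M'' 0 0 h2 k2 (SS M N M' N' h k x)) =
   TP M N M'' 0 (- 1) (lm A 0 h2 (rm (XX A M') h)) ?be + TP M N M'' (- 1) 0 (lm A 0 h2 (dl A M 0 h)) (lm A 0 k2 (lm A 0 k (XX A N)))"
  using TT_comp_left[OF rh dk h2'(1) k2'(1) fin] TT_comp_left[OF dh lk h2'(1) k2'(1) fin]
  by (simp add: fun_eq_iff[where g = "_ :: 'k mmap"] mmap_apply S1_def S2_def)
 have E4: "(\<lambda>x. SS M' N' M'' N'' h2 k2 (tmap A M N M' 0 0 h k x)) =
   TP M N M'' 0 (- 1) (rm (rm (XX A M'') h2) h) (rm (dl A N' 0 k2) k) + TP M N M'' (- 1) 0 ?al (rm (lm A 0 k2 (XX A N')) k)"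
  using TT_comp_right[OF rh2 dk2 h'(1) k'(1) fin] TT_comp_right[OF dh2 lk2 h'(1) k'(1) fin]
  by (simp add: fun_eq_iff[where g = "_ :: 'k mmap"] mmap_apply SS_def S1_def S2_def)
 have "SS M N M'' N'' (\<lambda>x. h2 (h x)) (\<lambda>x. k2 (k x)) -
  ((\<lambda>x. SS M' N' M'' N'' h2 k2 (tmap A M N M' 0 0 h k x)) + (\<lambda>x. tmap A M' N' M'' 0 0 h2 k2 (SS M N M' N' h k x))) =
  - hdiff (mtens A M N) (mtens A M'' N'') (- 2) ?b"
  unfolding D E3 E4
  unfolding SS_def S1_def S2_def E1 E2
  by (simp add: TT_add_left TT_add_right TT_diff_left TT_diff_right)
 also have "\<dots> = hdiff (mtens A M N) (mtens A M'' N'') (- 2) (- ?b)"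
  using hdiff_fsc[OF mtens_dmod[OF dA dm(1,2)] mtens_dmod[OF dA dm'] b, of "- 2" "- 1"] by (simp add: fsc_uminus_left)
 finally show ?thesis
  using lin_hom_uminus[OF b] by blast
qed

end

end

section \<open>The hexagons for components and coherence homotopies\<close>

lemma conj_add:
 fixes F G H K :: "'k::field mmap"
 assumes F: "F \<in> lin_hom A Q R p" and "\<And>x. G x \<in> mcar A (gens Q)" "\<And>x. H x \<in> mcar A (gens Q)"
 shows "(\<lambda>x. F ((G + H) (K x))) = (\<lambda>x. F (G (K x))) + (\<lambda>x. F (H (K x)))"
 by (rule ext) (simp add: mmap_apply lh_add[OF F assms(2,3)])

lemma comp_mid_right: "h \<in> lin_hom A M N p \<Longrightarrow> (\<lambda>x. h (mid A M x)) = h"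
 by (rule ext) (auto simp: mid_def lh_outside lh_0)

lemma comp_mid_left: "h \<in> lin_hom A M N p \<Longrightarrow> finite (gens M) \<Longrightarrow> (\<lambda>x. mid A N (h x)) = h"
 by (rule ext) (simp add: mid_def lh_mcar)

context poisson_data
begin

context
 fixes L M N L' M' N' :: "'k sfmod"
 assumes dmL: "dmod A L" and dmM: "dmod A M" and dmN: "dmod A N"
  and dmL': "dmod A L'" and dmM': "dmod A M'" and dmN': "dmod A N'"
begin

private lemmas fin_a = dm_finite[OF dmL] dm_finite[OF dmM] dm_finite[OF dmN]
 dm_finite[OF dmL'] dm_finite[OF dmM'] dm_finite[OF dmN']
private lemmas ft = finite_gens_mtens[OF fin_a(1,2), of A] finite_gens_mtens[OF fin_a(2,3), of A]
 finite_gens_mtens[OF fin_a(1,3), of A]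

lemma TP_asc_right:
 assumes \<alpha>: "\<alpha> \<in> fam A L L' p" and \<beta>: "\<beta> \<in> fam A M M' q" and \<beta>': "\<beta>' \<in> fam A N N' q"
  and k: "k \<in> lin_hom A M M' 0" and l: "l \<in> lin_hom A N N' 0"
  and eq: "\<forall>j<ngen A. \<omega> j = tmap A M N M' (q - ed A j) 0 (\<beta> j) l + tmap A M N M' 0 (q - ed A j) k (\<beta>' j)"
 shows "(\<lambda>x. asc2 A L' M' N' (TP L (mtens A M N) L' p q \<alpha> \<omega> (asc1 A L M N x))) =
  tmap A (mtens A L M) N (mtens A L' M') (p + q) 0 (TP L M L' p q \<alpha> \<beta>) l +
  (\<lambda>x. tmap A (mtens A M' L') N' (mtens A L' M') 0 0 (braid A M' L') (mid A N')
   (asc2 A M' L' N' (tmap A M (mtens A L N) M' 0 (p + q) k (TP L N L' p q \<alpha> \<beta>')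
    (asc1 A M L N (tmap A (mtens A L M) N (mtens A M L) 0 0 (braid A L M) (mid A N) x)))))"
proof -
 let ?b = "\<lambda>j. tmap A M N M' (q - ed A j) 0 (\<beta> j) l" and ?b' = "\<lambda>j. tmap A M N M' 0 (q - ed A j) k (\<beta>' j)"
 have "TP L (mtens A M N) L' p q \<alpha> \<omega> = TP L (mtens A M N) L' p q \<alpha> (?b + ?b')"
  by (rule TT_cong[OF refl]) (simp only: eq[rule_format] fam_apply)
 then have T: "TP L (mtens A M N) L' p q \<alpha> \<omega> = TP L (mtens A M N) L' p q \<alpha> ?b + TP L (mtens A M N) L' p q \<alpha> ?b'"
  by (simp only: TT_add_right)
 note b = tmap_fam_left[OF \<beta> l fin_a(2,3)] and b' = tmap_fam_right[OF \<beta>' k fin_a(2,3)]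
 note 1 = TT_lin_hom[OF \<alpha> b fin_a(1) ft(2) refl] and 2 = TT_lin_hom[OF \<alpha> b' fin_a(1) ft(2) refl]
 have F: "finite (gens (mtens A L (mtens A M N)))" by (intro finite_gens_mtens fin_a)
 show ?thesis
  unfolding T conj_add[OF asc2_lin_hom[OF fin_a(4-6)] lh_mcar[OF 1 F] lh_mcar[OF 2 F]]
   TT_hexagon_right[OF fin_a \<alpha> \<beta> l] TT_hexagon_middle_right[OF fin_a \<alpha> \<beta>' k] ..
qed

lemma TP_asc_left:
 assumes \<alpha>: "\<alpha> \<in> fam A M M' p" and \<alpha>': "\<alpha>' \<in> fam A L L' p" and \<beta>: "\<beta> \<in> fam A N N' q"
  and h: "h \<in> lin_hom A L L' 0" and k: "k \<in> lin_hom A M M' 0"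
  and eq: "\<forall>i<ngen A. \<omega> i = tmap A L M L' 0 (p - ed A i) h (\<alpha> i) + tmap A L M L' (p - ed A i) 0 (\<alpha>' i) k"
 shows "(\<lambda>x. asc1 A L' M' N' (TP (mtens A L M) N (mtens A L' M') p q \<omega> \<beta> (asc2 A L M N x))) =
  tmap A L (mtens A M N) L' 0 (p + q) h (TP M N M' p q \<alpha> \<beta>) +
  (\<lambda>x. tmap A L' (mtens A N' M') L' 0 0 (mid A L') (braid A N' M')
   (asc1 A L' N' M' (tmap A (mtens A L N) M (mtens A L' N') (p + q) 0 (TP L N L' p q \<alpha>' \<beta>) k
    (asc2 A L N M (tmap A L (mtens A M N) L 0 0 (mid A L) (braid A M N) x)))))"
proof -
 let ?b = "\<lambda>i. tmap A L M L' 0 (p - ed A i) h (\<alpha> i)" and ?b' = "\<lambda>i. tmap A L M L' (p - ed A i) 0 (\<alpha>' i) k"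
 have "TP (mtens A L M) N (mtens A L' M') p q \<omega> \<beta> = TP (mtens A L M) N (mtens A L' M') p q (?b + ?b') \<beta>"
  by (rule TT_cong[OF _ refl]) (simp only: eq[rule_format] fam_apply)
 then have T: "TP (mtens A L M) N (mtens A L' M') p q \<omega> \<beta> =
   TP (mtens A L M) N (mtens A L' M') p q ?b \<beta> + TP (mtens A L M) N (mtens A L' M') p q ?b' \<beta>"
  by (simp only: TT_add_left)
 note b = tmap_fam_right[OF \<alpha> h fin_a(1,2)] and b' = tmap_fam_left[OF \<alpha>' k fin_a(1,2)]
 note 1 = TT_lin_hom[OF b \<beta> ft(1) fin_a(3) refl] and 2 = TT_lin_hom[OF b' \<beta> ft(1) fin_a(3) refl]
 have F: "finite (gens (mtens A (mtens A L M) N))" by (intro finite_gens_mtens fin_a)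
 show ?thesis
  unfolding T conj_add[OF asc1_lin_hom[OF fin_a(4-6)] lh_mcar[OF 1 F] lh_mcar[OF 2 F]]
   TT_hexagon_left[OF fin_a \<alpha> \<beta> h] TT_hexagon_middle_left[OF fin_a \<alpha>' \<beta> k] ..
qed

text \<open>Each half has one family on M (x) N: the derivative of the tensor product of k and l,
  and the Atiyah family followed by it. Both split by the Leibniz rule, so the identity holds
  without any homotopy.\<close>

lemma SS_hexagon1:
 assumes h: "h \<in> lin_hom A L L' 0" and k: "k \<in> lin_hom A M M' 0" and l: "l \<in> lin_hom A N N' 0"
 shows "(\<lambda>x. asc2 A L' M' N' (SS L (mtens A M N) L' (mtens A M' N') h (tmap A M N M' 0 0 k l) (asc1 A L M N x))) =
  tmap A (mtens A L M) N (mtens A L' M') (- 1) 0 (SS L M L' M' h k) l +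
  (\<lambda>x. tmap A (mtens A M' L') N' (mtens A L' M') 0 0 (braid A M' L') (mid A N')
   (asc2 A M' L' N' (tmap A M (mtens A L N) M' 0 (- 1) k (SS L N L' N' h l)
    (asc1 A M L N (tmap A (mtens A L M) N (mtens A M L) 0 0 (braid A L M) (mid A N) x)))))"
proof -
 note X = XX_fam[OF dA]
 have rh: "rm (XX A L') h \<in> fam A L L' 0" by (rule rm_fam[OF h X[OF dmL'] fin_a(1)]) simp
 have dh: "dl A L 0 h \<in> fam A L L' (- 1)" by (rule dl_fam[OF dA h fin_a(1)]) simp
 have dk: "dl A M 0 k \<in> fam A M M' (- 1)" by (rule dl_fam[OF dA k fin_a(2)]) simp
 have dl: "dl A N 0 l \<in> fam A N N' (- 1)" by (rule dl_fam[OF dA l fin_a(3)]) simp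
 have lk: "lm A 0 k (XX A M) \<in> fam A M M' 0" by (rule lm_fam[OF k X[OF dmM] fin_a(2)]) simp
 have ll: "lm A 0 l (XX A N) \<in> fam A N N' 0" by (rule lm_fam[OF l X[OF dmN] fin_a(3)]) simp
 have T: "tmap A M N M' 0 0 k l \<in> lin_hom A (mtens A M N) (mtens A M' N') 0"
  by (rule tmap_lin_hom[OF k l fin_a(2,3)]) simp
 have e2: "\<forall>j<ngen A. lm A 0 (tmap A M N M' 0 0 k l) (XX A (mtens A M N)) j =
   tmap A M N M' (0 - ed A j) 0 (lm A 0 k (XX A M) j) l + tmap A M N M' 0 (0 - ed A j) k (lm A 0 l (XX A N) j)"
 proof (intro allI impI)
  fix j assume j: "j < ngen A"
  note xm = famD[OF X[OF dmM] j] and xn = famD[OF X[OF dmN] j]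
  note x1 = tmap_lin_hom[OF xm lin_hom_mid fin_a(2,3) refl] and x2 = tmap_lin_hom[OF lin_hom_mid xn fin_a(2,3) refl]
  have "lm A 0 (tmap A M N M' 0 0 k l) (XX A (mtens A M N)) j =
   (\<lambda>x. tmap A M N M' 0 0 k l (tmap A M N M (0 - ed A j) 0 (XX A M j) (mid A N) x)) +
   (\<lambda>x. tmap A M N M' 0 0 k l (tmap A M N M 0 (0 - ed A j) (mid A M) (XX A N j) x))"
   unfolding lm_simps XX_mtens[OF dA dmM dmN j]
   by (rule conj_add[OF T lh_mcar[OF x1 ft(2)] lh_mcar[OF x2 ft(2)]])
  then show "lm A 0 (tmap A M N M' 0 0 k l) (XX A (mtens A M N)) j =
   tmap A M N M' (0 - ed A j) 0 (lm A 0 k (XX A M) j) l + tmap A M N M' 0 (0 - ed A j) k (lm A 0 l (XX A N) j)"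
   unfolding tmap_comp[OF xm lin_hom_mid k l fin_a(2,3,2,3)] tmap_comp[OF lin_hom_mid xn k l fin_a(2,3,2,3)]
    comp_mid_right[OF k] comp_mid_right[OF l] lm_simps by simp
 qed
 have e1: "\<forall>j<ngen A. dl A (mtens A M N) 0 (tmap A M N M' 0 0 k l) j =
   tmap A M N M' (- 1 - ed A j) 0 (dl A M 0 k j) l + tmap A M N M' 0 (- 1 - ed A j) k (dl A N 0 l j)"
  by (intro allI impI dl_tmap[OF dA k l fin_a(2,3)])
 note s = S_lin_hom[OF dmL mtens_dmod[OF dA dmM dmN] dmL' mtens_dmod[OF dA dmM' dmN'] h T]
 have F: "finite (gens (mtens A L (mtens A M N)))" by (intro finite_gens_mtens fin_a)
 note t = S_lin_hom[OF dmL dmN dmL' dmN' h l]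
 note k1 = tmap_lin_hom[OF k t(1) fin_a(2) ft(3), of "- 1", simplified] and k2 = tmap_lin_hom[OF k t(2) fin_a(2) ft(3), of "- 1", simplified]
 have F': "finite (gens (mtens A M (mtens A L N)))" by (intro finite_gens_mtens fin_a)
 have B: "(\<lambda>y. tmap A (mtens A M' L') N' (mtens A L' M') 0 0 (braid A M' L') (mid A N') (asc2 A M' L' N' y)) \<in>
   lin_hom A (mtens A M' (mtens A L' N')) (mtens A (mtens A L' M') N') 0"
  by (rule lin_hom_comp[OF tmap_lin_hom[OF braid_lin_hom[OF fin_a(5,4)] lin_hom_mid _ fin_a(6) refl] asc2_lin_hom[OF fin_a(5,4,6)]])
    (auto intro!: finite_gens_mtens fin_a)
 show ?thesis
  unfolding SS_def conj_add[OF asc2_lin_hom[OF fin_a(4-6)] lh_mcar[OF s(1) F] lh_mcar[OF s(2) F]]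
   tmap_add_left tmap_add_right
   conj_add[OF B lh_mcar[OF k1 F'] lh_mcar[OF k2 F']]
  unfolding S1_def S2_def TP_asc_right[OF rh dk dl k l e1] TP_asc_right[OF dh lk ll k l e2]
  by simp
qed

text \<open>Now the family to be split sits on L (x) M. For \<open>S1\<close> it is the Atiyah
  family after the tensor product of h and k, for \<open>S2\<close> the derivative of that tensor
  product.\<close>

lemma SS_hexagon2:
 assumes h: "h \<in> lin_hom A L L' 0" and k: "k \<in> lin_hom A M M' 0" and l: "l \<in> lin_hom A N N' 0"
 shows "(\<lambda>x. asc1 A L' M' N' (SS (mtens A L M) N (mtens A L' M') N' (tmap A L M L' 0 0 h k) l (asc2 A L M N x))) =
  tmap A L (mtens A M N) L' 0 (- 1) h (SS M N M' N' k l) +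
  (\<lambda>x. tmap A L' (mtens A N' M') L' 0 0 (mid A L') (braid A N' M')
   (asc1 A L' N' M' (tmap A (mtens A L N) M (mtens A L' N') (- 1) 0 (SS L N L' N' h l) k
    (asc2 A L N M (tmap A L (mtens A M N) L 0 0 (mid A L) (braid A M N) x)))))"
proof -
 note X = XX_fam[OF dA]
 have rh: "rm (XX A L') h \<in> fam A L L' 0" by (rule rm_fam[OF h X[OF dmL'] fin_a(1)]) simp
 have rk: "rm (XX A M') k \<in> fam A M M' 0" by (rule rm_fam[OF k X[OF dmM'] fin_a(2)]) simp
 have dh: "dl A L 0 h \<in> fam A L L' (- 1)" by (rule dl_fam[OF dA h fin_a(1)]) simp
 have dk: "dl A M 0 k \<in> fam A M M' (- 1)" by (rule dl_fam[OF dA k fin_a(2)]) simp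
 have dl: "dl A N 0 l \<in> fam A N N' (- 1)" by (rule dl_fam[OF dA l fin_a(3)]) simp
 have ll: "lm A 0 l (XX A N) \<in> fam A N N' 0" by (rule lm_fam[OF l X[OF dmN] fin_a(3)]) simp
 have T: "tmap A L M L' 0 0 h k \<in> lin_hom A (mtens A L M) (mtens A L' M') 0"
  by (rule tmap_lin_hom[OF h k fin_a(1,2)]) simp
 have e2: "\<forall>j<ngen A. rm (XX A (mtens A L' M')) (tmap A L M L' 0 0 h k) j =
   tmap A L M L' 0 (0 - ed A j) h (rm (XX A M') k j) + tmap A L M L' (0 - ed A j) 0 (rm (XX A L') h j) k"
 proof (intro allI impI)
  fix j assume j: "j < ngen A"
  note xl = famD[OF X[OF dmL'] j] and xm = famD[OF X[OF dmM'] j]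
  have "rm (XX A (mtens A L' M')) (tmap A L M L' 0 0 h k) j =
   (\<lambda>x. tmap A L' M' L' (0 - ed A j) 0 (XX A L' j) (mid A M') (tmap A L M L' 0 0 h k x)) +
   (\<lambda>x. tmap A L' M' L' 0 (0 - ed A j) (mid A L') (XX A M' j) (tmap A L M L' 0 0 h k x))"
   unfolding rm_apply XX_mtens[OF dA dmL' dmM' j] by (rule ext) (simp only: mmap_apply)
  then show "rm (XX A (mtens A L' M')) (tmap A L M L' 0 0 h k) j =
   tmap A L M L' 0 (0 - ed A j) h (rm (XX A M') k j) + tmap A L M L' (0 - ed A j) 0 (rm (XX A L') h j) k"
   unfolding tmap_comp[OF h k xl lin_hom_mid fin_a(1,2,4,5)] tmap_comp[OF h k lin_hom_mid xm fin_a(1,2,4,5)]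
    comp_mid_left[OF k fin_a(2)] comp_mid_left[OF h fin_a(1)] rm_apply by (simp add: add.commute)
 qed
 have e1: "\<forall>j<ngen A. dl A (mtens A L M) 0 (tmap A L M L' 0 0 h k) j =
   tmap A L M L' 0 (- 1 - ed A j) h (dl A M 0 k j) + tmap A L M L' (- 1 - ed A j) 0 (dl A L 0 h j) k"
  using dl_tmap[OF dA h k fin_a(1,2)] by (simp only: add.commute) simp
 note s = S_lin_hom[OF mtens_dmod[OF dA dmL dmM] dmN mtens_dmod[OF dA dmL' dmM'] dmN' T l]
 have F: "finite (gens (mtens A (mtens A L M) N))" by (intro finite_gens_mtens fin_a)
 note t = S_lin_hom[OF dmL dmN dmL' dmN' h l]
 note k1 = tmap_lin_hom[OF t(1) k ft(3) fin_a(2), of "- 1", simplified] and k2 = tmap_lin_hom[OF t(2) k ft(3) fin_a(2), of "- 1", simplified]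
 have F': "finite (gens (mtens A (mtens A L N) M))" by (intro finite_gens_mtens fin_a)
 have B: "(\<lambda>y. tmap A L' (mtens A N' M') L' 0 0 (mid A L') (braid A N' M') (asc1 A L' N' M' y)) \<in>
   lin_hom A (mtens A (mtens A L' N') M') (mtens A L' (mtens A M' N')) 0"
  by (rule lin_hom_comp[OF tmap_lin_hom[OF lin_hom_mid braid_lin_hom[OF fin_a(6,5)] fin_a(4) _ refl] asc1_lin_hom[OF fin_a(4,6,5)]])
    (auto intro!: finite_gens_mtens fin_a)
 show ?thesis
  unfolding SS_def conj_add[OF asc1_lin_hom[OF fin_a(4-6)] lh_mcar[OF s(1) F] lh_mcar[OF s(2) F]]
   tmap_add_left tmap_add_right
   conj_add[OF B lh_mcar[OF k1 F'] lh_mcar[OF k2 F']]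
  unfolding S1_def S2_def TP_asc_left[OF rk rh dl h k e2] TP_asc_left[OF dk dh ll h k e1]
  by simp
qed

end

lemma tt_hexagon1:
 assumes dm: "dmod A L" "dmod A M" "dmod A N"
 shows "(\<lambda>x. asc2 A L M N (tt L (mtens A M N) (asc1 A L M N x))) =
  tmap A (mtens A L M) N (mtens A L M) 0 0 (tt L M) (mid A N) +
  (\<lambda>x. tmap A (mtens A M L) N (mtens A L M) 0 0 (braid A M L) (mid A N)
   (asc2 A M L N (tmap A M (mtens A L N) M 0 0 (mid A M) (tt L N)
    (asc1 A M L N (tmap A (mtens A L M) N (mtens A M L) 0 0 (braid A L M) (mid A N) x)))))"
proof -
 have "\<forall>j<ngen A. XX A (mtens A M N) j =
   tmap A M N M (0 - ed A j) 0 (XX A M j) (mid A N) + tmap A M N M 0 (0 - ed A j) (mid A M) (XX A N j)"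
  using XX_mtens[OF dA dm(2,3)] by blast
 from TP_asc_right[OF dm dm XX_fam[OF dA dm(1)] XX_fam[OF dA dm(2)] XX_fam[OF dA dm(3)] lin_hom_mid lin_hom_mid this]
 show ?thesis by (simp add: tt_def)
qed

lemma tt_hexagon2:
 assumes dm: "dmod A L" "dmod A M" "dmod A N"
 shows "(\<lambda>x. asc1 A L M N (tt (mtens A L M) N (asc2 A L M N x))) =
  tmap A L (mtens A M N) L 0 0 (mid A L) (tt M N) +
  (\<lambda>x. tmap A L (mtens A N M) L 0 0 (mid A L) (braid A N M)
   (asc1 A L N M (tmap A (mtens A L N) M (mtens A L N) 0 0 (tt L N) (mid A M)
    (asc2 A L N M (tmap A L (mtens A M N) L 0 0 (mid A L) (braid A M N) x)))))"
proof -
 have "\<forall>j<ngen A. XX A (mtens A L M) j =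
   tmap A L M L 0 (0 - ed A j) (mid A L) (XX A M j) + tmap A L M L (0 - ed A j) 0 (XX A L j) (mid A M)"
  using trans[OF XX_mtens[OF dA dm(1,2)] add.commute] by blast
 from TP_asc_left[OF dm dm XX_fam[OF dA dm(2)] XX_fam[OF dA dm(1)] XX_fam[OF dA dm(3)] lin_hom_mid lin_hom_mid this]
 show ?thesis by (simp add: tt_def)
qed

end

subsection \<open>The de Rham differential and the universal Atiyah class\<close>

lemma pairing_par:
 assumes "\<omega> \<in> mcar A (Om_gens A)" "j < ngen A"
 shows "pairing A (- zdeg A j) (par A j) \<omega> = ksgn A (- zdeg A j) (\<omega> (GAtom j))"
proof -
 have "pairing A (- zdeg A j) (par A j) \<omega> = (\<Sum>i<ngen A. if i = j then ksgn A (- zdeg A j) (\<omega> (GAtom j)) else 0)"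
  unfolding pairing_def by (intro sum.cong refl) (use assms in \<open>auto simp: par_avar amul_1_right mcar_def\<close>)
 with assms show ?thesis by simp
qed

text \<open>Existence is the expansion of D(a) along the values D(z_i); the sign |z_i| restores the
  order of the factors. For uniqueness, pairing with the coordinate derivation
  \<open>par A j\<close> reads off the coefficient at d_dR z_j up to sign.\<close>

lemma ddR_eq:
 fixes a :: "'k::field fga"
 assumes a: "a \<in> acar A"
 shows "ddR A a = (\<lambda>g. case g of GAtom i \<Rightarrow> if i < ngen A then ksgn A (zdeg A i) (apar A i a) else 0 | _ \<Rightarrow> 0)"
  (is "_ = ?w")
 unfolding ddR_def
proof (rule the_equality)
 have "pairing A p D ?w = D a" if D: "D \<in> der A p" for p D
 proof -
  have "amul A (ksgn A p (ksgn A (zdeg A i) (apar A i a))) (D (avar i)) = amul A (D (avar i)) (apar A i a)" if "i < ngen A" for i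
   using amul_commute[OF der_ahom[OF D ahom_avar[OF that refl] refl], of "apar A i a"]
   by (simp add: ksgn_ksgn add.commute)
  then show ?thesis
   unfolding pairing_def der_apply[OF D a] by (intro sum.cong refl) simp
 qed
 then show "?w \<in> mcar A (Om_gens A) \<and> (\<forall>p. \<forall>D\<in>der A p. pairing A p D ?w = D a)"
  using a by (auto simp: mcar_def Om_gens_def acar_apar split: gen.split)
next
 fix \<omega> :: "'k mel" assume \<omega>: "\<omega> \<in> mcar A (Om_gens A) \<and> (\<forall>p. \<forall>D\<in>der A p. pairing A p D \<omega> = D a)"
 show "\<omega> = ?w"
 proof (rule ext)
  fix g
  show "\<omega> g = ?w g"
  proof (cases "g \<in> Om_gens A")
   case True
   then obtain j where j: "g = GAtom j" "j < ngen A" by (auto simp: Om_gens_def)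
   then have "ksgn A (- zdeg A j) (\<omega> (GAtom j)) = apar A j a"
    using \<omega> par_der[OF j(2)] pairing_par[of \<omega> A j] par_apply[OF j(2) a] by metis
   then have "ksgn A (zdeg A j) (apar A j a) = ksgn A 0 (\<omega> (GAtom j))"
    by (metis ksgn_ksgn add.right_inverse)
   then show ?thesis using j by (simp add: ksgn_even)
  next
   case False
   then have "\<omega> g = 0" using \<omega> by (simp add: mcar_def)
   then show ?thesis using False by (auto simp: Om_gens_def split: gen.split)
  qed
 qed
qed

definition EM :: "'k::field cdga \<Rightarrow> (nat \<Rightarrow> 'k mmap) \<Rightarrow> 'k mmap" where
 "EM A \<alpha> = (\<lambda>x. \<Sum>i<ngen A. tel A (gdeg (Om1 A)) (ge (GAtom i)) (\<alpha> i x))"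

text \<open>The sign |z_i| of the de Rham differential and the sign of s^{-1} combine to |e_i|. This
  is the sign of moving the coefficient behind e_i, so on the right no sign is visible.\<close>

lemma sddR_eq:
 fixes x :: "'k::field mel"
 assumes x: "x \<in> mcar A (gens M)" and fin_a: "finite (gens M)"
 shows "sddR A M x = (\<Sum>i<ngen A. tel A (gdeg (Om1 A)) (ge (GAtom i)) (nab A i x))"
proof (rule ext)
 fix g
 show "sddR A M x g = (\<Sum>i<ngen A. tel A (gdeg (Om1 A)) (ge (GAtom i)) (nab A i x)) g"
 proof (cases g)
  case (GPair u v)
  have xw: "x w \<in> acar A" for w using x by (simp add: mcar_def)
  have xv: "x v = 0" if "v \<notin> gens M" using x that by (simp add: mcar_def)
  have "sddR A M x g = (\<Sum>w\<in>gens M. if w = v then sinv A (ddR A (x v)) u else 0)"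
   unfolding sddR_def sum_apply GPair tel_def gen.case
  proof (intro sum.cong refl)
   fix w
   have "sinv A (ddR A (x v)) u \<in> acar A"
    by (auto simp: sinv_def ddR_eq[OF xw] acar_apar[OF xw] split: gen.split)
   then show "amul A (sinv A (ddR A (x w)) u) (ksgn A (gdeg (Om1 A) u) (ge w v)) =
     (if w = v then sinv A (ddR A (x v)) u else 0)"
    by (auto simp: ge_def amul_1_right)
  qed
  also have "\<dots> = sinv A (ddR A (x v)) u"
   using fin_a xv by (auto simp: sinv_def ddR_eq[OF acar_0] split: gen.split)
  also have "\<dots> = (\<Sum>i<ngen A. if GAtom i = u then ksgn A (ed A i) (apar A i (x v)) else 0)"
  proof (cases u)
   case (GAtom j)
   have "ksgn A 1 (ksgn A (zdeg A j) b) = ksgn A (ed A j) b" for b :: "'k fga"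
    unfolding ksgn_ksgn by (rule ksgn_cong) auto
   then show ?thesis
    by (simp add: GAtom sinv_def ddR_eq[OF xw])
  qed (simp add: sinv_def ddR_eq[OF xw] zero_fun_apply)
  also have "\<dots> = (\<Sum>i<ngen A. tel A (gdeg (Om1 A)) (ge (GAtom i)) (nab A i x)) g"
   unfolding sum_apply GPair
   by (intro sum.cong refl)
     (auto simp: tel_def ge_def nab_def amul_1_left acar_apar[OF xw])
  finally show ?thesis .
 qed (simp add: sddR_def sum_apply tel_def zero_fun_apply)
qed

context
 fixes A :: "'k::field cdga" and M M' :: "'k sfmod" and \<alpha> :: "nat \<Rightarrow> 'k mmap" and p :: int
 assumes \<alpha>: "\<alpha> \<in> fam A M M' p" and fin_a: "finite (gens M)"
begin

text \<open>The component at i has degree p - |e_i|, and the coefficient additionally passes e_i, so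
  that linearity holds with sign exponent p for all components alike.\<close>

lemma EM_lin_hom: "EM A \<alpha> \<in> lin_hom A M (mtens A (Om1 A) M') p"
proof -
 note f = famD[OF \<alpha>]
 have e: "ge (GAtom i) \<in> mhom A (Om1 A) (ed A i)" if "i < ngen A" for i
  by (rule mhom_ge) (use that in simp_all)
 show ?thesis
  unfolding lin_hom_def mem_Collect_eq EM_def
 proof (intro conjI allI impI ballI)
  fix x :: "'k mel" assume "x \<notin> mcar A (gens M)"
  then show "(\<Sum>i<ngen A. tel A (gdeg (Om1 A)) (ge (GAtom i)) (\<alpha> i x)) = 0"
   by (intro sum.neutral ballI) (simp add: lh_outside[OF f])
 next
  fix x y :: "'k mel" assume "x \<in> mcar A (gens M)" "y \<in> mcar A (gens M)"
  then show "(\<Sum>i<ngen A. tel A (gdeg (Om1 A)) (ge (GAtom i)) (\<alpha> i (x + y))) =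
    (\<Sum>i<ngen A. tel A (gdeg (Om1 A)) (ge (GAtom i)) (\<alpha> i x)) + (\<Sum>i<ngen A. tel A (gdeg (Om1 A)) (ge (GAtom i)) (\<alpha> i y))"
   unfolding sum.distrib[symmetric] by (intro sum.cong refl) (simp add: lh_add[OF f] tel_add_right)
 next
  fix c and x :: "'k mel" assume "x \<in> mcar A (gens M)"
  then show "(\<Sum>i<ngen A. tel A (gdeg (Om1 A)) (ge (GAtom i)) (\<alpha> i (msc c x))) =
    msc c (\<Sum>i<ngen A. tel A (gdeg (Om1 A)) (ge (GAtom i)) (\<alpha> i x))"
   unfolding msc_sum by (intro sum.cong refl) (simp add: lh_msc[OF f])
 next
  fix k and x :: "'k mel" assume x: "x \<in> mhom A M k"
  have "tel A (gdeg (Om1 A)) (ge (GAtom i)) (\<alpha> i x) \<in> mhom A (mtens A (Om1 A) M') (k + p)" if "i < ngen A" for i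
   by (rule tel_mhom[OF e[OF that] lh_mhom[OF f[OF that] x refl]]) simp
  then show "(\<Sum>i<ngen A. tel A (gdeg (Om1 A)) (ge (GAtom i)) (\<alpha> i x)) \<in> mhom A (mtens A (Om1 A) M') (k + p)"
   by (auto intro!: mhom_sum)
 next
  fix k and a :: "'k fga" and x :: "'k mel" assume a: "a \<in> ahom A k" and x: "x \<in> mcar A (gens M)"
  have "tel A (gdeg (Om1 A)) (ge (GAtom i)) (\<alpha> i (mact A a x)) =
    msc (sg (p * k)) (mact A a (tel A (gdeg (Om1 A)) (ge (GAtom i)) (\<alpha> i x)))" if i: "i < ngen A" for i
  proof -
   have "sg ((p - ed A i) * k) * sg (ed A i * k) = (sg (p * k) :: 'k)"
    unfolding sg_add[symmetric] by (rule sg_eqI) auto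
   then show ?thesis
    unfolding lh_mact[OF f[OF i] a x] tel_simps tel_mact_right[OF e[OF i] a] by simp
  qed
  then show "(\<Sum>i<ngen A. tel A (gdeg (Om1 A)) (ge (GAtom i)) (\<alpha> i (mact A a x))) =
    msc (sg (p * k)) (mact A a (\<Sum>i<ngen A. tel A (gdeg (Om1 A)) (ge (GAtom i)) (\<alpha> i x)))"
   by (simp add: mact_sum msc_sum)
 qed
qed

end

text \<open>The sign is the part of the middle interchange that depends on the two basis elements
  only. With it the coefficients become graded symmetric for the degrees \<open>ed\<close>.\<close>

definition Pi_of :: "'k::field cdga \<Rightarrow> 'k fga \<Rightarrow> nat \<Rightarrow> nat \<Rightarrow> 'k fga" where
 "Pi_of A P i j = fsm (sg (ed A i * ed A j)) (wt2_pairing A P (GAtom i) (GAtom j))"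

text \<open>Interchanging \<alpha>_i(x) with e_j costs the sign (|x| + p - |e_i|) |e_j|. Of this,
  |e_i| |e_j| belongs to \<open>Pi_of\<close>, and the rest combines with q |x| to the sign in
  \<open>TT\<close>.\<close>

lemma iota_sigma:
 fixes A :: "'k::field cdga"
 assumes bv: "bivector A (Pi_of A P)"
  and \<alpha>: "\<alpha> \<in> fam A M M' p" and \<beta>: "\<beta> \<in> fam A N N' q"
  and fin_a: "finite (gens M)" "finite (gens N)" "finite (gens M')" "finite (gens N')"
 shows "(\<lambda>x. cmp (iota A P) (M', N') (cmp (sigma A) (M', N')
   (tmap A M N (mtens A (Om1 A) M') p q (EM A \<alpha>) (EM A \<beta>) x))) = TT A (Pi_of A P) M N M' p q \<alpha> \<beta>"
proof (rule lin_hom_eqI)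
 interpret bivector A "Pi_of A P" by (rule bv)
 have wt: "wt2_pairing A P (GAtom i) (GAtom j) \<in> ahom A (ed A i + ed A j)" if "i < ngen A" "j < ngen A" for i j
  using ahom_fsm[OF Pi[OF that], of "sg (ed A i * ed A j)"] by (simp add: Pi_of_def)
 note E = EM_lin_hom[OF \<alpha> fin_a(1)] EM_lin_hom[OF \<beta> fin_a(2)]
 note S = sigma_lin_hom[OF fin_a(3,4), of A]
 have I: "cmp (iota A P) (M', N') \<in>
   lin_hom A (mtens A (mtens A (Om1 A) (Om1 A)) (mtens A M' N')) (mtens A M' N') 0"
  by (rule iota_lin_hom[OF fin_a(3,4) wt])
 note T = tmap_lin_hom[OF E fin_a(1,2) refl]
 show F: "finite (gens (mtens A M N))" by (intro finite_gens_mtens fin_a)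
 show "(\<lambda>x. cmp (iota A P) (M', N') (cmp (sigma A) (M', N')
   (tmap A M N (mtens A (Om1 A) M') p q (EM A \<alpha>) (EM A \<beta>) x))) \<in> lin_hom A (mtens A M N) (mtens A M' N') (p + q)"
  by (rule lin_hom_comp[OF I lin_hom_comp[OF S T F refl] F]) simp_all
 show "TT A (Pi_of A P) M N M' p q \<alpha> \<beta> \<in> lin_hom A (mtens A M N) (mtens A M' N') (p + q)"
  by (rule TT_lin_hom[OF \<alpha> \<beta> fin_a(1,2) refl])
 fix g assume "g \<in> gens (mtens A M N)"
 then obtain v w where g: "g = GPair v w" "v \<in> gens M" "w \<in> gens N" by (rule gens_mtensE)
 note a = lh_mhom[OF famD[OF \<alpha>] mhom_ge[OF g(2) refl] refl] and b = lh_mcar[OF famD[OF \<beta>] fin_a(2), of _ "ge w"]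
 let ?G = "gdeg (mtens A (Om1 A) M')" and ?g = "gdeg (Om1 A)"
 let ?t = "\<lambda>i j. tel A ?G (tel A ?g (ge (GAtom i)) (\<alpha> i (ge v))) (tel A ?g (ge (GAtom j)) (\<beta> j (ge w)))"
 have e: "ge (GAtom i) \<in> mcar A (gens (Om1 A))" if "i < ngen A" for i
  by (rule mcar_ge) (use that in simp)
 have t: "?t i j \<in> mcar A (gens (mtens A (mtens A (Om1 A) M') (mtens A (Om1 A) N')))"
  if "i \<in> {..<ngen A}" "j \<in> {..<ngen A}" for i j
  using that by (intro tel_mcar mhom_mcar[OF a] b e) auto
 define r where "r i j = msc (sg ((gdeg M v + (p - ed A i)) * ed A j))
   (tel A (gdeg (mtens A (Om1 A) (Om1 A))) (ge (GPair (GAtom i) (GAtom j))) (tel A (gdeg M') (\<alpha> i (ge v)) (\<beta> j (ge w))))" for i j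
 have s: "cmp (sigma A) (M', N') (?t i j) = r i j" if "i \<in> {..<ngen A}" "j \<in> {..<ngen A}" for i j
  unfolding r_def using that by (subst sigma_tel[OF fin_a(3,4) _ _ a b]) auto
 have r: "r i j \<in> mcar A (gens (mtens A (mtens A (Om1 A) (Om1 A)) (mtens A M' N')))"
  if "i \<in> {..<ngen A}" "j \<in> {..<ngen A}" for i j
  unfolding r_def using that by (intro mcar_msc tel_mcar mhom_mcar[OF a] b mcar_ge) auto
 have i: "cmp (iota A P) (M', N') (r i j) = msc (sg ((gdeg M v + (p - ed A i)) * ed A j))
   (mact A (wt2_pairing A P (GAtom i) (GAtom j)) (tel A (gdeg M') (\<alpha> i (ge v)) (\<beta> j (ge w))))"
  if ij: "i \<in> {..<ngen A}" "j \<in> {..<ngen A}" for i j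
 proof -
  have ij': "i < ngen A" "j < ngen A" using ij by auto
  note z = tel_mcar[OF mhom_mcar[OF a[OF ij'(1)]] b[OF ij'(2)], of "gdeg M'"]
  have m: "tel A (gdeg (mtens A (Om1 A) (Om1 A))) (ge (GPair (GAtom i) (GAtom j))) (tel A (gdeg M') (\<alpha> i (ge v)) (\<beta> j (ge w)))
    \<in> mcar A (gens (mtens A (mtens A (Om1 A) (Om1 A)) (mtens A M' N')))"
   by (rule tel_mcar[OF mcar_ge z]) (use ij in auto)
  show ?thesis
   unfolding r_def lh_msc[OF I m]
   by (rule arg_cong[where f = "msc _"], rule iota_tel[OF fin_a(3,4) wt ij' z])
 qed
 have tt: "(\<Sum>i<ngen A. \<Sum>j<ngen A. ?t i j) \<in> mcar A (gens (mtens A (mtens A (Om1 A) M') (mtens A (Om1 A) N')))"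
  by (intro mcar_sum t)
 have rr: "(\<Sum>i<ngen A. \<Sum>j<ngen A. r i j) \<in> mcar A (gens (mtens A (mtens A (Om1 A) (Om1 A)) (mtens A M' N')))"
  by (intro mcar_sum r)
 have "tmap A M N (mtens A (Om1 A) M') p q (EM A \<alpha>) (EM A \<beta>) (ge g) =
   msc (sg (q * gdeg M v)) (\<Sum>i<ngen A. \<Sum>j<ngen A. ?t i j)"
  unfolding g(1) tmap_ge[OF E fin_a(1,2) g(2,3)]
  unfolding EM_def tel_sum_left
  unfolding tel_sum_right ..
 moreover have "cmp (sigma A) (M', N') (msc c (\<Sum>i<ngen A. \<Sum>j<ngen A. ?t i j)) =
   msc c (\<Sum>i<ngen A. \<Sum>j<ngen A. r i j)" for c
 proof -
  have "cmp (sigma A) (M', N') (\<Sum>i<ngen A. \<Sum>j<ngen A. ?t i j) = (\<Sum>i<ngen A. cmp (sigma A) (M', N') (\<Sum>j<ngen A. ?t i j))"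
   by (rule lh_sum[OF S mcar_sum[OF t]])
  also have "\<dots> = (\<Sum>i<ngen A. \<Sum>j<ngen A. cmp (sigma A) (M', N') (?t i j))"
   by (rule sum.cong[OF refl lh_sum[OF S t]])
  also have "\<dots> = (\<Sum>i<ngen A. \<Sum>j<ngen A. r i j)"
   by (intro sum.cong refl s)
  finally show ?thesis
   using lh_msc[OF S tt, of c] by simp
 qed
 moreover have "cmp (iota A P) (M', N') (msc c (\<Sum>i<ngen A. \<Sum>j<ngen A. r i j)) =
   msc c (\<Sum>i<ngen A. \<Sum>j<ngen A. cmp (iota A P) (M', N') (r i j))" for c
 proof -
  have "cmp (iota A P) (M', N') (\<Sum>i<ngen A. \<Sum>j<ngen A. r i j) = (\<Sum>i<ngen A. cmp (iota A P) (M', N') (\<Sum>j<ngen A. r i j))"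
   by (rule lh_sum[OF I mcar_sum[OF r]])
  also have "\<dots> = (\<Sum>i<ngen A. \<Sum>j<ngen A. cmp (iota A P) (M', N') (r i j))"
   by (rule sum.cong[OF refl lh_sum[OF I r]])
  finally show ?thesis
   using lh_msc[OF I rr, of c] by simp
 qed
 moreover have "msc (sg (q * gdeg M v)) (\<Sum>i<ngen A. \<Sum>j<ngen A. cmp (iota A P) (M', N') (r i j)) =
   TT A (Pi_of A P) M N M' p q \<alpha> \<beta> (ge g)"
  unfolding g(1) TT_ge[OF \<alpha> \<beta> fin_a(1,2) g(2,3)] PS_def msc_sum
 proof (intro sum.cong refl)
  fix k l assume kl: "k \<in> {..<ngen A}" "l \<in> {..<ngen A}"
  show "msc (sg (q * gdeg M v)) (cmp (iota A P) (M', N') (r k l)) = mact A (Pi_of A P k l)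
    (msc (sg (p * ed A l) * sg ((q - ed A l) * gdeg M v)) (tel A (gdeg M') (\<alpha> k (ge v)) (\<beta> l (ge w))))"
   unfolding i[OF kl] Pi_of_def mact_simps msc_simps sg_add[symmetric]
   by (rule arg_cong2[OF sg_eqI refl, of _ _ msc]) auto
 qed
 ultimately show "cmp (iota A P) (M', N') (cmp (sigma A) (M', N')
   (tmap A M N (mtens A (Om1 A) M') p q (EM A \<alpha>) (EM A \<beta>) (ge g))) = TT A (Pi_of A P) M N M' p q \<alpha> \<beta> (ge g)"
  by simp
qed auto

lemma xi_cmp:
 assumes dA: "adiff A \<in> der A 1" and M: "dmod A M"
 shows "cmp (xi A) M = EM A (XX A M)"
proof (rule lin_hom_eqI)
 note fin_a = dm_finite[OF M]
 have eq: "sddR A M (mdiff M (ge w)) = EM A (XX A M) (ge w)" if "w \<in> gens M" for w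
  unfolding sddR_eq[OF dm_mcar[OF M] fin_a] EM_def using XX_ge[OF dA M that] by simp
 have m: "sddR A M (mdiff M (ge w)) \<in> mhom A (mtens A (Om1 A) M) (gdeg M w + 0)" if "w \<in> gens M" for w
  unfolding eq[OF that] by (rule lh_mhom[OF EM_lin_hom[OF XX_fam[OF dA M] fin_a] mhom_ge[OF that refl] refl])
 show "cmp (xi A) M \<in> lin_hom A M (mtens A (Om1 A) M) 0"
  unfolding xi_def ptrans.simps by (rule alin_lin_hom[OF fin_a m refl])
 show "EM A (XX A M) \<in> lin_hom A M (mtens A (Om1 A) M) 0"
  by (rule EM_lin_hom[OF XX_fam[OF dA M] fin_a])
 show "finite (gens M)" by (rule fin_a)
 fix w assume w: "w \<in> gens M"
 show "cmp (xi A) M (ge w) = EM A (XX A M) (ge w)"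
  unfolding xi_def ptrans.simps by (subst alin_ge[where W' = "gens (mtens A (Om1 A) M)" and A = A, OF fin_a w]) (rule mhom_mcar[OF m[OF w]], rule eq[OF w])
qed simp

lemma xi_coh:
 assumes dA: "adiff A \<in> der A 1" and h: "h \<in> lin_hom A M M' 0" and fin_a: "finite (gens M)" "finite (gens M')"
 shows "coh (xi A) M M' h = EM A (dl A M 0 h)"
proof (rule lin_hom_eqI)
 have d: "dl A M 0 h \<in> fam A M M' (- 1)" by (rule dl_fam[OF dA h fin_a(1)]) simp
 have eq: "- sddR A M' (h (ge w)) = EM A (dl A M 0 h) (ge w)" if "w \<in> gens M" for w
  unfolding sddR_eq[OF lh_mcar[OF h fin_a(1)] fin_a(2)] EM_def using dl_ge[OF dA h fin_a(1) that]
  by (simp add: tel_uminus_right sum_negf)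
 have m: "- sddR A M' (h (ge w)) \<in> mhom A (mtens A (Om1 A) M') (gdeg M w + - 1)" if "w \<in> gens M" for w
  unfolding eq[OF that] by (rule lh_mhom[OF EM_lin_hom[OF d fin_a(1)] mhom_ge[OF that refl] refl])
 show "coh (xi A) M M' h \<in> lin_hom A M (mtens A (Om1 A) M') (- 1)"
  unfolding xi_def ptrans.simps by (rule alin_lin_hom[OF fin_a(1) m refl])
 show "EM A (dl A M 0 h) \<in> lin_hom A M (mtens A (Om1 A) M') (- 1)"
  by (rule EM_lin_hom[OF d fin_a(1)])
 show "finite (gens M)" by (rule fin_a)
 fix w assume w: "w \<in> gens M"
 show "coh (xi A) M M' h (ge w) = EM A (dl A M 0 h) (ge w)"
  unfolding xi_def ptrans.simps by (subst alin_ge[where W' = "gens (mtens A (Om1 A) M')" and A = A, OF fin_a(1) w]) (rule mhom_mcar[OF m[OF w]], rule eq[OF w])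
qed simp

lemma tmap_Om_EM:
 assumes dA: "adiff A \<in> der A 1" and \<alpha>: "\<alpha> \<in> fam A M M' p" and k: "k \<in> lin_hom A M' M'' 0"
  and fin_a: "finite (gens M)" "finite (gens M')"
 shows "(\<lambda>x. tmap A (Om1 A) M' (Om1 A) 0 0 (mid A (Om1 A)) k (EM A \<alpha> x)) = EM A (lm A 0 k \<alpha>)"
proof (rule ext)
 fix x
 have e: "ge (GAtom i) \<in> mhom A (Om1 A) (ed A i)" if "i < ngen A" for i
  by (rule mhom_ge) (use that in simp_all)
 have m: "\<alpha> i x \<in> mcar A (gens M')" if "i < ngen A" for i
  by (rule lh_mcar[OF famD[OF \<alpha> that] fin_a(1)])
 note T = tmap_lin_hom[OF lin_hom_mid k finite_gens_Om1 fin_a(2) refl]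
 have "tmap A (Om1 A) M' (Om1 A) 0 0 (mid A (Om1 A)) k (EM A \<alpha> x) =
   (\<Sum>i<ngen A. tmap A (Om1 A) M' (Om1 A) 0 0 (mid A (Om1 A)) k (tel A (gdeg (Om1 A)) (ge (GAtom i)) (\<alpha> i x)))"
  unfolding EM_def by (rule lh_sum[OF T]) (auto intro!: tel_mcar mhom_mcar[OF e] m)
 also have "\<dots> = EM A (lm A 0 k \<alpha>) x"
  unfolding EM_def by (intro sum.cong refl)
   (simp add: tmap_tel[OF lin_hom_mid k finite_gens_Om1 fin_a(2) e m] mid_ge lm_simps)
 finally show "tmap A (Om1 A) M' (Om1 A) 0 0 (mid A (Om1 A)) k (EM A \<alpha> x) = EM A (lm A 0 k \<alpha>) x" .
qed

section \<open>Linear extension to formal combinations of pairs\<close>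

definition lext :: "('u \<Rightarrow> 'k::field mmap) \<Rightarrow> ('u \<Rightarrow>\<^sub>0 'k) \<Rightarrow> 'k mmap" where
 "lext \<phi> p = psum (\<lambda>u a. fsc a (\<phi> u)) p"

lemma lext_addb: "addb (\<lambda>u a. fsc a (\<phi> u))"
 by (simp add: addb_def fsc_add_left)

lemma lext_0[simp]: "lext \<phi> 0 = 0"
 by (simp add: lext_def)

lemma lext_add: "lext \<phi> (p + q) = lext \<phi> p + lext \<phi> q"
 unfolding lext_def by (rule psum_add[OF lext_addb])

lemma lext_diff: "lext \<phi> (p - q) = lext \<phi> p - lext \<phi> q"
 unfolding lext_def by (rule psum_diff[OF lext_addb])

lemma lext_psum: "lext \<phi> (psum b p) = (\<Sum>u\<in>Poly_Mapping.keys p. lext \<phi> (b u (Poly_Mapping.lookup p u)))"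
 unfolding lext_def by (subst psum_def) (rule psum_sum[OF lext_addb])

lemma lext_single[simp]: "lext \<phi> (Poly_Mapping.single u a) = fsc a (\<phi> u)"
 unfolding lext_def by (simp add: psum_single)

lemma lext_push: "lext \<phi> (psum (\<lambda>u. Poly_Mapping.single (g u)) p) = lext (\<lambda>u. \<phi> (g u)) p"
 unfolding lext_psum lext_single unfolding lext_def psum_def ..

lemma lext_scaled: "lext \<phi> (psum (\<lambda>u y. Poly_Mapping.single (g u) (x * y)) p) = fsc x (lext (\<lambda>u. \<phi> (g u)) p)"
 unfolding lext_psum lext_single unfolding lext_def psum_def fsc_sum fsc_simps ..

text \<open>Composition in a box product and the rebracketing functors produce nested sums of single
  pairs. This turns them into iterated extensions, on which identities can be checked pair by
  pair.\<close>

lemma lext_nest: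
 "lext \<phi> (psum (\<lambda>u x. psum (\<lambda>v y. Poly_Mapping.single (g u v) (x * y)) (Q u)) p) =
  lext (\<lambda>u. lext (\<lambda>v. \<phi> (g u v)) (Q u)) p"
 unfolding lext_psum[of _ _ p] lext_scaled unfolding lext_def[of _ p] psum_def[of _ p] ..

lemma lext_fsm:
 fixes p :: "'u \<Rightarrow>\<^sub>0 'k::field"
 shows "lext \<phi> (fsm c p) = fsc c (lext \<phi> p)"
proof -
 have "addb (\<lambda>(u::'u) y. Poly_Mapping.single u (c * y))"
  by (simp add: addb_def distrib_left single_add)
 then have "fsm c p = psum (\<lambda>u y. Poly_Mapping.single u (c * y)) p"
  by (induction p rule: poly_mapping_linear_induct_UNIV) (simp_all add: fsm_add psum_add psum_single fsm_single)
 then show ?thesis using lext_scaled[of \<phi> "\<lambda>u. u" c p] by simp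
qed

lemma lext_cong: "(\<And>u. u \<in> Poly_Mapping.keys p \<Longrightarrow> \<phi> u = \<psi> u) \<Longrightarrow> lext \<phi> p = lext \<psi> p"
 unfolding lext_def by (rule psum_cong) simp

lemma lext_plus: "lext \<phi> p + lext \<psi> p = lext (\<lambda>u. \<phi> u + \<psi> u) p"
 by (simp add: lext_def psum_def fsc_add sum.distrib)

lemma lext_minus: "lext \<phi> p - lext \<psi> p = lext (\<lambda>u. \<phi> u - \<psi> u) p"
 by (simp add: lext_def psum_def fsc_diff sum_subtractf)

lemma lext_zero[simp]: "lext (\<lambda>u. 0) p = 0" "lext 0 p = 0"
 by (simp_all add: lext_def psum_def fapp del: lam_zero)

lemma lext_lin_hom:
 "(\<And>u. u \<in> Poly_Mapping.keys p \<Longrightarrow> \<phi> u \<in> lin_hom A M N r) \<Longrightarrow> lext \<phi> p \<in> lin_hom A M N r"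
 unfolding lext_def psum_def by (intro lin_hom_sum lin_hom_fsc)

lemma lext_apply: "lext \<phi> p x = (\<Sum>u\<in>Poly_Mapping.keys p. msc (Poly_Mapping.lookup p u) (\<phi> u x))"
 by (simp add: lext_def psum_def sum_mmap_apply fsc_apply)

lemma lext_right: "(\<lambda>x. lext \<phi> p (G x)) = lext (\<lambda>u x. \<phi> u (G x)) p"
 by (rule ext) (simp add: lext_apply)

lemma lext_conj:
 assumes F: "F \<in> lin_hom A Q R r" and \<phi>: "\<And>u. u \<in> Poly_Mapping.keys p \<Longrightarrow> \<phi> u \<in> lin_hom A M Q s" and fin: "finite (gens M)"
 shows "(\<lambda>x. F (lext \<phi> p (G x))) = lext (\<lambda>u x. F (\<phi> u (G x))) p"
proof (rule ext)
 fix x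
 have "F (lext \<phi> p (G x)) = (\<Sum>u\<in>Poly_Mapping.keys p. F (msc (Poly_Mapping.lookup p u) (\<phi> u (G x))))"
  unfolding lext_apply by (rule lh_sum[OF F mcar_msc[OF lh_mcar[OF \<phi> fin]]])
 also have "\<dots> = lext (\<lambda>u x. F (\<phi> u (G x))) p x"
  unfolding lext_apply by (intro sum.cong refl lh_msc[OF F lh_mcar[OF \<phi> fin]])
 finally show "F (lext \<phi> p (G x)) = lext (\<lambda>u x. F (\<phi> u (G x))) p x" .
qed

text \<open>The version for triples, which are formal pairs one entry of which is again a formal
  combination of pairs.\<close>

lemma lext_conj2:
 assumes F: "F \<in> lin_hom A Q R r" and fin: "finite (gens M)"
  and \<phi>: "\<And>u v. u \<in> Poly_Mapping.keys p \<Longrightarrow> v \<in> Poly_Mapping.keys (S u) \<Longrightarrow> \<phi> u v \<in> lin_hom A M Q s"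
 shows "(\<lambda>x. F (lext (\<lambda>u. lext (\<phi> u) (S u)) p (G x))) = lext (\<lambda>u. lext (\<lambda>v x. F (\<phi> u v (G x))) (S u)) p"
 by (subst lext_conj[OF F lext_lin_hom fin]) (auto intro: \<phi> lext_cong simp: lext_conj[OF F \<phi> fin])

lemma lext_mem:
 assumes 0: "0 \<in> X" and add: "\<And>x y. x \<in> X \<Longrightarrow> y \<in> X \<Longrightarrow> x + y \<in> X" and sc: "\<And>c x. x \<in> X \<Longrightarrow> fsc c x \<in> X"
  and \<phi>: "\<And>u. u \<in> Poly_Mapping.keys p \<Longrightarrow> \<phi> u \<in> X"
 shows "lext \<phi> p \<in> X"
 unfolding lext_def psum_def using finite_keys[of p] \<phi>
 by (induction rule: finite_induct) (auto intro: 0 add sc)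

lemma tmap_lext_left: "tmap A M N M' p q (lext \<phi> r) k = lext (\<lambda>u. tmap A M N M' p q (\<phi> u) k) r"
 by (simp add: lext_def psum_def tmap_sum_left)

lemma tmap_lext_right: "tmap A M N M' p q h (lext \<phi> r) = lext (\<lambda>u. tmap A M N M' p q h (\<phi> u)) r"
 by (simp add: lext_def psum_def tmap_sum_right)

lemma tcar_psum: "(\<And>u a. u \<in> Poly_Mapping.keys p \<Longrightarrow> b u a \<in> tcar X Y) \<Longrightarrow> psum b p \<in> tcar X Y"
 unfolding psum_def tcar_def using keys_sum[of "\<lambda>u. b u (Poly_Mapping.lookup p u)" "Poly_Mapping.keys p"] by blast

lemma tcar_single: "u \<in> X \<Longrightarrow> v \<in> Y \<Longrightarrow> Poly_Mapping.single (u, v) a \<in> tcar X Y"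
 unfolding tcar_def by (auto split: if_splits)

lemma tcarD: "p \<in> tcar X Y \<Longrightarrow> u \<in> Poly_Mapping.keys p \<Longrightarrow> fst u \<in> X \<and> snd u \<in> Y"
 unfolding tcar_def by auto

lemma tcar_mono: "p \<in> tcar X Y \<Longrightarrow> X \<subseteq> X' \<Longrightarrow> Y \<subseteq> Y' \<Longrightarrow> p \<in> tcar X' Y'"
 unfolding tcar_def by blast

lemma psum_single_prod: "psum (\<lambda>u. Poly_Mapping.single (g u)) (Poly_Mapping.single u a) = Poly_Mapping.single (g u) a"
 by (simp add: psum_single)

lemma psum_nest_single: "psum (\<lambda>u x. psum (\<lambda>v y. Poly_Mapping.single (g u v) (x * y)) (Q u)) (Poly_Mapping.single u (a::'k::ring)) =
  psum (\<lambda>v y. Poly_Mapping.single (g u v) (a * y)) (Q u)"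
 by (simp add: psum_single psum_def)

lemma psum_scaled_single: "psum (\<lambda>v y. Poly_Mapping.single (g v) (x * y)) (Poly_Mapping.single u a) =
  Poly_Mapping.single (g u) (x * (a::'k::ring))"
 by (simp add: psum_single)

lemma alin_0[simp]: "alin A W p \<phi> 0 = 0"
 by (simp add: alin_apply mcar_0 fapp mact_simps)

lemma alin_mid[simp]: "alin A (gens M) p \<phi> (mid A M x) = alin A (gens M) p \<phi> x"
 by (auto simp: mid_def alin_def fapp)

lemma tmap_outer_mid: "tmap A M N M' p q h k (mid A (mtens A M N) x) = tmap A M N M' p q h k x"
 by (simp add: tmap_def)

lemma tmap_zero_arg[simp]: "tmap A M N M' p q h k 0 = 0"
 by (simp add: tmap_def)

lemma mid_zero[simp]: "mid A M 0 = 0"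
 by (simp add: mid_def)

lemma tensF_f0: "f0 (tensF A) c c' p = lext (\<lambda>u. tmap A (fst c) (snd c) (fst c') 0 0 (fst u) (snd u)) p"
 by (simp add: tensF_def lext_def split_def)

lemma tensF_fm: "fm (tensF A) c c' pq =
  lext (\<lambda>u. tmap A (fst c) (snd c) (fst c') 0 (- 1) (fst u) (snd u)) (fst pq) +
  lext (\<lambda>u. tmap A (fst c) (snd c) (fst c') (- 1) 0 (fst u) (snd u)) (snd pq)"
 by (simp add: tensF_def lext_def split_def)

lemma tensF_fo: "fo (tensF A) c = mtens A (fst c) (snd c)"
 by (simp add: tensF_def split_def)

lemma hcat_simps:
 "Ob (hcat A) = {M. is_sfmod A M}"
 "deg0 (Hom (hcat A) M N) = {h \<in> lin_hom A M N 0. hdiff M N 0 h = 0}"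
 "null0 (Hom (hcat A) M N) = {0}"
 "degm (Hom (hcat A) M N) = lin_hom A M N (- 1)"
 "nullm (Hom (hcat A) M N) = hdiff M N (- 2) ` lin_hom A M N (- 2)"
 "dd (Hom (hcat A) M N) = hdiff M N (- 1)"
 "sc0 (Hom (hcat A) M N) = fsc" "scm (Hom (hcat A) M N) = fsc"
 "c00 (hcat A) h k = (\<lambda>x. h (k x))" "c0m (hcat A) h k = (\<lambda>x. h (k x))" "cm0 (hcat A) h k = (\<lambda>x. h (k x))"
 "idm (hcat A) = mid A"
 by (simp_all add: hcat_def)

lemma boxC_simps:
 "Ob (boxC C D) = Ob C \<times> Ob D"
 "Hom (boxC C D) c c' = ch2_tens (Hom C (fst c) (fst c')) (Hom D (snd c) (snd c'))"
 "c00 (boxC C D) = (\<lambda>p q. psum (\<lambda>u a. psum (\<lambda>v b.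
   Poly_Mapping.single (c00 C (fst u) (fst v), c00 D (snd u) (snd v)) (a * b)) q) p)"
 "idm (boxC C D) c = Poly_Mapping.single (idm C (fst c), idm D (snd c)) 1"
 by (simp_all add: boxC_def split_def)

lemma ptrans_simps:
 "cmp (vcomp D \<eta> \<zeta>) c = c00 D (cmp \<eta> c) (cmp \<zeta> c)"
 "coh (vcomp D \<eta> \<zeta>) c c' h = cm0 D (coh \<eta> c c' h) (cmp \<zeta> c) + c0m D (cmp \<eta> c') (coh \<zeta> c c' h)"
 "cmp (hcomp E F G F' \<zeta>' \<zeta>) c = c00 E (cmp \<zeta>' (fo G c)) (f0 F' (fo F c) (fo G c) (cmp \<zeta> c))"
 "coh (hcomp E F G F' \<zeta>' \<zeta>) c c' h =
   cm0 E (coh \<zeta>' (fo G c) (fo G c') (f0 G c c' h)) (f0 F' (fo F c) (fo G c) (cmp \<zeta> c)) +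
   c0m E (cmp \<zeta>' (fo G c')) (fm F' (fo F c) (fo G c') (coh \<zeta> c c' h))"
 "cmp (pid D K) c = idm D (fo K c)" "coh (pid D K) c c' h = 0"
 "cmp (padd \<zeta> \<eta>) c = cmp \<zeta> c + cmp \<eta> c" "coh (padd \<zeta> \<eta>) c c' h = coh \<zeta> c c' h + coh \<eta> c c' h"
 by (simp_all add: vcomp_def hcomp_def pid_def padd_def del: lam_zero)

lemma boxP_simps:
 "cmp (boxP C' D' F G' \<zeta> \<eta>) c = Poly_Mapping.single (cmp \<zeta> (fst c), cmp \<eta> (snd c)) 1"
 "coh (boxP C' D' F G' \<zeta> \<eta>) c c' p =
  (psum (\<lambda>u. Poly_Mapping.single (c00 C' (cmp \<zeta> (fst c')) (f0 F (fst c) (fst c') (fst u)), coh \<eta> (snd c) (snd c') (snd u))) p,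
   psum (\<lambda>u. Poly_Mapping.single (coh \<zeta> (fst c) (fst c') (fst u), c00 D' (f0 G' (snd c) (snd c') (snd u)) (cmp \<eta> (snd c)))) p)"
 by (simp_all add: boxP_def split_def)

lemma efun_simps:
 "fo idF c = c" "f0 idF c c' h = h" "fm idF c c' k = k"
 "fo (compF G F) c = fo G (fo F c)"
 "f0 (compF G F) c c' h = f0 G (fo F c) (fo F c') (f0 F c c' h)"
 "fm (compF G F) c c' k = fm G (fo F c) (fo F c') (fm F c c' k)"
 by (simp_all add: idF_def compF_def)

lemma boxF_simps:
 "fo (boxF F G) d = (fo F (fst d), fo G (snd d))"
 "f0 (boxF F G) d d' = psum (\<lambda>u. Poly_Mapping.single (f0 F (fst d) (fst d') (fst u), f0 G (snd d) (snd d') (snd u)))"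
 by (simp_all add: boxF_def split_def)

lemma flipF_simps:
 "fo flipF d = (snd d, fst d)"
 "f0 flipF d d' = psum (\<lambda>u. Poly_Mapping.single (snd u, fst u))"
 "fm flipF d d' pq = (psum (\<lambda>u. Poly_Mapping.single (snd u, fst u)) (snd pq),
   psum (\<lambda>u. Poly_Mapping.single (snd u, fst u)) (fst pq))"
 by (simp_all add: flipF_def split_def)

lemma assocF_simps:
 "fo assocF c = (fst (fst c), (snd (fst c), snd c))"
 "f0 assocF c c' = psum (\<lambda>u x. psum (\<lambda>v y.
   Poly_Mapping.single (fst v, Poly_Mapping.single (snd v, snd u) 1) (x * y)) (fst u))"
 "fo assocF_inv d = ((fst d, fst (snd d)), snd (snd d))"
 "f0 assocF_inv d d' = psum (\<lambda>u x. psum (\<lambda>v y.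
   Poly_Mapping.single (Poly_Mapping.single (fst u, fst v) 1, snd v) (x * y)) (snd u))"
 by (simp_all add: assocF_def assocF_inv_def split_def)

lemmas enriched_simps = boxC_simps(3,4) ptrans_simps boxP_simps efun_simps boxF_simps flipF_simps assocF_simps
 tensF_f0 tensF_fm tensF_fo hcat_simps(9-12)

lemma OmF_simps: "fo (OmF A) M = mtens A (Om1 A) M"
 "f0 (OmF A) M M' h = tmap A (Om1 A) M (Om1 A) 0 0 (mid A (Om1 A)) h"
 by (simp_all add: OmF_def)

lemma lext_pair_0: "fst (0 :: 'a::zero \<times> 'b::zero) = 0" "snd (0 :: 'a::zero \<times> 'b::zero) = 0"
 by (simp_all add: zero_prod_def)

section \<open>The transformation in components\<close>

locale poisson_transformation = poisson_data A "Pi_of A P" for A :: "'k::field cdga" and P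
begin

lemma wt: "i < ngen A \<Longrightarrow> j < ngen A \<Longrightarrow> wt2_pairing A P (GAtom i) (GAtom j) \<in> ahom A (ed A i + ed A j)"
 using ahom_fsm[OF Pi, of i j "sg (ed A i * ed A j)"] by (simp add: Pi_of_def)

lemma tb_cmp:
 assumes M: "dmod A M" and N: "dmod A N"
 shows "cmp (tbraid A P) (M, N) = tt M N"
proof -
 note fin = dm_finite[OF M] dm_finite[OF N]
 note fT = finite_gens_mtens
 have E: "cmp (xi A) M = EM A (XX A M)" "cmp (xi A) N = EM A (XX A N)"
  by (rule xi_cmp[OF dA M], rule xi_cmp[OF dA N])
 have T: "tmap A M N (mtens A (Om1 A) M) 0 0 (EM A (XX A M)) (EM A (XX A N)) \<in> 
   lin_hom A (mtens A M N) (mtens A (mtens A (Om1 A) M) (mtens A (Om1 A) N)) 0"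
  by (rule tmap_lin_hom[OF EM_lin_hom[OF XX_fam[OF dA M] fin(1)] EM_lin_hom[OF XX_fam[OF dA N] fin(2)] fin]) simp
 note c = comp_mid_left[OF T fT[OF fin], THEN fun_cong]
 show ?thesis
  unfolding tbraid_def tt_def
  by (simp add: enriched_simps OmF_simps E c
    iota_sigma[OF bivector_axioms XX_fam[OF dA M] XX_fam[OF dA N] fin fin])
qed

lemma tb_coh:
 assumes M: "dmod A M" and N: "dmod A N" and M': "dmod A M'" and N': "dmod A N'"
  and p: "p \<in> tcar (lin_hom A M M' 0) (lin_hom A N N' 0)"
 shows "coh (tbraid A P) (M, N) (M', N') p = lext (\<lambda>u. SS M N M' N' (fst u) (snd u)) p"
proof -
 note fin = dm_finite[OF M] dm_finite[OF N] dm_finite[OF M'] dm_finite[OF N']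
 note fT = finite_gens_mtens
 let ?K = "mtens A (mtens A (Om1 A) M') (mtens A (Om1 A) N')"
 let ?F = "\<lambda>x. cmp (iota A P) (M', N') (cmp (sigma A) (M', N') x)"
 have i: "cmp (iota A P) (M', N') \<in> lin_hom A (mtens A (mtens A (Om1 A) (Om1 A)) (mtens A M' N')) (mtens A M' N') 0"
  by (rule iota_lin_hom[OF fin(3,4) wt])
 have fK: "finite (gens ?K)" by (intro fT fin finite_gens_Om1)
 have F: "?F \<in> lin_hom A ?K (mtens A M' N') 0"
  by (rule lin_hom_comp[OF i sigma_lin_hom[OF fin(3,4)] fK]) simp
 have z: "coh (iota A P) c c' q = 0" "coh (sigma A) c c' q = 0" for c c' q
  by (simp_all add: iota_def sigma_def del: lam_zero)
 have i0: "cmp (iota A P) (M', N') 0 = 0" by (rule lh_0[OF i])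
 \<comment> \<open>The two summands before contraction, with values in the tensor product that still
   contains two copies of Omega_A[1].\<close>
 define \<phi> where "\<phi> u = tmap A M N (mtens A (Om1 A) M') 0 (- 1) (EM A (rm (XX A M') (fst u))) (EM A (dl A N 0 (snd u)))" for u
 define \<psi> where "\<psi> u = tmap A M N (mtens A (Om1 A) M') (- 1) 0 (EM A (dl A M 0 (fst u))) (EM A (lm A 0 (snd u) (XX A N)))" for u
 have mem: "fst u \<in> lin_hom A M M' 0" "snd u \<in> lin_hom A N N' 0" if "u \<in> Poly_Mapping.keys p" for u
  using tcarD[OF p that] by auto
 note f1 = rm_fam[OF mem(1) XX_fam[OF dA M'] fin(1), of _ 0, simplified] and f2 = dl_fam[OF dA mem(2) fin(2), of _ "- 1", simplified]
  and f3 = dl_fam[OF dA mem(1) fin(1), of _ "- 1", simplified] and f4 = lm_fam[OF mem(2) XX_fam[OF dA N] fin(2), of _ 0, simplified]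
 have P1: "\<phi> u \<in> lin_hom A (mtens A M N) ?K (- 1)" if "u \<in> Poly_Mapping.keys p" for u
  unfolding \<phi>_def by (rule tmap_lin_hom[OF EM_lin_hom[OF f1[OF that] fin(1)] EM_lin_hom[OF f2[OF that] fin(2)] fin(1,2)]) simp
 have P2: "\<psi> u \<in> lin_hom A (mtens A M N) ?K (- 1)" if "u \<in> Poly_Mapping.keys p" for u
  unfolding \<psi>_def by (rule tmap_lin_hom[OF EM_lin_hom[OF f3[OF that] fin(1)] EM_lin_hom[OF f4[OF that] fin(2)] fin(1,2)]) simp
 have P: "\<phi> u + \<psi> u \<in> lin_hom A (mtens A M N) ?K (- 1)" if "u \<in> Poly_Mapping.keys p" for u
  by (rule lin_hom_add[OF P1[OF that] P2[OF that]])
 have L: "lext (\<lambda>u. \<phi> u + \<psi> u) p \<in> lin_hom A (mtens A M N) ?K (- 1)" by (rule lext_lin_hom[OF P])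
 have e1: "tmap A M N (mtens A (Om1 A) M') 0 (- 1) (\<lambda>x. cmp (xi A) M' (fst u x)) (coh (xi A) N N' (snd u)) = \<phi> u"
  if "u \<in> Poly_Mapping.keys p" for u
  unfolding \<phi>_def xi_cmp[OF dA M'] xi_coh[OF dA mem(2)[OF that] fin(2,4)] by (simp add: EM_def rm_def)
 have e2: "tmap A M N (mtens A (Om1 A) M') (- 1) 0 (coh (xi A) M M' (fst u))
   (\<lambda>x. f0 (OmF A) N N' (snd u) (cmp (xi A) N x)) = \<psi> u" if "u \<in> Poly_Mapping.keys p" for u
  unfolding \<psi>_def xi_cmp[OF dA N] xi_coh[OF dA mem(1)[OF that] fin(1,3)] OmF_simps
   tmap_Om_EM[OF dA XX_fam[OF dA N] mem(2)[OF that] fin(2,2)] ..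
 have "coh (tbraid A P) (M, N) (M', N') p = (\<lambda>x. ?F (mid A ?K (lext (\<lambda>u. \<phi> u + \<psi> u) p x)))"
  unfolding tbraid_def
  by (simp add: enriched_simps OmF_simps(1) z mmap_apply i0 lext_push lext_plus lext_cong[OF e1] lext_cong[OF e2])
 also have "\<dots> = (\<lambda>x. ?F (lext (\<lambda>u. \<phi> u + \<psi> u) p x))"
  by (simp add: comp_mid_left[OF L fT[OF fin(1,2)], THEN fun_cong])
 also have "\<dots> = lext (\<lambda>u x. ?F ((\<phi> u + \<psi> u) x)) p"
  by (rule lext_conj[OF F P fT[OF fin(1,2)]])
 also have "\<dots> = lext (\<lambda>u. SS M N M' N' (fst u) (snd u)) p"
 proof (rule lext_cong)
  fix u assume u: "u \<in> Poly_Mapping.keys p"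
  have "(\<lambda>x. ?F ((\<phi> u + \<psi> u) x)) = (\<lambda>x. ?F (\<phi> u x)) + (\<lambda>x. ?F (\<psi> u x))"
   by (rule conj_add[OF F, where K = "\<lambda>x. x"]) (rule lh_mcar[OF P1[OF u] fT[OF fin(1,2)]], rule lh_mcar[OF P2[OF u] fT[OF fin(1,2)]])
  then show "(\<lambda>x. ?F ((\<phi> u + \<psi> u) x)) = SS M N M' N' (fst u) (snd u)"
   unfolding SS_def S1_def S2_def \<phi>_def \<psi>_def
    iota_sigma[OF bivector_axioms f1[OF u] f2[OF u] fin] iota_sigma[OF bivector_axioms f3[OF u] f4[OF u] fin] .
 qed
 finally show ?thesis .
qed

end

lemma ch2_tens_simps:
 "deg0 (ch2_tens V W) = tcar (deg0 V) (deg0 W)"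
 "null0 (ch2_tens V W) = tnull (sc0 V) (deg0 V) (null0 V) (sc0 W) (deg0 W) (null0 W)"
 "degm (ch2_tens V W) = tcar (deg0 V) (degm W) \<times> tcar (degm V) (deg0 W)"
 "dd (ch2_tens V W) = (\<lambda>pq. psum (\<lambda>u. Poly_Mapping.single (fst u, dd W (snd u))) (fst pq) +
   psum (\<lambda>u. Poly_Mapping.single (dd V (fst u), snd u)) (snd pq))"
 "sc0 (ch2_tens V W) = fsm"
 by (simp_all add: ch2_tens_def split_def)

lemma tcar_add: "p \<in> tcar X Y \<Longrightarrow> q \<in> tcar X Y \<Longrightarrow> p + q \<in> tcar X Y"
 unfolding tcar_def using keys_add[of p q] by blast

lemma tcar_diff: "p \<in> tcar X Y \<Longrightarrow> q \<in> tcar X Y \<Longrightarrow> p - (q :: _ \<Rightarrow>\<^sub>0 'k::ab_group_add) \<in> tcar X Y"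
 unfolding tcar_def using keys_diff[of p q] by blast

lemma tcar_fsm: "p \<in> tcar X Y \<Longrightarrow> fsm c p \<in> tcar X Y"
 unfolding tcar_def using keys_fsm[of c p] by blast

lemma tcar_zero: "0 \<in> tcar X Y"
 by (simp add: tcar_def)

lemma tcar_push: "(\<And>u. u \<in> Poly_Mapping.keys p \<Longrightarrow> f u \<in> X \<and> g u \<in> Y) \<Longrightarrow>
  psum (\<lambda>u. Poly_Mapping.single (f u, g u)) p \<in> tcar X Y"
 by (intro tcar_psum tcar_single) auto

lemma tcar_nest: "(\<And>u v. u \<in> Poly_Mapping.keys p \<Longrightarrow> v \<in> Poly_Mapping.keys (Q u) \<Longrightarrow> f u v \<in> X \<and> g u v \<in> Y) \<Longrightarrow>
  psum (\<lambda>u x. psum (\<lambda>v y. Poly_Mapping.single (f u v, g u v) (x * y)) (Q u)) p \<in> tcar X Y"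
 by (intro tcar_psum tcar_single) auto

lemma tcar_scaled: "(\<And>u. u \<in> Poly_Mapping.keys p \<Longrightarrow> f u \<in> X \<and> g u \<in> Y) \<Longrightarrow>
  psum (\<lambda>u y. Poly_Mapping.single (f u, g u) (x * y)) p \<in> tcar X Y"
 by (intro tcar_psum tcar_single) auto

lemma single_addb: "addb (\<lambda>u. Poly_Mapping.single (g u))"
 by (simp add: addb_def single_add)

lemma scaled_addb: "addb (\<lambda>u y. Poly_Mapping.single (g u) ((x::'k::ring) * y))"
 by (simp add: addb_def single_add distrib_left)

lemma psum_push_psum:
 fixes b :: "'u \<Rightarrow> 'c::zero \<Rightarrow> 'v \<Rightarrow>\<^sub>0 'k::ab_group_add"
 shows "psum (\<lambda>u. Poly_Mapping.single (g u)) (psum b p) = psum (\<lambda>u x. psum (\<lambda>u. Poly_Mapping.single (g u)) (b u x)) p"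
 unfolding psum_def[of b] psum_sum[OF single_addb] by (simp add: psum_def[of _ p])

lemma psum_scaled_psum: "psum (\<lambda>u y. Poly_Mapping.single (g u) ((x::'k::ring) * y)) (psum b p) =
  psum (\<lambda>u z. psum (\<lambda>u y. Poly_Mapping.single (g u) (x * y)) (b u z)) p"
 unfolding psum_def[of b] psum_sum[OF scaled_addb] by (simp add: psum_def[of _ p])

lemma nest_addb: "addb (\<lambda>u x. psum (\<lambda>v y. Poly_Mapping.single (g u v) ((x::'k::ring) * y)) (Q u))"
 by (simp add: addb_def single_add distrib_right psum_def sum.distrib)

lemma psum_nest_psum:
 "psum (\<lambda>u x. psum (\<lambda>v y. Poly_Mapping.single (g u v) ((x::'k::ring) * y)) (Q u)) (psum b p) =
  psum (\<lambda>u z. psum (\<lambda>u x. psum (\<lambda>v y. Poly_Mapping.single (g u v) (x * y)) (Q u)) (b u z)) p"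
 unfolding psum_def[of b] psum_sum[OF nest_addb] by (simp add: psum_def[of _ p])

text \<open>Rewrites a sum whose index is itself a formal sum into nested form; the functors in the
  hexagons stack several such sums.\<close>

lemmas psum_fuse = psum_push_psum psum_scaled_psum psum_nest_psum psum_single_prod psum_scaled_single psum_nest_single

lemma hdiff_lext:
 assumes "dmod A M" "dmod A N" "\<And>u. u \<in> Poly_Mapping.keys p \<Longrightarrow> \<phi> u \<in> lin_hom A M N r"
 shows "hdiff M N q (lext \<phi> p) = lext (\<lambda>u. hdiff M N q (\<phi> u)) p"
 unfolding lext_def psum_def
 by (subst hdiff_sum[OF assms(1,2) lin_hom_fsc[OF assms(3)]]) (auto intro!: sum.cong hdiff_fsc[OF assms(1,2,3)])

lemma nl_closed:
 assumes M: "dmod A M" and N: "dmod A N" and S: "S = hdiff M N q ` lin_hom A M N r"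
 shows "0 \<in> S" "\<And>x y. x \<in> S \<Longrightarrow> y \<in> S \<Longrightarrow> x + y \<in> S" "\<And>c x. x \<in> S \<Longrightarrow> fsc c x \<in> S" "\<And>x. x \<in> S \<Longrightarrow> - x \<in> S"
proof -
 show "0 \<in> S" unfolding S using hdiff_0[OF N, of M q] lin_hom_0 by (metis image_eqI)
 show 1: "fsc c x \<in> S" if "x \<in> S" for c x
  using that unfolding S by (auto intro!: image_eqI[where f = "hdiff M N q", OF hdiff_fsc[OF M N, symmetric]] lin_hom_fsc)
 show "x + y \<in> S" if "x \<in> S" "y \<in> S" for x y
  using that unfolding S by (auto intro!: image_eqI[where f = "hdiff M N q", OF hdiff_add[OF M N, symmetric]] lin_hom_add)
 show "- x \<in> S" if "x \<in> S" for x
  using 1[OF that, of "- 1"] by (simp add: fsc_def msc_uminus_left fapp fun_Compl_def)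
qed

lemma lext_nl:
 assumes "dmod A M" "dmod A N" "\<And>u. u \<in> Poly_Mapping.keys p \<Longrightarrow> \<phi> u \<in> hdiff M N q ` lin_hom A M N r"
 shows "lext \<phi> p \<in> hdiff M N q ` lin_hom A M N r"
 by (rule lext_mem[OF nl_closed(1,2,3)[OF assms(1,2) refl]]) (use assms(3) in auto)

section \<open>Pseudo-naturality and equivariance\<close>

context poisson_transformation
begin

lemma cl_closed:
 assumes "is_sfmod A M" "is_sfmod A N"
 shows "0 \<in> cl M N" "h \<in> cl M N \<Longrightarrow> h' \<in> cl M N \<Longrightarrow> h + h' \<in> cl M N" "h \<in> cl M N \<Longrightarrow> fsc c h \<in> cl M N"
 using hdiff_add[OF assms[THEN is_sfmod_dmod]] hdiff_fsc[OF assms[THEN is_sfmod_dmod]]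
 by (auto simp: hdiff_0[OF is_sfmod_dmod[OF assms(2)]] lin_hom_add lin_hom_fsc)

text \<open>Bilinearity of the coherence map annihilates every generating relation, so it descends
  to the tensor product. Membership in \<open>tcar\<close> is proved alongside because
  \<open>tb_coh\<close> applies only there.\<close>

lemma SS_null:
 assumes sf: "is_sfmod A M" "is_sfmod A N" "is_sfmod A M'" "is_sfmod A N'"
  and h: "h \<in> tnull fsc (cl M M') {0} fsc (cl N N') {0}"
 shows "h \<in> tcar (cl M M') (cl N N') \<and> lext (\<lambda>u. SS M N M' N' (fst u) (snd u)) h = 0"
proof -
 note fM = dm_finite[OF is_sfmod_dmod[OF sf(1)]] and dM' = is_sfmod_dmod[OF sf(3)]
 note c1 = cl_closed[OF sf(1,3)] and c2 = cl_closed[OF sf(2,4)]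
 have s0: "SS M N M' N' 0 k = 0" "SS M N M' N' u 0 = 0" for k u
  using SS_fsc_left[OF dM' lin_hom_0 fM, of N N' 0 k] SS_fsc_right[of M N M' N' u 0 0] by simp_all
 show ?thesis
  using h
 proof (induction rule: tnull.induct)
  case zero then show ?case by (simp add: tcar_zero)
 next
  case plus then show ?case by (auto simp: tcar_add lext_add)
 next
  case (add_left u u' v c)
  then show ?case
   using SS_add_left[OF dM', of u M u' N N' v] fM c1(2)[OF add_left(1,2)]
   by (auto simp: lext_diff fsc_add intro!: tcar_diff tcar_single)
 next
  case (add_right u v v' c)
  then show ?case
   using c2(2)[OF add_right(2,3)] by (auto simp: lext_diff fsc_add SS_add_right intro!: tcar_diff tcar_single)
 next
  case (scale_left u v r c)
  then show ?case
   using SS_fsc_left[OF dM', of u M N N' r v] fM c1(3)[OF scale_left(1), of r]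
   by (auto simp: lext_diff mult.commute intro!: tcar_diff tcar_single)
 next
  case (scale_right u v r c)
  then show ?case
   using c2(3)[OF scale_right(2), of r] by (auto simp: lext_diff SS_fsc_right mult.commute intro!: tcar_diff tcar_single)
 next
  case (null_left u v c)
  then show ?case using c1(1) by (auto simp: s0 intro!: tcar_single)
 next
  case (null_right u v c)
  then show ?case using c2(1) by (auto simp: s0 intro!: tcar_single)
 qed
qed

lemma tbraid_ptrans: "is_ptrans (hcat2 A) (hcat A) (tensF A) (tensF A) (tbraid A P)"
proof -
 have 1: "cmp (tbraid A P) c \<in> deg0 (Hom (hcat A) (fo (tensF A) c) (fo (tensF A) c))" if "c \<in> Ob (hcat2 A)" for c
  using that by (auto simp: boxC_simps hcat_simps tensF_fo tb_cmp is_sfmod_dmod tt_lin_hom hdiff_tt)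
 have idc: "eqm (Hom (hcat A) (fo (tensF A) c) (fo (tensF A) c)) (coh (tbraid A P) c c (idm (hcat2 A) c)) 0" if "c \<in> Ob (hcat2 A)" for c
 proof -
  from that obtain M N where c: "c = (M, N)" "is_sfmod A M" "is_sfmod A N" by (auto simp: boxC_simps hcat_simps)
  note d = c(2,3)[THEN is_sfmod_dmod]
  have "coh (tbraid A P) c c (idm (hcat2 A) c) = 0"
   unfolding c(1) by (simp add: boxC_simps hcat_simps tb_coh[OF d d] tcar_single lin_hom_mid SS_mid[OF c(2,3,2,3)])
  then show ?thesis
   unfolding eqm_def by (simp add: c(1) hcat_simps tensF_fo nl_closed(1)[OF mtens_dmod[OF dA d] mtens_dmod[OF dA d] refl])
 qed
 have main: "let V = Hom (hcat2 A) c c'; U = Hom (hcat A) (fo (tensF A) c) (fo (tensF A) c'); z = coh (tbraid A P) c c' in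
    (\<forall>h\<in>deg0 V. z h \<in> degm U) \<and> (\<forall>h\<in>null0 V. z h \<in> nullm U) \<and>
    (\<forall>h\<in>deg0 V. \<forall>h'\<in>deg0 V. eqm U (z (h + h')) (z h + z h')) \<and>
    (\<forall>r. \<forall>h\<in>deg0 V. eqm U (z (sc0 V r h)) (scm U r (z h))) \<and>
    (\<forall>h\<in>deg0 V. eq0 U (c00 (hcat A) (f0 (tensF A) c c' h) (cmp (tbraid A P) c) -
      c00 (hcat A) (cmp (tbraid A P) c') (f0 (tensF A) c c' h)) (dd U (z h))) \<and>
    (\<forall>k\<in>degm V. eqm U (cm0 (hcat A) (fm (tensF A) c c' k) (cmp (tbraid A P) c) -
      c0m (hcat A) (cmp (tbraid A P) c') (fm (tensF A) c c' k)) (z (dd V k)))"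
  if "c \<in> Ob (hcat2 A)" "c' \<in> Ob (hcat2 A)" for c c'
 proof -
  from that obtain M N M' N' where c: "c = (M, N)" "c' = (M', N')"
   and sf: "is_sfmod A M" "is_sfmod A N" "is_sfmod A M'" "is_sfmod A N'"
   by (auto simp: boxC_simps hcat_simps)
  note d = sf[THEN is_sfmod_dmod]
  note fin = d[THEN dm_finite]
  note dt = mtens_dmod[OF dA d(1,2)] mtens_dmod[OF dA d(3,4)]
  note n0 = nl_closed(1)[OF dt refl]
  let ?T = "tmap A M N M'" and ?S = "\<lambda>u. SS M N M' N' (fst u) (snd u)" and ?t = "tt M' N'"
  have tl: "?t \<in> lin_hom A (mtens A M' N') (mtens A M' N') 0" by (rule tt_lin_hom[OF d(3,4)])
  have ft: "finite (gens (mtens A M N))" by (rule finite_gens_mtens[OF fin(1,2)])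
  have z: "coh (tbraid A P) c c' p = lext ?S p" if "p \<in> tcar (lin_hom A M M' 0) (lin_hom A N N' 0)" for p
   unfolding c by (rule tb_coh[OF d that])
  have mono: "p \<in> tcar (lin_hom A M M' 0) (lin_hom A N N' 0)" if "p \<in> tcar (cl M M') (cl N N')" for p
   by (rule tcar_mono[OF that]) auto
  note z' = z[OF mono]
  have Sl: "?S u \<in> lin_hom A (mtens A M N) (mtens A M' N') (- 1)" if "p \<in> tcar (cl M M') (cl N N')" "u \<in> Poly_Mapping.keys p" for p u
   using tcarD[OF that] by (intro S_lin_hom[OF d]) auto
  have a: "coh (tbraid A P) c c' h \<in> lin_hom A (mtens A M N) (mtens A M' N') (- 1)" if h: "h \<in> tcar (cl M M') (cl N N')" for h
   unfolding z'[OF h] by (rule lext_lin_hom[OF Sl[OF h]])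
  have e: "(\<lambda>x. lext (\<lambda>u. ?T 0 0 (fst u) (snd u)) h (tt M N x)) - (\<lambda>x. ?t (lext (\<lambda>u. ?T 0 0 (fst u) (snd u)) h x)) =
    hdiff (mtens A M N) (mtens A M' N') (- 1) (lext ?S h)" if h: "h \<in> tcar (cl M M') (cl N N')" for h
  proof -
   have m: "?T 0 0 (fst u) (snd u) \<in> lin_hom A (mtens A M N) (mtens A M' N') 0" if "u \<in> Poly_Mapping.keys h" for u
    using tcarD[OF h that] by (intro tmap_lin_hom fin) auto
   show ?thesis
    by (simp only: hdiff_lext[OF dt Sl[OF h]] lext_right[where G = "tt M N"] lext_conj[OF tl m ft, where G = "\<lambda>x. x"] lext_minus)
     (rule lext_cong, rule tt_natural[OF sf], use tcarD[OF h] in auto)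
  qed
  \<comment> \<open>A morphism of degree -1 has a component of type (0, -1) and one of type (-1, 0).
    They are treated by \<open>tt_natural_right\<close> and \<open>tt_natural_left\<close>, and the
    two exact errors are added.\<close>
  have fm: "cm0 (hcat A) (fm (tensF A) c c' k) (cmp (tbraid A P) c) -
    c0m (hcat A) (cmp (tbraid A P) c') (fm (tensF A) c c' k) - coh (tbraid A P) c c' (dd (Hom (hcat2 A) c c') k) \<in> nl (mtens A M N) (mtens A M' N')"
   if "k \<in> degm (Hom (hcat2 A) c c')" for k
  proof -
   from that obtain p q where k: "k = (p, q)" and p: "p \<in> tcar (cl M M') (lin_hom A N N' (- 1))" and q: "q \<in> tcar (lin_hom A M M' (- 1)) (cl N N')"
    by (auto simp: c boxC_simps ch2_tens_simps hcat_simps)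
   have pm: "fst u \<in> cl M M' \<and> snd u \<in> lin_hom A N N' (- 1)" if "u \<in> Poly_Mapping.keys p" for u using tcarD[OF p that] by auto
   have qm: "fst u \<in> lin_hom A M M' (- 1) \<and> snd u \<in> cl N N'" if "u \<in> Poly_Mapping.keys q" for u using tcarD[OF q that] by auto
   have tp: "psum (\<lambda>u. Poly_Mapping.single (fst u, hdiff N N' (- 1) (snd u))) p \<in> tcar (lin_hom A M M' 0) (lin_hom A N N' 0)"
    by (rule tcar_push) (use pm in \<open>auto intro!: hdiff_lin_hom[OF dA d(2,4)]\<close>)
   have tq: "psum (\<lambda>u. Poly_Mapping.single (hdiff M M' (- 1) (fst u), snd u)) q \<in> tcar (lin_hom A M M' 0) (lin_hom A N N' 0)"
    by (rule tcar_push) (use qm in \<open>auto intro!: hdiff_lin_hom[OF dA d(1,3)]\<close>)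
   have m1: "?T 0 (- 1) (fst u) (snd u) \<in> lin_hom A (mtens A M N) (mtens A M' N') (- 1)" if "u \<in> Poly_Mapping.keys p" for u
    using pm[OF that] by (intro tmap_lin_hom fin) auto
   have m2: "?T (- 1) 0 (fst u) (snd u) \<in> lin_hom A (mtens A M N) (mtens A M' N') (- 1)" if "u \<in> Poly_Mapping.keys q" for u
    using qm[OF that] by (intro tmap_lin_hom fin) auto
   let ?p = "lext (\<lambda>u. ?T 0 (- 1) (fst u) (snd u)) p" and ?q = "lext (\<lambda>u. ?T (- 1) 0 (fst u) (snd u)) q"
   have A1: "(\<lambda>x. ?p (tt M N x)) - (\<lambda>x. ?t (?p x)) - lext (\<lambda>u. SS M N M' N' (fst u) (hdiff N N' (- 1) (snd u))) p \<in> nl (mtens A M N) (mtens A M' N')"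
    by (simp only: lext_right[where G = "tt M N"] lext_conj[OF tl m1 ft, where G = "\<lambda>x. x"] lext_minus)
     (rule lext_nl[OF dt], rule tt_natural_right[OF sf], use pm in auto)
   have A2: "(\<lambda>x. ?q (tt M N x)) - (\<lambda>x. ?t (?q x)) - lext (\<lambda>u. SS M N M' N' (hdiff M M' (- 1) (fst u)) (snd u)) q \<in> nl (mtens A M N) (mtens A M' N')"
    by (simp only: lext_right[where G = "tt M N"] lext_conj[OF tl m2 ft, where G = "\<lambda>x. x"] lext_minus)
     (rule lext_nl[OF dt], rule tt_natural_left[OF sf], use qm in auto)
   have add: "(\<lambda>x. ?t ((?p + ?q) x)) = (\<lambda>x. ?t (?p x)) + (\<lambda>x. ?t (?q x))"
    by (rule conj_add[OF tl, where K = "\<lambda>x. x"]) (rule lh_mcar[OF lext_lin_hom[OF m1] ft], assumption, rule lh_mcar[OF lext_lin_hom[OF m2] ft])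
   have add': "(\<lambda>x. (?p + ?q) (tt M N x)) = (\<lambda>x. ?p (tt M N x)) + (\<lambda>x. ?q (tt M N x))"
    by (rule ext) (simp add: mmap_apply)
   show ?thesis
    using nl_closed(2)[OF dt refl A1 A2]
    by (simp add: k boxC_simps(2) ch2_tens_simps hcat_simps z[unfolded c, OF tcar_add[OF tp tq]] lext_add lext_push c tensF_fm tb_cmp d add add' algebra_simps)
  qed
  have b: "coh (tbraid A P) c c' h \<in> nl (mtens A M N) (mtens A M' N')" if "h \<in> null0 (Hom (hcat2 A) c c')" for h
   using SS_null[OF sf, of h] that n0 by (simp add: c z'[unfolded c] boxC_simps ch2_tens_simps hcat_simps)
  show ?thesis
   unfolding Let_def
   by (intro conjI ballI allI) (use a b e fm n0 in
    \<open>simp_all add: c z'[unfolded c] boxC_simps(2) ch2_tens_simps hcat_simps tensF_fo tensF_f0 eqm_def eq0_def tcar_add tcar_fsm lext_add lext_fsm tb_cmp d\<close>)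
 qed
 have comp: "eqm (Hom (hcat A) (fo (tensF A) c) (fo (tensF A) c'')) (coh (tbraid A P) c c'' (c00 (hcat2 A) h' h))
     (cm0 (hcat A) (coh (tbraid A P) c' c'' h') (f0 (tensF A) c c' h) + c0m (hcat A) (f0 (tensF A) c' c'' h') (coh (tbraid A P) c c' h))"
  if c: "c \<in> Ob (hcat2 A)" "c' \<in> Ob (hcat2 A)" "c'' \<in> Ob (hcat2 A)"
   and h: "h \<in> deg0 (Hom (hcat2 A) c c')" and h': "h' \<in> deg0 (Hom (hcat2 A) c' c'')" for c c' c'' h h'
 proof -
  from c obtain M N M' N' M'' N'' where c: "c = (M, N)" "c' = (M', N')" "c'' = (M'', N'')"
   and sf: "is_sfmod A M" "is_sfmod A N" "is_sfmod A M'" "is_sfmod A N'" "is_sfmod A M''" "is_sfmod A N''"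
   by (auto simp: boxC_simps hcat_simps)
  note d = sf[THEN is_sfmod_dmod]
  note fin = d[THEN dm_finite]
  note dt = mtens_dmod[OF dA d(1,2)] mtens_dmod[OF dA d(5,6)]
  have h: "h \<in> tcar (cl M M') (cl N N')" and h': "h' \<in> tcar (cl M' M'') (cl N' N'')"
   using h h' by (simp_all add: c boxC_simps(2) ch2_tens_simps hcat_simps)
  have hm: "fst u \<in> cl M M'" "snd u \<in> cl N N'" if "u \<in> Poly_Mapping.keys h" for u using tcarD[OF h that] by auto
  have hm': "fst u \<in> cl M' M''" "snd u \<in> cl N' N''" if "u \<in> Poly_Mapping.keys h'" for u using tcarD[OF h' that] by auto
  have ft: "finite (gens (mtens A M N))" by (rule finite_gens_mtens[OF fin(1,2)])
  have t1: "h \<in> tcar (lin_hom A M M' 0) (lin_hom A N N' 0)" by (rule tcar_mono[OF h]) auto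
  have t2: "h' \<in> tcar (lin_hom A M' M'' 0) (lin_hom A N' N'' 0)" by (rule tcar_mono[OF h']) auto
  note t = t1 t2
  have t3: "c00 (hcat2 A) h' h \<in> tcar (lin_hom A M M'' 0) (lin_hom A N N'' 0)"
   unfolding boxC_simps hcat_simps
  proof (rule tcar_nest, intro conjI)
   fix u v assume u: "u \<in> Poly_Mapping.keys h'" and v: "v \<in> Poly_Mapping.keys h"
   show "(\<lambda>x. fst u (fst v x)) \<in> lin_hom A M M'' 0"
    by (rule lin_hom_comp[where N = M' and p = 0 and q = 0]) (use hm'(1)[OF u] hm(1)[OF v] fin(1) in simp_all)
   show "(\<lambda>x. snd u (snd v x)) \<in> lin_hom A N N'' 0"
    by (rule lin_hom_comp[where N = N' and p = 0 and q = 0]) (use hm'(2)[OF u] hm(2)[OF v] fin(2) in simp_all)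
  qed
  have S: "SS M N M' N' (fst v) (snd v) \<in> lin_hom A (mtens A M N) (mtens A M' N') (- 1)" if "v \<in> Poly_Mapping.keys h" for v
   using hm[OF that] by (intro S_lin_hom[OF d(1-4)]) auto
  have T: "tmap A M N M' 0 0 (fst v) (snd v) \<in> lin_hom A (mtens A M N) (mtens A M' N') 0" if "v \<in> Poly_Mapping.keys h" for v
   using hm[OF that] by (intro tmap_lin_hom fin) auto
  have S': "SS M' N' M'' N'' (fst v) (snd v) \<in> lin_hom A (mtens A M' N') (mtens A M'' N'') (- 1)" if "v \<in> Poly_Mapping.keys h'" for v
   using hm'[OF that] by (intro S_lin_hom[OF d(3-6)]) auto
  have T': "tmap A M' N' M'' 0 0 (fst v) (snd v) \<in> lin_hom A (mtens A M' N') (mtens A M'' N'') 0" if "v \<in> Poly_Mapping.keys h'" for v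
   using hm'[OF that] by (intro tmap_lin_hom fin) auto
  \<comment> \<open>Both composites are written as double sums over pairs of pairs, so that
    \<open>SS_comp\<close> applies termwise modulo exact maps.\<close>
  have l1: "(\<lambda>x. lext (\<lambda>u. SS M' N' M'' N'' (fst u) (snd u)) h' (lext (\<lambda>v. tmap A M N M' 0 0 (fst v) (snd v)) h x)) =
    lext (\<lambda>u. lext (\<lambda>v x. SS M' N' M'' N'' (fst u) (snd u) (tmap A M N M' 0 0 (fst v) (snd v) x)) h) h'"
   by (rule trans[OF lext_right lext_cong]) (rule lext_conj[OF S' T ft, where G = "\<lambda>x. x"])
  have l2: "(\<lambda>x. lext (\<lambda>u. tmap A M' N' M'' 0 0 (fst u) (snd u)) h' (lext (\<lambda>v. SS M N M' N' (fst v) (snd v)) h x)) =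
    lext (\<lambda>u. lext (\<lambda>v x. tmap A M' N' M'' 0 0 (fst u) (snd u) (SS M N M' N' (fst v) (snd v) x)) h) h'"
   by (rule trans[OF lext_right lext_cong]) (rule lext_conj[OF T' S ft, where G = "\<lambda>x. x"])
  show ?thesis
   unfolding eqm_def c hcat_simps tensF_f0 tb_coh[OF d(1-4) t(1)] tb_coh[OF d(3-6) t(2)] tb_coh[OF d(1,2,5,6) t3[unfolded c]] tensF_fo fst_conv snd_conv l1 l2
   unfolding boxC_simps hcat_simps lext_nest lext_plus lext_minus
   by (intro lext_nl[OF dt]) (simp add: SS_comp[OF sf(1-6) hm hm'])
 qed
 show ?thesis
  unfolding is_ptrans_def using 1 main idc comp by blast
qed

text \<open>The components agree strictly, by \<open>tt_braid\<close>; the coherence maps agree only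
  modulo exact maps, by \<open>SS_braid\<close> on each pair.\<close>

lemma tbraid_equivariant: "gamma_equivariant A (tbraid A P)"
proof -
 have "eq0 (Hom (hcat A) (fo (tensF A) c) (fo (compF (tensF A) flipF) c)) (cmp (vcomp (hcat A) (gam A) (tbraid A P)) c)
   (cmp (vcomp (hcat A) (whisker (hcat A) (tensF A) (tbraid A P) (hcat2 A) flipF) (gam A)) c)" if "c \<in> Ob (hcat2 A)" for c
 proof -
  from that obtain M N where c: "c = (M, N)" and sf: "is_sfmod A M" "is_sfmod A N" by (auto simp: boxC_simps hcat_simps)
  note d = sf[THEN is_sfmod_dmod]
  note fin = d[THEN dm_finite]
  note B = tt_braid[OF sf sf, THEN fun_cong]
  note m = comp_mid_right[OF tt_lin_hom[OF d(2,1)], THEN fun_cong]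
  show ?thesis
   unfolding c eq0_def by (simp add: hcat_simps enriched_simps gam_def tb_cmp d tmap_mid fin m B fun_diff_def)
 qed
 moreover have "eqm (Hom (hcat A) (fo (tensF A) c) (fo (compF (tensF A) flipF) c')) (coh (vcomp (hcat A) (gam A) (tbraid A P)) c c' h)
   (coh (vcomp (hcat A) (whisker (hcat A) (tensF A) (tbraid A P) (hcat2 A) flipF) (gam A)) c c' h)"
  if "c \<in> Ob (hcat2 A)" "c' \<in> Ob (hcat2 A)" and h: "h \<in> deg0 (Hom (hcat2 A) c c')" for c c' h
 proof -
  from that obtain M N M' N' where c: "c = (M, N)" "c' = (M', N')"
   and sf: "is_sfmod A M" "is_sfmod A N" "is_sfmod A M'" "is_sfmod A N'"
   by (auto simp: boxC_simps hcat_simps)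
  note d = sf[THEN is_sfmod_dmod]
  note fin = d[THEN dm_finite]
  note dt = mtens_dmod[OF dA d(1,2)] mtens_dmod[OF dA d(4,3)]
  have h: "h \<in> tcar (cl M M') (cl N N')" using h by (simp_all add: c boxC_simps(2) ch2_tens_simps hcat_simps)
  have hm: "fst u \<in> cl M M'" "snd u \<in> cl N N'" if "u \<in> Poly_Mapping.keys h" for u using tcarD[OF h that] by auto
  have t: "h \<in> tcar (lin_hom A M M' 0) (lin_hom A N N' 0)" by (rule tcar_mono[OF h]) auto
  have t': "psum (\<lambda>u. Poly_Mapping.single (snd u, fst u)) h \<in> tcar (lin_hom A N N' 0) (lin_hom A M M' 0)"
   by (rule tcar_push) (use hm in auto)
  have S: "SS M N M' N' (fst v) (snd v) \<in> lin_hom A (mtens A M N) (mtens A M' N') (- 1)" if "v \<in> Poly_Mapping.keys h" for v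
   using hm[OF that] by (intro S_lin_hom[OF d(1-4)]) auto
  have S': "lext (\<lambda>u. SS N M N' M' (snd u) (fst u)) h \<in> lin_hom A (mtens A N M) (mtens A N' M') (- 1)"
   by (rule lext_lin_hom, rule S_lin_hom[OF d(2,1,4,3)]) (use hm in auto)
  have b0: "tt N' M' 0 = 0" by (rule lh_0[OF tt_lin_hom[OF d(4,3)]])
  note m = comp_mid_right[OF S', THEN fun_cong]
  note L = lext_conj[OF braid_lin_hom[OF fin(3,4)] S finite_gens_mtens[OF fin(1,2)], where G = "\<lambda>x. x"]
  have "lext (\<lambda>u. (\<lambda>x. braid A M' N' (SS M N M' N' (fst u) (snd u) x)) - (\<lambda>x. SS N M N' M' (snd u) (fst u) (braid A M N x))) h
    \<in> nl (mtens A M N) (mtens A N' M')"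
   by (rule lext_nl[OF dt], rule SS_braid[OF sf]) (use hm in auto)
  then have *: "(\<lambda>x. braid A M' N' (lext (\<lambda>u. SS M N M' N' (fst u) (snd u)) h x)) -
    (\<lambda>x. lext (\<lambda>u. SS N M N' M' (snd u) (fst u)) h (braid A M N x)) \<in> nl (mtens A M N) (mtens A N' M')"
   by (simp only: L lext_right[where G = "braid A M N"] lext_minus)
  have z: "coh (gam A) c c' q = 0" for c c' q by (simp add: gam_def del: lam_zero)
  have g: "cmp (gam A) (M, N) = braid A M N" for M N by (simp add: gam_def)
  show ?thesis
   unfolding c eqm_def using *
   by (simp add: hcat_simps enriched_simps z g tb_coh[OF d t] tb_coh[OF d(2,1,4,3) t'] lext_push tmap_mid fin m
     tb_cmp d mmap_apply lext_pair_0 b0)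
 qed
 ultimately show ?thesis
  unfolding gamma_equivariant_def ptrans_eq_def by blast
qed

end

section \<open>The hexagon relations\<close>

lemma lext_cong': "p = q \<Longrightarrow> (\<And>u. u \<in> Poly_Mapping.keys q \<Longrightarrow> \<phi> u = \<psi> u) \<Longrightarrow> lext \<phi> p = lext \<psi> q"
 using lext_cong by blast

lemma mid_mcar: "mid A M y \<in> mcar A (gens M)"
 by (simp add: mid_def mcar_0)

lemma mid_lext: "(\<And>u. u \<in> Poly_Mapping.keys p \<Longrightarrow> mid A M (\<phi> u x) = \<phi> u x) \<Longrightarrow> mid A M (lext \<phi> p x) = lext \<phi> p x"
proof -
 assume a: "\<And>u. u \<in> Poly_Mapping.keys p \<Longrightarrow> mid A M (\<phi> u x) = \<phi> u x"
 have "\<phi> u x \<in> mcar A (gens M)" if "u \<in> Poly_Mapping.keys p" for u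
  by (subst a[OF that, symmetric]) (rule mid_mcar)
 then have "lext \<phi> p x \<in> mcar A (gens M)"
  unfolding lext_apply by (intro mcar_sum mcar_msc) auto
 then show ?thesis by (simp add: mid_def)
qed

lemma mid_tmap:
 assumes "h \<in> lin_hom A M M' p" "k \<in> lin_hom A N N' q" "finite (gens M)" "finite (gens N)"
 shows "mid A (mtens A M' N') (tmap A M N M' p q h k x) = tmap A M N M' p q h k x"
 using comp_mid_left[OF tmap_lin_hom[OF assms refl] finite_gens_mtens[OF assms(3,4)], THEN fun_cong] .

lemma fm_0:
 "fm (boxF F G) d d' 0 = 0" "fm assocF c c' 0 = 0" "fm assocF_inv e e' 0 = 0"
 by (simp_all add: boxF_def assocF_def assocF_inv_def zero_prod_def split_def del: lam_zero)

text \<open>For equality of transformations it suffices that the representatives agree, as 0 is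
  exact.\<close>

lemma ptrans_eqI:
 assumes "\<And>c. c \<in> Ob C \<Longrightarrow> dmod A (fo F c) \<and> dmod A (fo G c)"
  and "\<And>c. c \<in> Ob C \<Longrightarrow> cmp x c = cmp y c"
  and "\<And>c c' h. c \<in> Ob C \<Longrightarrow> c' \<in> Ob C \<Longrightarrow> h \<in> deg0 (Hom C c c') \<Longrightarrow> coh x c c' h = coh y c c' h"
 shows "ptrans_eq C (hcat A) F G x y"
 unfolding ptrans_eq_def eq0_def eqm_def hcat_simps
 using assms(2,3) nl_closed(1)[OF conjunct1[OF assms(1)] conjunct2[OF assms(1)] refl] by simp

context poisson_transformation
begin

lemma tbraid_hexagon1: "hexagon1 A (tbraid A P)"
proof -
 \<comment> \<open>The associators get names of their own, which keeps their generator-level case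
   distinctions out of the simplification.\<close>
 define a1 where "a1 L M N = asc1 A L M N" for L M N
 define a2 where "a2 L M N = asc2 A L M N" for L M N
 note a1_lin_hom = asc1_lin_hom[where A = A, folded a1_def] and a2_lin_hom = asc2_lin_hom[where A = A, folded a2_def]
 have coh0: "coh (gam A) c c' q = 0" "coh (gam_inv A) c c' q = 0" "coh (asc A) b b' q' = 0" "coh (asc_inv A) b b' q' = 0"
  for c c' q b b' q'
  by (simp_all add: gam_def gam_inv_def asc_def asc_inv_def del: lam_zero)
 have cmps: "cmp (gam A) (M, N) = braid A M N" "cmp (gam_inv A) (M, N) = braid A N M"
  "cmp (asc A) ((L, M), N) = a1 L M N" "cmp (asc_inv A) ((L, M), N) = a2 L M N" for L M N
  unfolding gam_def gam_inv_def asc_def asc_inv_def ptrans.simps prod.case a1_def a2_def by (rule refl)+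
 have a_mid: "a1 L M N (mid A (mtens A (mtens A L M) N) x) = a1 L M N x" "a2 L M N (mid A (mtens A L (mtens A M N)) x) = a2 L M N x"
  "a1 L M N 0 = 0" "a2 L M N 0 = 0" for L M N x
  unfolding a1_def a2_def by (rule alin_mid alin_0)+
 have a_out: "finite (gens L) \<Longrightarrow> finite (gens M) \<Longrightarrow> finite (gens N) \<Longrightarrow>
   mid A (mtens A L (mtens A M N)) (a1 L M N x) = a1 L M N x \<and> mid A (mtens A (mtens A L M) N) (a2 L M N x) = a2 L M N x" for L M N x
  using comp_mid_left[OF a1_lin_hom, of L M N, THEN fun_cong] comp_mid_left[OF a2_lin_hom, of L M N, THEN fun_cong]
  by (simp add: finite_gens_mtens)
 note hs = enriched_simps coh0 cmps a_mid a_out fm_0 psum_fuse lext_push lext_nest tmap_outer_mid lext_pair_0 mid_tmap lin_hom_mid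
  tmap_mid mmap_apply finite_gens_mtens braid_lin_hom
 show ?thesis
  unfolding hexagon1_def Let_def
 proof (rule ptrans_eqI, goal_cases)
  case (1 c)
  then obtain L M N where c: "c = ((L, M), N)" and sf: "is_sfmod A L" "is_sfmod A M" "is_sfmod A N"
   by (auto simp: boxC_simps hcat_simps)
  note d = sf[THEN is_sfmod_dmod]
  show ?case
   using mtens_dmod[OF dA mtens_dmod[OF dA d(1,2)] d(3)] by (simp add: c enriched_simps)
 next
  case (2 c)
  then obtain L M N where c: "c = ((L, M), N)" and sf: "is_sfmod A L" "is_sfmod A M" "is_sfmod A N"
   by (auto simp: boxC_simps hcat_simps)
  note d = sf[THEN is_sfmod_dmod]
  note fin = d[THEN dm_finite]
  note tl = tt_lin_hom[OF d(1) mtens_dmod[OF dA d(2,3)]] tt_lin_hom[OF d(1,2)] tt_lin_hom[OF d(1,3)]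
  note tm = comp_mid_right[OF tl(1), THEN fun_cong]
  note tb = tb_cmp[OF d(1) mtens_dmod[OF dA d(2,3)]] tb_cmp[OF d(1,2)] tb_cmp[OF d(1,3)]
  show ?case
   using tt_hexagon1[OF d, folded a1_def a2_def] by (simp add: c hs tm tl tb fin)
 next
  case (3 c c' p)
  then obtain L M N L' M' N' where c: "c = ((L, M), N)" "c' = ((L', M'), N')"
   and sf: "is_sfmod A L" "is_sfmod A M" "is_sfmod A N" "is_sfmod A L'" "is_sfmod A M'" "is_sfmod A N'"
   by (auto simp: boxC_simps hcat_simps)
  have p: "p \<in> tcar (tcar (cl L L') (cl M M')) (cl N N')"
   using 3(3) by (simp add: c boxC_simps(2) ch2_tens_simps hcat_simps)
  note d = sf[THEN is_sfmod_dmod]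
  note fin = d[THEN dm_finite]
  have m: "fst v \<in> lin_hom A L L' 0" "snd v \<in> lin_hom A M M' 0" if "u \<in> Poly_Mapping.keys p" "v \<in> Poly_Mapping.keys (fst u)" for u v
   using tcarD[OF p that(1)] tcarD[of "fst u", OF _ that(2)] by auto
  have m0: "snd u \<in> lin_hom A N N' 0" if "u \<in> Poly_Mapping.keys p" for u
   using tcarD[OF p that] by auto
  have m1: "fst u \<in> tcar (lin_hom A L L' 0) (lin_hom A M M' 0)" if "u \<in> Poly_Mapping.keys p" for u
   using tcarD[OF p that] tcar_mono[of "fst u" "cl L L'" "cl M M'"] by auto
  note tl = tt_lin_hom[OF d(1) mtens_dmod[OF dA d(2,3)]] tt_lin_hom[OF d(1,2)] tt_lin_hom[OF d(1,3)]
  note tl' = tt_lin_hom[OF d(4) mtens_dmod[OF dA d(5,6)]] tt_lin_hom[OF d(4,5)] tt_lin_hom[OF d(4,6)]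
  note tb = tb_cmp[OF d(1) mtens_dmod[OF dA d(2,3)]] tb_cmp[OF d(1,2)] tb_cmp[OF d(1,3)] tb_cmp[OF d(4) mtens_dmod[OF dA d(5,6)]] tb_cmp[OF d(4,5)] tb_cmp[OF d(4,6)]
  note z = lh_0[OF tl'(1)] lh_0[OF tl'(2)] lh_0[OF tl'(3)]
  note S = S_lin_hom(3)[OF d(1,2,4,5)] S_lin_hom(3)[OF d(1,3,4,6)] S_lin_hom(3)[OF d(1) mtens_dmod[OF dA d(2,3)] d(4) mtens_dmod[OF dA d(5,6)]]
  note tc = tb_coh[OF d(1,2,4,5)] tb_coh[OF d(1,3,4,6)] tb_coh[OF d(1) mtens_dmod[OF dA d(2,3)] d(4) mtens_dmod[OF dA d(5,6)]]
  note T = tmap_lin_hom[where p = 0 and q = 0 and r = 0, simplified]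
  note cm = comp_mid_left[where M = M and N = M' and p = 0 and A = A] comp_mid_left[where M = L and N = L' and p = 0 and A = A]
   comp_mid_right[where M = N and N = N' and p = 0 and A = A]
  have X1: "SS L (mtens A M N) L' (mtens A M' N') (fst v) (tmap A M N M' 0 0 (snd v) (snd u)) \<in> lin_hom A (mtens A L (mtens A M N)) (mtens A L' (mtens A M' N')) (- 1)" if "u \<in> Poly_Mapping.keys p" "v \<in> Poly_Mapping.keys (fst u)" for u v
   by (rule S(3)[OF m(1) T[OF m(2) m0 fin(2,3)]]) (use that in simp_all)
  have X3: "tmap A M (mtens A L N) M' 0 (- 1) (snd v) (SS L N L' N' (fst v) (snd u)) \<in> lin_hom A (mtens A M (mtens A L N)) (mtens A M' (mtens A L' N')) (- 1)" if "u \<in> Poly_Mapping.keys p" "v \<in> Poly_Mapping.keys (fst u)" for u v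
   by (rule tmap_lin_hom[OF m(2) S(2)[OF m(1) m0] fin(2) finite_gens_mtens[OF fin(1,3)]]) (use that in simp_all)
  \<comment> \<open>The coherence at a formal triple is a double sum. Conjugation is moved inside
    both sums, which leaves one instance of \<open>SS_hexagon1\<close> for each term.\<close>
  have e1: "(\<lambda>x. a2 L' M' N' (lext (\<lambda>u. lext (\<lambda>v. SS L (mtens A M N) L' (mtens A M' N') (fst v) (tmap A M N M' 0 0 (snd v) (snd u))) (fst u)) p (a1 L M N x))) =
    lext (\<lambda>u. lext (\<lambda>v x. a2 L' M' N' (SS L (mtens A M N) L' (mtens A M' N') (fst v) (tmap A M N M' 0 0 (snd v) (snd u)) (a1 L M N x))) (fst u)) p"
   by (rule lext_conj2[OF a2_lin_hom[OF fin(4,5,6)] finite_gens_mtens[OF fin(1) finite_gens_mtens[OF fin(2,3)]] X1])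
  have e3: "(\<lambda>x. tmap A (mtens A M' L') N' (mtens A L' M') 0 0 (braid A M' L') (mid A N') (a2 M' L' N' (lext (\<lambda>u. lext (\<lambda>v. tmap A M (mtens A L N) M' 0 (- 1) (snd v) (SS L N L' N' (fst v) (snd u))) (fst u)) p (a1 M L N (tmap A (mtens A L M) N (mtens A M L) 0 0 (braid A L M) (mid A N) x))))) =
    lext (\<lambda>u. lext (\<lambda>v x. tmap A (mtens A M' L') N' (mtens A L' M') 0 0 (braid A M' L') (mid A N') (a2 M' L' N' (tmap A M (mtens A L N) M' 0 (- 1) (snd v) (SS L N L' N' (fst v) (snd u)) (a1 M L N (tmap A (mtens A L M) N (mtens A M L) 0 0 (braid A L M) (mid A N) x))))) (fst u)) p"
   by (rule lext_conj2[OF lin_hom_comp[OF tmap_lin_hom[OF braid_lin_hom[OF fin(5,4)] lin_hom_mid finite_gens_mtens[OF fin(5,4)] fin(6) refl] a2_lin_hom[OF fin(5,4,6)]] finite_gens_mtens[OF fin(2) finite_gens_mtens[OF fin(1,3)]] X3]) (simp_all add: finite_gens_mtens[OF fin(5) finite_gens_mtens[OF fin(4,6)]])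
  have "(\<lambda>x. a2 L' M' N' (lext (\<lambda>u. lext (\<lambda>v. SS L (mtens A M N) L' (mtens A M' N') (fst v) (tmap A M N M' 0 0 (snd v) (snd u))) (fst u)) p (a1 L M N x))) =
   lext (\<lambda>u. lext (\<lambda>v. tmap A (mtens A L M) N (mtens A L' M') (- 1) 0 (SS L M L' M' (fst v) (snd v)) (snd u)) (fst u)) p +
   (\<lambda>x. tmap A (mtens A M' L') N' (mtens A L' M') 0 0 (braid A M' L') (mid A N') (a2 M' L' N' (lext (\<lambda>u. lext (\<lambda>v. tmap A M (mtens A L N) M' 0 (- 1) (snd v) (SS L N L' N' (fst v) (snd u))) (fst u)) p (a1 M L N (tmap A (mtens A L M) N (mtens A M L) 0 0 (braid A L M) (mid A N) x)))))"
   unfolding e1 e3 lext_plus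
   by (intro lext_cong SS_hexagon1[OF d m(1) m(2) m0, folded a1_def a2_def])
  then show ?case
   by (simp add: c hs tl tl' tb fin m m1 m0 z S tc T cm tcar_nest tcar_push tcar_scaled tcar_single mid_lext
    tmap_lext_left tmap_lext_right cong: lext_cong')
 qed
qed

text \<open>Formal triples are now nested in the second entry, and M is braided past N instead of L;
  the termwise identity is \<open>SS_hexagon2\<close>.\<close>

lemma tbraid_hexagon2: "hexagon2 A (tbraid A P)"
proof -
 define a1 where "a1 L M N = asc1 A L M N" for L M N
 define a2 where "a2 L M N = asc2 A L M N" for L M N
 note a1_lin_hom = asc1_lin_hom[where A = A, folded a1_def] and a2_lin_hom = asc2_lin_hom[where A = A, folded a2_def]
 have coh0: "coh (gam A) c c' q = 0" "coh (gam_inv A) c c' q = 0" "coh (asc A) b b' q' = 0" "coh (asc_inv A) b b' q' = 0"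
  for c c' q b b' q'
  by (simp_all add: gam_def gam_inv_def asc_def asc_inv_def del: lam_zero)
 have cmps: "cmp (gam A) (M, N) = braid A M N" "cmp (gam_inv A) (M, N) = braid A N M"
  "cmp (asc A) ((L, M), N) = a1 L M N" "cmp (asc_inv A) ((L, M), N) = a2 L M N" for L M N
  unfolding gam_def gam_inv_def asc_def asc_inv_def ptrans.simps prod.case a1_def a2_def by (rule refl)+
 have a_mid: "a1 L M N (mid A (mtens A (mtens A L M) N) x) = a1 L M N x" "a2 L M N (mid A (mtens A L (mtens A M N)) x) = a2 L M N x"
  "a1 L M N 0 = 0" "a2 L M N 0 = 0" for L M N x
  unfolding a1_def a2_def by (rule alin_mid alin_0)+
 have a_out: "finite (gens L) \<Longrightarrow> finite (gens M) \<Longrightarrow> finite (gens N) \<Longrightarrow>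
   mid A (mtens A L (mtens A M N)) (a1 L M N x) = a1 L M N x \<and> mid A (mtens A (mtens A L M) N) (a2 L M N x) = a2 L M N x" for L M N x
  using comp_mid_left[OF a1_lin_hom, of L M N, THEN fun_cong] comp_mid_left[OF a2_lin_hom, of L M N, THEN fun_cong]
  by (simp add: finite_gens_mtens)
 note hs = enriched_simps coh0 cmps a_mid a_out fm_0 psum_fuse lext_push lext_nest tmap_outer_mid lext_pair_0 mid_tmap lin_hom_mid
  tmap_mid mmap_apply finite_gens_mtens braid_lin_hom
 show ?thesis
  unfolding hexagon2_def Let_def
 proof (rule ptrans_eqI, goal_cases)
  case (1 c)
  then obtain L M N where c: "c = (L, (M, N))" and sf: "is_sfmod A L" "is_sfmod A M" "is_sfmod A N"
   by (auto simp: boxC_simps hcat_simps)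
  note d = sf[THEN is_sfmod_dmod]
  show ?case
   using mtens_dmod[OF dA d(1) mtens_dmod[OF dA d(2,3)]] by (simp add: c enriched_simps)
 next
  case (2 c)
  then obtain L M N where c: "c = (L, (M, N))" and sf: "is_sfmod A L" "is_sfmod A M" "is_sfmod A N"
   by (auto simp: boxC_simps hcat_simps)
  note d = sf[THEN is_sfmod_dmod]
  note fin = d[THEN dm_finite]
  note tl = tt_lin_hom[OF mtens_dmod[OF dA d(1,2)] d(3)] tt_lin_hom[OF d(2,3)] tt_lin_hom[OF d(1,3)]
  note tm = comp_mid_right[OF tl(1), THEN fun_cong]
  note tb = tb_cmp[OF mtens_dmod[OF dA d(1,2)] d(3)] tb_cmp[OF d(2,3)] tb_cmp[OF d(1,3)]
  show ?case
   using tt_hexagon2[OF d, folded a1_def a2_def] by (simp add: c hs tm tl tb fin)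
 next
  case (3 c c' p)
  then obtain L M N L' M' N' where c: "c = (L, (M, N))" "c' = (L', (M', N'))"
   and sf: "is_sfmod A L" "is_sfmod A M" "is_sfmod A N" "is_sfmod A L'" "is_sfmod A M'" "is_sfmod A N'"
   by (auto simp: boxC_simps hcat_simps)
  have p: "p \<in> tcar (cl L L') (tcar (cl M M') (cl N N'))"
   using 3(3) by (simp add: c boxC_simps(2) ch2_tens_simps hcat_simps)
  note d = sf[THEN is_sfmod_dmod]
  note fin = d[THEN dm_finite]
  have m: "fst v \<in> lin_hom A M M' 0" "snd v \<in> lin_hom A N N' 0" if "u \<in> Poly_Mapping.keys p" "v \<in> Poly_Mapping.keys (snd u)" for u v
   using tcarD[OF p that(1)] tcarD[of "snd u", OF _ that(2)] by auto
  have m0: "fst u \<in> lin_hom A L L' 0" if "u \<in> Poly_Mapping.keys p" for u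
   using tcarD[OF p that] by auto
  have m1: "snd u \<in> tcar (lin_hom A M M' 0) (lin_hom A N N' 0)" if "u \<in> Poly_Mapping.keys p" for u
   using tcarD[OF p that] tcar_mono[of "snd u" "cl M M'" "cl N N'"] by auto
  note tl = tt_lin_hom[OF mtens_dmod[OF dA d(1,2)] d(3)] tt_lin_hom[OF d(2,3)] tt_lin_hom[OF d(1,3)]
  note tl' = tt_lin_hom[OF mtens_dmod[OF dA d(4,5)] d(6)] tt_lin_hom[OF d(5,6)] tt_lin_hom[OF d(4,6)]
  note tb = tb_cmp[OF mtens_dmod[OF dA d(1,2)] d(3)] tb_cmp[OF d(2,3)] tb_cmp[OF d(1,3)] tb_cmp[OF mtens_dmod[OF dA d(4,5)] d(6)] tb_cmp[OF d(5,6)] tb_cmp[OF d(4,6)]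
  note z = lh_0[OF tl'(1)] lh_0[OF tl'(2)] lh_0[OF tl'(3)]
  note S = S_lin_hom(3)[OF d(2,3,5,6)] S_lin_hom(3)[OF d(1,3,4,6)] S_lin_hom(3)[OF mtens_dmod[OF dA d(1,2)] d(3) mtens_dmod[OF dA d(4,5)] d(6)]
  note tc = tb_coh[OF d(2,3,5,6)] tb_coh[OF d(1,3,4,6)] tb_coh[OF mtens_dmod[OF dA d(1,2)] d(3) mtens_dmod[OF dA d(4,5)] d(6)]
  note T = tmap_lin_hom[where p = 0 and q = 0 and r = 0, simplified]
  note cm = comp_mid_right[where M = M and N = M' and p = 0 and A = A] comp_mid_left[where M = L and N = L' and p = 0 and A = A]
   comp_mid_right[where M = N and N = N' and p = 0 and A = A]
  have X1: "SS (mtens A L M) N (mtens A L' M') N' (tmap A L M L' 0 0 (fst u) (fst v)) (snd v) \<in> lin_hom A (mtens A (mtens A L M) N) (mtens A (mtens A L' M') N') (- 1)" if "u \<in> Poly_Mapping.keys p" "v \<in> Poly_Mapping.keys (snd u)" for u v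
   by (rule S(3)[OF T[OF m0 m(1) fin(1,2)] m(2)]) (use that in simp_all)
  have X3: "tmap A (mtens A L N) M (mtens A L' N') (- 1) 0 (SS L N L' N' (fst u) (snd v)) (fst v) \<in> lin_hom A (mtens A (mtens A L N) M) (mtens A (mtens A L' N') M') (- 1)" if "u \<in> Poly_Mapping.keys p" "v \<in> Poly_Mapping.keys (snd u)" for u v
   by (rule tmap_lin_hom[OF S(2)[OF m0 m(2)] m(1) finite_gens_mtens[OF fin(1,3)] fin(2)]) (use that in simp_all)
  have e1: "(\<lambda>x. a1 L' M' N' (lext (\<lambda>u. lext (\<lambda>v. SS (mtens A L M) N (mtens A L' M') N' (tmap A L M L' 0 0 (fst u) (fst v)) (snd v)) (snd u)) p (a2 L M N x))) =
    lext (\<lambda>u. lext (\<lambda>v x. a1 L' M' N' (SS (mtens A L M) N (mtens A L' M') N' (tmap A L M L' 0 0 (fst u) (fst v)) (snd v) (a2 L M N x))) (snd u)) p"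
   by (rule lext_conj2[OF a1_lin_hom[OF fin(4,5,6)] finite_gens_mtens[OF finite_gens_mtens[OF fin(1,2)] fin(3)] X1])
  have e3: "(\<lambda>x. tmap A L' (mtens A N' M') L' 0 0 (mid A L') (braid A N' M') (a1 L' N' M' (lext (\<lambda>u. lext (\<lambda>v. tmap A (mtens A L N) M (mtens A L' N') (- 1) 0 (SS L N L' N' (fst u) (snd v)) (fst v)) (snd u)) p (a2 L N M (tmap A L (mtens A M N) L 0 0 (mid A L) (braid A M N) x))))) =
    lext (\<lambda>u. lext (\<lambda>v x. tmap A L' (mtens A N' M') L' 0 0 (mid A L') (braid A N' M') (a1 L' N' M' (tmap A (mtens A L N) M (mtens A L' N') (- 1) 0 (SS L N L' N' (fst u) (snd v)) (fst v) (a2 L N M (tmap A L (mtens A M N) L 0 0 (mid A L) (braid A M N) x))))) (snd u)) p"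
   by (rule lext_conj2[OF lin_hom_comp[OF tmap_lin_hom[OF lin_hom_mid braid_lin_hom[OF fin(6,5)] fin(4) finite_gens_mtens[OF fin(6,5)] refl] a1_lin_hom[OF fin(4,6,5)]] finite_gens_mtens[OF finite_gens_mtens[OF fin(1,3)] fin(2)] X3]) (simp_all add: finite_gens_mtens[OF finite_gens_mtens[OF fin(4,6)] fin(5)])
  have "(\<lambda>x. a1 L' M' N' (lext (\<lambda>u. lext (\<lambda>v. SS (mtens A L M) N (mtens A L' M') N' (tmap A L M L' 0 0 (fst u) (fst v)) (snd v)) (snd u)) p (a2 L M N x))) =
   lext (\<lambda>u. lext (\<lambda>v. tmap A L (mtens A M N) L' 0 (- 1) (fst u) (SS M N M' N' (fst v) (snd v))) (snd u)) p +
   (\<lambda>x. tmap A L' (mtens A N' M') L' 0 0 (mid A L') (braid A N' M') (a1 L' N' M' (lext (\<lambda>u. lext (\<lambda>v. tmap A (mtens A L N) M (mtens A L' N') (- 1) 0 (SS L N L' N' (fst u) (snd v)) (fst v)) (snd u)) p (a2 L N M (tmap A L (mtens A M N) L 0 0 (mid A L) (braid A M N) x)))))"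
   unfolding e1 e3 lext_plus
   by (intro lext_cong SS_hexagon2[OF d m0 m(1) m(2), folded a1_def a2_def])
  then show ?case
   by (simp add: c hs tl tl' tb fin m m1 m0 z S tc T cm tcar_nest tcar_push tcar_scaled tcar_single mid_lext
    tmap_lext_left tmap_lext_right cong: lext_cong')
 qed
qed

end

section \<open>Weight 2 coefficients and the contraction\<close>

lemma gvars_cong:
 assumes "ngen V = ngen W" "zdeg V = zdeg W"
 shows "amul V = amul W" "apar V = apar W" "acar V = acar W" "ahom V = ahom W" "ksgn V = ksgn W" "ader V v = ader W v"
proof -
 have m: "mon_ok V = mon_ok W" "mdeg V = mdeg W"
  by (auto simp: mon_ok_def mdeg_def assms fun_eq_iff)
 show a: "amul V = amul W" "apar V = apar W" "ksgn V = ksgn W" "ahom V = ahom W"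
  by (intro ext, simp only: amul_def apar_def acar_def ahom_def ksgn_def m assms)+
 show b: "acar V = acar W"
  by (simp only: acar_def m)
 show "ader V v = ader W v"
  by (intro ext) (simp only: ader_def a b assms)
qed

lemma fsm_diff_left: "fsm (c - d) p = fsm c p - fsm d p"
 using fsm_add_left[of c "- d" p] by (simp add: fsm_uminus_left)

lemma sum_if_const: "(\<Sum>c\<in>S. if P then F c else 0) = (if P then \<Sum>c\<in>S. F c else 0)"
 by simp

text \<open>Where characteristic 0 enters the antisymmetry arguments: a sum that equals its own
  negative after exchanging two indices vanishes.\<close>

lemma pm_double_zero:
 fixes x :: "'m \<Rightarrow>\<^sub>0 'k::field_char_0"
 assumes "x = - x"
 shows "x = 0"
proof -
 have "x + x = 0" using assms by (metis add.right_inverse)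
 then have "fsm 2 x = 0" using fsm_add_left[of 1 1 x] by simp
 then have "fsm (1 / 2) (fsm 2 x) = 0" by simp
 then show ?thesis by simp
qed

text \<open>The generators of A have indices below N and the shifted derivations indices from N on,
  so a monomial splits uniquely into these two parts.\<close>

lemma split_exponent:
 fixes u w e m :: "nat \<Rightarrow>\<^sub>0 nat"
 assumes "Poly_Mapping.keys u \<subseteq> {..<N}" "Poly_Mapping.keys w \<subseteq> {..<N}" "Poly_Mapping.keys e \<subseteq> {N..}" "Poly_Mapping.keys m \<subseteq> {N..}"
  and eq: "u + e = w + m"
 shows "u = w \<and> e = m"
proof -
 have z: "Poly_Mapping.lookup e k = 0 \<and> Poly_Mapping.lookup m k = 0" if "k < N" for k
  using assms(3,4) that by (auto simp: subset_iff in_keys_iff simp flip: not_less)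
 have z': "Poly_Mapping.lookup u k = 0 \<and> Poly_Mapping.lookup w k = 0" if "\<not> k < N" for k
  using assms(1,2) that by (auto simp: subset_iff in_keys_iff)
 have l: "Poly_Mapping.lookup u k + Poly_Mapping.lookup e k = Poly_Mapping.lookup w k + Poly_Mapping.lookup m k" for k
  using eq by (metis lookup_add)
 have "Poly_Mapping.lookup u k = Poly_Mapping.lookup w k \<and> Poly_Mapping.lookup e k = Poly_Mapping.lookup m k" for k
  using l[of k] z[of k] z'[of k] by (cases "k < N") auto
 then show ?thesis by (auto intro!: poly_mapping_eqI)
qed

lemma two_singles: "Poly_Mapping.single a (Suc 0) + Poly_Mapping.single b (Suc 0) = Poly_Mapping.single c (Suc 0) + Poly_Mapping.single d (Suc 0)
  \<longleftrightarrow> (a = c \<and> b = d) \<or> (a = d \<and> b = c)" (is "?l = ?r \<longleftrightarrow> _")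
proof
 assume e: "?l = ?r"
 have "Poly_Mapping.lookup ?l k = Poly_Mapping.lookup ?r k" for k using e by simp
 from this[of a] this[of b] this[of c] show "(a = c \<and> b = d) \<or> (a = d \<and> b = c)"
  by (auto simp: lookup_add lookup_single when_def split: if_splits)
qed (auto simp: add.commute)

abbreviation exp2 :: "nat \<Rightarrow> nat \<Rightarrow> nat \<Rightarrow> (nat \<Rightarrow>\<^sub>0 nat)" where
 "exp2 N i j \<equiv> Poly_Mapping.single (N + i) (Suc 0) + Poly_Mapping.single (N + j) (Suc 0)"

text \<open>Extraction of a coefficient rewritten as a sum over the support of P, which makes its
  additivity a general fact about \<open>psum\<close>. As subtraction of exponents is truncated, the
  second condition says that the quadratic monomial divides m.\<close>

lemma wt2_psum: "wt2_coeff A P i j =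
 psum (\<lambda>m x. if Poly_Mapping.keys (m - exp2 (ngen A) i j) \<subseteq> {..<ngen A} \<and> m = (m - exp2 (ngen A) i j) + exp2 (ngen A) i j
  then Poly_Mapping.single (m - exp2 (ngen A) i j) x else 0) P"
proof -
 let ?e = "exp2 (ngen A) i j"
 have "wt2_coeff A P i j = (\<Sum>u | Poly_Mapping.keys u \<subseteq> {..<ngen A} \<and> u + ?e \<in> Poly_Mapping.keys P.
   Poly_Mapping.single u (Poly_Mapping.lookup P (u + ?e)))"
  by (simp add: wt2_coeff_def Let_def)
 also have "\<dots> = (\<Sum>m\<in>{m \<in> Poly_Mapping.keys P. Poly_Mapping.keys (m - ?e) \<subseteq> {..<ngen A} \<and> m = (m - ?e) + ?e}.
   Poly_Mapping.single (m - ?e) (Poly_Mapping.lookup P m))"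
  by (rule sum.reindex_bij_witness[where i = "\<lambda>m. m - ?e" and j = "\<lambda>u. u + ?e"]) auto
 also have "\<dots> = psum (\<lambda>m x. if Poly_Mapping.keys (m - ?e) \<subseteq> {..<ngen A} \<and> m = (m - ?e) + ?e
   then Poly_Mapping.single (m - ?e) x else 0) P"
  unfolding psum_def by (rule sum.inter_filter) simp
 finally show ?thesis .
qed

lemma wt2_add: "wt2_coeff A (P + Q) i j = wt2_coeff A P i j + wt2_coeff A Q i j"
 unfolding wt2_psum by (rule psum_add) (auto simp: addb_def single_add)

lemma wt2_sum: "wt2_coeff A (sum f S) i j = (\<Sum>s\<in>S. wt2_coeff A (f s) i j)"
 unfolding wt2_psum by (rule psum_sum) (auto simp: addb_def single_add)

lemma wt2_single:
 assumes w: "Poly_Mapping.keys w \<subseteq> {..<ngen A}" and m: "Poly_Mapping.keys m \<subseteq> {ngen A..}"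
 shows "wt2_coeff A (Poly_Mapping.single (w + m) x) i j = (if m = exp2 (ngen A) i j then Poly_Mapping.single w x else 0)"
proof -
 let ?e = "exp2 (ngen A) i j"
 have e: "Poly_Mapping.keys ?e \<subseteq> {ngen A..}" by (auto simp: keys_plus_nat)
 have 1: "wt2_coeff A (Poly_Mapping.single (w + m) x) i j =
   (if Poly_Mapping.keys (w + m - ?e) \<subseteq> {..<ngen A} \<and> w + m = (w + m - ?e) + ?e then Poly_Mapping.single (w + m - ?e) x else 0)"
  unfolding wt2_psum by (rule psum_single) simp
 show ?thesis
 proof (cases "m = ?e")
  case True then show ?thesis unfolding 1 using w by simp
 next
  case False
  then have neg: "\<not> (Poly_Mapping.keys (w + m - ?e) \<subseteq> {..<ngen A} \<and> w + m = (w + m - ?e) + ?e)"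
   using split_exponent[OF _ w e m, of "w + m - ?e"] by auto
  then show ?thesis unfolding 1 if_not_P[OF neg] if_not_P[OF False] by simp
 qed
qed

lemma acar_wt2: "P \<in> acar (Pol_gvars A) \<Longrightarrow> wt2_coeff A P i j \<in> acar A"
 unfolding wt2_coeff_def Let_def
proof (intro acar_sum acar_single)
 fix u :: "nat \<Rightarrow>\<^sub>0 nat" let ?e = "Poly_Mapping.single (ngen A + i) 1 + Poly_Mapping.single (ngen A + j) 1 :: nat \<Rightarrow>\<^sub>0 nat"
 assume P: "P \<in> acar (Pol_gvars A)" and u: "u \<in> {u. Poly_Mapping.keys u \<subseteq> {..<ngen A} \<and> u + ?e \<in> Poly_Mapping.keys P}"
 then have "mon_ok (Pol_gvars A) (u + ?e)" by (auto simp: acar_def)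
 then have "mon_ok (Pol_gvars A) u" by (rule mon_ok_addD)
 moreover have "Poly_Mapping.lookup u k = 0" if "\<not> k < ngen A" for k
  using u that by (auto simp: subset_iff in_keys_iff)
 ultimately show "mon_ok A u"
  using u by (auto simp: mon_ok_def Pol_gvars_def) (metis le0)
qed

lemma pairing_ge_left: "j < ngen A \<Longrightarrow> k < ngen A \<Longrightarrow> pairing A q (apar A j) (ge (GAtom k)) = (if j = k then 1 else (0::'k::field fga))"
proof -
 assume j: "j < ngen A" and k: "k < ngen A"
 have "pairing A q (apar A j) (ge (GAtom k)) = (\<Sum>i<ngen A. if i = k then (if j = k then 1 else 0) else (0::'k fga))"
  unfolding pairing_def by (intro sum.cong refl) (auto simp: ge_def apar_avar amul_1_left)
 then show ?thesis using k by simp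
qed

text \<open>The symmetrized pairing evaluates the two derivations in both orders. The coefficients
  are indexed by i \<le> j, so for distinct indices exactly one order occurs, whereas on the
  diagonal both do and the coefficient is counted twice up to sign.\<close>

lemma wt2_pairing_eq:
 assumes P: "P \<in> acar (Pol_gvars A)" and k: "k < ngen A" and l: "l < ngen A"
 shows "wt2_pairing A P (GAtom k) (GAtom l) =
  (if l \<le> k then fsm (sg (zdeg A k + zdeg A l)) (wt2_coeff A P l k) else 0) +
  (if k \<le> l then fsm (sg (ed A k * ed A l) * sg (zdeg A k + zdeg A l)) (wt2_coeff A P k l) else 0)"
proof -
 let ?n = "ngen A" and ?C = "wt2_coeff A P"
 have b: "bipairing A (- zdeg A i) (apar A i) (- zdeg A j) (apar A j) (zdeg A k) (ge (GAtom k)) (ge (GAtom l)) =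
   (if j = k then if i = l then fsm (sg (zdeg A k + zdeg A l)) 1 else 0 else 0) +
   (if i = k then if j = l then fsm (sg (ed A k * ed A l) * sg (zdeg A k + zdeg A l)) 1 else 0 else (0::'a fga))"
  if "i < ?n" "j < ?n" for i j
 proof -
  have m: "mact A (if P then 1 else 0) (ge (GAtom l)) = (if P then ge (GAtom l) else (0::'a mel))" for P
   by (auto simp: mact_def ge_def amul_1_left fapp fun_eq_iff)
  have p0: "pairing A q D 0 = (0::'a fga)" for q D by (simp add: pairing_def fapp)
  have s: "sg (zdeg A k - zdeg A l) = (sg (zdeg A k + zdeg A l) :: 'a)" "sg ((1 - zdeg A k) * (1 - zdeg A l)) = (sg (ed A k * ed A l) :: 'a)"
   "sg (2 * zdeg A k) = (1 :: 'a)" for k l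
   by (rule sg_eqI, simp, rule sg_eqI, simp, rule sg_even, simp)
  show ?thesis
   unfolding bipairing_def using that k l by (auto simp: pairing_ge_left m p0 s)
 qed
 have "wt2_pairing A P (GAtom k) (GAtom l) = (\<Sum>j<?n. \<Sum>i\<le>j.
   (if j = k then if i = l then fsm (sg (zdeg A k + zdeg A l)) (?C i j) else 0 else 0) +
   (if i = k then if j = l then fsm (sg (ed A k * ed A l) * sg (zdeg A k + zdeg A l)) (?C i j) else 0 else 0))"
  unfolding wt2_pairing_def prod.case gen.case
 proof (intro sum.cong refl)
  fix j i assume "j \<in> {..<?n}" "i \<in> {..j}"
  then have ij: "i < ?n" "j < ?n" by auto
  show "amul A (?C i j) (bipairing A (- zdeg A i) (apar A i) (- zdeg A j) (apar A j) (zdeg A k) (ge (GAtom k)) (ge (GAtom l))) =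
   (if j = k then if i = l then fsm (sg (zdeg A k + zdeg A l)) (?C i j) else 0 else 0) +
   (if i = k then if j = l then fsm (sg (ed A k * ed A l) * sg (zdeg A k + zdeg A l)) (?C i j) else 0 else 0)"
   unfolding b[OF ij] using acar_wt2[OF P, of i j] by (auto simp: amul_add_right amul_fsm_right amul_1_right)
 qed
 also have "\<dots> = (\<Sum>j<?n. if j = k then (\<Sum>i\<le>j. if i = l then fsm (sg (zdeg A k + zdeg A l)) (?C i j) else 0) else 0) +
   (\<Sum>j<?n. if j = l then (\<Sum>i\<le>j. if i = k then fsm (sg (ed A k * ed A l) * sg (zdeg A k + zdeg A l)) (?C i j) else 0) else 0)"
  unfolding sum.distrib by (intro arg_cong2[where f = "(+)"] sum.cong refl) (auto intro!: sum.neutral sum.cong)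
 also have "\<dots> = (\<Sum>i\<le>k. if i = l then fsm (sg (zdeg A k + zdeg A l)) (?C i k) else 0) +
   (\<Sum>i\<le>l. if i = k then fsm (sg (ed A k * ed A l) * sg (zdeg A k + zdeg A l)) (?C i l) else 0)"
  using k l by (simp only: sum_lessThan_delta)
 finally show ?thesis by (simp add: sum.delta)
qed

section \<open>The Chevalley-Eilenberg algebra in coordinates\<close>

locale CE_data =
 fixes n :: nat and f K :: "nat \<Rightarrow> nat \<Rightarrow> nat \<Rightarrow> 'k::field_char_0" and \<pi> pt :: "nat \<Rightarrow> nat \<Rightarrow> 'k"
 assumes f_anti: "\<And>a b c. a < n \<Longrightarrow> b < n \<Longrightarrow> c < n \<Longrightarrow> f b a c = - f a b c"
  and K_anti: "\<And>a b c. a < n \<Longrightarrow> b < n \<Longrightarrow> c < n \<Longrightarrow> K b a c = - K a b c \<and> K a c b = - K a b c"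
  and pi_sym: "\<And>a b. a < n \<Longrightarrow> b < n \<Longrightarrow> \<pi> a b = \<pi> b a"
  and pi_inv: "\<And>a b c. a < n \<Longrightarrow> b < n \<Longrightarrow> c < n \<Longrightarrow> (\<Sum>d<n. f c d a * \<pi> d b) + (\<Sum>d<n. f c d b * \<pi> a d) = 0"
  and pt_br: "\<And>b c d. b < n \<Longrightarrow> c < n \<Longrightarrow> d < n \<Longrightarrow> (\<Sum>e<n. pt e b * f c d e) =
   (\<Sum>a<n. \<pi> a b * K c d a) + (\<Sum>a<n. pt c a * f a d b + pt d a * f c a b)"
  and pt_pi: "\<And>a b. a < n \<Longrightarrow> b < n \<Longrightarrow> (\<Sum>c<n. \<pi> c b * pt c a) + (\<Sum>c<n. \<pi> a c * pt c b) = 0"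
begin

abbreviation A where "A \<equiv> CE n f K"

lemma A_simps: "ngen A = Suc n" "zdeg A = (\<lambda>i. if i < n then 1 else 2)"
 by (simp_all add: CE_def CE_gvars_def Let_def)

lemma G_cong: "amul (CE_gvars n) = amul A" "ader (CE_gvars n) v = ader A v"
 by (rule gvars_cong; simp add: A_simps CE_gvars_def)+

lemma th: "a < n \<Longrightarrow> avar a \<in> ahom A 1" "avar n \<in> ahom A 2" "a < n \<Longrightarrow> avar a \<in> acar A"
 by (rule ahom_avar ahom_avar acar_avar; simp add: A_simps)+

text \<open>The quadratic form in the theta's with coefficients g. It depends on the antisymmetric
  part of g only, so comparing two quadratic elements amounts to showing that the difference of
  their arrays is symmetric.\<close>

definition Q :: "(nat \<Rightarrow> nat \<Rightarrow> 'k) \<Rightarrow> 'k fga" where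
 "Q g = (\<Sum>c<n. \<Sum>d<n. fsm (g c d) (amul A (avar c) (avar d)))"

lemma Q_add: "Q g + Q h = Q (\<lambda>c d. g c d + h c d)"
 by (simp add: Q_def fsm_add_left sum.distrib)

lemma Q_uminus: "- Q g = Q (\<lambda>c d. - g c d)"
 by (simp add: Q_def fsm_uminus_left sum_negf)

lemma Q_fsm: "fsm x (Q g) = Q (\<lambda>c d. x * g c d)"
 by (simp add: Q_def fsm_sum)

lemma Q_sum: "(\<Sum>k\<in>S. Q (g k)) = Q (\<lambda>c d. \<Sum>k\<in>S. g k c d)"
 unfolding Q_def fsm_sum_left
 by (subst sum.swap) (intro sum.cong refl, subst sum.swap, rule refl)

lemma Q_cong: "(\<And>c d. c < n \<Longrightarrow> d < n \<Longrightarrow> g c d = h c d) \<Longrightarrow> Q g = Q h"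
 by (simp add: Q_def)

lemma Q_swap: "Q g = Q (\<lambda>c d. - g d c)"
proof -
 have "Q g = (\<Sum>d<n. \<Sum>c<n. fsm (g c d) (amul A (avar c) (avar d)))"
  unfolding Q_def by (rule sum.swap)
 also have "\<dots> = Q (\<lambda>c d. - g d c)"
  unfolding Q_def
 proof (intro sum.cong refl)
  fix d c assume "d \<in> {..<n}" "c \<in> {..<n}"
  then have "amul A (avar c) (avar d) = - amul A (avar d) (avar c :: 'k fga)"
   using amul_commute_hom[OF th(1) th(1), of c d] by (simp add: sg_odd fsm_uminus_left)
  then show "fsm (g c d) (amul A (avar c) (avar d)) = fsm (- g c d) (amul A (avar d) (avar c))"
   by (simp add: fsm_uminus fsm_uminus_left)
 qed
 finally show ?thesis .
qed

lemma Q_zero: "(\<And>c d. c < n \<Longrightarrow> d < n \<Longrightarrow> g c d = g d c) \<Longrightarrow> Q g = 0"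
 by (rule pm_double_zero) (subst Q_swap, auto simp: Q_uminus intro!: Q_cong)

lemma Q_hom: "Q g \<in> ahom A 2"
 unfolding Q_def by (intro ahom_sum ahom_fsm ahom_amul[OF th(1) th(1)]) auto

lemma d_eq: "adiff A = ader A (\<lambda>i. if i < n then Q (\<lambda>c d. - (1 / 2) * f c d i)
  else (\<Sum>a<n. \<Sum>b<n. \<Sum>c<n. fsm (- (1 / fact 3) * K a b c) (amul A (amul A (avar a) (avar b)) (avar c))))"
proof -
 have "adiff A = ader (CE_gvars n) (\<lambda>i. if i < n then \<Sum>b<n. \<Sum>c<n. fsm (- (1 / 2) * f b c i) (amul (CE_gvars n) (avar b) (avar c))
  else (\<Sum>a<n. \<Sum>b<n. \<Sum>c<n. fsm (- (1 / fact 3) * K a b c) (amul (CE_gvars n) (amul (CE_gvars n) (avar a) (avar b)) (avar c))))"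
  by (simp add: CE_def Let_def)
 then show ?thesis unfolding G_cong Q_def .
qed

lemma dA: "adiff A \<in> der A 1"
 unfolding d_eq
proof (rule ader_der)
 fix i assume "i < ngen A"
 have "amul A (amul A (avar a) (avar b)) (avar c) \<in> ahom A 3" if "a < n" "b < n" "c < n" for a b c
  by (rule ahom_amul[OF ahom_amul[OF th(1) th(1) refl] th(1)]) (use that in simp_all)
 then show "(if i < n then Q (\<lambda>c d. - (1 / 2) * f c d i) else (\<Sum>a<n. \<Sum>b<n. \<Sum>c<n.
   fsm (- (1 / fact 3) * K a b c) (amul A (amul A (avar a) (avar b)) (avar c)))) \<in> ahom A (zdeg A i + 1)"
  using Q_hom by (auto simp: A_simps intro!: ahom_sum ahom_fsm)
qed

lemma d_th: "b < n \<Longrightarrow> adiff A (avar b) = Q (\<lambda>c d. - (1 / 2) * f c d b)"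
 unfolding d_eq by (subst ader_avar) (auto simp: A_simps intro: ahom_acar[OF Q_hom])

lemma d_nu: "adiff A (avar n) = (\<Sum>a<n. \<Sum>b<n. \<Sum>c<n. fsm (- (1 / fact 3) * K a b c) (amul A (amul A (avar a) (avar b)) (avar c)))"
 unfolding d_eq by (subst ader_avar) (auto simp: A_simps intro!: acar_sum acar_fsm)

lemma apar_th2: "c < n \<Longrightarrow> d < n \<Longrightarrow> i \<le> n \<Longrightarrow> apar A i (amul A (avar c) (avar d)) = (if i = c then avar d else 0) - (if i = d then avar c else 0)"
 by (subst apar_amul[OF th(1) th(3)])
  (auto simp: apar_avar A_simps amul_1_left amul_1_right th sg_odd fsm_uminus_left)

lemma apar_Q: "i \<le> n \<Longrightarrow> apar A i (Q g) = (if i < n then \<Sum>d<n. fsm (g i d - g d i) (avar d) else 0)"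
proof -
 assume i: "i \<le> n"
 have "apar A i (Q g) = (\<Sum>c<n. if i = c then \<Sum>d<n. fsm (g c d) (avar d) else 0) -
   (\<Sum>c<n. \<Sum>d<n. if i = d then fsm (g c d) (avar c) else 0)"
  unfolding Q_def apar_sum apar_fsm
  using i by (simp add: apar_th2 fsm_diff sum_subtractf if_distrib[of "fsm _"] sum_if_const cong: if_cong)
 then show ?thesis
  by (simp add: sum.delta' fsm_diff_left sum_subtractf)
qed

text \<open>Differentiating the quadratic form gives two terms, equal by antisymmetry of the
  structure constants; this removes the factor 1/2.\<close>

lemma cc_th: "a \<le> n \<Longrightarrow> b < n \<Longrightarrow> cc A a b = (if a < n then \<Sum>d<n. fsm (- f a d b) (avar d) else 0)"
 using f_anti[of _ a b] by (auto simp: cc_def d_th apar_Q intro!: sum.cong arg_cong2[where f = fsm])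

lemma apar_th3:
 assumes "a < n" "b < n" "c < n" "i \<le> n"
 shows "apar A i (amul A (amul A (avar a) (avar b)) (avar c)) = (if i = a then amul A (avar b) (avar c) else 0) -
  (if i = b then amul A (avar a) (avar c) else 0) + (if i = c then amul A (avar a) (avar b) else 0)"
 by (subst apar_amul[OF ahom_amul[OF th(1) th(1) refl] th(3)])
  (auto simp: assms apar_th2 apar_avar amul_1_right amul_diff_left sg_even)

lemma apar_nu:
 assumes "i \<le> n"
 shows "apar A i (\<Sum>a<n. \<Sum>b<n. \<Sum>c<n. fsm (h a b c) (amul A (amul A (avar a) (avar b)) (avar c))) =
  (if i < n then Q (h i) - Q (\<lambda>a c. h a i c) + Q (\<lambda>a b. h a b i) else 0)"
proof -
 have "apar A i (\<Sum>a<n. \<Sum>b<n. \<Sum>c<n. fsm (h a b c) (amul A (amul A (avar a) (avar b)) (avar c))) =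
   (\<Sum>a<n. if i = a then \<Sum>b<n. \<Sum>c<n. fsm (h a b c) (amul A (avar b) (avar c)) else 0) -
   (\<Sum>a<n. \<Sum>b<n. if i = b then \<Sum>c<n. fsm (h a b c) (amul A (avar a) (avar c)) else 0) +
   (\<Sum>a<n. \<Sum>b<n. \<Sum>c<n. if i = c then fsm (h a b c) (amul A (avar a) (avar b)) else 0)"
  unfolding apar_sum apar_fsm
  using assms by (simp add: apar_th3 fsm_diff fsm_add sum_subtractf sum.distrib if_distrib[of "fsm _"] sum_if_const cong: if_cong)
 then show ?thesis
  by (simp add: sum.delta' Q_def)
qed

text \<open>The three positions of the index contribute equally by antisymmetry of the cocycle, so
  1/3! becomes 1/2. Since nu does not occur in its own differential, its derivative along nu
  vanishes.\<close>

lemma cc_nu: "a < n \<Longrightarrow> cc A a n = Q (\<lambda>c d. - (1 / 2) * K a c d)" "cc A n n = 0"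
proof -
 assume a: "a < n"
 have "cc A a n = Q (\<lambda>c d. - (1 / fact 3) * K a c d + - (- (1 / fact 3) * K c a d) + - (1 / fact 3) * K c d a)"
  unfolding cc_def d_nu apar_nu[OF less_imp_le[OF a]] using a by (simp only: diff_conv_add_uminus Q_uminus Q_add if_True)
 also have "\<dots> = Q (\<lambda>c d. - (1 / 2) * K a c d)"
 proof (rule Q_cong)
  fix c d assume "c < n" "d < n"
  then have "K c a d = - K a c d" "K c d a = K a c d" using K_anti[of a c d] K_anti[of c a d] a by auto
  then show "- (1 / fact 3) * K a c d + - (- (1 / fact 3) * K c a d) + - (1 / fact 3) * K c d a = - (1 / 2) * K a c d"
   by (simp add: fact_numeral field_simps)
 qed
 finally show "cc A a n = Q (\<lambda>c d. - (1 / 2) * K a c d)" .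
next
 show "cc A n n = 0" unfolding cc_def d_nu apar_nu[OF order_refl] by simp
qed

text \<open>The coefficient of s^3 d/dtheta^a s^3 d/dnu in the bivector, a linear form in the
  theta's.\<close>

definition lam :: "nat \<Rightarrow> 'k fga" where
 "lam a = (\<Sum>b<n. fsm (pt b a) (avar b))"

lemma lam_hom: "lam a \<in> ahom A 1"
 unfolding lam_def by (intro ahom_sum ahom_fsm th) simp

lemma d_lam: "adiff A (lam a) = Q (\<lambda>c d. \<Sum>b<n. pt b a * (- (1 / 2) * f c d b))"
proof -
 have "adiff A (lam a) = (\<Sum>b<n. adiff A (fsm (pt b a) (avar b)))"
  unfolding lam_def by (rule der_sum[OF dA]) (intro acar_fsm th, simp)
 also have "\<dots> = (\<Sum>b<n. fsm (pt b a) (adiff A (avar b)))"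
  by (intro sum.cong refl der_fsm[OF dA] th) simp
 also have "\<dots> = (\<Sum>b<n. Q (\<lambda>c d. pt b a * (- (1 / 2) * f c d b)))"
  by (intro sum.cong refl) (simp only: lessThan_iff d_th Q_fsm)
 finally show ?thesis unfolding Q_sum .
qed

lemma lam_cc: "k < n \<Longrightarrow> a < n \<Longrightarrow> amul A (lam k) (cc A k a) = Q (\<lambda>c d. pt c k * - f k d a)"
 unfolding lam_def amul_sum_left amul_fsm_left
 by (simp add: cc_th amul_sum_right amul_fsm_right fsm_sum Q_def)

text \<open>The coefficient of each theta^d is the invariance of \<pi>, after one use of
  antisymmetry of f.\<close>

lemma pi_cc: "a < n \<Longrightarrow> b < n \<Longrightarrow> (\<Sum>k<n. fsm (\<pi> k b) (cc A k a)) + (\<Sum>k<n. fsm (\<pi> a k) (cc A k b)) = 0"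
proof -
 assume ab: "a < n" "b < n"
 have "(\<Sum>k<n. fsm (\<pi> k b) (cc A k a)) + (\<Sum>k<n. fsm (\<pi> a k) (cc A k b)) =
   (\<Sum>k<n. \<Sum>d<n. fsm (- (\<pi> k b * f k d a)) (avar d)) + (\<Sum>k<n. \<Sum>d<n. fsm (- (\<pi> a k * f k d b)) (avar d))"
  using ab by (simp add: cc_th fsm_sum)
 also have "\<dots> = (\<Sum>d<n. fsm ((\<Sum>k<n. - (\<pi> k b * f k d a)) + (\<Sum>k<n. - (\<pi> a k * f k d b))) (avar d))"
  by (simp only: fsm_add_left fsm_sum_left sum.distrib sum.swap[of "\<lambda>k d. fsm (- (\<pi> k b * f k d a)) (avar d)"]
   sum.swap[of "\<lambda>k d. fsm (- (\<pi> a k * f k d b)) (avar d)"])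
 also have "\<dots> = 0"
 proof (intro sum.neutral ballI)
  fix d assume "d \<in> {..<n}"
  then have d: "d < n" by simp
  have "(\<Sum>k<n. - (\<pi> k b * f k d a)) + (\<Sum>k<n. - (\<pi> a k * f k d b)) = (\<Sum>k<n. f d k a * \<pi> k b) + (\<Sum>k<n. f d k b * \<pi> a k)"
   using f_anti[OF d] ab by (intro arg_cong2[where f = "(+)"] sum.cong refl) simp_all
  also have "\<dots> = 0" by (rule pi_inv[OF ab d])
  finally show "fsm ((\<Sum>k<n. - (\<pi> k b * f k d a)) + (\<Sum>k<n. - (\<pi> a k * f k d b))) (avar d) = (0 :: 'k fga)" by simp
 qed
 finally show ?thesis .
qed

text \<open>Both sides are quadratic in the theta's. Half of the compatibility condition of pi-tilde
  with the bracket says that the difference of their coefficient arrays is symmetric, so that the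
  difference vanishes.\<close>

lemma lam_closed: "a < n \<Longrightarrow> adiff A (lam a) = (\<Sum>k<n. amul A (lam k) (cc A k a)) + (\<Sum>k<n. fsm (\<pi> a k) (cc A k n))"
proof -
 assume a: "a < n"
 have "adiff A (lam a) - ((\<Sum>k<n. amul A (lam k) (cc A k a)) + (\<Sum>k<n. fsm (\<pi> a k) (cc A k n))) =
   Q (\<lambda>c d. (\<Sum>b<n. pt b a * (- (1 / 2) * f c d b)) + (- (\<Sum>k<n. pt c k * - f k d a) + - (\<Sum>k<n. \<pi> a k * (- (1 / 2) * K k c d))))"
 proof -
  have s1: "(\<Sum>k<n. amul A (lam k) (cc A k a)) = Q (\<lambda>c d. \<Sum>k<n. pt c k * - f k d a)"
   unfolding Q_sum[symmetric] by (intro sum.cong refl lam_cc) (simp_all add: a)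
  have s2: "(\<Sum>k<n. fsm (\<pi> a k) (cc A k n)) = Q (\<lambda>c d. \<Sum>k<n. \<pi> a k * (- (1 / 2) * K k c d))"
   unfolding Q_sum[symmetric] by (intro sum.cong refl) (simp only: lessThan_iff cc_nu Q_fsm)
  show ?thesis
   unfolding s1 s2 d_lam diff_conv_add_uminus minus_add_distrib Q_uminus Q_add ..
 qed
 also have "\<dots> = 0"
 proof (rule Q_zero)
  fix c d assume cd: "c < n" "d < n"
  \<comment> \<open>The compatibility condition with all indices brought into the order of the
    arrays, using antisymmetry of f and K and symmetry of \<pi>.\<close>
  have e: "(\<Sum>b<n. pt b a * f c d b) - (\<Sum>k<n. \<pi> a k * K k c d) = (\<Sum>k<n. pt c k * f k d a) - (\<Sum>k<n. pt d k * f k c a)"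
  proof -
   have "K c d k = K k c d" if "k < n" for k using K_anti[of c d k] K_anti[of c k d] that cd by auto
   moreover have "f c k a = - f k c a" if "k < n" for k using f_anti[of k c a] that cd a by auto
   ultimately have "(\<Sum>k<n. \<pi> k a * K c d k) + (\<Sum>k<n. pt c k * f k d a + pt d k * f c k a) =
     (\<Sum>k<n. \<pi> a k * K k c d) + (\<Sum>k<n. pt c k * f k d a + pt d k * - f k c a)"
    using pi_sym a by (intro arg_cong2[where f = "(+)"] sum.cong refl) simp_all
   from trans[OF pt_br[OF a cd] this] show ?thesis by (simp add: sum.distrib sum_negf sum_subtractf)
  qed
  then have e': "(\<Sum>b<n. pt b a * f c d b) = (\<Sum>k<n. pt c k * f k d a) - (\<Sum>k<n. pt d k * f k c a) + (\<Sum>k<n. \<pi> a k * K k c d)"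
   by (simp add: algebra_simps)
  have m: "(\<Sum>b<n. pt b a * f d c b) = - (\<Sum>b<n. pt b a * f c d b)" "(\<Sum>k<n. \<pi> a k * K k d c) = - (\<Sum>k<n. \<pi> a k * K k c d)"
  proof -
   have "K k d c = - K k c d" if "k < n" for k using K_anti[of k c d] that cd by simp
   then show "(\<Sum>k<n. \<pi> a k * K k d c) = - (\<Sum>k<n. \<pi> a k * K k c d)"
    unfolding sum_negf[symmetric] by (intro sum.cong refl) simp
   show "(\<Sum>b<n. pt b a * f d c b) = - (\<Sum>b<n. pt b a * f c d b)"
    unfolding sum_negf[symmetric] by (intro sum.cong refl) (simp add: f_anti[OF cd])
  qed
  have h: "(\<Sum>b<n. g b * (- (1 / 2) * h b)) = - (1 / 2) * (\<Sum>b<n. g b * h b)" "(\<Sum>k<n. g k * - h k) = - (\<Sum>k<n. g k * h k)" for g h :: "nat \<Rightarrow> 'k"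
   by (simp_all add: sum_distrib_left sum_negf algebra_simps)
  show "(\<Sum>b<n. pt b a * (- (1 / 2) * f c d b)) + (- (\<Sum>k<n. pt c k * - f k d a) + - (\<Sum>k<n. \<pi> a k * (- (1 / 2) * K k c d))) =
    (\<Sum>b<n. pt b a * (- (1 / 2) * f d c b)) + (- (\<Sum>k<n. pt d k * - f k c a) + - (\<Sum>k<n. \<pi> a k * (- (1 / 2) * K k d c)))"
   unfolding h m e' by (simp add: field_simps)
 qed
 finally show ?thesis by simp
qed

end

section \<open>The bivector of the pair of tensors\<close>

lemma below_single: "below V x (Poly_Mapping.single y (Suc 0)) = (if y < x then zdeg V y else 0)"
 by (simp add: below_def)

lemma chi_avar: "chi V (Poly_Mapping.single x (Suc 0)) m = zdeg V x * below V x m"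
 using chi_single_left[of V x m] by simp

lemma amul_avar_single:
 assumes "x < ngen V" "y < ngen V" "x < y \<or> even (zdeg V x) \<and> even (zdeg V y)"
 shows "amul V (avar x) (avar y) = (Poly_Mapping.single (Poly_Mapping.single x (Suc 0) + Poly_Mapping.single y (Suc 0)) 1 :: 'k::field fga)"
proof -
 have "even (chi V (Poly_Mapping.single x (Suc 0)) (Poly_Mapping.single y (Suc 0)))"
  using assms(3) by (auto simp: chi_avar below_single)
 moreover have "mon_ok V (Poly_Mapping.single x (Suc 0) + Poly_Mapping.single y (Suc 0))"
  using assms by (auto simp: mon_ok_def keys_plus_nat lookup_add lookup_single when_def split: if_splits)
 ultimately show ?thesis
  unfolding avar_def One_nat_def amul_single mmul_def by (simp add: sg_even)
qed

context CE_data
begin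

abbreviation V where "V \<equiv> Pol_gvars A"
abbreviation p where "p a \<equiv> avar (Suc n + a)"
abbreviation P where "P \<equiv> pi2 n \<pi> pt"

lemma V_simps: "ngen V = 2 * Suc n" "a < n \<Longrightarrow> zdeg V a = 1" "zdeg V n = 2"
 "a < n \<Longrightarrow> zdeg V (Suc n + a) = 2" "zdeg V (Suc n + n) = 1"
 by (simp_all add: Pol_gvars_def A_simps)

lemma P_eq: "P = (\<Sum>a<n. \<Sum>b<n. fsm (1 / 2 * \<pi> a b) (amul V (p a) (p b))) +
  (\<Sum>a<n. \<Sum>b<n. fsm (pt b a) (amul V (amul V (avar b) (p a)) (p n)))"
proof -
 have "Pol_gvars (CE_gvars n) = V" "ngen (CE_gvars n) = Suc n"
  by (auto simp: Pol_gvars_def A_simps CE_gvars_def fun_eq_iff)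
 then show ?thesis by (simp add: pi2_def Let_def s3par_def)
qed

text \<open>In each product the generators are already sorted or have even degree: theta precedes
  the shifted derivations, and among these only the one for nu, the last, is odd. Hence the
  monomials carry no signs.\<close>

lemma P_single: "P = (\<Sum>a<n. \<Sum>b<n. Poly_Mapping.single (0 + exp2 (Suc n) a b) (1 / 2 * \<pi> a b)) +
  (\<Sum>a<n. \<Sum>b<n. Poly_Mapping.single (Poly_Mapping.single b (Suc 0) + exp2 (Suc n) a n) (pt b a))"
proof -
 have 1: "amul V (p a) (p b) = Poly_Mapping.single (exp2 (Suc n) a b) (1::'k)" if "a < n" "b < n" for a b
  using that by (subst amul_avar_single) (auto simp: V_simps simp del: add_Suc)
 have 2: "amul V (amul V (avar b) (p a)) (p n) = Poly_Mapping.single (Poly_Mapping.single b (Suc 0) + exp2 (Suc n) a n) (1::'k)"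
  if "a < n" "b < n" for a b
 proof -
  have "amul V (avar b) (p a) = Poly_Mapping.single (Poly_Mapping.single b (Suc 0) + Poly_Mapping.single (Suc n + a) (Suc 0)) (1::'k)"
   using that by (subst amul_avar_single) (auto simp: V_simps simp del: add_Suc)
  moreover have "chi V (Poly_Mapping.single b (Suc 0) + Poly_Mapping.single (Suc n + a) (Suc 0)) (Poly_Mapping.single (Suc n + n) (Suc 0)) = 0"
   using that by (simp add: chi_add_left chi_avar below_single)
  moreover have "mon_ok V (Poly_Mapping.single b (Suc 0) + Poly_Mapping.single (Suc n + a) (Suc 0) + Poly_Mapping.single (Suc n + n) (Suc 0))"
   using that by (auto simp: mon_ok_def keys_plus_nat lookup_add lookup_single when_def V_simps)
  ultimately show ?thesis
   by (simp only: avar_def[of "Suc n + n"] One_nat_def amul_single mmul_def) (simp add: add.assoc)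
 qed
 show ?thesis
  unfolding P_eq by (simp add: 1 2 del: add_Suc)
qed

lemma P_hom: "P \<in> ahom V 4"
 unfolding P_eq
proof (intro ahom_add ahom_sum ahom_fsm)
 fix a b assume "a \<in> {..<n}" "b \<in> {..<n}"
 then have ab: "a < n" "b < n" by auto
 have p: "p a \<in> ahom V 2" if "a < n" for a by (rule ahom_avar) (use that in \<open>simp_all add: V_simps del: add_Suc\<close>)
 have q: "p n \<in> ahom V 1" "avar b \<in> ahom V 1" by (rule ahom_avar; use ab in \<open>simp add: V_simps del: add_Suc\<close>)+
 show "amul V (p a) (p b) \<in> ahom V 4" by (rule ahom_amul[OF p[OF ab(1)] p[OF ab(2)]]) simp
 show "amul V (amul V (avar b) (p a)) (p n) \<in> ahom V 4" by (rule ahom_amul[OF ahom_amul[OF q(2) p[OF ab(1)] refl] q(1)]) simp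
qed

lemma P_weight: "m \<in> Poly_Mapping.keys P \<Longrightarrow> 2 \<le> Pol_weight A m"
proof -
 assume "m \<in> Poly_Mapping.keys P"
 then have "m \<in> (\<Union>a<n. \<Union>b<n. {0 + exp2 (Suc n) a b}) \<union> (\<Union>a<n. \<Union>b<n. {Poly_Mapping.single b (Suc 0) + exp2 (Suc n) a n})"
  unfolding P_single by (auto dest!: subsetD[OF keys_add] subsetD[OF keys_sum] split: if_splits)
 then obtain w a b where m: "m = w + exp2 (Suc n) a b" by blast
 have w: "Pol_weight A m = (\<Sum>i\<in>S - {..<ngen A}. Poly_Mapping.lookup m i)" if "finite S" "Poly_Mapping.keys m \<subseteq> S" for S
  unfolding Pol_weight_def using that by (intro sum.mono_neutral_left) (auto simp: in_keys_iff)
 let ?S = "Poly_Mapping.keys w \<union> {Suc n + a, Suc n + b}"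
 have "2 = (\<Sum>i\<in>?S - {..<ngen A}. Poly_Mapping.lookup (exp2 (Suc n) a b) i)"
  by (simp add: lookup_add lookup_single when_def sum.distrib sum.delta A_simps)
 also have "\<dots> \<le> (\<Sum>i\<in>?S - {..<ngen A}. Poly_Mapping.lookup m i)"
  by (intro sum_mono) (simp add: m lookup_add)
 also have "\<dots> = Pol_weight A m"
  by (rule w[symmetric]) (auto simp: m keys_plus_nat)
 finally show ?thesis .
qed

lemma fsm_one: "fsm c 1 = (Poly_Mapping.single 0 c :: 'k fga)"
 by (metis fsm_single mult.right_neutral single_one)

text \<open>Off the diagonal \<pi>_ij / 2 and \<pi>_ji / 2 meet in the same monomial and add up; on
  the diagonal one half remains.\<close>

lemma wt2_P:
 assumes "i \<le> j" "j \<le> n"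
 shows "wt2_coeff A P i j = (if j < n then fsm (if i = j then 1 / 2 * \<pi> i i else \<pi> i j) 1 else if i < n then lam i else 0)"
proof -
 have e: "wt2_coeff A P i j = (\<Sum>a<n. \<Sum>b<n. if (a = i \<and> b = j) \<or> (a = j \<and> b = i) then fsm (1 / 2 * \<pi> a b) 1 else 0) +
  (\<Sum>a<n. \<Sum>b<n. if (a = i \<and> n = j) \<or> (a = j \<and> n = i) then fsm (pt b a) (avar b) else 0)"
  unfolding P_single wt2_add wt2_sum
 proof (intro arg_cong2[where f = "(+)"] sum.cong refl)
  fix a b assume ab: "a \<in> {..<n}" "b \<in> {..<n}"
  show "wt2_coeff A (Poly_Mapping.single (0 + exp2 (Suc n) a b) (1 / 2 * \<pi> a b)) i j =
    (if (a = i \<and> b = j) \<or> (a = j \<and> b = i) then fsm (1 / 2 * \<pi> a b) 1 else 0)"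
   by (subst wt2_single) (auto simp: A_simps keys_plus_nat two_singles fsm_one simp del: add_Suc)
  show "wt2_coeff A (Poly_Mapping.single (Poly_Mapping.single b (Suc 0) + exp2 (Suc n) a n) (pt b a)) i j =
    (if (a = i \<and> n = j) \<or> (a = j \<and> n = i) then fsm (pt b a) (avar b) else 0)"
   using ab by (subst wt2_single) (auto simp: A_simps keys_plus_nat two_singles avar_def simp del: add_Suc)
 qed
 have d: "(\<Sum>a<n. \<Sum>b<n. if a = i \<and> b = j then F a b else 0) = (if i < n \<and> j < n then F i j else (0::'k fga))" for F and i j
 proof -
  have "(\<Sum>a<n. \<Sum>b<n. if a = i \<and> b = j then F a b else 0) = (\<Sum>a<n. if a = i then (\<Sum>b<n. if b = j then F a b else 0) else 0)"
  proof (intro sum.cong refl)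
   fix a
   show "(\<Sum>b<n. if a = i \<and> b = j then F a b else 0) = (if a = i then (\<Sum>b<n. if b = j then F a b else 0) else 0)"
    by (cases "a = i") simp_all
  qed
  also have "\<dots> = (if i < n \<and> j < n then F i j else 0)" by (simp add: sum.delta)
  finally show ?thesis .
 qed
 have 1: "(\<Sum>a<n. \<Sum>b<n. if (a = i \<and> b = j) \<or> (a = j \<and> b = i) then fsm (1 / 2 * \<pi> a b) 1 else 0) =
   (if j < n then fsm (if i = j then 1 / 2 * \<pi> i i else \<pi> i j) 1 else (0::'k fga))"
 proof (cases "i = j")
  case True then show ?thesis by (simp add: d)
 next
  case False
  then have "(\<Sum>a<n. \<Sum>b<n. if (a = i \<and> b = j) \<or> (a = j \<and> b = i) then fsm (1 / 2 * \<pi> a b) 1 else (0::'k fga)) =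
   (\<Sum>a<n. \<Sum>b<n. (if a = i \<and> b = j then fsm (1 / 2 * \<pi> a b) 1 else 0) + (if a = j \<and> b = i then fsm (1 / 2 * \<pi> a b) 1 else 0))"
   by (intro sum.cong refl) auto
  also have "\<dots> = (if j < n then fsm (1 / 2 * \<pi> i j) 1 + fsm (1 / 2 * \<pi> j i) 1 else 0)"
   unfolding sum.distrib d using assms by auto
  also have "\<dots> = (if j < n then fsm (\<pi> i j) 1 else 0)"
   using pi_sym[of i j] assms by (auto simp: fsm_add_left[symmetric])
  finally show ?thesis using False by simp
 qed
 have 2: "(\<Sum>a<n. \<Sum>b<n. if (a = i \<and> n = j) \<or> (a = j \<and> n = i) then fsm (pt b a) (avar b) else 0) =
   (if j = n \<and> i < n then lam i else 0)"
 proof -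
  have "(\<Sum>a<n. \<Sum>b<n. if (a = i \<and> n = j) \<or> (a = j \<and> n = i) then fsm (pt b a) (avar b) else 0) =
   (\<Sum>a<n. if a = i then if n = j then lam a else 0 else 0)"
  proof (intro sum.cong refl)
   fix a assume "a \<in> {..<n}"
   then have "\<not> (a = j \<and> n = i)" using assms by auto
   then have e: "(if (a = i \<and> n = j) \<or> (a = j \<and> n = i) then y else 0) = (if a = i then if n = j then y else 0 else 0)" for y :: "'k fga"
    by auto
   show "(\<Sum>b<n. if (a = i \<and> n = j) \<or> (a = j \<and> n = i) then fsm (pt b a) (avar b) else 0) =
     (if a = i then if n = j then lam a else 0 else 0)"
    unfolding e sum_if_const lam_def ..
  qed
  also have "\<dots> = (if j = n \<and> i < n then lam i else 0)" by (auto simp: sum.delta)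
  finally show ?thesis .
 qed
 show ?thesis unfolding e 1 2 using assms by auto
qed

text \<open>The double counting of the diagonal in the pairing cancels the remaining factor 1/2. The
  minus sign in the mixed entries comes from the odd sum 1 + 2 of the degrees of theta and
  nu.\<close>

lemma Pi_eq:
 assumes "i \<le> n" "j \<le> n"
 shows "Pi_of A P i j = (if i < n then if j < n then fsm (\<pi> i j) 1 else - lam i else if j < n then - lam j else 0)"
proof -
 have l: "i < ngen A" "j < ngen A" using assms by (simp_all add: A_simps)
 consider "i < j" | "j < i" | "i = j" by linarith
 then show ?thesis
 proof cases
  case 1
  then show ?thesis
   unfolding Pi_of_def wt2_pairing_eq[OF ahom_acar[OF P_hom] l] using assms
   by (auto simp: wt2_P A_simps sg_odd sg_even fsm_uminus_left)
 next
  case 2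
  then show ?thesis
   unfolding Pi_of_def wt2_pairing_eq[OF ahom_acar[OF P_hom] l] using assms pi_sym[of i j]
   by (auto simp: wt2_P A_simps sg_odd sg_even fsm_uminus_left)
 next
  case 3
  then show ?thesis
   unfolding Pi_of_def wt2_pairing_eq[OF ahom_acar[OF P_hom] l] using assms
   by (auto simp: wt2_P A_simps sg_odd sg_even fsm_uminus_left fsm_add_left[symmetric])
 qed
qed

lemma CE_transformation: "poisson_transformation A P"
proof
 fix i j assume ij: "i < ngen A" "j < ngen A"
 then have ij': "i \<le> n" "j \<le> n" by (auto simp: A_simps)
 have l0: "fsm c 1 \<in> ahom A 0" for c by (rule ahom_fsm) simp
 show "Pi_of A P i j \<in> ahom A (ed A i + ed A j)"
  unfolding Pi_eq[OF ij'] using lam_hom l0 by (auto simp: A_simps intro: ahom_uminus)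
 show "Pi_of A P j i = fsm (sg (ed A i * ed A j)) (Pi_of A P i j)"
  unfolding Pi_eq[OF ij'] Pi_eq[OF ij'(2,1)] using pi_sym[of i j] by (auto simp: A_simps)
 have one: "amul A (fsm c 1) (cc A k l) = fsm c (cc A k l)" if "k \<le> n" "l \<le> n" for c k l
  using that by (simp add: amul_fsm_left amul_1_left cc_def acar_apar acar_der[OF dA])
 have d1: "adiff A (fsm c 1) = 0" for c using der_fsm[OF dA acar_1, of c] der_1[OF dA] by simp
 have dm: "adiff A (- lam a) = - adiff A (lam a)" for a by (rule der_uminus[OF dA ahom_acar[OF lam_hom]])
 \<comment> \<open>The differential never produces nu, so this row of the Jacobian vanishes and only
   k < n contributes.\<close>
 have n0: "cc A n l = 0" if "l \<le> n" for l using that cc_th[of n l] cc_nu(2) by (cases "l = n") auto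
 have S: "(\<Sum>k<ngen A. F k) = (\<Sum>k<n. F k) + F n" for F :: "nat \<Rightarrow> 'k fga" by (simp add: A_simps)
 have Pk: "Pi_of A P k l = (if l < n then fsm (\<pi> k l) 1 else - lam k)" "Pi_of A P l k = (if l < n then fsm (\<pi> l k) 1 else - lam k)"
  if "k < n" "l \<le> n" for k l using that by (simp_all add: Pi_eq)
 show "adiff A (Pi_of A P i j) + (\<Sum>k<ngen A. fsm (sg (ed A j)) (amul A (Pi_of A P k j) (cc A k i)) +
     fsm (sg (ed A i * (1 + ed A j + ed A k))) (amul A (Pi_of A P i k) (cc A k j))) = 0"
 \<comment> \<open>Two theta indices give the invariance of \<pi>. One theta and one nu give the
   compatibility condition in the form \<open>lam_closed\<close>. For two nu indices the two
   Jacobian sums have opposite signs and cancel.\<close>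
 proof (cases "i < n"; cases "j < n")
  assume ij: "i < n" "j < n"
  have "(\<Sum>k<n. fsm (sg (ed A j)) (amul A (Pi_of A P k j) (cc A k i)) +
     fsm (sg (ed A i * (1 + ed A j + ed A k))) (amul A (Pi_of A P i k) (cc A k j))) =
   (\<Sum>k<n. fsm (\<pi> k j) (cc A k i) + fsm (\<pi> i k) (cc A k j))"
   using ij by (intro sum.cong refl) (simp add: Pi_eq one A_simps)
  then show ?thesis
   using pi_cc[OF ij] ij unfolding S by (simp add: Pi_eq d1 n0 sum.distrib)
 next
  assume ij: "i < n" "\<not> j < n"
  then have j: "j = n" using ij' by simp
  have "(\<Sum>k<n. fsm (sg (ed A j)) (amul A (Pi_of A P k j) (cc A k i)) +
     fsm (sg (ed A i * (1 + ed A j + ed A k))) (amul A (Pi_of A P i k) (cc A k j))) =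
   (\<Sum>k<n. amul A (lam k) (cc A k i) + fsm (\<pi> i k) (cc A k n))"
   using ij j by (intro sum.cong refl) (simp add: Pi_eq one A_simps sg_odd fsm_uminus_left amul_uminus_left)
  then show ?thesis
   using lam_closed[OF ij(1)] ij unfolding S by (simp add: j Pi_eq dm n0 sum.distrib)
 next
  assume ij: "\<not> i < n" "j < n"
  then have i: "i = n" using ij' by simp
  have "(\<Sum>k<n. fsm (sg (ed A j)) (amul A (Pi_of A P k j) (cc A k i)) +
     fsm (sg (ed A i * (1 + ed A j + ed A k))) (amul A (Pi_of A P i k) (cc A k j))) =
   (\<Sum>k<n. fsm (\<pi> j k) (cc A k n) + amul A (lam k) (cc A k j))"
   using ij i pi_sym by (intro sum.cong refl) (simp add: Pi_eq one A_simps sg_odd fsm_uminus_left amul_uminus_left)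
  then show ?thesis
   using lam_closed[OF ij(2)] ij unfolding S by (simp add: i Pi_eq dm n0 sum.distrib)
 next
  assume ij: "\<not> i < n" "\<not> j < n"
  then have "i = n" "j = n" using ij' by simp_all
  then show ?thesis
   unfolding S by (simp add: Pi_eq n0 A_simps sg_odd sg_even fsm_uminus_left amul_uminus_left der_0[OF dA])
 qed
qed (rule dA)

end

section \<open>An explicit bracket of polyvector fields and its uniqueness\<close>

definition partner :: "'z gvars_scheme \<Rightarrow> nat \<Rightarrow> nat" where
 "partner A k = (if k < ngen A then ngen A + k else k - ngen A)"

text \<open>The canonical bracket of a shifted cotangent bundle: z_k is conjugate to s^3 d/dz_k, and
  conjugate degrees add up to 3. It serves as a witness for the conditions that define
  \<open>Pol_bracket\<close>.\<close>

definition bb :: "'k::field cdga \<Rightarrow> 'k fga \<Rightarrow> 'k fga \<Rightarrow> 'k fga" where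
 "bb A P Q = (\<Sum>k<2 * ngen A. amul (Pol_gvars A)
   (apar (Pol_gvars A) (partner A k) (ksgn (Pol_gvars A) (zdeg (Pol_gvars A) k) P)) (apar (Pol_gvars A) k Q))"

context
 fixes A :: "'k::field cdga"
begin

private abbreviation "V \<equiv> Pol_gvars A"
private abbreviation "N \<equiv> ngen A"

lemma Pol_simps: "ngen V = 2 * N" "k < N \<Longrightarrow> zdeg V k = zdeg A k" "zdeg V (N + k) = 3 - zdeg A k"
 by (simp_all add: Pol_gvars_def)

lemma partner: "k < 2 * N \<Longrightarrow> zdeg V (partner A k) = 3 - zdeg V k" "k < 2 * N \<Longrightarrow> partner A k < 2 * N"
 "k < 2 * N \<Longrightarrow> partner A (partner A k) = k"
 by (auto simp: partner_def Pol_gvars_def)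

lemma Pol_mon: "mon_ok A m \<Longrightarrow> mon_ok V m \<and> mdeg V m = mdeg A m"
proof -
 assume m: "mon_ok A m"
 have z: "Poly_Mapping.lookup m k = 0" if "\<not> k < N" for k
  using m that by (auto simp: mon_ok_def subset_iff in_keys_iff)
 have "mon_ok V m"
  unfolding mon_ok_def
 proof (intro conjI allI impI)
  show "Poly_Mapping.keys m \<subseteq> {..<ngen V}" using m by (auto simp: mon_ok_def Pol_simps)
  fix i assume "odd (zdeg V i)"
  then show "Poly_Mapping.lookup m i \<le> 1"
   using m z[of i] by (cases "i < N") (auto simp: mon_ok_def Pol_simps)
 qed
 moreover have "mdeg V m = mdeg A m"
  unfolding mdeg_def using m by (intro sum.cong refl) (auto simp: mon_ok_def Pol_simps)
 ultimately show ?thesis ..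
qed

lemma Pol_acar: "a \<in> acar A \<Longrightarrow> a \<in> acar V" and Pol_ahom: "a \<in> ahom A k \<Longrightarrow> a \<in> ahom V k"
 using Pol_mon by (auto simp: acar_def ahom_def)

lemma Pol_ksgn: "a \<in> acar A \<Longrightarrow> ksgn V k a = ksgn A k a"
 unfolding ksgn_def by (intro sum.cong refl) (use Pol_mon in \<open>auto simp: acar_def\<close>)

lemma Pol_apar: "a \<in> acar A \<Longrightarrow> i < N \<Longrightarrow> apar V i a = apar A i a"
 unfolding apar_def
 by (intro sum.cong refl arg_cong2[where f = Poly_Mapping.single] arg_cong2[where f = "(*)"] arg_cong[where f = sg])
  (auto simp: Pol_simps)

lemma Pol_apar_0: "a \<in> acar A \<Longrightarrow> apar V (N + i) a = 0"
 unfolding apar_def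
proof (intro sum.neutral ballI)
 fix m assume "a \<in> acar A" "m \<in> Poly_Mapping.keys a"
 then have "Poly_Mapping.keys m \<subseteq> {..<N}" by (auto simp: acar_def mon_ok_def)
 then have "Poly_Mapping.lookup m (N + i) = 0" by (auto simp: in_keys_iff subset_iff)
 then show "Poly_Mapping.single (m - Poly_Mapping.single (N + i) 1) (of_nat (Poly_Mapping.lookup m (N + i)) *
   sg (zdeg V (N + i) * (\<Sum>j\<in>Poly_Mapping.keys m \<inter> {..<N + i}. int (Poly_Mapping.lookup m j) * zdeg V j)) * Poly_Mapping.lookup a m) = 0"
  by simp
qed

lemma Pol_amul: "a \<in> acar A \<Longrightarrow> b \<in> acar A \<Longrightarrow> amul V a b = amul A a b"
 unfolding amul_def
proof (intro sum.cong refl)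
 fix m m' assume "a \<in> acar A" "b \<in> acar A" "m \<in> Poly_Mapping.keys a" "m' \<in> Poly_Mapping.keys b"
 then have m: "mon_ok A m" "mon_ok A m'" by (auto simp: acar_def)
 then have k: "Poly_Mapping.keys m \<subseteq> {..<N}" "Poly_Mapping.keys m' \<subseteq> {..<N}" by (auto simp: mon_ok_def)
 have z: "Poly_Mapping.lookup m j = 0 \<and> Poly_Mapping.lookup m' j = 0" if "\<not> j < N" for j
  using k that by (auto simp: subset_iff in_keys_iff)
 have "mon_ok V (m + m') \<longleftrightarrow> mon_ok A (m + m')"
 proof
  assume V: "mon_ok V (m + m')"
  show "mon_ok A (m + m')"
   unfolding mon_ok_def
  proof (intro conjI allI impI)
   show "Poly_Mapping.keys (m + m') \<subseteq> {..<N}" using k by (auto simp: keys_plus_nat)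
   fix i assume o: "odd (zdeg A i)"
   show "Poly_Mapping.lookup (m + m') i \<le> 1"
   proof (cases "i < N")
    case True
    then show ?thesis using V o by (simp add: mon_ok_def Pol_simps)
   qed (simp add: lookup_add z)
  qed
 qed (use Pol_mon in blast)
 moreover have "(\<Sum>i\<in>Poly_Mapping.keys m. \<Sum>j\<in>Poly_Mapping.keys m' \<inter> {..<i}. int (Poly_Mapping.lookup m i) * zdeg V i * (int (Poly_Mapping.lookup m' j) * zdeg V j)) =
   (\<Sum>i\<in>Poly_Mapping.keys m. \<Sum>j\<in>Poly_Mapping.keys m' \<inter> {..<i}. int (Poly_Mapping.lookup m i) * zdeg A i * (int (Poly_Mapping.lookup m' j) * zdeg A j))"
  using k by (intro sum.cong refl) (auto simp: Pol_simps subset_iff)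
 ultimately show "(if mon_ok V (m + m') then Poly_Mapping.single (m + m') (sg (\<Sum>i\<in>Poly_Mapping.keys m. \<Sum>j\<in>Poly_Mapping.keys m' \<inter> {..<i}.
    int (Poly_Mapping.lookup m i) * zdeg V i * (int (Poly_Mapping.lookup m' j) * zdeg V j)) * Poly_Mapping.lookup a m * Poly_Mapping.lookup b m') else 0) =
   (if mon_ok A (m + m') then Poly_Mapping.single (m + m') (sg (\<Sum>i\<in>Poly_Mapping.keys m. \<Sum>j\<in>Poly_Mapping.keys m' \<inter> {..<i}.
    int (Poly_Mapping.lookup m i) * zdeg A i * (int (Poly_Mapping.lookup m' j) * zdeg A j)) * Poly_Mapping.lookup a m * Poly_Mapping.lookup b m') else 0)"
  by simp
qed

lemma s3par_hom: "i < N \<Longrightarrow> (s3par A i :: 'k fga) \<in> ahom V (3 - zdeg A i)"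
 unfolding s3par_def by (rule ahom_avar) (simp_all add: Pol_simps)

lemma apar_s3par: "apar V l (s3par A i :: 'k fga) = (if l = N + i then 1 else 0)"
 by (simp add: s3par_def apar_avar)

lemma s3_coeff:
 assumes D: "(D :: 'k fga \<Rightarrow> 'k fga) \<in> der A p" and i: "i < N"
 shows "D (avar i) \<in> ahom A (zdeg A i + p)" "ksgn A 1 (D (avar i)) = fsm (sg (zdeg A i + p)) (D (avar i))"
proof -
 show h: "D (avar i) \<in> ahom A (zdeg A i + p)" by (rule der_ahom[OF D ahom_avar[OF i refl] refl])
 show "ksgn A 1 (D (avar i)) = fsm (sg (zdeg A i + p)) (D (avar i))" by (simp add: ksgn_ahom[OF h])
qed

lemma s3_eq: "(D :: 'k fga \<Rightarrow> 'k fga) \<in> der A p \<Longrightarrow> s3 A D = (\<Sum>i<N. fsm (sg (zdeg A i + p)) (amul V (D (avar i)) (s3par A i)))"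
 unfolding s3_def by (intro sum.cong refl) (simp add: s3_coeff(2) amul_fsm_left)

lemma s3_hom: "(D :: 'k fga \<Rightarrow> 'k fga) \<in> der A p \<Longrightarrow> s3 A D \<in> ahom V (p + 3)"
 by (subst s3_eq, assumption) (auto intro!: ahom_sum ahom_fsm ahom_amul[OF Pol_ahom[OF s3_coeff(1)] s3par_hom])

text \<open>The Hamiltonian derivation of P. It agrees with \<open>bb\<close> on the carrier and is
  an \<open>ader\<close>, which gives the Leibniz rule in the second argument of the
  bracket.\<close>

definition bd :: "'k fga \<Rightarrow> 'k fga \<Rightarrow> 'k fga" where
 "bd P = ader V (\<lambda>k. apar V (partner A k) (ksgn V (zdeg V k) P))"

lemma bd_der: "P \<in> ahom V p \<Longrightarrow> bd P \<in> der V (p - 3)"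
 unfolding bd_def by (rule ader_der) (auto simp: Pol_simps(1) partner(1) intro!: ahom_apar)

lemma bb_bd: "Q \<in> acar V \<Longrightarrow> bb A P Q = bd P Q"
 unfolding bb_def bd_def by (simp add: ader_apply Pol_simps)

lemma bd_avar: "P \<in> acar V \<Longrightarrow> k < 2 * N \<Longrightarrow> bd P (avar k) = apar V (partner A k) (ksgn V (zdeg V k) P)"
 unfolding bd_def by (rule ader_avar) (auto simp: Pol_simps acar_apar)

lemma apar_s3:
 assumes D: "(D :: 'k fga \<Rightarrow> 'k fga) \<in> der A p" and k: "k < N"
 shows "apar V (N + k) (s3 A D) = fsm (sg (zdeg A k + p) * sg ((3 - zdeg A k) * (zdeg A k + p))) (D (avar k))"
  and "apar V k (s3 A D) = (\<Sum>i<N. fsm (sg (zdeg A i + p)) (amul V (apar A k (D (avar i))) (s3par A i)))"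
proof -
 have m: "apar V l (amul V (D (avar i)) (s3par A i)) = amul V (apar V l (D (avar i))) (s3par A i) +
   fsm (sg (zdeg V l * (zdeg A i + p))) (amul V (D (avar i)) (apar V l (s3par A i)))" if "i < N" for i l
  by (rule apar_amul[OF Pol_ahom[OF s3_coeff(1)[OF D that]] ahom_acar[OF s3par_hom[OF that]]])
 have c: "D (avar i) \<in> acar A" for i by (rule acar_der[OF D])
 have "apar V (N + k) (s3 A D) = (\<Sum>i<N. if k = i then fsm (sg (zdeg A i + p) * sg ((3 - zdeg A k) * (zdeg A i + p))) (D (avar i)) else 0)"
  unfolding s3_eq[OF D] apar_sum apar_fsm
  by (intro sum.cong refl) (auto simp: m Pol_apar_0[OF c] Pol_simps apar_s3par amul_1_right Pol_acar[OF c])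
 then show "apar V (N + k) (s3 A D) = fsm (sg (zdeg A k + p) * sg ((3 - zdeg A k) * (zdeg A k + p))) (D (avar k))"
  using k by (simp add: sum.delta')
 show "apar V k (s3 A D) = (\<Sum>i<N. fsm (sg (zdeg A i + p)) (amul V (apar A k (D (avar i))) (s3par A i)))"
  unfolding s3_eq[OF D] apar_sum apar_fsm using k
  by (intro sum.cong refl) (simp add: m Pol_apar[OF c] apar_s3par)
qed

text \<open>On elements of A only the derivatives along the z_k act, and their coefficients are the
  derivatives of s^3 D along s^3 d/dz_k. The signs of the shift, of the parity involution and of
  this derivative cancel, leaving D(z_k).\<close>

lemma bb_s3:
 assumes D: "(D :: 'k fga \<Rightarrow> 'k fga) \<in> der A p" and a: "a \<in> acar A"
 shows "bd (s3 A D) a = D a"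
proof -
 have v: "apar V (N + k) (ksgn V (zdeg A k) (s3 A D)) = D (avar k)" if k: "k < N" for k
 proof -
  have "sg (zdeg A k * (p + 3)) * (sg (zdeg A k + p) * sg ((3 - zdeg A k) * (zdeg A k + p))) = (1::'k)"
   unfolding sg_add[symmetric] by (rule sg_even) auto
  then show ?thesis by (simp add: ksgn_ahom[OF s3_hom[OF D]] apar_fsm apar_s3(1)[OF D k])
 qed
 have "bd (s3 A D) a = (\<Sum>k<N + N. amul V (apar V (partner A k) (ksgn V (zdeg V k) (s3 A D))) (apar V k a))"
  unfolding bd_def by (simp add: ader_apply[OF Pol_acar[OF a]] Pol_simps mult_2)
 also have "\<dots> = (\<Sum>k<N. amul V (apar V (N + k) (ksgn V (zdeg A k) (s3 A D))) (apar A k a))"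
  unfolding sum.nat_group[symmetric] using Pol_apar_0[OF a]
  by (intro sum.mono_neutral_cong_right) (auto simp: partner_def Pol_simps Pol_apar[OF a] not_less dest!: le_Suc_ex)
 also have "\<dots> = (\<Sum>k<N. amul A (D (avar k)) (apar A k a))"
  by (intro sum.cong refl) (simp add: v Pol_amul acar_der[OF D] acar_apar a)
 also have "\<dots> = D a" by (rule der_apply[OF D a, symmetric])
 finally show ?thesis .
qed

text \<open>Applied to s^3 D' the Hamiltonian derivation acts on the coefficients, which gives D D',
  and on the generators, which gives the term with D' D. Together they form the commutator.\<close>

lemma bb_s3_s3:
 assumes D: "(D :: 'k fga \<Rightarrow> 'k fga) \<in> der A p" and D': "(D' :: 'k fga \<Rightarrow> 'k fga) \<in> der A q"
 shows "bd (s3 A D) (s3 A D') = fsm (sg p) (s3 A (dcomm p q D D'))"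
proof -
 note c = acar_der[OF D] and c' = acar_der[OF D']
 have E: "bd (s3 A D) \<in> der V p" using bd_der[OF s3_hom[OF D]] by simp
 let ?z = "zdeg A" and ?p = "s3par A :: nat \<Rightarrow> 'k fga"
 have Ep: "bd (s3 A D) (?p j) = fsm (sg ((3 - ?z j) * (p + 3))) (\<Sum>i<N. fsm (sg (?z i + p)) (amul V (apar A j (D (avar i))) (?p i)))"
  if j: "j < N" for j
  unfolding s3par_def using j
  by (subst bd_avar) (auto simp: ahom_acar[OF s3_hom[OF D]] partner_def Pol_simps ksgn_ahom[OF s3_hom[OF D]] apar_fsm apar_s3(2)[OF D j] s3par_def)
 have "bd (s3 A D) (s3 A D') = (\<Sum>j<N. fsm (sg (?z j + q)) (bd (s3 A D) (amul V (D' (avar j)) (?p j))))"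
  unfolding s3_eq[OF D'] by (subst der_sum[OF E]) (auto simp: der_fsm[OF E] acar_fsm)
 also have "\<dots> = (\<Sum>j<N. fsm (sg (?z j + q)) (amul V (D (D' (avar j))) (?p j)) +
   (\<Sum>i<N. fsm (- sg (?z i + p * q + p + q + p)) (amul V (amul A (D' (avar j)) (apar A j (D (avar i)))) (?p i))))"
 proof (intro sum.cong refl)
  fix j assume "j \<in> {..<N}"
  then have j: "j < N" by simp
  have s: "sg (?z j + q) * sg (p * (?z j + q)) * sg ((3 - ?z j) * (p + 3)) * sg (?z i + p) = (- sg (?z i + p * q + p + q + p) :: 'k)" for i
  proof -
   have "sg (?z j + q + p * (?z j + q) + (3 - ?z j) * (p + 3) + (?z i + p)) = (sg (?z i + p * q + p + q + p + 1) :: 'k)"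
    by (rule sg_eqI) auto
   then show ?thesis by (simp add: sg_add sg_odd)
  qed
  have "bd (s3 A D) (amul V (D' (avar j)) (?p j)) = amul V (D (D' (avar j))) (?p j) +
    fsm (sg (p * (?z j + q))) (amul V (D' (avar j)) (bd (s3 A D) (?p j)))"
   using der_amul[OF E Pol_ahom[OF s3_coeff(1)[OF D' j]] ahom_acar[OF s3par_hom[OF j]]] by (simp add: bb_s3[OF D c'])
  also have "fsm (sg (?z j + q)) \<dots> = fsm (sg (?z j + q)) (amul V (D (D' (avar j))) (?p j)) +
   (\<Sum>i<N. fsm (sg (?z j + q) * sg (p * (?z j + q)) * sg ((3 - ?z j) * (p + 3)) * sg (?z i + p))
    (amul V (D' (avar j)) (amul V (apar A j (D (avar i))) (?p i))))"
   unfolding Ep[OF j] by (simp add: fsm_add amul_fsm_right amul_sum_right fsm_sum mult.assoc)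
  finally show "fsm (sg (?z j + q)) (bd (s3 A D) (amul V (D' (avar j)) (?p j))) = fsm (sg (?z j + q)) (amul V (D (D' (avar j))) (?p j)) +
   (\<Sum>i<N. fsm (- sg (?z i + p * q + p + q + p)) (amul V (amul A (D' (avar j)) (apar A j (D (avar i)))) (?p i)))"
   unfolding s by (simp add: amul_assoc[symmetric] Pol_amul c' acar_apar c)
 qed
 \<comment> \<open>Exchanging the two sums collects, at each generator i, the expansion of D'
   applied to D(z_i).\<close>
 also have "\<dots> = (\<Sum>i<N. fsm (sg (?z i + q)) (amul V (D (D' (avar i))) (?p i))) +
   (\<Sum>i<N. fsm (- sg (?z i + p * q + p + q + p)) (amul V (\<Sum>j<N. amul A (D' (avar j)) (apar A j (D (avar i)))) (?p i)))"
  unfolding sum.distrib amul_sum_left fsm_sum by (subst (2) sum.swap) (rule refl)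
 also have "\<dots> = (\<Sum>i<N. fsm (sg (?z i + q)) (amul V (D (D' (avar i))) (?p i))) +
   (\<Sum>i<N. fsm (- sg (?z i + p * q + p + q + p)) (amul V (D' (D (avar i))) (?p i)))"
  by (simp only: der_apply[OF D' c, symmetric])
 also have "\<dots> = fsm (sg p) (s3 A (dcomm p q D D'))"
  unfolding s3_def fsm_sum sum.distrib[symmetric]
 proof (intro sum.cong refl)
  fix i assume "i \<in> {..<N}"
  then have i: "i < N" by simp
  have h: "D (D' (avar i)) \<in> ahom A (?z i + q + p)" "D' (D (avar i)) \<in> ahom A (?z i + p + q)"
   by (rule der_ahom[OF D s3_coeff(1)[OF D' i] refl], rule der_ahom[OF D' s3_coeff(1)[OF D i] refl])
  have s: "sg p * sg (?z i + q + p) = (sg (?z i + q) :: 'k)" "sg p * (sg (p * q) * sg (?z i + p + q)) = (sg (?z i + p * q + p + q + p) :: 'k)"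
   unfolding sg_add[symmetric] by (rule sg_eqI, auto)+
  have "ksgn A 1 (dcomm p q D D' (avar i)) = fsm (sg (?z i + q + p)) (D (D' (avar i))) - fsm (sg (p * q) * sg (?z i + p + q)) (D' (D (avar i)))"
   by (simp add: dcomm_def ksgn_diff ksgn_fsm ksgn_ahom[OF h(1)] ksgn_ahom[OF h(2)])
  then show "fsm (sg (?z i + q)) (amul V (D (D' (avar i))) (?p i)) + fsm (- sg (?z i + p * q + p + q + p)) (amul V (D' (D (avar i))) (?p i)) =
    fsm (sg p) (amul V (ksgn A 1 (dcomm p q D D' (avar i))) (?p i))"
   by (simp add: amul_diff_left amul_fsm_left fsm_diff fsm_uminus_left s)
 qed
 finally show ?thesis .
qed

text \<open>Reindexing by the conjugate variable exchanges the two factors. The total sign is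
  independent of k because conjugate degrees add up to 3.\<close>

lemma bb_sym:
 assumes P: "P \<in> ahom V p" and Q: "Q \<in> ahom V q"
 shows "bb A P Q = fsm (sg (p * q)) (bb A Q P)"
proof -
 let ?w = "zdeg V"
 have "bb A P Q = (\<Sum>k<2 * N. fsm (sg (p * q)) (amul V (apar V (partner A k) (ksgn V (?w k) Q)) (apar V k P)))"
  unfolding bb_def
 proof (rule sum.reindex_bij_witness[where i = "partner A" and j = "partner A"])
  fix k assume "k \<in> {..<2 * N}"
  then have k: "k < 2 * N" by simp
  let ?l = "partner A k"
  have h: "apar V ?l P \<in> ahom V (p - ?w ?l)" "apar V k Q \<in> ahom V (q - ?w k)"
   by (rule ahom_apar[OF P refl], rule ahom_apar[OF Q refl])
  have s: "sg (p * q) * (sg (?w ?l * q) * sg ((q - ?w k) * (p - ?w ?l))) = (sg (?w k * p) :: 'k)"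
   unfolding sg_add[symmetric] partner(1)[OF k] by (rule sg_eqI) auto
  have "fsm (sg (p * q)) (amul V (apar V k (ksgn V (?w ?l) Q)) (apar V ?l P)) =
    fsm (sg (p * q) * (sg (?w ?l * q) * sg ((q - ?w k) * (p - ?w ?l)))) (amul V (apar V ?l P) (apar V k Q))"
   by (simp add: ksgn_ahom[OF Q] apar_fsm amul_fsm_left amul_commute_hom[OF h(2,1)])
  then show "fsm (sg (p * q)) (amul V (apar V (partner A ?l) (ksgn V (?w ?l) Q)) (apar V ?l P)) =
    amul V (apar V ?l (ksgn V (?w k) P)) (apar V k Q)"
   unfolding s partner(3)[OF k] by (simp add: ksgn_ahom[OF P] apar_fsm amul_fsm_left)
 qed (auto simp: partner)
 then show ?thesis unfolding bb_def by (simp add: fsm_sum)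
qed

lemma bb_bracket: "is_Pol_bracket A (bb A)"
 unfolding is_Pol_bracket_def Let_def
proof (intro conjI allI ballI)
 fix p q and D D' :: "'k fga \<Rightarrow> 'k fga" assume D: "D \<in> der A p" "D' \<in> der A q"
 show "bb A (s3 A D) (s3 A D') = fsm (sg p) (s3 A (dcomm p q D D'))"
  unfolding bb_bd[OF ahom_acar[OF s3_hom[OF D(2)]]] by (rule bb_s3_s3[OF D])
next
 fix p and D :: "'k fga \<Rightarrow> 'k fga" and a :: "'k fga" assume "D \<in> der A p" "a \<in> acar A"
 then show "bb A (s3 A D) a = D a" by (simp add: bb_bd Pol_acar bb_s3)
next
 fix a a' :: "'k fga" assume a: "a \<in> acar A" "a' \<in> acar A"
 have "apar V (partner A k) (ksgn V (zdeg V k) a) = 0 \<or> apar V k a' = 0" if "k < 2 * N" for k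
 proof (cases "k < N")
  case True then show ?thesis using Pol_apar_0[of "ksgn V (zdeg V k) a"] a by (simp add: partner_def Pol_ksgn)
 next
  case False
  then obtain i where "k = N + i" by (metis le_Suc_ex not_less)
  then show ?thesis using Pol_apar_0[OF a(2)] by simp
 qed
 then show "bb A a a' = 0" unfolding bb_def by (intro sum.neutral) force
next
 fix p q and P Q :: "'k fga" assume P: "P \<in> ahom V p" and Q: "Q \<in> ahom V q"
 show "bb A P Q \<in> ahom V (p + q - 3)"
  unfolding bb_bd[OF ahom_acar[OF Q]] by (rule der_ahom[OF bd_der[OF P] Q]) simp
 show "bb A P Q = fsm (sg (p * q)) (bb A Q P)" by (rule bb_sym[OF P Q])
 fix R :: "'k fga" assume "R \<in> acar V"
 then show "bb A P (amul V Q R) = amul V (bb A P Q) R + fsm (sg ((p - 3) * q)) (amul V Q (bb A P R))"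
  using der_amul[OF bd_der[OF P] Q] by (simp add: bb_bd ahom_acar[OF Q])
qed (auto simp: bb_def ksgn_add ksgn_fsm apar_add apar_fsm amul_add_left amul_add_right amul_fsm_left amul_fsm_right sum.distrib fsm_sum)

text \<open>A derivation whose image under s^3 is a single generator. Through it, the conditions on
  the bracket stated for all derivations determine the values on generators.\<close>

definition pd :: "nat \<Rightarrow> 'k fga \<Rightarrow> 'k fga" where
 "pd i = ader A (\<lambda>j. if j = i then 1 else 0)"

lemma pd: "pd i \<in> der A (- zdeg A i)" "i < N \<Longrightarrow> s3 A (pd i) = s3par A i"
proof -
 show d: "pd i \<in> der A (- zdeg A i)" unfolding pd_def by (rule ader_der) auto
 assume i: "i < N"
 have "s3 A (pd i) = (\<Sum>j<N. if j = i then s3par A j else 0)"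
  unfolding s3_def pd_def by (intro sum.cong refl) (auto simp: ader_avar amul_1_left ahom_acar[OF s3par_hom])
 then show "s3 A (pd i) = s3par A i" using i by simp
qed

lemma bracket_props:
 assumes B: "is_Pol_bracket A B"
 shows bracket_add: "\<And>P Q R. P \<in> acar V \<Longrightarrow> Q \<in> acar V \<Longrightarrow> R \<in> acar V \<Longrightarrow> B P (Q + R) = B P Q + B P R"
  and bracket_fsm: "\<And>P Q c. P \<in> acar V \<Longrightarrow> Q \<in> acar V \<Longrightarrow> B P (fsm c Q) = fsm c (B P Q)"
  and bracket_hom: "\<And>P Q p q l. P \<in> ahom V p \<Longrightarrow> Q \<in> ahom V q \<Longrightarrow> l = p + q - 3 \<Longrightarrow> B P Q \<in> ahom V l"
  and bracket_zero: "\<And>a a'. a \<in> acar A \<Longrightarrow> a' \<in> acar A \<Longrightarrow> B a a' = 0"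
  and bracket_s3: "\<And>p D a. D \<in> der A p \<Longrightarrow> a \<in> acar A \<Longrightarrow> B (s3 A D) a = D a"
  and bracket_s3_s3: "\<And>p q D D'. D \<in> der A p \<Longrightarrow> D' \<in> der A q \<Longrightarrow> B (s3 A D) (s3 A D') = fsm (sg p) (s3 A (dcomm p q D D'))"
  and bracket_sym: "\<And>P Q p q. P \<in> ahom V p \<Longrightarrow> Q \<in> ahom V q \<Longrightarrow> B P Q = fsm (sg (p * q)) (B Q P)"
  and bracket_amul: "\<And>P Q R p q. P \<in> ahom V p \<Longrightarrow> Q \<in> ahom V q \<Longrightarrow> R \<in> acar V \<Longrightarrow>
   B P (amul V Q R) = amul V (B P Q) R + fsm (sg ((p - 3) * q)) (amul V Q (B P R))"
proof -
 note b = B[unfolded is_Pol_bracket_def Let_def]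
 note b1 = conjunct1[OF b] and c1 = conjunct2[OF b]
 note b2 = conjunct1[OF c1] and c2 = conjunct2[OF c1]
 note b3 = conjunct1[OF c2] and c3 = conjunct2[OF c2]
 note b4 = conjunct1[OF c3] and c4 = conjunct2[OF c3]
 note b5 = conjunct1[OF c4] and c5 = conjunct2[OF c4]
 note b6 = conjunct1[OF c5] and b7 = conjunct2[OF c5]
 show "B P (Q + R) = B P Q + B P R" if "P \<in> acar V" "Q \<in> acar V" "R \<in> acar V" for P Q R using b1[rule_format, OF that] by blast
 show "B P (fsm c Q) = fsm c (B P Q)" if "P \<in> acar V" "Q \<in> acar V" for P Q c using b1[rule_format, OF that(1,2,2)] by blast
 show "B P Q \<in> ahom V l" if "P \<in> ahom V p" "Q \<in> ahom V q" "l = p + q - 3" for P Q p q l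
  unfolding that(3) by (rule b2[rule_format, OF that(1,2)])
 show "B a a' = 0" if "a \<in> acar A" "a' \<in> acar A" for a a' by (rule b3[rule_format, OF that])
 show "B (s3 A D) a = D a" if "D \<in> der A p" "a \<in> acar A" for p D a by (rule b4[rule_format, OF that])
 show "B (s3 A D) (s3 A D') = fsm (sg p) (s3 A (dcomm p q D D'))" if "D \<in> der A p" "D' \<in> der A q" for p q D D'
  by (rule b5[rule_format, OF that])
 show "B P Q = fsm (sg (p * q)) (B Q P)" if "P \<in> ahom V p" "Q \<in> ahom V q" for P Q p q by (rule b6[rule_format, OF that])
 show "B P (amul V Q R) = amul V (B P Q) R + fsm (sg ((p - 3) * q)) (amul V Q (B P R))"
  if "P \<in> ahom V p" "Q \<in> ahom V q" "R \<in> acar V" for P Q R p q by (rule b7[rule_format, OF that])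
qed

text \<open>In its second argument a bracket is a derivation, so it is determined by the values on
  generators; symmetry transfers this to the first argument. On pairs of generators the conditions
  fix the values.\<close>

lemma Pol_bracket_unique:
 fixes P Q :: "'k fga"
 assumes B: "is_Pol_bracket A B" and B': "is_Pol_bracket A B'" and P: "P \<in> ahom V p" and Q: "Q \<in> acar V"
 shows "B P Q = B' P Q"
proof -
 \<comment> \<open>Cut off outside the carrier, where the conditions leave the bracket
   arbitrary.\<close>
 have d: "(\<lambda>Q. if Q \<in> acar V then B P Q else 0) \<in> der V (p - 3)" if B: "is_Pol_bracket A B" and P: "P \<in> ahom V p" for B P p
  unfolding der_def
  by (intro CollectI conjI allI ballI impI)
   (simp_all add: acar_add acar_fsm ahom_acar bracket_add[OF B ahom_acar[OF P]] bracket_fsm[OF B ahom_acar[OF P]]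
    bracket_hom[OF B P] bracket_amul[OF B P])
 have eq: "B P Q = B' P Q" if P: "P \<in> ahom V p" and Q: "Q \<in> acar V" and g: "\<And>l. l < 2 * N \<Longrightarrow> B P (avar l) = B' P (avar l)" for P Q p
  using der_eqI[OF d[OF B P] d[OF B' P], of Q] Q g by (auto simp: Pol_simps acar_avar)
 have a: "(avar k :: 'k fga) \<in> ahom V (zdeg V k)" if "k < 2 * N" for k
  by (rule ahom_avar) (use that in \<open>simp_all add: Pol_simps\<close>)
 have zz: "B (avar k) (avar l) = B' (avar k) (avar l)" if "k < N" "l < N" for k l
  using that by (simp add: bracket_zero[OF B] bracket_zero[OF B'] acar_avar)
 have pz: "B (s3par A k) (avar l) = B' (s3par A k) (avar l)" if "k < N" "l < N" for k l
  unfolding pd(2)[OF that(1), symmetric] using bracket_s3[OF B pd(1)] bracket_s3[OF B' pd(1)] that by (simp add: acar_avar)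
 have pp: "B (s3par A k) (s3par A l) = B' (s3par A k) (s3par A l)" if "k < N" "l < N" for k l
  unfolding pd(2)[OF that(1), symmetric] pd(2)[OF that(2), symmetric]
   bracket_s3_s3[OF B pd(1) pd(1)] bracket_s3_s3[OF B' pd(1) pd(1)] ..
 have sw: "B P Q = fsm (sg (p * q)) (B Q P) \<and> B' P Q = fsm (sg (p * q)) (B' Q P)" if "P \<in> ahom V p" "Q \<in> ahom V q" for P Q p q
  using bracket_sym[OF B that] bracket_sym[OF B' that] ..
 have zp: "B (avar l) (s3par A k) = B' (avar l) (s3par A k)" if "k < N" "l < N" for k l
 proof -
  have "l < 2 * N" using that by simp
  then show ?thesis using sw[OF a s3par_hom[OF that(1)], of l] pz[OF that] by simp
 qed
 have gg: "B (avar k) (avar l) = B' (avar k) (avar l)" if kl: "k < 2 * N" "l < 2 * N" for k l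
 proof -
  have e: "m < N \<or> (\<exists>i<N. avar m = (s3par A i :: 'k fga))" if "m < 2 * N" for m
   using that by (cases "m < N") (auto simp: s3par_def not_less dest!: le_Suc_ex)
  show ?thesis using e[OF kl(1)] e[OF kl(2)] zz pz zp pp by auto
 qed
 have Pg: "B P (avar l) = B' P (avar l)" if "l < 2 * N" for l
  using sw[OF P a[OF that]] eq[OF a[OF that] ahom_acar[OF P] gg[OF that]] by simp
 show ?thesis by (rule eq[OF P Q Pg])
qed

lemma Pol_bracket_eq: "P \<in> ahom V p \<Longrightarrow> Q \<in> acar V \<Longrightarrow> Pol_bracket A P Q = bb A P Q"
 unfolding Pol_bracket_def by (rule Pol_bracket_unique[OF someI[of "is_Pol_bracket A"] bb_bracket]) (rule bb_bracket)

end

section \<open>The Poisson equation for the bivector\<close>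

lemma sum_split_add: "(\<Sum>k<m + l. F k) = (\<Sum>k<m. F k) + (\<Sum>k<l. F (m + k :: nat) :: 'a::comm_monoid_add)"
 by (induction l) (simp_all add: add.assoc)

context CE_data
begin

declare add_Suc[simp del]

lemma ph: "a < n \<Longrightarrow> p a \<in> ahom V 2" "p n \<in> ahom V 1" "a \<le> n \<Longrightarrow> p a \<in> acar V" "a < n \<Longrightarrow> avar a \<in> ahom V 1"
proof -
 show "a < n \<Longrightarrow> p a \<in> ahom V 2" "p n \<in> ahom V 1" "a < n \<Longrightarrow> avar a \<in> ahom V 1"
  by (rule ahom_avar; simp add: V_simps)+
 show "a \<le> n \<Longrightarrow> p a \<in> acar V" by (rule acar_avar) (simp add: V_simps)
qed

lemma pp: "a < n \<Longrightarrow> b < n \<Longrightarrow> amul V (p a) (p b) = (amul V (p b) (p a) :: 'k fga)"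
 by (subst amul_commute_hom[OF ph(1) ph(1)]) (simp_all add: sg_even)

lemma nn: "amul V (p n) (p n) = (0 :: 'k fga)"
 by (rule pm_double_zero, rule trans[OF amul_commute_hom[OF ph(2) ph(2)]]) (simp add: sg_odd fsm_uminus_left)

lemma nb: "a < n \<Longrightarrow> amul V (p n) (p a) = (amul V (p a) (p n) :: 'k fga)"
 by (rule trans[OF amul_commute_hom[OF ph(2) ph(1)]]) (simp_all add: sg_even)

lemma nan: "a < n \<Longrightarrow> amul V (p n) (amul V (p a) (p n)) = (0 :: 'k fga)"
 by (simp only: amul_assoc[symmetric] nb) (simp add: amul_assoc nn)

lemma apar_gen: "c \<le> n \<Longrightarrow> apar V c (p a) = 0" "apar V (Suc n + c) (p a) = (if c = a then 1 else 0)"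
 "b < n \<Longrightarrow> apar V (Suc n + c) (avar b) = 0" "b < n \<Longrightarrow> apar V c (avar b) = (if c = b then 1 else 0)"
 by (auto simp: apar_avar)

lemma apar_pp:
 assumes ab: "a < n" "b < n"
 shows "apar V k (amul V (p a) (p b)) = amul V (apar V k (p a)) (p b) + (amul V (p a) (apar V k (p b)) :: 'k fga)"
proof -
 have 1: "p a \<in> (ahom V 2 :: 'k fga set)" by (rule ph(1)[OF ab(1)])
 have 2: "p b \<in> (acar V :: 'k fga set)" by (rule ph(3)) (use ab in simp)
 show ?thesis unfolding apar_amul[OF 1 2] by (simp add: sg_even)
qed

lemma apar_tpn:
 assumes ab: "a < n" "b < n"
 shows "apar V k (amul V (amul V (avar b) (p a)) (p n)) =
  amul V (amul V (apar V k (avar b)) (p a) + fsm (sg (zdeg V k)) (amul V (avar b) (apar V k (p a)))) (p n) +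
  (fsm (sg (zdeg V k * 3)) (amul V (amul V (avar b) (p a)) (apar V k (p n))) :: 'k fga)"
proof -
 have 1: "avar b \<in> (ahom V 1 :: 'k fga set)" by (rule ph(4)[OF ab(2)])
 have 2: "p a \<in> (ahom V 2 :: 'k fga set)" by (rule ph(1)[OF ab(1)])
 have 3: "amul V (avar b) (p a) \<in> (ahom V 3 :: 'k fga set)" by (rule ahom_amul[OF 1 2]) simp
 have 4: "p n \<in> (acar V :: 'k fga set)" by (rule ph(3)) simp
 show ?thesis unfolding apar_amul[OF 3 4] apar_amul[OF 1 ahom_acar[OF 2]] by simp
qed

text \<open>As nu does not occur in the bivector, the conjugate pair consisting of nu and s^3 d/dnu
  drops out of the bracket.\<close>

lemma P_nu: "apar V n P = 0"
 unfolding P_eq apar_add apar_sum apar_fsm by (simp add: apar_pp apar_tpn apar_gen)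

lemma P_th: "c < n \<Longrightarrow> apar V c P = (\<Sum>a<n. fsm (pt c a) (amul V (p a) (p n)))"
proof -
 assume c: "c < n"
 have "apar V c P = (\<Sum>a<n. \<Sum>b<n. if c = b then fsm (pt b a) (amul V (p a) (p n)) else 0)"
  unfolding P_eq apar_add apar_sum apar_fsm using c
  by (simp add: apar_pp apar_tpn apar_gen amul_1_left ph if_distrib[of "fsm _"] if_distrib[of "\<lambda>x. amul V x _"] cong: if_cong)
 then show ?thesis using c by simp
qed

lemma P_p: "c < n \<Longrightarrow> apar V (Suc n + c) P = (\<Sum>b<n. fsm (\<pi> c b) (p b)) + (\<Sum>b<n. fsm (pt b c) (amul V (avar b) (p n)))"
proof -
 assume c: "c < n"
 have a: "avar b \<in> acar V" if "b < n" for b using ahom_acar[OF ph(4)[OF that]] .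
 have "apar V (Suc n + c) P = ((\<Sum>a<n. if c = a then (\<Sum>b<n. fsm (1 / 2 * \<pi> a b) (p b)) else 0) +
   (\<Sum>a<n. \<Sum>b<n. if c = b then fsm (1 / 2 * \<pi> a b) (p a) else 0)) +
   (\<Sum>a<n. if c = a then (\<Sum>b<n. fsm (pt b a) (amul V (avar b) (p n))) else 0)"
  unfolding P_eq apar_add apar_sum apar_fsm using c
  by (simp add: apar_pp apar_tpn apar_gen amul_1_left amul_1_right ph a V_simps sg_even fsm_add sum.distrib sum_if_const
   if_distrib[of "fsm _"] if_distrib[of "\<lambda>x. amul V x _"] if_distrib[of "\<lambda>x. amul V _ x"] cong: if_cong)
 also have "\<dots> = ((\<Sum>b<n. fsm (1 / 2 * \<pi> c b) (p b)) + (\<Sum>b<n. fsm (1 / 2 * \<pi> b c) (p b))) + (\<Sum>b<n. fsm (pt b c) (amul V (avar b) (p n)))"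
  using c by simp
 also have "(\<Sum>b<n. fsm (1 / 2 * \<pi> c b) (p b)) + (\<Sum>b<n. fsm (1 / 2 * \<pi> b c) (p b)) = (\<Sum>b<n. fsm (\<pi> c b) (p b))"
  unfolding sum.distrib[symmetric] fsm_add_left[symmetric]
  by (intro sum.cong refl arg_cong2[where f = fsm]) (use pi_sym[OF c] in simp)
 finally show ?thesis .
qed

text \<open>The generators s^3 d/dtheta^a are even and commute, so exchanging a and b shows that the
  sum is its own negative.\<close>

lemma anti_zero:
 assumes "\<And>a b. a < n \<Longrightarrow> b < n \<Longrightarrow> G a b = - G b a"
 shows "(\<Sum>a<n. \<Sum>b<n. amul V (G a b) (amul V (p a) (p b))) = (0 :: 'k fga)"
proof (rule pm_double_zero)
 have "(\<Sum>a<n. \<Sum>b<n. amul V (G a b) (amul V (p a) (p b))) = (\<Sum>b<n. \<Sum>a<n. amul V (G a b) (amul V (p a) (p b)))"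
  by (rule sum.swap)
 also have "\<dots> = (\<Sum>b<n. \<Sum>a<n. - amul V (G b a) (amul V (p b) (p a)))"
 proof (intro sum.cong refl)
  fix b a assume "b \<in> {..<n}" "a \<in> {..<n}"
  then have ab: "a < n" "b < n" by auto
  show "amul V (G a b) (amul V (p a) (p b)) = - amul V (G b a) (amul V (p b) (p a))"
   unfolding assms[OF ab] pp[OF ab] by (rule amul_uminus_left)
 qed
 finally show "(\<Sum>a<n. \<Sum>b<n. amul V (G a b) (amul V (p a) (p b))) = - (\<Sum>a<n. \<Sum>b<n. amul V (G a b) (amul V (p a) (p b)))"
  by (simp only: sum_negf)
qed

text \<open>The bracket is twice the sum over c of the derivatives along theta^c and its conjugate.
  Up to the common factor s^3 d/dnu this is the quadratic form with coefficients from \<pi> and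
  pi-tilde, and the condition on their composite makes these antisymmetric.\<close>

lemma bracket_zero: "Pol_bracket A P P = 0"
proof -
 let ?X = "\<lambda>c. amul V (apar V (Suc n + c) P) (apar V c P)"
 \<comment> \<open>P has the even degree 4, so the parity involutions in \<open>bb\<close> act
   trivially.\<close>
 have k: "ksgn V z P = P" if "True" for z by (simp add: ksgn_ahom[OF P_hom] sg_even)
 have N: "2 * ngen A = Suc n + Suc n" by (simp add: A_simps)
 have c: "amul V (apar V c P) (apar V (Suc n + c) P) = ?X c" if c: "c < n" for c
 proof -
  have "apar V c P \<in> ahom V 3" "apar V (Suc n + c) P \<in> ahom V 2"
   by (rule ahom_apar[OF P_hom], use c in \<open>simp add: V_simps\<close>)+
  then show ?thesis by (subst amul_commute_hom) (auto simp: sg_even)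
 qed
 have X: "(\<Sum>c<n. ?X c) = 0"
 proof -
  \<comment> \<open>The pi-tilde part of one derivative and all of the other end in the odd
    generator \<open>p n\<close>, whose square vanishes; only the part with \<pi> survives.\<close>
  have x: "?X c = amul V (\<Sum>b<n. \<Sum>a<n. amul V (fsm (\<pi> c b * pt c a) 1) (amul V (p b) (p a))) (p n)" if c: "c < n" for c
  proof -
   have "amul V (\<Sum>b<n. fsm (pt b c) (amul V (avar b) (p n))) (\<Sum>a<n. fsm (pt c a) (amul V (p a) (p n))) = 0"
    unfolding amul_sum_left amul_sum_right by (intro sum.neutral ballI) (simp add: amul_fsm_left amul_fsm_right amul_assoc nan)
   moreover have "amul V (\<Sum>b<n. fsm (\<pi> c b) (p b)) (\<Sum>a<n. fsm (pt c a) (amul V (p a) (p n))) =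
     (\<Sum>b<n. \<Sum>a<n. fsm (\<pi> c b * pt c a) (amul V (p b) (amul V (p a) (p n))))"
    unfolding amul_sum_left amul_fsm_left unfolding amul_sum_right amul_fsm_right fsm_sum fsm_fsm ..
   moreover have "amul V (\<Sum>b<n. \<Sum>a<n. amul V (fsm (\<pi> c b * pt c a) 1) (amul V (p b) (p a))) (p n) =
     (\<Sum>b<n. \<Sum>a<n. fsm (\<pi> c b * pt c a) (amul V (p b) (amul V (p a) (p n))))"
    by (simp add: amul_sum_left amul_fsm_left amul_1_left amul_assoc)
   ultimately show ?thesis
    unfolding P_p[OF c] P_th[OF c] amul_add_left by (simp only: add_0_right)
  qed
  have "(\<Sum>c<n. ?X c) = amul V (\<Sum>c<n. \<Sum>b<n. \<Sum>a<n. amul V (fsm (\<pi> c b * pt c a) 1) (amul V (p b) (p a))) (p n)"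
   unfolding amul_sum_left[of _ _ "{..<n}" "p n"] by (intro sum.cong refl) (simp only: lessThan_iff x amul_sum_left)
  also have "(\<Sum>c<n. \<Sum>b<n. \<Sum>a<n. amul V (fsm (\<pi> c b * pt c a) 1) (amul V (p b) (p a))) =
    (\<Sum>b<n. \<Sum>a<n. amul V (fsm (\<Sum>c<n. \<pi> c b * pt c a) 1) (amul V (p b) (p a)))"
   unfolding fsm_sum_left amul_sum_left by (rule trans[OF sum.swap sum.cong[OF refl sum.swap]])
  also have "\<dots> = 0"
  proof (rule anti_zero)
   fix a b assume ab: "a < n" "b < n"
   have "(\<Sum>c<n. \<pi> c a * pt c b) = - (\<Sum>c<n. \<pi> c b * pt c a)"
    using pt_pi[OF ab] pi_sym ab by (simp add: eq_neg_iff_add_eq_0 add.commute)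
   then show "fsm (\<Sum>c<n. \<pi> c a * pt c b) 1 = - fsm (\<Sum>c<n. \<pi> c b * pt c a) (1 :: 'k fga)"
    by (simp add: fsm_uminus_left)
  qed
  finally show ?thesis by simp
 qed
 have "Pol_bracket A P P = bb A P P" by (rule Pol_bracket_eq[OF P_hom ahom_acar[OF P_hom]])
 also have "\<dots> = (\<Sum>c<Suc n. ?X c) + (\<Sum>c<Suc n. amul V (apar V c P) (apar V (Suc n + c) P))"
  unfolding bb_def N sum_split_add by (intro arg_cong2[where f = "(+)"] sum.cong refl) (auto simp: k partner_def A_simps)
 also have "\<dots> = (\<Sum>c<n. ?X c) + (\<Sum>c<n. ?X c)"
  by (simp add: P_nu c)
 finally show ?thesis unfolding X by simp
qed

text \<open>The differential of s^3 d/dtheta^a, that is, -s^3 of the commutator of d_A with the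
  derivation, expanded in generators by the Jacobian. The minus sign at nu is due to the even degree
  of \<open>cc A a n\<close>.\<close>

definition E where "E a = (\<Sum>b<n. amul V (cc A a b) (p b)) - amul V (cc A a n) (p n)"

lemma cc_hom: "a < n \<Longrightarrow> b < n \<Longrightarrow> cc A a b \<in> ahom A 1" "a < n \<Longrightarrow> cc A a n \<in> ahom A 2" "a \<le> n \<Longrightarrow> cc A n a = 0"
proof -
 show "a < n \<Longrightarrow> b < n \<Longrightarrow> cc A a b \<in> ahom A 1" by (simp add: cc_th) (intro ahom_sum ahom_fsm th, simp)
 show "a < n \<Longrightarrow> cc A a n \<in> ahom A 2" by (simp only: cc_nu Q_hom)
 show "a \<le> n \<Longrightarrow> cc A n a = 0" using cc_th[of n a] cc_nu(2) by (cases "a = n") auto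
qed

lemma s3_d: "k \<le> n \<Longrightarrow> - s3 A (dcomm 1 (- zdeg A k) (adiff A) (apar A k)) = (if k < n then E k else 0)"
proof -
 assume k: "k \<le> n"
 have d: "dcomm 1 (- zdeg A k) (adiff A) (apar A k) (avar j) = fsm (- sg (zdeg A k)) (cc A k j)" for j
  by (auto simp: dcomm_def cc_def apar_avar der_0[OF dA] der_1[OF dA] fsm_uminus_left)
 have "- s3 A (dcomm 1 (- zdeg A k) (adiff A) (apar A k)) =
   (\<Sum>j<n. fsm (sg (zdeg A k)) (amul V (ksgn A 1 (cc A k j)) (p j))) + fsm (sg (zdeg A k)) (amul V (ksgn A 1 (cc A k n)) (p n))"
  unfolding s3_def d by (simp add: A_simps(1) s3par_def ksgn_uminus fsm_uminus_left ksgn_fsm amul_fsm_left amul_uminus_left sum_negf add.commute)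
 also have "\<dots> = (if k < n then E k else 0)"
 proof (cases "k < n")
  case True
  then show ?thesis
   by (simp add: E_def ksgn_ahom[OF cc_hom(1)] ksgn_ahom[OF cc_hom(2)] A_simps sg_odd sg_even amul_fsm_left fsm_uminus_left amul_uminus_left)
 next
  case False
  then have "k = n" using k by simp
  then show ?thesis by (simp add: cc_hom(3))
 qed
 finally show ?thesis .
qed

lemma E_hom: "a < n \<Longrightarrow> E a \<in> ahom V 3"
 unfolding E_def by (intro ahom_diff ahom_sum ahom_amul[OF Pol_ahom[OF cc_hom(1)] ph(1)] ahom_amul[OF Pol_ahom[OF cc_hom(2)] ph(2)]) simp_all

lemma diff_der: "Pol_diff A \<in> der V 1"
 unfolding Pol_diff_def
proof (rule ader_der)
 fix i assume i: "i < ngen V"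
 show "(if i < ngen A then adiff A (avar i) else - s3 A (dcomm 1 (- zdeg A (i - ngen A)) (adiff A) (apar A (i - ngen A)))) \<in> ahom V (zdeg V i + 1)"
 proof (cases "i < ngen A")
  case True
  then show ?thesis using Pol_ahom[OF der_ahom[OF dA ahom_avar[OF True refl] refl]] by (simp add: Pol_simps)
 next
  case False
  then obtain k where ik: "i = Suc n + k" "k \<le> n" using i by (auto simp: V_simps A_simps not_less dest!: le_Suc_ex)
  then have e: "i - ngen A = k" by (simp add: A_simps)
  show ?thesis
   using False E_hom[of k] ik unfolding e s3_d[OF ik(2)] by (auto simp: V_simps)
 qed
qed

lemma diff_p: "k \<le> n \<Longrightarrow> Pol_diff A (p k) = (if k < n then E k else 0)"
proof -
 assume k: "k \<le> n"
 let ?F = "\<lambda>i. if i < ngen A then adiff A (avar i) else - s3 A (dcomm 1 (- zdeg A (i - ngen A)) (adiff A) (apar A (i - ngen A)))"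
 have e: "?F (Suc n + k) = (if k < n then E k else 0)"
  using s3_d[OF k] by (simp add: A_simps(1))
 have "Pol_diff A (p k) = ?F (Suc n + k)"
  unfolding Pol_diff_def
 proof (rule ader_avar)
  show "Suc n + k < ngen V" using k by (simp add: V_simps)
  show "?F (Suc n + k) \<in> acar V" unfolding e using E_hom[of k] by (auto intro: ahom_acar)
 qed
 then show ?thesis unfolding e .
qed

lemma diff_A: "a \<in> acar A \<Longrightarrow> Pol_diff A a = adiff A a"
proof -
 assume a: "a \<in> acar A"
 have v: "Pol_diff A (avar i) = adiff A (avar i)" if "i < Suc n" for i
  unfolding Pol_diff_def using that by (subst ader_avar) (auto simp: V_simps A_simps intro!: Pol_acar[OF acar_der[OF dA]])
 have "Pol_diff A a = (\<Sum>i<Suc n + Suc n. amul V (Pol_diff A (avar i)) (apar V i a))"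
 proof -
  have "ngen V = Suc n + Suc n" by (simp add: V_simps(1))
  from der_apply[OF diff_der Pol_acar[OF a], unfolded this] show ?thesis .
 qed
 also have "\<dots> = (\<Sum>i<Suc n. amul V (Pol_diff A (avar i)) (apar V i a))"
  unfolding sum_split_add using Pol_apar_0[OF a] by (simp add: A_simps)
 also have "\<dots> = (\<Sum>i<ngen A. amul A (adiff A (avar i)) (apar A i a))"
 proof (intro sum.cong)
  fix i assume "i \<in> {..<ngen A}"
  then have i: "i < ngen A" by simp
  show "amul V (Pol_diff A (avar i)) (apar V i a) = amul A (adiff A (avar i)) (apar A i a)"
   using v[of i] i by (simp add: A_simps(1)) (simp add: Pol_apar[OF a i] Pol_amul acar_apar a acar_der[OF dA])
 qed (simp add: A_simps)
 also have "\<dots> = adiff A a" by (rule der_apply[OF dA a, symmetric])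
 finally show ?thesis .
qed

lemma P_lam: "P = (\<Sum>a<n. \<Sum>b<n. fsm (1 / 2 * \<pi> a b) (amul V (p a) (p b))) + (\<Sum>a<n. amul V (amul V (lam a) (p a)) (p n))"
 unfolding P_eq lam_def amul_sum_left amul_fsm_left ..

text \<open>The result is sorted by the two kinds of monomials in the shifted derivations. The part
  without s^3 d/dnu vanishes by invariance of \<pi>; the part with it vanishes by
  \<open>lam_closed\<close>.\<close>

lemma diff_zero: "Pol_diff A P = 0"
proof -
 note D = diff_der
 note L = Pol_ahom[OF lam_hom] and la = ahom_acar[OF lam_hom]
 let ?U = "\<lambda>b. \<Sum>a<n. fsm (\<pi> a b) (cc A a n)" and ?W = "\<lambda>b. \<Sum>a<n. amul A (lam a) (cc A a b)"
 have 1: "Pol_diff A (amul V (p a) (p b)) = amul V (E a) (p b) + amul V (E b) (p a)" if "a < n" "b < n" for a b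
  using der_amul[OF D ph(1)[OF that(1)] ph(3), of b] that amul_commute_hom[OF ph(1)[OF that(1)] E_hom[OF that(2)]]
  by (simp add: diff_p sg_even)
 have 2: "Pol_diff A (amul V (amul V (lam a) (p a)) (p n)) = amul V (adiff A (lam a)) (amul V (p a) (p n)) - amul V (amul V (lam a) (E a)) (p n)"
  if "a < n" for a
  using der_amul[OF D ahom_amul[OF L ph(1)[OF that] refl] ph(3), of n] der_amul[OF D L ph(3), of a a] that
  by (simp add: diff_p diff_A la sg_odd fsm_uminus_left amul_diff_left amul_assoc)
 have "Pol_diff A P = (\<Sum>a<n. \<Sum>b<n. fsm (1 / 2 * \<pi> a b) (Pol_diff A (amul V (p a) (p b)))) +
   (\<Sum>a<n. Pol_diff A (amul V (amul V (lam a) (p a)) (p n)))"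
  unfolding P_lam by (simp add: der_add[OF D] der_sum[OF D] der_fsm[OF D] acar_sum acar_fsm)
 also have "\<dots> = ((\<Sum>a<n. \<Sum>b<n. fsm (1 / 2 * \<pi> a b) (amul V (E a) (p b))) + (\<Sum>a<n. \<Sum>b<n. fsm (1 / 2 * \<pi> a b) (amul V (E b) (p a)))) +
   ((\<Sum>a<n. amul V (adiff A (lam a)) (amul V (p a) (p n))) - (\<Sum>a<n. amul V (amul V (lam a) (E a)) (p n)))"
  by (simp add: 1 2 fsm_add sum.distrib sum_subtractf)
 also have "(\<Sum>a<n. \<Sum>b<n. fsm (1 / 2 * \<pi> a b) (amul V (E b) (p a))) = (\<Sum>a<n. \<Sum>b<n. fsm (1 / 2 * \<pi> a b) (amul V (E a) (p b)))"
  by (subst sum.swap) (intro sum.cong refl, use pi_sym in simp)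
 also have "(\<Sum>a<n. \<Sum>b<n. fsm (1 / 2 * \<pi> a b) (amul V (E a) (p b))) + (\<Sum>a<n. \<Sum>b<n. fsm (1 / 2 * \<pi> a b) (amul V (E a) (p b))) =
   (\<Sum>b<n. \<Sum>a<n. fsm (\<pi> a b) (amul V (E a) (p b)))"
  unfolding sum.distrib[symmetric] fsm_add_left[symmetric] by (subst sum.swap) simp
 also have "\<dots> = (\<Sum>b<n. \<Sum>a<n. \<Sum>c<n. fsm (\<pi> a b) (amul V (cc A a c) (amul V (p c) (p b)))) - (\<Sum>b<n. amul V (?U b) (amul V (p b) (p n)))"
 proof -
  have "fsm (\<pi> a b) (amul V (E a) (p b)) = (\<Sum>c<n. fsm (\<pi> a b) (amul V (cc A a c) (amul V (p c) (p b)))) -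
    amul V (fsm (\<pi> a b) (cc A a n)) (amul V (p b) (p n))" if "b < n" for a b
   using that
   by (simp add: nb E_def amul_diff_left amul_sum_left amul_assoc fsm_diff fsm_sum amul_fsm_left sg_even)
  then show ?thesis by (simp add: sum_subtractf amul_sum_left)
 qed
 \<comment> \<open>Invariance, in the form \<open>pi_cc\<close>, makes the coefficient antisymmetric
   in the two indices of commuting generators.\<close>
 also have "(\<Sum>b<n. \<Sum>a<n. \<Sum>c<n. fsm (\<pi> a b) (amul V (cc A a c) (amul V (p c) (p b)))) = 0"
 proof -
  have "(\<Sum>b<n. \<Sum>a<n. \<Sum>c<n. fsm (\<pi> a b) (amul V (cc A a c) (amul V (p c) (p b)))) =
    (\<Sum>b<n. \<Sum>c<n. amul V (\<Sum>a<n. fsm (\<pi> a b) (cc A a c)) (amul V (p b) (p c)))"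
  proof (rule sum.cong[OF refl])
   fix b assume "b \<in> {..<n}"
   then have b: "b < n" by simp
   show "(\<Sum>a<n. \<Sum>c<n. fsm (\<pi> a b) (amul V (cc A a c) (amul V (p c) (p b)))) = (\<Sum>c<n. amul V (\<Sum>a<n. fsm (\<pi> a b) (cc A a c)) (amul V (p b) (p c)))"
    unfolding amul_sum_left amul_fsm_left by (subst sum.swap) (intro sum.cong refl, simp only: lessThan_iff pp[OF b])
  qed
  also have "\<dots> = 0"
  proof (rule anti_zero)
   fix b c assume bc: "b < n" "c < n"
   have "(\<Sum>k<n. fsm (\<pi> c k) (cc A k b)) = (\<Sum>k<n. fsm (\<pi> k c) (cc A k b))"
    by (intro sum.cong refl) (use pi_sym bc in simp)
   then show "(\<Sum>a<n. fsm (\<pi> a b) (cc A a c)) = - (\<Sum>a<n. fsm (\<pi> a c) (cc A a b))"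
    using pi_cc[OF bc(2,1)] by (simp add: eq_neg_iff_add_eq_0)
  qed
  finally show ?thesis .
 qed
 also have "(\<Sum>a<n. amul V (amul V (lam a) (E a)) (p n)) = (\<Sum>b<n. amul V (?W b) (amul V (p b) (p n)))"
 proof -
  have "amul V (amul V (lam a) (E a)) (p n) = (\<Sum>b<n. amul V (amul A (lam a) (cc A a b)) (amul V (p b) (p n)))" if "a < n" for a
   using that by (simp add: E_def amul_diff_left amul_diff_right amul_sum_left amul_sum_right amul_assoc nn
    Pol_amul[OF la ahom_acar[OF cc_hom(1)], symmetric])
  then show ?thesis unfolding amul_sum_left by (simp add: sum.swap[of "\<lambda>a b. amul V (amul A (lam a) (cc A a b)) (amul V (p b) (p n))"])
 qed
 \<comment> \<open>\<open>lam_closed\<close> splits the differential of the linear form: the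
   Jacobian part cancels the term with \<open>E\<close>, and the part with \<pi> cancels what the
   first sum has left over.\<close>
 also have "(\<Sum>a<n. amul V (adiff A (lam a)) (amul V (p a) (p n))) = (\<Sum>b<n. amul V (?W b + ?U b) (amul V (p b) (p n)))"
 proof (intro sum.cong refl)
  fix b assume "b \<in> {..<n}"
  then have b: "b < n" by simp
  have "(\<Sum>k<n. fsm (\<pi> b k) (cc A k n)) = ?U b" by (intro sum.cong refl) (use pi_sym b in simp)
  then show "amul V (adiff A (lam b)) (amul V (p b) (p n)) = amul V (?W b + ?U b) (amul V (p b) (p n))"
   using lam_closed[OF b] by simp
 qed
 also have "0 - (\<Sum>b<n. amul V (?U b) (amul V (p b) (p n))) + ((\<Sum>b<n. amul V (?W b + ?U b) (amul V (p b) (p n))) - (\<Sum>b<n. amul V (?W b) (amul V (p b) (p n)))) = 0"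
  by (simp add: amul_add_left sum.distrib)
 finally show ?thesis .
qed

lemma CE_poisson2: "poisson2 A P"
 unfolding poisson2_def using P_hom P_weight diff_zero bracket_zero by simp

lemma CE_result: "poisson2 A P \<and> inf_2braiding A (tbraid A P) \<and> gamma_equivariant A (tbraid A P)"
proof -
 interpret poisson_transformation A P by (rule CE_transformation)
 show ?thesis
  unfolding inf_2braiding_def using CE_poisson2 tbraid_ptrans tbraid_hexagon1 tbraid_hexagon2 tbraid_equivariant by simp
qed

end

section \<open>Passage from the Lie algebra to coordinates\<close>

context
 fixes scale :: "'k::field_char_0 \<Rightarrow> 'g::ab_group_add \<Rightarrow> 'g" and n :: nat and x :: "nat \<Rightarrow> 'g"
 assumes vs: "vector_space scale" and basis: "finite_basis scale n x"
begin

interpretation vector_space scale by (rule vs)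

lemma basis_sum: "(\<Sum>v\<in>x ` {..<n}. scale (u v) v) = (\<Sum>c<n. scale (u (x c)) (x c))"
 using basis by (simp add: finite_basis_def sum.reindex)

lemma coord_exists: "\<exists>g. v = (\<Sum>c<n. scale (g c) (x c))"
proof -
 have "v \<in> span (x ` {..<n})" using basis by (simp add: finite_basis_def)
 then obtain u where "v = (\<Sum>v\<in>x ` {..<n}. scale (u v) v)" using span_finite[of "x ` {..<n}"] by auto
 then have "v = (\<Sum>c<n. scale (u (x c)) (x c))" unfolding basis_sum .
 then show ?thesis by (rule exI[where x = "\<lambda>c. u (x c)"])
qed

lemma coord_unique:
 assumes eq: "(\<Sum>c<n. scale (g c) (x c)) = (\<Sum>c<n. scale (h c) (x c))" and c: "c < n"
 shows "g c = h c"
proof (rule ccontr)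
 assume ne: "g c \<noteq> h c"
 have inj: "inj_on x {..<n}" and ind: "independent (x ` {..<n})" using basis by (simp_all add: finite_basis_def)
 define u where "u v = g (inv_into {..<n} x v) - h (inv_into {..<n} x v)" for v
 have u: "u (x d) = g d - h d" if "d < n" for d using inv_into_f_f[OF inj] that by (simp add: u_def)
 have "(\<Sum>v\<in>x ` {..<n}. scale (u v) v) = (\<Sum>c<n. scale (g c - h c) (x c))"
  unfolding basis_sum by (intro sum.cong refl) (simp add: u)
 also have "\<dots> = 0" by (simp add: scale_left_diff_distrib sum_subtractf eq)
 finally have "(\<Sum>v\<in>x ` {..<n}. scale (u v) v) = 0" .
 moreover have "x c \<in> x ` {..<n}" "u (x c) \<noteq> 0" using c ne by (auto simp: u)
 ultimately have "dependent (x ` {..<n})" unfolding dependent_finite[OF finite_imageI[OF finite_lessThan]] by blast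
 with ind show False by simp
qed

lemma linear_basis_sum:
 assumes "\<And>u v. F (u + v) = F u + (F v :: 'g)" "\<And>c u. F (scale c u) = scale c (F u)"
 shows "F (\<Sum>c\<in>S. scale (g c) (x c)) = (\<Sum>c\<in>S. scale (g c) (F (x c)))"
proof -
 have "F 0 = 0" using assms(2)[of 0 0] by simp
 then show ?thesis by (induction S rule: infinite_finite_induct) (simp_all add: assms)
qed

lemma basis_sum_sum: "(\<Sum>e<n. scale (g e) (\<Sum>b<n. scale (h e b) (x b))) = (\<Sum>b<n. scale (\<Sum>e<n. g e * h e b) (x b))"
 by (simp add: scale_sum_right scale_sum_left) (rule sum.swap)

text \<open>Only the values at indices below n are determined by the choice, hence the index bounds
  in all rules about it.\<close>

definition co :: "'g \<Rightarrow> nat \<Rightarrow> 'k" where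
 "co v = (SOME g. v = (\<Sum>c<n. scale (g c) (x c)))"

lemma co_eq: "(\<Sum>c<n. scale (co v c) (x c)) = v"
 unfolding co_def using someI_ex[OF coord_exists[of v]] by simp

lemma co_sum: "c < n \<Longrightarrow> co (\<Sum>c<n. scale (h c) (x c)) c = h c"
 by (rule coord_unique[OF co_eq])

lemma co_basis: "a < n \<Longrightarrow> c < n \<Longrightarrow> co (x a) c = (if c = a then 1 else 0)"
 by (rule coord_unique, unfold co_eq) (simp_all add: if_distrib[of "\<lambda>r. scale r _"] sum.delta cong: if_cong)

lemma co_add: "c < n \<Longrightarrow> co (u + v) c = co u c + co v c"
 by (rule coord_unique, unfold co_eq) (simp_all add: scale_left_distrib sum.distrib co_eq)

lemma co_scale: "c < n \<Longrightarrow> co (scale r v) c = r * co v c"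
proof (rule coord_unique, unfold co_eq)
 have "(\<Sum>c<n. scale (r * co v c) (x c)) = scale r (\<Sum>c<n. scale (co v c) (x c))" by (simp add: scale_sum_right)
 then show "scale r v = (\<Sum>c<n. scale (r * co v c) (x c))" unfolding co_eq by simp
qed

text \<open>The functional that multiplies the i-th coordinate of the left entry with the j-th of
  the right one is bilinear, so it kills all relations of the tensor product. It makes an equation
  between tensors available coefficient by coefficient.\<close>

lemma co_null:
 assumes p: "p \<in> tnull scale UNIV {0} scale UNIV {0}" and ij: "i < n" "j < n"
 shows "psum (\<lambda>w r. r * (co (fst w) i * co (snd w) j)) p = 0"
proof -
 have ad: "addb (\<lambda>w r. r * (co (fst w) i * co (snd w) j))" by (simp add: addb_def distrib_right)
 have z: "co 0 k = 0" if "k < n" for k using co_scale[OF that, of 0 0] by simp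
 show ?thesis
  using p
 proof (induction rule: tnull.induct)
  case (null_left u v c)
  then have "u = 0" by simp
  then show ?case by (subst psum_single) (simp_all add: z ij)
 next
  case (null_right u v c)
  then have "v = 0" by simp
  then show ?case by (subst psum_single) (simp_all add: z ij)
 qed (simp_all add: psum_add[OF ad] psum_diff[OF ad] psum_single co_add co_scale ij algebra_simps)
qed

text \<open>Each condition is evaluated on basis vectors, and coefficients are compared by linear
  independence. Antisymmetry of the structure constants and of the cocycle comes from the
  alternating laws by polarization.\<close>

lemma CE_dataI:
 fixes br :: "'g \<Rightarrow> 'g \<Rightarrow> 'g" and f :: "nat \<Rightarrow> nat \<Rightarrow> nat \<Rightarrow> 'k" and \<kappa> :: "'g \<Rightarrow> 'g \<Rightarrow> 'g \<Rightarrow> 'k"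
  and \<pi> ptc :: "nat \<Rightarrow> nat \<Rightarrow> 'k" and pt :: "'g \<Rightarrow> 'g"
 assumes lie: "lie_algebra scale br"
  and sc: "\<And>a b. a < n \<Longrightarrow> b < n \<Longrightarrow> br (x a) (x b) = (\<Sum>c<n. scale (f a b c) (x c))"
  and cocycle: "three_cocycle scale br \<kappa>"
  and pi_sym: "\<And>a b. a < n \<Longrightarrow> b < n \<Longrightarrow> \<pi> a b = \<pi> b a"
  and pi_inv: "\<And>a b c. a < n \<Longrightarrow> b < n \<Longrightarrow> c < n \<Longrightarrow> (\<Sum>d<n. f c d a * \<pi> d b) + (\<Sum>d<n. f c d b * \<pi> a d) = 0"
  and pt_linear: "Vector_Spaces.linear scale scale pt"
  and pt_coeff: "\<And>a. a < n \<Longrightarrow> pt (x a) = (\<Sum>b<n. scale (ptc a b) (x b))"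
  and pt_pi: "(\<Sum>a<n. \<Sum>b<n. Poly_Mapping.single (pt (x a), x b) (1 / 2 * \<pi> a b)) +
    (\<Sum>a<n. \<Sum>b<n. Poly_Mapping.single (x a, pt (x b)) (1 / 2 * \<pi> a b)) \<in> tnull scale UNIV {0} scale UNIV {0}"
  and pt_br: "\<And>u v. pt (br u v) = br (pt u) v + br u (pt v) +
   (\<Sum>a<n. \<Sum>b<n. scale (1 / 2 * \<pi> a b * \<kappa> u v (x a)) (x b)) + (\<Sum>a<n. \<Sum>b<n. scale (1 / 2 * \<pi> a b * \<kappa> u v (x b)) (x a))"
 shows "CE_data n f (\<lambda>a b c. \<kappa> (x a) (x b) (x c)) \<pi> ptc"
proof
 have br: "br (u + v) w = br u w + br v w" "br w (u + v) = br w u + br w v"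
  "br (scale c u) w = scale c (br u w)" "br w (scale c u) = scale c (br w u)" "br u u = 0" for u v w c
  using lie by (simp_all add: lie_algebra_def Vector_Spaces.linear_iff)
 have ptl: "pt (u + v) = pt u + pt v" "pt (scale c u) = scale c (pt u)" for u v c
  using pt_linear by (simp_all add: Vector_Spaces.linear_iff)
 have ka: "\<kappa> (u + v) w z = \<kappa> u w z + \<kappa> v w z" "\<kappa> w (u + v) z = \<kappa> w u z + \<kappa> w v z" "\<kappa> w z (u + v) = \<kappa> w z u + \<kappa> w z v"
  "\<kappa> u u w = 0" "\<kappa> w u u = 0" for u v w z
  using cocycle by (simp_all add: three_cocycle_def Vector_Spaces.linear_iff)
 have kanti: "\<kappa> v u w = - \<kappa> u v w" "\<kappa> w v u = - \<kappa> w u v" for u v w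
 proof -
  show "\<kappa> v u w = - \<kappa> u v w"
   using ka(4)[of "u + v" w] unfolding ka(1,2) by (simp add: ka(4) eq_neg_iff_add_eq_0 add.commute)
  show "\<kappa> w v u = - \<kappa> w u v"
   using ka(5)[of w "u + v"] unfolding ka(2,3) by (simp add: ka(5) eq_neg_iff_add_eq_0 add.commute)
 qed
 have banti: "br v u = - br u v" for u v
  using br(5)[of "u + v"] unfolding br(1,2) by (simp add: br(5) eq_neg_iff_add_eq_0 add.commute)
 fix a b c assume abc: "a < n" "b < n" "c < n"
 show "\<kappa> (x b) (x a) (x c) = - \<kappa> (x a) (x b) (x c) \<and> \<kappa> (x a) (x c) (x b) = - \<kappa> (x a) (x b) (x c)"
  using kanti by blast
 have "(\<Sum>c<n. scale (f b a c) (x c)) = (\<Sum>c<n. scale (- f a b c) (x c))"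
  using banti[of "x b" "x a"] abc by (simp add: sc sum_negf)
 then show "f b a c = - f a b c" by (rule coord_unique) (rule abc)
next
 have ad: "addb (\<lambda>w r. r * (co (fst w) i * co (snd w) j))" for i j by (simp add: addb_def distrib_right)
 fix a b assume ab: "a < n" "b < n"
 have cp: "co (pt (x d)) e = ptc d e" if "d < n" "e < n" for d e using that by (simp add: pt_coeff co_sum)
 \<comment> \<open>The (a, b) coefficient of the first displayed condition. Coordinates of basis
   vectors are Kronecker deltas, which collapse one of the two sums in each term.\<close>
 have "0 = (\<Sum>d<n. \<Sum>e<n. 1 / 2 * \<pi> d e * (co (pt (x d)) a * co (x e) b)) + (\<Sum>d<n. \<Sum>e<n. 1 / 2 * \<pi> d e * (co (x d) a * co (pt (x e)) b))"
  using co_null[OF pt_pi ab] by (simp add: psum_add[OF ad] psum_sum[OF ad] psum_single)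
 also have "(\<Sum>d<n. \<Sum>e<n. 1 / 2 * \<pi> d e * (co (pt (x d)) a * co (x e) b)) = (\<Sum>d<n. 1 / 2 * (\<pi> d b * ptc d a))"
 proof (intro sum.cong refl)
  fix d assume "d \<in> {..<n}"
  then have d: "d < n" by simp
  have "(\<Sum>e<n. 1 / 2 * \<pi> d e * (co (pt (x d)) a * co (x e) b)) = (\<Sum>e<n. if b = e then 1 / 2 * (\<pi> d e * ptc d a) else 0)"
   by (intro sum.cong refl) (use d ab in \<open>simp add: cp co_basis\<close>)
  then show "(\<Sum>e<n. 1 / 2 * \<pi> d e * (co (pt (x d)) a * co (x e) b)) = 1 / 2 * (\<pi> d b * ptc d a)" using ab by simp
 qed
 also have "(\<Sum>d<n. \<Sum>e<n. 1 / 2 * \<pi> d e * (co (x d) a * co (pt (x e)) b)) = (\<Sum>e<n. 1 / 2 * (\<pi> a e * ptc e b))"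
 proof (subst sum.swap, intro sum.cong refl)
  fix e assume "e \<in> {..<n}"
  then have e: "e < n" by simp
  have "(\<Sum>d<n. 1 / 2 * \<pi> d e * (co (x d) a * co (pt (x e)) b)) = (\<Sum>d<n. if a = d then 1 / 2 * (\<pi> d e * ptc e b) else 0)"
   by (intro sum.cong refl) (use e ab in \<open>simp add: cp co_basis\<close>)
  then show "(\<Sum>d<n. 1 / 2 * \<pi> d e * (co (x d) a * co (pt (x e)) b)) = 1 / 2 * (\<pi> a e * ptc e b)" using ab by simp
 qed
 finally have "0 = 1 / 2 * ((\<Sum>c<n. \<pi> c b * ptc c a) + (\<Sum>c<n. \<pi> a c * ptc c b))"
  by (simp only: sum_distrib_left[symmetric] distrib_left)
 then show "(\<Sum>c<n. \<pi> c b * ptc c a) + (\<Sum>c<n. \<pi> a c * ptc c b) = 0" by simp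
next
 have br: "br (u + v) w = br u w + br v w" "br w (u + v) = br w u + br w v"
  "br (scale c u) w = scale c (br u w)" "br w (scale c u) = scale c (br w u)" for u v w c
  using lie by (simp_all add: lie_algebra_def Vector_Spaces.linear_iff)
 have ptl: "pt (u + v) = pt u + pt v" "pt (scale c u) = scale c (pt u)" for u v c
  using pt_linear by (simp_all add: Vector_Spaces.linear_iff)
 fix b c d assume bcd: "b < n" "c < n" "d < n"
 let ?K = "\<lambda>a. \<kappa> (x c) (x d) (x a)"
 have 1: "pt (br (x c) (x d)) = (\<Sum>b<n. scale (\<Sum>e<n. f c d e * ptc e b) (x b))"
  unfolding sc[OF bcd(2,3)] linear_basis_sum[of pt, OF ptl] basis_sum_sum[symmetric] by (intro sum.cong refl) (simp add: pt_coeff)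
 have 2: "br (pt (x c)) (x d) = (\<Sum>b<n. scale (\<Sum>e<n. ptc c e * f e d b) (x b))"
  unfolding pt_coeff[OF bcd(2)] linear_basis_sum[of "\<lambda>u. br u (x d)", OF br(1,3)] basis_sum_sum[symmetric]
  by (intro sum.cong refl) (simp add: sc bcd)
 have 3: "br (x c) (pt (x d)) = (\<Sum>b<n. scale (\<Sum>e<n. ptc d e * f c e b) (x b))"
  unfolding pt_coeff[OF bcd(3)] linear_basis_sum[of "br (x c)", OF br(2,4)] basis_sum_sum[symmetric]
  by (intro sum.cong refl) (simp add: sc bcd)
 have 4: "(\<Sum>a<n. \<Sum>b<n. scale (1 / 2 * \<pi> a b * ?K a) (x b)) = (\<Sum>b<n. scale (\<Sum>a<n. 1 / 2 * \<pi> a b * ?K a) (x b))"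
  unfolding scale_sum_left by (rule sum.swap)
 have 5: "(\<Sum>a<n. \<Sum>b<n. scale (1 / 2 * \<pi> a b * ?K b) (x a)) = (\<Sum>b<n. scale (\<Sum>a<n. 1 / 2 * \<pi> b a * ?K a) (x b))"
  unfolding scale_sum_left ..
 have "(\<Sum>b<n. scale (\<Sum>e<n. f c d e * ptc e b) (x b)) = (\<Sum>b<n. scale ((\<Sum>e<n. ptc c e * f e d b) + (\<Sum>e<n. ptc d e * f c e b) +
   (\<Sum>a<n. 1 / 2 * \<pi> a b * ?K a) + (\<Sum>a<n. 1 / 2 * \<pi> b a * ?K a)) (x b))"
  using pt_br[of "x c" "x d"] unfolding 1 2 3 4 5 by (simp only: scale_left_distrib sum.distrib)
 from coord_unique[OF this bcd(1)]
 have "(\<Sum>e<n. f c d e * ptc e b) = (\<Sum>e<n. ptc c e * f e d b) + (\<Sum>e<n. ptc d e * f c e b) +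
   ((\<Sum>a<n. 1 / 2 * \<pi> a b * ?K a) + (\<Sum>a<n. 1 / 2 * \<pi> b a * ?K a))" by (simp only: add.assoc)
 \<comment> \<open>By symmetry of \<pi> the two contractions of the cocycle agree, and the two
   halves add up to the full coefficient.\<close>
 also have "(\<Sum>a<n. 1 / 2 * \<pi> a b * ?K a) + (\<Sum>a<n. 1 / 2 * \<pi> b a * ?K a) = (\<Sum>a<n. \<pi> a b * ?K a)"
  unfolding sum.distrib[symmetric] by (intro sum.cong refl) (use pi_sym bcd in \<open>simp add: field_simps\<close>)
 finally show "(\<Sum>e<n. ptc e b * f c d e) = (\<Sum>a<n. \<pi> a b * ?K a) + (\<Sum>a<n. ptc c a * f a d b + ptc d a * f c a b)"
  by (simp add: sum.distrib mult.commute algebra_simps)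
qed (fact pi_sym pi_inv)+

end

theorem corollary4p12:
  fixes scale :: "'k::field_char_0 \<Rightarrow> 'g::ab_group_add \<Rightarrow> 'g"
    and br :: "'g \<Rightarrow> 'g \<Rightarrow> 'g"
    and n :: nat
    and x :: "nat \<Rightarrow> 'g"
    and f :: "nat \<Rightarrow> nat \<Rightarrow> nat \<Rightarrow> 'k"
    and \<kappa> :: "'g \<Rightarrow> 'g \<Rightarrow> 'g \<Rightarrow> 'k"
    and \<pi> :: "nat \<Rightarrow> nat \<Rightarrow> 'k"
    and pt :: "'g \<Rightarrow> 'g"
    and ptc :: "nat \<Rightarrow> nat \<Rightarrow> 'k"
  assumes lie: "lie_algebra scale br"
    and basis: "finite_basis scale n x"
    and structure_constants:
      "\<And>a b. a < n \<Longrightarrow> b < n \<Longrightarrow> br (x a) (x b) = (\<Sum>c<n. scale (f a b c) (x c))"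
    and cocycle: "three_cocycle scale br \<kappa>"
    and pi_sym: "\<And>a b. a < n \<Longrightarrow> b < n \<Longrightarrow> \<pi> a b = \<pi> b a"
    and pi_inv: "\<And>a b c. a < n \<Longrightarrow> b < n \<Longrightarrow> c < n \<Longrightarrow>
      (\<Sum>d<n. f c d a * \<pi> d b) + (\<Sum>d<n. f c d b * \<pi> a d) = 0"
    and pt_linear: "Vector_Spaces.linear scale scale pt"
    and pt_coeff: "\<And>a. a < n \<Longrightarrow> pt (x a) = (\<Sum>b<n. scale (ptc a b) (x b))"
    and pt_pi:
      "(\<Sum>a<n. \<Sum>b<n. Poly_Mapping.single (pt (x a), x b) (1 / 2 * \<pi> a b)) +
       (\<Sum>a<n. \<Sum>b<n. Poly_Mapping.single (x a, pt (x b)) (1 / 2 * \<pi> a b))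
         \<in> tnull scale UNIV {0} scale UNIV {0}"
    and pt_br: "\<And>u v. pt (br u v) = br (pt u) v + br u (pt v) +
      (\<Sum>a<n. \<Sum>b<n. scale (1 / 2 * \<pi> a b * \<kappa> u v (x a)) (x b)) +
      (\<Sum>a<n. \<Sum>b<n. scale (1 / 2 * \<pi> a b * \<kappa> u v (x b)) (x a))"
  shows "let A = CE n f (\<lambda>a b c. \<kappa> (x a) (x b) (x c)); P = pi2 n \<pi> ptc in
    poisson2 A P \<and> inf_2braiding A (tbraid A P) \<and> gamma_equivariant A (tbraid A P)"
proof -
  have vs: "vector_space scale" using lie by (simp add: lie_algebra_def)
  have "CE_data n f (\<lambda>a b c. \<kappa> (x a) (x b) (x c)) \<pi> ptc"
    by (rule CE_dataI[where br = br and \<kappa> = \<kappa> and pt = pt, OF vs basis];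
      fact lie structure_constants cocycle pi_sym pi_inv pt_linear pt_coeff pt_pi pt_br)
  then show ?thesis unfolding Let_def by (rule CE_data.CE_result)
qed

end
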